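(* (Jacobinski cancellation theorem) Let $R$ be a Dedekind domain, let $\mathcal A$ be a fully additive hom-finite $R$-category, and let $A$ be an object of $\mathcal A$ such that, with $E=K\otimes_R\operatorname{End}_{\mathcal A}A$, $$E/\operatorname{nil}E\simeq\prod_{i=1}^m \operatorname{Mat}(n_i,D_i),$$ where the $D_i$ are skewfields and for every $i$ either the skewfield $D_i$ is commutative or $n_i>1$ (or both). Let $A',A''\in G(A)$. Then $A'\oplus A\simeq A''\oplus A$ if and only if $A'\simeq A''$.
   Context: All categories are small and preadditive. A category is fully additive if it is additive and every idempotent endomorphism splits. An $R$-category is a category whose Hom sets $\mathcal A(A,B)$ are $R$-modules with $R$-bilinear composition; it is hom-finite if all $\mathcal A(A,B)$ are finitely generated $R$-modules. $\operatorname{End}_{\mathcal A}A=\mathcal A(A,A)$. $R$ is a Dedekind domain with field of fractions $K$ and set of maximal ideals $\max R$. $\operatorname{nil}E$ is the prime (lower nil) radical of the ring $E$; here $E$ is a finite dimensional $K$-algebra, so this is its largest nilpotent ideal. $\operatorname{Mat}(n,D)$ is the ring of $n\times n$ matrices over $D$. For $\mathfrak p\in\max R$, $A_{\mathfrak p}$ denotes $A$ regarded as an object of $R_{\mathfrak p}\otimes_R\mathcal A$ (the category with the same objects as $\mathcal A$ and morphisms $R_{\mathfrak p}\otimes_R\mathcal A(A,B)$). The genus of $A$ is $G(A)=\{B\in\operatorname{ob}\mathcal A\mid B_{\mathfrak p}\simeq A_{\mathfrak p}\text{ for all }\mathfrak p\in\max R\}$. *)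

theory Defs
  imports "HOL-Algebra.Chinese_Remainder" "HOL-Algebra.Polynomials" "HOL-Algebra.Free_Abelian_Groups"
begin

section \<open>Dedekind domains with a field of fractions\<close>

text \<open>
  \<open>R\<close> is a Dedekind domain and \<open>\<iota>\<close> embeds it in a field of fractions \<open>K\<close>.
  Fields count as Dedekind domains.
\<close>

locale dedekind_domain = R: noetherian_domain R + K: field K
  for R :: "('r, 'x) ring_scheme" and K :: "('k, 'y) ring_scheme" and \<iota> :: "'r \<Rightarrow> 'k" +
  assumes emb_hom: "\<iota> \<in> ring_hom R K"
    and emb_inj: "inj_on \<iota> (carrier R)"
    and fractions: "x \<in> carrier K \<Longrightarrow>
      \<exists>a \<in> carrier R. \<exists>b \<in> carrier R - {\<zero>\<^bsub>R\<^esub>}. x = \<iota> a \<otimes>\<^bsub>K\<^esub> inv\<^bsub>K\<^esub> (\<iota> b)"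
    and integrally_closed:
      "\<lbrakk> x \<in> carrier K; p \<in> carrier ((\<iota> ` carrier R)[X]\<^bsub>K\<^esub>); p \<noteq> []; lead_coeff p = \<one>\<^bsub>K\<^esub>;
         ring.eval K p x = \<zero>\<^bsub>K\<^esub> \<rbrakk> \<Longrightarrow> x \<in> \<iota> ` carrier R"
    and prime_maximal: "\<lbrakk> primeideal P R; P \<noteq> {\<zero>\<^bsub>R\<^esub>} \<rbrakk> \<Longrightarrow> maximalideal P R"

text \<open>The localization at a prime ideal \<open>P\<close>, as the subring of the fractions \<open>a / s\<close>
  with \<open>s \<notin> P\<close> of the field of fractions.\<close>

definition local_ring ::
    "('r, 'x) ring_scheme \<Rightarrow> ('k, 'y) ring_scheme \<Rightarrow> ('r \<Rightarrow> 'k) \<Rightarrow> 'r set \<Rightarrow> ('k, 'y) ring_scheme"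
  where "local_ring R K \<iota> P = K \<lparr> carrier :=
    {\<iota> a \<otimes>\<^bsub>K\<^esub> inv\<^bsub>K\<^esub> (\<iota> s) | a s. a \<in> carrier R \<and> s \<in> carrier R - P} \<rparr>"


section \<open>Linear categories\<close>

text \<open>\<open>Comp C A B D g f\<close> is the composite of \<open>f\<close> from \<open>A\<close> to \<open>B\<close> and \<open>g\<close> from \<open>B\<close> to \<open>D\<close>.
  The \<open>mult\<close> and \<open>one\<close> fields of the records \<open>Hom C A B\<close> are never used.\<close>

record ('r, 'o, 'm) lin_cat =
  Obj :: "'o set"
  Hom :: "'o \<Rightarrow> 'o \<Rightarrow> ('r, 'm) module"
  Comp :: "'o \<Rightarrow> 'o \<Rightarrow> 'o \<Rightarrow> 'm \<Rightarrow> 'm \<Rightarrow> 'm"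
  Id :: "'o \<Rightarrow> 'm"

locale linear_category = cring R
  for R :: "('r, 'x) ring_scheme" and C :: "('r, 'o, 'm) lin_cat" +
  assumes hom_module: "\<lbrakk> A \<in> Obj C; B \<in> Obj C \<rbrakk> \<Longrightarrow> module R (Hom C A B)"
    and id_closed: "A \<in> Obj C \<Longrightarrow> Id C A \<in> carrier (Hom C A A)"
    and comp_closed:
      "\<lbrakk> A \<in> Obj C; B \<in> Obj C; D \<in> Obj C; f \<in> carrier (Hom C A B); g \<in> carrier (Hom C B D) \<rbrakk>
       \<Longrightarrow> Comp C A B D g f \<in> carrier (Hom C A D)"
    and comp_id_left:
      "\<lbrakk> A \<in> Obj C; B \<in> Obj C; f \<in> carrier (Hom C A B) \<rbrakk> \<Longrightarrow> Comp C A B B (Id C B) f = f"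
    and comp_id_right:
      "\<lbrakk> A \<in> Obj C; B \<in> Obj C; f \<in> carrier (Hom C A B) \<rbrakk> \<Longrightarrow> Comp C A A B f (Id C A) = f"
    and comp_assoc:
      "\<lbrakk> A \<in> Obj C; B \<in> Obj C; D \<in> Obj C; F \<in> Obj C;
         f \<in> carrier (Hom C A B); g \<in> carrier (Hom C B D); h \<in> carrier (Hom C D F) \<rbrakk>
       \<Longrightarrow> Comp C A D F h (Comp C A B D g f) = Comp C A B F (Comp C B D F h g) f"
    and comp_add_left:
      "\<lbrakk> A \<in> Obj C; B \<in> Obj C; D \<in> Obj C;
         f \<in> carrier (Hom C A B); g \<in> carrier (Hom C B D); h \<in> carrier (Hom C B D) \<rbrakk>
       \<Longrightarrow> Comp C A B D (g \<oplus>\<^bsub>Hom C B D\<^esub> h) f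
         = Comp C A B D g f \<oplus>\<^bsub>Hom C A D\<^esub> Comp C A B D h f"
    and comp_add_right:
      "\<lbrakk> A \<in> Obj C; B \<in> Obj C; D \<in> Obj C;
         f \<in> carrier (Hom C A B); h \<in> carrier (Hom C A B); g \<in> carrier (Hom C B D) \<rbrakk>
       \<Longrightarrow> Comp C A B D g (f \<oplus>\<^bsub>Hom C A B\<^esub> h)
         = Comp C A B D g f \<oplus>\<^bsub>Hom C A D\<^esub> Comp C A B D g h"
    and comp_smult_left:
      "\<lbrakk> A \<in> Obj C; B \<in> Obj C; D \<in> Obj C; r \<in> carrier R;
         f \<in> carrier (Hom C A B); g \<in> carrier (Hom C B D) \<rbrakk>
       \<Longrightarrow> Comp C A B D (r \<odot>\<^bsub>Hom C B D\<^esub> g) f = r \<odot>\<^bsub>Hom C A D\<^esub> Comp C A B D g f"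
    and comp_smult_right:
      "\<lbrakk> A \<in> Obj C; B \<in> Obj C; D \<in> Obj C; r \<in> carrier R;
         f \<in> carrier (Hom C A B); g \<in> carrier (Hom C B D) \<rbrakk>
       \<Longrightarrow> Comp C A B D g (r \<odot>\<^bsub>Hom C A B\<^esub> f) = r \<odot>\<^bsub>Hom C A D\<^esub> Comp C A B D g f"

definition isomorphic_in :: "('r, 'o, 'm) lin_cat \<Rightarrow> 'o \<Rightarrow> 'o \<Rightarrow> bool"
  where "isomorphic_in C A B \<longleftrightarrow>
    (\<exists>f \<in> carrier (Hom C A B). \<exists>g \<in> carrier (Hom C B A).
       Comp C A B A g f = Id C A \<and> Comp C B A B f g = Id C B)"

definition direct_sum :: "('r, 'o, 'm) lin_cat \<Rightarrow> 'o \<Rightarrow> 'o \<Rightarrow> 'o \<Rightarrow> bool"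
  where "direct_sum C S A B \<longleftrightarrow> S \<in> Obj C \<and>
    (\<exists>i \<in> carrier (Hom C A S). \<exists>j \<in> carrier (Hom C B S).
     \<exists>p \<in> carrier (Hom C S A). \<exists>q \<in> carrier (Hom C S B).
       Comp C A S A p i = Id C A \<and> Comp C B S B q j = Id C B \<and>
       Comp C A S B q i = \<zero>\<^bsub>Hom C A B\<^esub> \<and> Comp C B S A p j = \<zero>\<^bsub>Hom C B A\<^esub> \<and>
       Comp C S A S i p \<oplus>\<^bsub>Hom C S S\<^esub> Comp C S B S j q = Id C S)"

definition additive_category :: "('r, 'o, 'm) lin_cat \<Rightarrow> bool"
  where "additive_category C \<longleftrightarrow>
    (\<exists>Z \<in> Obj C. Id C Z = \<zero>\<^bsub>Hom C Z Z\<^esub>) \<and>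
    (\<forall>A \<in> Obj C. \<forall>B \<in> Obj C. \<exists>S. direct_sum C S A B)"

definition fully_additive :: "('r, 'o, 'm) lin_cat \<Rightarrow> bool"
  where "fully_additive C \<longleftrightarrow> additive_category C \<and>
    (\<forall>A \<in> Obj C. \<forall>e \<in> carrier (Hom C A A). Comp C A A A e e = e \<longrightarrow>
      (\<exists>B \<in> Obj C. \<exists>p \<in> carrier (Hom C A B). \<exists>q \<in> carrier (Hom C B A).
         Comp C A B A q p = e \<and> Comp C B A B p q = Id C B))"

definition finitely_generated_module ::
    "('r, 'x) ring_scheme \<Rightarrow> ('r, 'm, 'z) module_scheme \<Rightarrow> bool"
  where "finitely_generated_module R M \<longleftrightarrow>
    (\<exists>G. finite G \<and> G \<subseteq> carrier M \<and>
      (\<forall>m \<in> carrier M. \<exists>c \<in> G \<rightarrow> carrier R. m = (\<Oplus>\<^bsub>M\<^esub>x\<in>G. c x \<odot>\<^bsub>M\<^esub> x)))"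

definition hom_finite :: "('r, 'x) ring_scheme \<Rightarrow> ('r, 'o, 'm) lin_cat \<Rightarrow> bool"
  where "hom_finite R C \<longleftrightarrow>
    (\<forall>A \<in> Obj C. \<forall>B \<in> Obj C. finitely_generated_module R (Hom C A B))"

definition End_ring :: "('r, 'o, 'm) lin_cat \<Rightarrow> 'o \<Rightarrow> 'm ring"
  where "End_ring C A =
    \<lparr> carrier = carrier (Hom C A A), monoid.mult = Comp C A A A, one = Id C A,
      ring.zero = \<zero>\<^bsub>Hom C A A\<^esub>, add = add (Hom C A A) \<rparr>"


section \<open>Extension of scalars\<close>

text \<open>
  For a ring homomorphism \<open>\<phi>\<close> from \<open>R\<close> to \<open>S\<close>, the tensor product of \<open>S\<close> and \<open>M\<close> over \<open>R\<close>
  is the free abelian group on \<open>carrier S \<times> carrier M\<close> modulo the subgroup \<open>tensor_kernel\<close>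
  generated by the bilinearity and balancing relations; its elements are cosets.
\<close>

definition tensor_relations ::
    "('r, 'x) ring_scheme \<Rightarrow> ('s, 'y) ring_scheme \<Rightarrow> ('r \<Rightarrow> 's) \<Rightarrow> ('r, 'm) module
      \<Rightarrow> ('s \<times> 'm \<Rightarrow>\<^sub>0 int) set"
  where "tensor_relations R S \<phi> M =
    {frag_of (s \<oplus>\<^bsub>S\<^esub> t, x) - frag_of (s, x) - frag_of (t, x) | s t x.
       s \<in> carrier S \<and> t \<in> carrier S \<and> x \<in> carrier M} \<union>
    {frag_of (s, x \<oplus>\<^bsub>M\<^esub> y) - frag_of (s, x) - frag_of (s, y) | s x y.
       s \<in> carrier S \<and> x \<in> carrier M \<and> y \<in> carrier M} \<union>
    {frag_of (s \<otimes>\<^bsub>S\<^esub> \<phi> r, x) - frag_of (s, r \<odot>\<^bsub>M\<^esub> x) | s r x.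
       s \<in> carrier S \<and> r \<in> carrier R \<and> x \<in> carrier M}"

definition tensor_free ::
    "('s, 'y) ring_scheme \<Rightarrow> ('r, 'm) module \<Rightarrow> ('s \<times> 'm \<Rightarrow>\<^sub>0 int) monoid"
  where "tensor_free S M = free_Abelian_group (carrier S \<times> carrier M)"

definition tensor_kernel ::
    "('r, 'x) ring_scheme \<Rightarrow> ('s, 'y) ring_scheme \<Rightarrow> ('r \<Rightarrow> 's) \<Rightarrow> ('r, 'm) module
      \<Rightarrow> ('s \<times> 'm \<Rightarrow>\<^sub>0 int) set"
  where "tensor_kernel R S \<phi> M = generate (tensor_free S M) (tensor_relations R S \<phi> M)"

definition tensor_class ::
    "('r, 'x) ring_scheme \<Rightarrow> ('s, 'y) ring_scheme \<Rightarrow> ('r \<Rightarrow> 's) \<Rightarrow> ('r, 'm) module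
      \<Rightarrow> ('s \<times> 'm \<Rightarrow>\<^sub>0 int) \<Rightarrow> ('s \<times> 'm \<Rightarrow>\<^sub>0 int) set"
  where "tensor_class R S \<phi> M u = tensor_kernel R S \<phi> M #>\<^bsub>tensor_free S M\<^esub> u"

text \<open>Operations on cosets are unions over all representatives, as for \<open>rcoset_mult\<close>: all
  representatives give the same coset. Scalars act by \<open>s \<odot> (t \<otimes> x) = st \<otimes> x\<close>, and composition
  is \<open>(s \<otimes> g) \<circ> (t \<otimes> f) = st \<otimes> (g \<circ> f)\<close>. In particular \<open>End_ring (base_change R S \<phi> C) A\<close>
  is the tensor product of the rings \<open>S\<close> and \<open>End_ring C A\<close> over \<open>R\<close>.\<close>

definition extend_scalars ::
    "('r, 'x) ring_scheme \<Rightarrow> ('s, 'y) ring_scheme \<Rightarrow> ('r \<Rightarrow> 's) \<Rightarrow> ('r, 'm) module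
      \<Rightarrow> ('s, ('s \<times> 'm \<Rightarrow>\<^sub>0 int) set) module"
  where "extend_scalars R S \<phi> M =
    (let T = tensor_free S M Mod tensor_kernel R S \<phi> M in
     \<lparr> carrier = carrier T, monoid.mult = undefined, one = undefined, ring.zero = \<one>\<^bsub>T\<^esub>, add = monoid.mult T,
       smult = (\<lambda>s U. \<Union>u\<in>U.
         tensor_class R S \<phi> M (frag_extend (\<lambda>(t, x). frag_of (s \<otimes>\<^bsub>S\<^esub> t, x)) u)) \<rparr>)"

definition base_change ::
    "('r, 'x) ring_scheme \<Rightarrow> ('s, 'y) ring_scheme \<Rightarrow> ('r \<Rightarrow> 's) \<Rightarrow> ('r, 'o, 'm) lin_cat
      \<Rightarrow> ('s, 'o, ('s \<times> 'm \<Rightarrow>\<^sub>0 int) set) lin_cat"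
  where "base_change R S \<phi> C =
    \<lparr> Obj = Obj C,
      Hom = (\<lambda>A B. extend_scalars R S \<phi> (Hom C A B)),
      Comp = (\<lambda>A B D G F. \<Union>g\<in>G. \<Union>f\<in>F. tensor_class R S \<phi> (Hom C A D)
        (frag_extend (\<lambda>(s, y). frag_extend (\<lambda>(t, x). frag_of (s \<otimes>\<^bsub>S\<^esub> t, Comp C A B D y x)) f) g)),
      Id = (\<lambda>A. tensor_class R S \<phi> (Hom C A A) (frag_of (\<one>\<^bsub>S\<^esub>, Id C A))) \<rparr>"

definition genus ::
    "('r, 'x) ring_scheme \<Rightarrow> ('k, 'y) ring_scheme \<Rightarrow> ('r \<Rightarrow> 'k) \<Rightarrow> ('r, 'o, 'm) lin_cat
      \<Rightarrow> 'o \<Rightarrow> 'o set"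
  where "genus R K \<iota> C A = {B \<in> Obj C. \<forall>P. maximalideal P R \<longrightarrow>
    isomorphic_in (base_change R (local_ring R K \<iota> P) \<iota> C) B A}"


section \<open>Noncommutative rings\<close>

text \<open>\<open>primeideal\<close> from the library is restricted to commutative rings.\<close>

definition nc_prime_ideal :: "'a set \<Rightarrow> ('a, 'x) ring_scheme \<Rightarrow> bool"
  where "nc_prime_ideal P E \<longleftrightarrow> ideal P E \<and> P \<noteq> carrier E \<and>
    (\<forall>I J. ideal I E \<longrightarrow> ideal J E \<longrightarrow> I \<cdot>\<^bsub>E\<^esub> J \<subseteq> P \<longrightarrow> I \<subseteq> P \<or> J \<subseteq> P)"

definition prime_radical :: "('a, 'x) ring_scheme \<Rightarrow> 'a set"
  where "prime_radical E = {x \<in> carrier E. \<forall>P. nc_prime_ideal P E \<longrightarrow> x \<in> P}"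

locale skewfield = ring D for D (structure) +
  assumes one_not_zero: "\<one> \<noteq> \<zero>"
    and Units_eq: "Units D = carrier D - {\<zero>}"

definition matrix_ring :: "nat \<Rightarrow> ('d, 'x) ring_scheme \<Rightarrow> (nat \<times> nat \<Rightarrow> 'd) ring"
  where "matrix_ring n D =
    \<lparr> carrier = {..<n} \<times> {..<n} \<rightarrow>\<^sub>E carrier D,
      monoid.mult = (\<lambda>M N. \<lambda>(i, j) \<in> {..<n} \<times> {..<n}. \<Oplus>\<^bsub>D\<^esub>k\<in>{..<n}. M (i, k) \<otimes>\<^bsub>D\<^esub> N (k, j)),
      one = (\<lambda>(i, j) \<in> {..<n} \<times> {..<n}. if i = j then \<one>\<^bsub>D\<^esub> else \<zero>\<^bsub>D\<^esub>),
      ring.zero = (\<lambda>(i, j) \<in> {..<n} \<times> {..<n}. \<zero>\<^bsub>D\<^esub>),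
      add = (\<lambda>M N. \<lambda>(i, j) \<in> {..<n} \<times> {..<n}. M (i, j) \<oplus>\<^bsub>D\<^esub> N (i, j)) \<rparr>"

end

theory Submission
  imports Defs "HOL-Algebra.Polynomial_Divisibility"
begin

text \<open>
  Over \<open>K\<close> the objects of the genus become isomorphic to \<open>A\<close>, so that their \<open>Hom\<close> groups are, up to
  torsion, lattices in \<open>E\<close>. An isomorphism of \<open>A' \<oplus> A\<close> with \<open>A'' \<oplus> A\<close> is a \<open>2 \<times> 2\<close> matrix; since
  \<open>End A\<close> has stable range one locally, an elementary operation makes its lower right entry \<open>d\<close>
  invertible at \<open>P\<close>, and \<open>d\<close> times its Schur complement yields a local isomorphism of \<open>A'\<close> with \<open>A''\<close>.
  Its class in \<open>E\<^sup>\<times>\<close> modulo products of unipotent elements does not depend on \<open>P\<close>: it plays the role of a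
  determinant, the quotient being commutative by the hypothesis on \<open>D\<^sub>i\<close> and \<open>n\<^sub>i\<close>. Local isomorphisms that
  differ by unipotent elements can be glued by the strong approximation property of such elements.
\<close>

section \<open>Products of unipotent elements\<close>

text \<open>Two obstacles shape the proof. The elementary operation that makes \<open>d\<close>
  invertible at \<open>P\<close> depends on \<open>P\<close>. Two such operations are compared
  through a third one that differs from each of them by a unit of \<open>E\<close>; it is found by
  shifting by a scalar that avoids finitely many values. This requires \<open>K\<close> to be
  infinite, so the case of a field \<open>R\<close> is settled separately. Moreover,
  \<open>Hom\<close> groups may have torsion, which \<open>E\<close> does not see: the glued
  morphism is invertible only up to torsion and has to be repaired at the finitely many places that
  carry it.

  Unipotent elements take the place of elements of reduced norm one because they can be approximated
  by hand: \<open>1 + m\<close> belongs to the family \<open>1 + r m\<close>, whose members and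
  their inverses are polynomials in \<open>r m\<close>. They also make the nilradical harmless, as
  \<open>1 + n\<close> is unipotent for nilpotent \<open>n\<close>. In a noncommutative
  \<open>D\<^sub>i\<close> with \<open>n\<^sub>i = 1\<close> the only unipotent element is 1, and
  nothing could absorb the commutators.\<close>

context ring begin

declare Units_closed [simp]

text \<open>Sorting a sum can leave up to three summands between an element and its negative, out of
  reach of \<open>r_neg1\<close> and \<open>r_neg2\<close>.\<close>

lemma cancel_deep_aux:
  assumes "x \<in> carrier R" "y \<in> carrier R" "z \<in> carrier R" "u \<in> carrier R" "v \<in> carrier R"
  shows "x \<oplus> (y \<oplus> \<ominus> x) = y"
    "x \<oplus> (y \<oplus> (\<ominus> x \<oplus> z)) = y \<oplus> z"
    "\<ominus> x \<oplus> (y \<oplus> x) = y"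
    "\<ominus> x \<oplus> (y \<oplus> (x \<oplus> z)) = y \<oplus> z"
    "x \<oplus> (y \<oplus> (u \<oplus> \<ominus> x)) = y \<oplus> u"
    "x \<oplus> (y \<oplus> (u \<oplus> (\<ominus> x \<oplus> z))) = y \<oplus> (u \<oplus> z)"
    "\<ominus> x \<oplus> (y \<oplus> (u \<oplus> x)) = y \<oplus> u"
    "\<ominus> x \<oplus> (y \<oplus> (u \<oplus> (x \<oplus> z))) = y \<oplus> (u \<oplus> z)"
    "x \<oplus> (y \<oplus> (u \<oplus> (v \<oplus> \<ominus> x))) = y \<oplus> (u \<oplus> v)"
    "x \<oplus> (y \<oplus> (u \<oplus> (v \<oplus> (\<ominus> x \<oplus> z)))) = y \<oplus> (u \<oplus> (v \<oplus> z))"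
    "\<ominus> x \<oplus> (y \<oplus> (u \<oplus> (v \<oplus> x))) = y \<oplus> (u \<oplus> v)"
    "\<ominus> x \<oplus> (y \<oplus> (u \<oplus> (v \<oplus> (x \<oplus> z)))) = y \<oplus> (u \<oplus> (v \<oplus> z))"
  using assms by algebra+

lemmas cancel_deep =
  cancel_deep_aux(1,3)[OF _ _ zero_closed zero_closed zero_closed]
  cancel_deep_aux(2,4)[OF _ _ _ zero_closed zero_closed]
  cancel_deep_aux(5,7)[OF _ _ zero_closed _ zero_closed]
  cancel_deep_aux(6,8)[OF _ _ _ _ zero_closed]
  cancel_deep_aux(9,11)[OF _ _ zero_closed] cancel_deep_aux(10,12)

text \<open>Normalization of noncommutative ring expressions; the method \<open>algebra\<close> lacks
  \<open>r_one\<close> outside of commutative rings.\<close>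

lemmas nc_simps = a_minus_def r_distr l_distr r_minus l_minus minus_add m_assoc
  a_assoc a_comm a_lcomm r_neg l_neg r_neg1 r_neg2 cancel_deep

end

text \<open>The subgroup of the units that unipotent elements generate; inverses need not be added,
  because the inverse of \<open>1 + n\<close> has the same form. For matrices of size at least two
  over a skewfield it is the group generated by the elementary matrices.\<close>

inductive_set unipotent_products :: "('a, 'x) ring_scheme \<Rightarrow> 'a set"
  for R (structure) where
  one: "\<one> \<in> unipotent_products R"
| step: "\<lbrakk> x \<in> unipotent_products R; n \<in> carrier R; n [^] (k::nat) = \<zero> \<rbrakk>
    \<Longrightarrow> x \<otimes> (\<one> \<oplus> n) \<in> unipotent_products R"

primrec geometric_sum :: "('a, 'x) ring_scheme \<Rightarrow> 'a \<Rightarrow> nat \<Rightarrow> 'a" where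
  "geometric_sum R x 0 = \<zero>\<^bsub>R\<^esub>"
| "geometric_sum R x (Suc k) = \<one>\<^bsub>R\<^esub> \<oplus>\<^bsub>R\<^esub> x \<otimes>\<^bsub>R\<^esub> geometric_sum R x k"

context ring begin

lemma geometric_sum_closed [simp]: "x \<in> carrier R \<Longrightarrow> geometric_sum R x k \<in> carrier R"
  by (induction k) auto

lemma geometric_sum_left:
  assumes "x \<in> carrier R" shows "(\<one> \<ominus> x) \<otimes> geometric_sum R x k = \<one> \<ominus> x [^] k"
proof (induction k)
  case (Suc k)
  let ?g = "geometric_sum R x k"
  have "(\<one> \<ominus> x) \<otimes> (\<one> \<oplus> x \<otimes> ?g) = (\<one> \<ominus> x) \<oplus> x \<otimes> ((\<one> \<ominus> x) \<otimes> ?g)"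
    using assms by (simp add: nc_simps)
  also have "\<dots> = \<one> \<ominus> x \<otimes> x [^] k"
    unfolding Suc using assms by (simp add: nc_simps)
  also have "x \<otimes> x [^] k = x [^] Suc k"
    using assms by (simp only: nat_pow_Suc2)
  finally show ?case by simp
qed (use assms in \<open>simp add: nc_simps\<close>)

lemma geometric_sum_comm:
  assumes "x \<in> carrier R" shows "x \<otimes> geometric_sum R x k = geometric_sum R x k \<otimes> x"
proof (induction k)
  case (Suc k)
  have "x \<otimes> (x \<otimes> geometric_sum R x k) = x \<otimes> geometric_sum R x k \<otimes> x"
    using assms Suc by (metis m_assoc geometric_sum_closed)
  thus ?case using assms by (simp add: r_distr l_distr)
qed (use assms in simp)

lemma geometric_sum_right:
  assumes "x \<in> carrier R" shows "geometric_sum R x k \<otimes> (\<one> \<ominus> x) = \<one> \<ominus> x [^] k"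
  using geometric_sum_left[OF assms, of k] geometric_sum_comm[OF assms, of k] assms
  by (simp add: a_minus_def l_distr r_distr l_minus r_minus)

lemma Units_inv_mult:
  assumes "x \<in> Units R" "y \<in> Units R" shows "inv (x \<otimes> y) = inv y \<otimes> inv x"
proof (rule inv_unique'[symmetric])
  have "x \<otimes> y \<otimes> (inv y \<otimes> inv x) = x \<otimes> (y \<otimes> inv y) \<otimes> inv x"
    "inv y \<otimes> inv x \<otimes> (x \<otimes> y) = inv y \<otimes> (inv x \<otimes> x) \<otimes> y"
    using assms by (simp_all add: m_assoc del: Units_l_inv Units_r_inv)
  thus "x \<otimes> y \<otimes> (inv y \<otimes> inv x) = \<one>" "inv y \<otimes> inv x \<otimes> (x \<otimes> y) = \<one>"
    using assms by simp_all
qed (use assms in auto)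

text \<open>The sign depends on the parity of \<open>k\<close>, but only the vanishing of the power
  is ever used.\<close>

lemma pow_uminus_cases:
  assumes "n \<in> carrier R"
  shows "(\<ominus> n) [^] (k::nat) = n [^] k \<or> (\<ominus> n) [^] k = \<ominus> (n [^] k)"
  by (induction k) (use assms in \<open>auto simp: l_minus r_minus\<close>)

text \<open>The inverse is wanted as an explicit polynomial in \<open>n\<close>, since the
  denominators of such inverses are estimated from it later on.\<close>

lemma geometric_sum_inverse:
  assumes "n \<in> carrier R" "n [^] (k::nat) = \<zero>"
  shows "(\<one> \<oplus> n) \<otimes> geometric_sum R (\<ominus> n) k = \<one>" "geometric_sum R (\<ominus> n) k \<otimes> (\<one> \<oplus> n) = \<one>"
proof -
  have "(\<ominus> n) [^] k = \<zero>"
    using pow_uminus_cases[of n k] assms by auto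
  thus "(\<one> \<oplus> n) \<otimes> geometric_sum R (\<ominus> n) k = \<one>" "geometric_sum R (\<ominus> n) k \<otimes> (\<one> \<oplus> n) = \<one>"
    using geometric_sum_left[of "\<ominus> n" k] geometric_sum_right[of "\<ominus> n" k] assms
    by (simp_all add: a_minus_def)
qed

lemma unipotent_Units:
  assumes "n \<in> carrier R" "n [^] (k::nat) = \<zero>" shows "\<one> \<oplus> n \<in> Units R"
  using geometric_sum_inverse[OF assms] assms unfolding Units_def by force

lemma unipotent_products_Units: "x \<in> unipotent_products R \<Longrightarrow> x \<in> Units R"
  by (induction rule: unipotent_products.induct) (auto intro: unipotent_Units)

lemma unipotent_in_unipotent_products:
  assumes "n \<in> carrier R" "n [^] (k::nat) = \<zero>" shows "\<one> \<oplus> n \<in> unipotent_products R"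
  using unipotent_products.step[OF unipotent_products.one assms] assms by simp

lemma unipotent_products_mult:
  assumes "y \<in> unipotent_products R" "x \<in> unipotent_products R"
  shows "x \<otimes> y \<in> unipotent_products R"
  using assms
proof (induction rule: unipotent_products.induct)
  case one
  thus ?case using unipotent_products_Units by (simp add: Units_closed)
next
  case (step y n k)
  have "x \<in> carrier R" "y \<in> carrier R"
    using step unipotent_products_Units by auto
  hence "x \<otimes> (y \<otimes> (\<one> \<oplus> n)) = (x \<otimes> y) \<otimes> (\<one> \<oplus> n)"
    using step.hyps by (simp add: m_assoc)
  thus ?case using step unipotent_products.step by metis
qed

text \<open>If \<open>u\<close> is the inverse of \<open>1 + n\<close>, then
  \<open>u = 1 - n u\<close>, and \<open>n u\<close> is nilpotent because \<open>n\<close> commutes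
  with \<open>u\<close>.\<close>

lemma unipotent_products_inv:
  assumes "x \<in> unipotent_products R" shows "inv x \<in> unipotent_products R"
  using assms
proof (induction rule: unipotent_products.induct)
  case one
  show ?case using unipotent_products.one by simp
next
  case (step x n k)
  have x: "x \<in> Units R" and n: "\<one> \<oplus> n \<in> Units R"
    using step unipotent_products_Units unipotent_Units by auto
  let ?m = "\<ominus> (n \<otimes> inv (\<one> \<oplus> n))"
  have c: "n \<otimes> inv (\<one> \<oplus> n) = inv (\<one> \<oplus> n) \<otimes> n"
  proof -
    have "n \<otimes> (\<one> \<oplus> n) = (\<one> \<oplus> n) \<otimes> n" using step.hyps by (simp add: nc_simps)
    hence "inv (\<one> \<oplus> n) \<otimes> (n \<otimes> (\<one> \<oplus> n)) \<otimes> inv (\<one> \<oplus> n)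
        = inv (\<one> \<oplus> n) \<otimes> ((\<one> \<oplus> n) \<otimes> n) \<otimes> inv (\<one> \<oplus> n)" by simp
    moreover have "inv (\<one> \<oplus> n) \<otimes> (n \<otimes> (\<one> \<oplus> n)) \<otimes> inv (\<one> \<oplus> n) = inv (\<one> \<oplus> n) \<otimes> n \<otimes> ((\<one> \<oplus> n) \<otimes> inv (\<one> \<oplus> n))"
      using n step.hyps by (simp add: m_assoc del: Units_r_inv)
    moreover have "inv (\<one> \<oplus> n) \<otimes> ((\<one> \<oplus> n) \<otimes> n) \<otimes> inv (\<one> \<oplus> n) = (inv (\<one> \<oplus> n) \<otimes> (\<one> \<oplus> n)) \<otimes> n \<otimes> inv (\<one> \<oplus> n)"
      using n step.hyps by (simp add: m_assoc del: Units_l_inv)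
    ultimately show ?thesis using n step.hyps by simp
  qed
  have iu: "inv (\<one> \<oplus> n) = \<one> \<oplus> ?m"
  proof -
    have "(\<one> \<oplus> n) \<otimes> inv (\<one> \<oplus> n) = \<one>" using n by simp
    hence "inv (\<one> \<oplus> n) \<oplus> n \<otimes> inv (\<one> \<oplus> n) = \<one>"
      using n step.hyps by (simp add: l_distr del: Units_r_inv)
    thus ?thesis using n step.hyps
      by (metis Units_inv_closed a_minus_def add.inv_solve_right m_closed one_closed)
  qed
  have "(n \<otimes> inv (\<one> \<oplus> n)) [^] k = n [^] k \<otimes> (inv (\<one> \<oplus> n)) [^] k"
    using pow_mult_distrib[OF c] n step.hyps by simp
  hence z: "(n \<otimes> inv (\<one> \<oplus> n)) [^] k = \<zero>" using step.hyps n by simp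
  from pow_uminus_cases[of "n \<otimes> inv (\<one> \<oplus> n)" k] have "?m [^] k = \<zero>" using z n step.hyps by auto
  hence "\<one> \<oplus> ?m \<in> unipotent_products R"
    using unipotent_in_unipotent_products n step.hyps by auto
  hence "inv (\<one> \<oplus> n) \<in> unipotent_products R" using iu by simp
  moreover have "inv (x \<otimes> (\<one> \<oplus> n)) = inv (\<one> \<oplus> n) \<otimes> inv x"
    using x n by (simp add: Units_inv_mult)
  ultimately show ?case using unipotent_products_mult[OF step.IH] by simp
qed

lemma unit_conj_pow:
  assumes "v \<in> Units R" "n \<in> carrier R"
  shows "(v \<otimes> n \<otimes> inv v) [^] (k::nat) = v \<otimes> n [^] k \<otimes> inv v"
proof (induction k)
  case (Suc k)
  have "(v \<otimes> n [^] k \<otimes> inv v) \<otimes> (v \<otimes> n \<otimes> inv v) = v \<otimes> n [^] k \<otimes> (inv v \<otimes> v) \<otimes> (n \<otimes> inv v)"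
    using assms by (simp add: m_assoc del: Units_l_inv)
  also have "\<dots> = v \<otimes> n [^] Suc k \<otimes> inv v"
    using assms by (simp add: m_assoc)
  finally show ?case using Suc by simp
qed (use assms in simp)

lemma unipotent_conj:
  assumes "v \<in> Units R" "n \<in> carrier R"
  shows "v \<otimes> (\<one> \<oplus> n) = (\<one> \<oplus> v \<otimes> n \<otimes> inv v) \<otimes> v"
proof -
  have "(\<one> \<oplus> v \<otimes> n \<otimes> inv v) \<otimes> v = v \<oplus> v \<otimes> n \<otimes> (inv v \<otimes> v)"
    using assms by (simp add: l_distr m_assoc del: Units_l_inv)
  thus ?thesis using assms by (simp add: r_distr)
qed

lemma unipotent_products_conj:
  assumes "x \<in> unipotent_products R" "v \<in> Units R"
  shows "v \<otimes> x \<otimes> inv v \<in> unipotent_products R"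
  using assms(1)
proof (induction rule: unipotent_products.induct)
  case one
  show ?case using assms unipotent_products.one by simp
next
  case (step x n k)
  have x: "x \<in> carrier R" using step unipotent_products_Units by auto
  have "v \<otimes> (x \<otimes> (\<one> \<oplus> n)) \<otimes> inv v = v \<otimes> x \<otimes> (inv v \<otimes> v) \<otimes> (\<one> \<oplus> n) \<otimes> inv v"
    using x assms step.hyps by (simp add: m_assoc)
  also have "\<dots> = (v \<otimes> x \<otimes> inv v) \<otimes> (v \<otimes> (\<one> \<oplus> n)) \<otimes> inv v"
    using x assms step.hyps by (simp add: m_assoc del: Units_l_inv)
  also have "\<dots> = (v \<otimes> x \<otimes> inv v) \<otimes> (\<one> \<oplus> v \<otimes> n \<otimes> inv v) \<otimes> (v \<otimes> inv v)"
    unfolding unipotent_conj[OF assms(2) step.hyps(2)]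
    using x assms step.hyps by (simp add: m_assoc del: Units_r_inv)
  also have "\<dots> = (v \<otimes> x \<otimes> inv v) \<otimes> (\<one> \<oplus> v \<otimes> n \<otimes> inv v)"
    using x assms step.hyps by simp
  finally have *: "v \<otimes> (x \<otimes> (\<one> \<oplus> n)) \<otimes> inv v = \<dots>" .
  show ?case unfolding *
    by (rule unipotent_products.step[OF step.IH, where k = k])
      (use unit_conj_pow[OF assms(2) step.hyps(2), of k] assms step.hyps in simp_all)
qed

lemma unipotent_products_normal: "unipotent_products R \<lhd> units_of R"
proof -
  interpret U: group "units_of R" by (rule units_group)
  have s: "subgroup (unipotent_products R) (units_of R)"
    by (rule U.subgroupI)
      (use unipotent_products_Units unipotent_products.one[of R] unipotent_products_inv unipotent_products_mult
        in \<open>auto simp: units_of_carrier units_of_mult units_of_inv\<close>)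
  show ?thesis unfolding U.normal_inv_iff
    using s unipotent_products_conj by (auto simp: units_of_carrier units_of_mult units_of_inv)
qed

end

text \<open>The hypothesis on the \<open>D\<^sub>i\<close> and \<open>n\<^sub>i\<close> enters the proof only through the following property
  of \<open>K \<otimes> End A\<close>.\<close>

definition commutators_unipotent :: "('a, 'x) ring_scheme \<Rightarrow> bool" where
  "commutators_unipotent R \<longleftrightarrow> (\<forall>x \<in> Units R. \<forall>y \<in> Units R.
     x \<otimes>\<^bsub>R\<^esub> y \<otimes>\<^bsub>R\<^esub> inv\<^bsub>R\<^esub> x \<otimes>\<^bsub>R\<^esub> inv\<^bsub>R\<^esub> y \<in> unipotent_products R)"

text \<open>For matrices of size at least two over a skewfield this is the Dieudonne determinant;
  for a commutative ring without nilpotent elements it is in essence the unit itself.\<close>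

definition unit_class :: "('a, 'x) ring_scheme \<Rightarrow> 'a \<Rightarrow> 'a set" where
  "unit_class R x = unipotent_products R #>\<^bsub>units_of R\<^esub> x"

abbreviation unit_class_group :: "('a, 'x) ring_scheme \<Rightarrow> 'a set monoid" where
  "unit_class_group R \<equiv> units_of R Mod unipotent_products R"

context ring begin

lemma unit_class_closed: "x \<in> Units R \<Longrightarrow> unit_class R x \<in> carrier (unit_class_group R)"
  unfolding unit_class_def FactGroup_def RCOSETS_def by (auto simp: units_of_carrier)

lemma unit_class_mult:
  assumes "x \<in> Units R" "y \<in> Units R"
  shows "unit_class R (x \<otimes> y) = unit_class R x \<otimes>\<^bsub>unit_class_group R\<^esub> unit_class R y"
  using normal.rcos_sum[OF unipotent_products_normal, of x y] assms
  unfolding unit_class_def FactGroup_def by (simp add: units_of_carrier units_of_mult)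

lemma unit_class_eq_iff:
  assumes "x \<in> Units R" "y \<in> Units R"
  shows "unit_class R x = unit_class R y \<longleftrightarrow> x \<otimes> inv y \<in> unipotent_products R"
proof -
  interpret U: group "units_of R" by (rule units_group)
  have s: "subgroup (unipotent_products R) (units_of R)"
    using unipotent_products_normal by (simp add: normal_def)
  have x: "x \<in> unit_class R x"
    unfolding unit_class_def using U.rcos_self[OF _ s, of x] assms by (simp add: units_of_carrier)
  show ?thesis
  proof
    assume "unit_class R x = unit_class R y"
    hence "x \<in> unipotent_products R #>\<^bsub>units_of R\<^esub> y" using x unit_class_def by metis
    thus "x \<otimes> inv y \<in> unipotent_products R"
      using subgroup.rcos_module_imp[OF s U.group_axioms, of y x] assms
      by (simp add: units_of_carrier units_of_mult units_of_inv)
  next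
    assume "x \<otimes> inv y \<in> unipotent_products R"
    hence "x \<in> unipotent_products R #>\<^bsub>units_of R\<^esub> y"
      using subgroup.rcos_module_rev[OF s U.group_axioms, of y x] assms
      by (simp add: units_of_carrier units_of_mult units_of_inv)
    thus "unit_class R x = unit_class R y"
      unfolding unit_class_def using U.repr_independence[OF _ _ s, of x y] assms
      by (simp add: units_of_carrier)
  qed
qed

lemma unit_class_group: "group (unit_class_group R)"
  using normal.factorgroup_is_group[OF unipotent_products_normal] .

lemma unit_class_comm:
  assumes "commutators_unipotent R" shows "comm_group (unit_class_group R)"
proof (rule group.group_comm_groupI[OF unit_class_group])
  fix X' Y assume "X' \<in> carrier (unit_class_group R)" "Y \<in> carrier (unit_class_group R)"
  then obtain x y where x: "x \<in> Units R" "X' = unit_class R x" and y: "y \<in> Units R" "Y = unit_class R y"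
    unfolding FactGroup_def RCOSETS_def unit_class_def by (auto simp: units_of_carrier)
  have "x \<otimes> y \<otimes> inv (y \<otimes> x) = x \<otimes> y \<otimes> inv x \<otimes> inv y"
    using x y by (simp add: Units_inv_mult m_assoc)
  hence "x \<otimes> y \<otimes> inv (y \<otimes> x) \<in> unipotent_products R"
    using assms x y unfolding commutators_unipotent_def by auto
  hence "unit_class R (x \<otimes> y) = unit_class R (y \<otimes> x)"
    using unit_class_eq_iff x y by auto
  thus "X' \<otimes>\<^bsub>unit_class_group R\<^esub> Y = Y \<otimes>\<^bsub>unit_class_group R\<^esub> X'"
    using unit_class_mult x y by simp
qed

lemma commutators_unipotentI:
  assumes "comm_group (unit_class_group R)" shows "commutators_unipotent R"
  unfolding commutators_unipotent_def
proof (intro ballI)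
  fix x y assume x: "x \<in> Units R" and y: "y \<in> Units R"
  interpret G: comm_group "unit_class_group R" by fact
  have "unit_class R (x \<otimes> y) = unit_class R (y \<otimes> x)"
    using unit_class_mult unit_class_closed x y G.m_comm by simp
  hence "x \<otimes> y \<otimes> inv (y \<otimes> x) \<in> unipotent_products R"
    using unit_class_eq_iff x y by auto
  thus "x \<otimes> y \<otimes> inv x \<otimes> inv y \<in> unipotent_products R"
    using x y by (simp add: Units_inv_mult m_assoc)
qed

end

section \<open>Stable range one\<close>

text \<open>Bass's condition, with the coefficient of \<open>w\<close> absorbed into
  \<open>w\<close>: given \<open>z d + k w = 1\<close>, it is applied to \<open>k w\<close> in place
  of \<open>w\<close>, and a multiple of \<open>k w\<close> is again a multiple of
  \<open>w\<close>.\<close>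

definition stable_range_one :: "('a, 'x) ring_scheme \<Rightarrow> bool" where
  "stable_range_one R \<longleftrightarrow> (\<forall>d \<in> carrier R. \<forall>z \<in> carrier R. \<forall>w \<in> carrier R.
     z \<otimes>\<^bsub>R\<^esub> d \<oplus>\<^bsub>R\<^esub> w = \<one>\<^bsub>R\<^esub> \<longrightarrow> (\<exists>t \<in> carrier R. d \<oplus>\<^bsub>R\<^esub> t \<otimes>\<^bsub>R\<^esub> w \<in> Units R))"

section \<open>Peirce corners and block elimination\<close>

definition corner :: "('a, 'x) ring_scheme \<Rightarrow> 'a \<Rightarrow> ('a, 'x) ring_scheme" where
  "corner R e = R \<lparr> carrier := {x \<in> carrier R. e \<otimes>\<^bsub>R\<^esub> x = x \<and> x \<otimes>\<^bsub>R\<^esub> e = x}, one := e \<rparr>"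

lemma corner_simps [simp]:
  "carrier (corner R e) = {x \<in> carrier R. e \<otimes>\<^bsub>R\<^esub> x = x \<and> x \<otimes>\<^bsub>R\<^esub> e = x}"
  "\<one>\<^bsub>corner R e\<^esub> = e" "monoid.mult (corner R e) = monoid.mult R" "add (corner R e) = add R" "ring.zero (corner R e) = ring.zero R"
  by (simp_all add: corner_def)

context ring begin

lemma corner_ring:
  assumes "e \<in> carrier R" "e \<otimes> e = e" shows "ring (corner R e)"
proof (rule ringI)
  show "abelian_group (corner R e)"
  proof (rule abelian_groupI)
    fix x assume "x \<in> carrier (corner R e)"
    thus "\<exists>y\<in>carrier (corner R e). y \<oplus>\<^bsub>corner R e\<^esub> x = \<zero>\<^bsub>corner R e\<^esub>"
      using assms by (intro bexI[of _ "\<ominus> x"]) (auto simp: l_neg r_minus l_minus)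
  qed (use assms in \<open>auto simp: r_distr l_distr a_assoc a_comm a_lcomm\<close>)
  show "monoid (corner R e)"
    by (rule monoidI) (use assms in \<open>auto simp: m_assoc, metis m_assoc\<close>)
qed (use assms in \<open>auto simp: r_distr l_distr\<close>)

lemma corner_pow:
  assumes "e \<in> carrier R" "e \<otimes> e = e" "x \<in> carrier (corner R e)"
  shows "x [^]\<^bsub>corner R e\<^esub> Suc k = x [^] Suc k"
  using assms by (induction k) (auto simp: nat_pow_def)

text \<open>Replacing \<open>(d, w)\<close> by \<open>(P d Q + y w Q, w Q)\<close> does not affect
  whether some \<open>d + t w\<close> is a unit. This undoes the row and column operations of the
  elimination.\<close>

lemma good_transform:
  assumes "P \<in> Units R" "Q \<in> Units R" "d \<in> carrier R" "w \<in> carrier R" "y \<in> carrier R" "t \<in> carrier R"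
    and "P \<otimes> d \<otimes> Q \<oplus> y \<otimes> w \<otimes> Q \<oplus> t \<otimes> (w \<otimes> Q) \<in> Units R"
  shows "\<exists>t \<in> carrier R. d \<oplus> t \<otimes> w \<in> Units R"
proof -
  let ?t = "inv P \<otimes> (y \<oplus> t)"
  have c: "P \<in> carrier R" "Q \<in> carrier R" "inv P \<in> carrier R" "inv Q \<in> carrier R" using assms by auto
  have "P \<otimes> (d \<oplus> ?t \<otimes> w) \<otimes> Q = P \<otimes> d \<otimes> Q \<oplus> (P \<otimes> inv P) \<otimes> (y \<oplus> t) \<otimes> w \<otimes> Q"
    using c assms(3-6) by (simp add: r_distr l_distr m_assoc)
  also have "\<dots> = P \<otimes> d \<otimes> Q \<oplus> y \<otimes> w \<otimes> Q \<oplus> t \<otimes> (w \<otimes> Q)"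
    using c assms by (simp add: l_distr m_assoc a_assoc)
  finally have u: "P \<otimes> (d \<oplus> ?t \<otimes> w) \<otimes> Q \<in> Units R" using assms by simp
  have "inv P \<otimes> (P \<otimes> (d \<oplus> ?t \<otimes> w) \<otimes> Q) \<otimes> inv Q \<in> Units R"
    using u assms by (metis Units_m_closed Units_inv_Units)
  also have "inv P \<otimes> (P \<otimes> (d \<oplus> ?t \<otimes> w) \<otimes> Q) \<otimes> inv Q
      = (inv P \<otimes> P) \<otimes> (d \<oplus> ?t \<otimes> w) \<otimes> (Q \<otimes> inv Q)"
    using c assms(3-6) by (simp only: m_assoc m_closed a_closed)
  also have "\<dots> = d \<oplus> ?t \<otimes> w" using c assms by simp
  finally show ?thesis using c assms by (intro bexI[of _ ?t]) auto
qed

text \<open>The companion of \<open>good_transform\<close>: the hypothesis on \<open>(d, w)\<close>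
  survives the same operations, so that stable range one can be invoked again after them.\<close>

lemma unimodular_transform:
  assumes "P \<in> Units R" "Q \<in> Units R" "d \<in> carrier R" "w \<in> carrier R" "y \<in> carrier R"
    and "z \<in> carrier R" "k \<in> carrier R" "z \<otimes> d \<oplus> k \<otimes> w = \<one>"
  shows "\<exists>z \<in> carrier R. \<exists>k \<in> carrier R. z \<otimes> (P \<otimes> d \<otimes> Q \<oplus> y \<otimes> w \<otimes> Q) \<oplus> k \<otimes> (w \<otimes> Q) = \<one>"
proof -
  have c: "P \<in> carrier R" "Q \<in> carrier R" "inv P \<in> carrier R" "inv Q \<in> carrier R" using assms by auto
  define z' k' where "z' = inv Q \<otimes> z \<otimes> inv P" and "k' = inv Q \<otimes> (k \<ominus> z \<otimes> inv P \<otimes> y)"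
  have "z' \<otimes> (P \<otimes> d \<otimes> Q \<oplus> y \<otimes> w \<otimes> Q) \<oplus> k' \<otimes> (w \<otimes> Q)
    = inv Q \<otimes> (z \<otimes> (inv P \<otimes> P) \<otimes> d \<oplus> k \<otimes> w) \<otimes> Q"
    unfolding z'_def k'_def using c assms(3-7) by (simp add: nc_simps del: Units_l_inv)
  also have "\<dots> = inv Q \<otimes> Q" using c assms by simp
  also have "\<dots> = \<one>" using assms by simp
  finally show ?thesis unfolding z'_def k'_def using c assms by blast
qed

lemma square_zero_unit:
  assumes "n \<in> carrier R" "n \<otimes> n = \<zero>" shows "\<one> \<oplus> n \<in> Units R"
  using unipotent_Units[of n 2] assms by (simp add: numeral_2_eq_2)

lemma zero_prod:
  assumes "x \<in> carrier R" "p \<in> carrier R" "q \<in> carrier R" "y \<in> carrier R"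
    and "x \<otimes> p = x" "q \<otimes> y = y" "p \<otimes> q = \<zero>"
  shows "x \<otimes> y = \<zero>"
proof -
  have "x \<otimes> y = x \<otimes> (p \<otimes> q) \<otimes> y" using assms(1-6) by (metis m_assoc m_closed)
  thus ?thesis using assms by simp
qed

text \<open>Gaussian elimination on the Peirce blocks of \<open>d\<close>.\<close>

lemma stable_range_corners:
  assumes e: "e \<in> carrier R" "e \<otimes> e = e"
    and sre: "stable_range_one (corner R e)" and srf: "stable_range_one (corner R (\<one> \<ominus> e))"
  shows "stable_range_one R"
  unfolding stable_range_one_def
proof (intro ballI impI)
  fix d z w assume dzw: "d \<in> carrier R" "z \<in> carrier R" "w \<in> carrier R" "z \<otimes> d \<oplus> w = \<one>"
  define f where "f = \<one> \<ominus> e"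
  have f: "f \<in> carrier R" "f \<otimes> f = f" "e \<otimes> f = \<zero>" "f \<otimes> e = \<zero>" "e \<oplus> f = \<one>"
    using e by (simp_all add: f_def nc_simps)
  have er: "\<And>x. x \<in> carrier R \<Longrightarrow> e \<otimes> (e \<otimes> x) = e \<otimes> x" "\<And>x. x \<in> carrier R \<Longrightarrow> f \<otimes> (f \<otimes> x) = f \<otimes> x"
    "\<And>x. x \<in> carrier R \<Longrightarrow> e \<otimes> (f \<otimes> x) = \<zero>" "\<And>x. x \<in> carrier R \<Longrightarrow> f \<otimes> (e \<otimes> x) = \<zero>"
    using e f by (metis m_assoc, metis m_assoc, metis m_assoc l_null, metis m_assoc l_null)
  interpret Ce: ring "corner R e" by (rule corner_ring[OF e])
  interpret Cf: ring "corner R f" by (rule corner_ring[OF f(1,2)])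
  have split: "x = x \<otimes> e \<oplus> x \<otimes> f" if "x \<in> carrier R" for x
    using that e f r_distr[of e f x] by simp
  have splitl: "x = e \<otimes> x \<oplus> f \<otimes> x" if "x \<in> carrier R" for x
    using that e f l_distr[of e f x] by simp
  have "e \<otimes> z \<otimes> e \<otimes> (e \<otimes> d \<otimes> e) \<oplus> (e \<otimes> z \<otimes> f \<otimes> d \<otimes> e \<oplus> e \<otimes> w \<otimes> e) = e \<otimes> (z \<otimes> (e \<oplus> f) \<otimes> d \<oplus> w) \<otimes> e"
    using e f(1,2) dzw er by (simp add: m_assoc r_distr l_distr a_assoc)
  also have "\<dots> = e" using e f dzw by simp
  finally have "\<exists>y \<in> carrier (corner R e).
      e \<otimes> d \<otimes> e \<oplus> y \<otimes> (e \<otimes> z \<otimes> f \<otimes> d \<otimes> e \<oplus> e \<otimes> w \<otimes> e) \<in> Units (corner R e)"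
    using e f dzw er sre unfolding stable_range_one_def
    by (elim ballE[of _ _ "e \<otimes> d \<otimes> e"] ballE[of _ _ "e \<otimes> z \<otimes> e"]
        ballE[of _ _ "e \<otimes> z \<otimes> f \<otimes> d \<otimes> e \<oplus> e \<otimes> w \<otimes> e"])
      (simp_all add: m_assoc r_distr l_distr)
  then obtain y where y: "y \<in> carrier R" "e \<otimes> y = y" "y \<otimes> e = y"
    and uU: "e \<otimes> d \<otimes> e \<oplus> y \<otimes> (e \<otimes> z \<otimes> f \<otimes> d \<otimes> e \<oplus> e \<otimes> w \<otimes> e) \<in> Units (corner R e)"
    by auto
  \<comment> \<open>Stable range one in the corner at \<open>e\<close> adds multiples of
    \<open>e z f d e\<close> and of \<open>e w e\<close> to \<open>e d e\<close>. The former are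
    realized by the row operation \<open>P\<close>, unipotent because \<open>f y = 0\<close>, the
    latter by the summand \<open>y w\<close> of \<open>d1\<close>. Thus the block of
    \<open>d1\<close> at \<open>e\<close> becomes a unit.\<close>
  define P where "P = \<one> \<oplus> y \<otimes> z \<otimes> f"
  have fy: "f \<otimes> y = \<zero>" using y f e er by metis
  have yr: "\<And>x. x \<in> carrier R \<Longrightarrow> y \<otimes> (e \<otimes> x) = y \<otimes> x" using y e by (metis m_assoc)
  have "(y \<otimes> z \<otimes> f) \<otimes> (y \<otimes> z \<otimes> f) = y \<otimes> z \<otimes> (f \<otimes> y) \<otimes> (z \<otimes> f)"
    using y dzw f(1) by (simp add: m_assoc)
  hence "(y \<otimes> z \<otimes> f) \<otimes> (y \<otimes> z \<otimes> f) = \<zero>" using fy y dzw f by simp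
  hence P: "P \<in> Units R" "P \<in> carrier R" unfolding P_def using square_zero_unit y dzw f by auto
  define d1 where "d1 = P \<otimes> d \<oplus> y \<otimes> w"
  have d1: "d1 \<in> carrier R" unfolding d1_def using P dzw y by auto
  obtain z1 k1 where zk1: "z1 \<in> carrier R" "k1 \<in> carrier R" "z1 \<otimes> d1 \<oplus> k1 \<otimes> w = \<one>"
    using unimodular_transform[OF P(1) Units_one_closed dzw(1,3) y(1) dzw(2) one_closed] dzw P y
    unfolding d1_def by auto
  define u where "u = e \<otimes> d1 \<otimes> e"
  have "u = e \<otimes> d \<otimes> e \<oplus> y \<otimes> (e \<otimes> z \<otimes> f \<otimes> d \<otimes> e \<oplus> e \<otimes> w \<otimes> e)"
    unfolding u_def d1_def P_def
  proof -
    have "e \<otimes> ((\<one> \<oplus> y \<otimes> z \<otimes> f) \<otimes> d \<oplus> y \<otimes> w) \<otimes> e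
      = e \<otimes> d \<otimes> e \<oplus> ((e \<otimes> y) \<otimes> z \<otimes> f \<otimes> d \<otimes> e \<oplus> (e \<otimes> y) \<otimes> w \<otimes> e)"
      using e f(1) y(1) dzw by (simp add: m_assoc r_distr l_distr a_assoc)
    also have "\<dots> = e \<otimes> d \<otimes> e \<oplus> y \<otimes> (e \<otimes> z \<otimes> f \<otimes> d \<otimes> e \<oplus> e \<otimes> w \<otimes> e)"
      unfolding y(2) using e f(1) y(1) dzw yr by (simp add: m_assoc r_distr l_distr)
    finally show "e \<otimes> ((\<one> \<oplus> y \<otimes> z \<otimes> f) \<otimes> d \<oplus> y \<otimes> w) \<otimes> e = \<dots>" .
  qed
  with uU have "u \<in> Units (corner R e)" by simp
  then obtain u' where u': "u' \<in> carrier R" "e \<otimes> u' = u'" "u' \<otimes> e = u'" "u \<otimes> u' = e" "u' \<otimes> u = e"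
    unfolding Units_def by auto
  have u: "u \<in> carrier R" "e \<otimes> u = u" "u \<otimes> e = u"
    unfolding u_def using d1 e er by (auto simp: m_assoc)
  have fu': "f \<otimes> u' = \<zero>" "u' \<otimes> f = \<zero>" "f \<otimes> u = \<zero>" "u \<otimes> f = \<zero>"
    using u' u f e er by (metis, metis m_assoc r_null, metis, metis m_assoc r_null)
  \<comment> \<open>With the unit \<open>u\<close> as pivot, \<open>L\<close> and \<open>Q\<close>
    clear the two off-diagonal blocks of \<open>d1\<close>; the block left at \<open>f\<close> is
    the Schur complement \<open>v0\<close>.\<close>
  define L where "L = \<one> \<oplus> \<ominus> (f \<otimes> d1 \<otimes> u')"
  define Q where "Q = \<one> \<oplus> \<ominus> (u' \<otimes> d1 \<otimes> f)"
  have "(f \<otimes> d1 \<otimes> u') \<otimes> (f \<otimes> d1 \<otimes> u') = f \<otimes> d1 \<otimes> (u' \<otimes> f) \<otimes> (d1 \<otimes> u')"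
    "(u' \<otimes> d1 \<otimes> f) \<otimes> (u' \<otimes> d1 \<otimes> f) = u' \<otimes> d1 \<otimes> (f \<otimes> u') \<otimes> (d1 \<otimes> f)"
    using d1 u'(1) f(1) by (simp_all add: m_assoc)
  hence LQ: "L \<in> Units R" "Q \<in> Units R" "L \<in> carrier R" "Q \<in> carrier R"
    unfolding L_def Q_def using fu' d1 u' f
    by (auto intro!: square_zero_unit simp: l_minus r_minus)
  define d2 where "d2 = L \<otimes> d1 \<otimes> Q"
  have d2: "d2 \<in> carrier R" unfolding d2_def using LQ d1 by auto
  define v0 where "v0 = f \<otimes> d1 \<otimes> f \<ominus> f \<otimes> d1 \<otimes> u' \<otimes> d1 \<otimes> f"
  have v0: "v0 \<in> carrier R" "f \<otimes> v0 = v0" "v0 \<otimes> f = v0"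
    unfolding v0_def using f d1 u' er by (auto simp: nc_simps)
  have eq1: "L \<otimes> d1 = u \<oplus> e \<otimes> d1 \<otimes> f \<oplus> v0"
  proof -
    have a1: "d1 = u \<oplus> e \<otimes> d1 \<otimes> f \<oplus> (f \<otimes> d1 \<otimes> e \<oplus> f \<otimes> d1 \<otimes> f)"
      using splitl[OF d1] split[of "e \<otimes> d1"] split[of "f \<otimes> d1"] d1 e f u_def by simp
    have "f \<otimes> d1 \<otimes> u' \<otimes> d1 = f \<otimes> d1 \<otimes> (u' \<otimes> e) \<otimes> d1" using u' by simp
    also have "\<dots> = f \<otimes> d1 \<otimes> u' \<otimes> (e \<otimes> d1)" using u'(1) f(1) d1 e by (simp add: m_assoc)
    also have "e \<otimes> d1 = u \<oplus> e \<otimes> d1 \<otimes> f" using split[of "e \<otimes> d1"] d1 e u_def by simp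
    also have "f \<otimes> d1 \<otimes> u' \<otimes> (u \<oplus> e \<otimes> d1 \<otimes> f) = f \<otimes> d1 \<otimes> (u' \<otimes> u) \<oplus> f \<otimes> d1 \<otimes> (u' \<otimes> e) \<otimes> d1 \<otimes> f"
      using u'(1) u(1) f(1) d1 e(1) by (simp add: m_assoc r_distr)
    finally have a2: "f \<otimes> d1 \<otimes> u' \<otimes> d1 = f \<otimes> d1 \<otimes> e \<oplus> f \<otimes> d1 \<otimes> u' \<otimes> d1 \<otimes> f"
      using u' by simp
    have "L \<otimes> d1 = d1 \<ominus> f \<otimes> d1 \<otimes> u' \<otimes> d1"
      unfolding L_def using d1 f(1) u'(1) by (simp add: l_distr l_minus a_minus_def)
    also have "\<dots> = (u \<oplus> e \<otimes> d1 \<otimes> f \<oplus> (f \<otimes> d1 \<otimes> e \<oplus> f \<otimes> d1 \<otimes> f)) \<ominus> (f \<otimes> d1 \<otimes> e \<oplus> f \<otimes> d1 \<otimes> u' \<otimes> d1 \<otimes> f)"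
      using a1 a2 by simp
    finally show ?thesis unfolding v0_def
      using d1 f(1) u'(1) u(1) e(1) by (simp add: a_minus_def minus_add a_assoc a_comm a_lcomm r_neg l_neg r_neg1 r_neg2 cancel_deep)
  qed
  have d2_eq: "d2 = u \<oplus> v0"
  proof -
    have "d2 = (u \<oplus> e \<otimes> d1 \<otimes> f \<oplus> v0) \<oplus> \<ominus> ((u \<oplus> e \<otimes> d1 \<otimes> f \<oplus> v0) \<otimes> (u' \<otimes> d1 \<otimes> f))"
      unfolding d2_def eq1 unfolding Q_def using u(1) u'(1) e(1) f(1) d1 v0(1)
      by (simp add: r_distr r_minus)
    also have "(u \<oplus> e \<otimes> d1 \<otimes> f \<oplus> v0) \<otimes> (u' \<otimes> d1 \<otimes> f)
        = (u \<otimes> u') \<otimes> d1 \<otimes> f \<oplus> e \<otimes> d1 \<otimes> (f \<otimes> u') \<otimes> d1 \<otimes> f \<oplus> (v0 \<otimes> u') \<otimes> d1 \<otimes> f"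
      using u(1) u'(1) e(1) f(1) d1 v0(1) by (simp add: l_distr m_assoc)
    also have "v0 \<otimes> u' = \<zero>" using v0 fu' u' f by (metis m_assoc r_null)
    finally show ?thesis using u u' fu' e f(1) d1 v0
      by (simp add: a_assoc a_comm a_lcomm r_neg l_neg r_neg1 r_neg2 cancel_deep)
  qed
  define w2 where "w2 = w \<otimes> Q"
  have w2: "w2 \<in> carrier R" unfolding w2_def using LQ dzw by auto
  obtain z2 k2 where zk2: "z2 \<in> carrier R" "k2 \<in> carrier R" "z2 \<otimes> d2 \<oplus> k2 \<otimes> w2 = \<one>"
    using unimodular_transform[OF LQ(1,2) d1 dzw(3) zero_closed zk1] dzw LQ d1
    unfolding d2_def w2_def by auto
  have d2f: "d2 \<otimes> f = v0" unfolding d2_eq using u v0 f fu' by (simp add: l_distr)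
  have "f \<otimes> z2 \<otimes> f \<otimes> v0 \<oplus> f \<otimes> k2 \<otimes> w2 \<otimes> f = f \<otimes> (z2 \<otimes> (d2 \<otimes> f) \<oplus> k2 \<otimes> w2 \<otimes> f)"
    unfolding d2f using v0 zk2 w2 f(1) by (simp add: m_assoc r_distr)
  also have "\<dots> = f \<otimes> (z2 \<otimes> d2 \<oplus> k2 \<otimes> w2) \<otimes> f"
    using zk2(1,2) d2 w2 f(1) by (simp add: m_assoc r_distr l_distr)
  also have "\<dots> = f" using zk2 f by simp
  finally have "\<exists>t \<in> carrier (corner R f). v0 \<oplus> t \<otimes> (f \<otimes> k2 \<otimes> w2 \<otimes> f) \<in> Units (corner R f)"
    using v0 zk2 w2 f er srf[folded f_def] unfolding stable_range_one_def
    by (elim ballE[of _ _ v0] ballE[of _ _ "f \<otimes> z2 \<otimes> f"] ballE[of _ _ "f \<otimes> k2 \<otimes> w2 \<otimes> f"])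
      (simp_all add: m_assoc r_distr l_distr)
  then obtain y2 where y2: "y2 \<in> carrier R" "f \<otimes> y2 = y2" "y2 \<otimes> f = y2"
    and vU: "v0 \<oplus> y2 \<otimes> (f \<otimes> k2 \<otimes> w2 \<otimes> f) \<in> Units (corner R f)" by auto
  define v where "v = v0 \<oplus> y2 \<otimes> (f \<otimes> k2 \<otimes> w2 \<otimes> f)"
  obtain v' where v': "v' \<in> carrier R" "f \<otimes> v' = v'" "v' \<otimes> f = v'" "v \<otimes> v' = f" "v' \<otimes> v = f"
    and v: "v \<in> carrier R" "f \<otimes> v = v" "v \<otimes> f = v"
    using vU unfolding Units_def v_def[symmetric] by auto
  \<comment> \<open>Adding \<open>y2 k2 w2\<close> turns the block at \<open>f\<close> into a unit
    and also fills the lower left block, which is \<open>x\<close>. As \<open>y2 = f y2\<close>, the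
    upper row is untouched and the result is triangular.\<close>
  define x where "x = y2 \<otimes> k2 \<otimes> w2 \<otimes> e"
  have "f \<otimes> x = (f \<otimes> y2) \<otimes> k2 \<otimes> w2 \<otimes> e" "x \<otimes> e = y2 \<otimes> k2 \<otimes> w2 \<otimes> (e \<otimes> e)"
    unfolding x_def using y2(1) zk2(1,2) w2 e(1) f(1) by (simp_all add: m_assoc)
  hence x: "x \<in> carrier R" "f \<otimes> x = x" "x \<otimes> e = x"
    unfolding y2(2) e(2) x_def using y2(1) zk2(1,2) w2 e(1) by simp_all
  have tot: "d2 \<oplus> (y2 \<otimes> k2) \<otimes> w2 = u \<oplus> v \<oplus> x"
  proof -
    have "y2 \<otimes> (f \<otimes> k2 \<otimes> w2 \<otimes> f) = (y2 \<otimes> f) \<otimes> k2 \<otimes> w2 \<otimes> f"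
      using y2(1) zk2 w2 f(1) by (simp add: m_assoc)
    hence "v = v0 \<oplus> y2 \<otimes> k2 \<otimes> w2 \<otimes> f" unfolding v_def y2(3) by simp
    moreover have "y2 \<otimes> k2 \<otimes> w2 = x \<oplus> y2 \<otimes> k2 \<otimes> w2 \<otimes> f"
      unfolding x_def using y2 zk2 w2 by (intro split) auto
    ultimately show ?thesis unfolding d2_eq
      using u v0 x y2 zk2 w2 f(1) by (simp add: a_assoc a_comm a_lcomm)
  qed
  have z: "u \<otimes> v' = \<zero>" "v' \<otimes> u = \<zero>" "v \<otimes> u' = \<zero>" "u' \<otimes> v = \<zero>" "x \<otimes> v' = \<zero>" "u' \<otimes> x = \<zero>"
    by (rule zero_prod[of _ e f] zero_prod[of _ f e]; use u u' v v' x e f in simp; fail)+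
  \<comment> \<open>The inverse of a triangular matrix with diagonal blocks \<open>u\<close>,
    \<open>v\<close> and lower left block \<open>x\<close>.\<close>
  have "(u \<oplus> v \<oplus> x) \<otimes> (u' \<oplus> v' \<oplus> \<ominus> (v' \<otimes> x \<otimes> u'))
    = u \<otimes> u' \<oplus> v \<otimes> v' \<oplus> u \<otimes> v' \<oplus> v \<otimes> u' \<oplus> x \<otimes> u' \<oplus> x \<otimes> v'
      \<ominus> (u \<otimes> v') \<otimes> (x \<otimes> u') \<ominus> (v \<otimes> v') \<otimes> (x \<otimes> u') \<ominus> (x \<otimes> v') \<otimes> (x \<otimes> u')"
    using u(1) v(1) x(1) u'(1) v'(1) by (simp add: nc_simps)
  also have "\<dots> = \<one>"
    using z u' v' x u v f e m_assoc[of f x u'] by (simp add: a_minus_def a_assoc r_neg)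
  finally have i1: "(u \<oplus> v \<oplus> x) \<otimes> (u' \<oplus> v' \<oplus> \<ominus> (v' \<otimes> x \<otimes> u')) = \<one>" .
  have "(u' \<oplus> v' \<oplus> \<ominus> (v' \<otimes> x \<otimes> u')) \<otimes> (u \<oplus> v \<oplus> x)
    = u' \<otimes> u \<oplus> v' \<otimes> v \<oplus> u' \<otimes> v \<oplus> v' \<otimes> u \<oplus> u' \<otimes> x \<oplus> v' \<otimes> x
      \<ominus> (v' \<otimes> x) \<otimes> (u' \<otimes> u) \<ominus> (v' \<otimes> x) \<otimes> (u' \<otimes> v) \<ominus> (v' \<otimes> x) \<otimes> (u' \<otimes> x)"
    using u(1) v(1) x(1) u'(1) v'(1) by (simp add: nc_simps)
  also have "\<dots> = \<one>"
    using z u' v' x u v f e m_assoc[of v' x e] by (simp add: a_minus_def a_assoc r_neg)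
  finally have i2: "(u' \<oplus> v' \<oplus> \<ominus> (v' \<otimes> x \<otimes> u')) \<otimes> (u \<oplus> v \<oplus> x) = \<one>" .
  have "u \<oplus> v \<oplus> x \<in> Units R"
    unfolding Units_def using i1 i2 u v x u' v' by (auto intro!: bexI[of _ "u' \<oplus> v' \<oplus> \<ominus> (v' \<otimes> x \<otimes> u')"])
  hence LdQ: "L \<otimes> d1 \<otimes> Q \<oplus> \<zero> \<otimes> w \<otimes> Q \<oplus> (y2 \<otimes> k2) \<otimes> (w \<otimes> Q) \<in> Units R"
    using tot d2_def w2_def LQ d1 dzw by simp
  have "y2 \<otimes> k2 \<in> carrier R" using y2 zk2 by simp
  from good_transform[OF LQ(1,2) d1 dzw(3) zero_closed this LdQ]
  obtain t1 where t1: "t1 \<in> carrier R" "d1 \<oplus> t1 \<otimes> w \<in> Units R" ..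
  hence PdQ: "P \<otimes> d \<otimes> \<one> \<oplus> y \<otimes> w \<otimes> \<one> \<oplus> t1 \<otimes> (w \<otimes> \<one>) \<in> Units R"
    using d1_def P dzw y by simp
  show "\<exists>t\<in>carrier R. d \<oplus> t \<otimes> w \<in> Units R"
    by (rule good_transform[OF P(1) Units_one_closed dzw(1,3) y(1) t1(1) PdQ])
qed


section \<open>Strongly pi-regular rings\<close>

lemma nat_pow_regular:
  assumes "x \<in> carrier R" "w \<in> carrier R" "x \<otimes> w = w \<otimes> x" "x [^] (k::nat) = x [^] Suc k \<otimes> w"
  shows "\<exists>e \<in> carrier R. e \<otimes> e = e \<and> x [^] k = x [^] k \<otimes> e \<and> (\<exists>q \<in> carrier R. e = q \<otimes> x [^] k \<and> e = x [^] k \<otimes> q)"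
proof -
  \<comment> \<open>\<open>?p\<close> fixes \<open>x [^] k\<close>, and its \<open>k\<close>-th
    power is a multiple of \<open>x [^] k\<close>; hence that power is idempotent. It is the Fitting
    idempotent of \<open>x\<close>.\<close>
  let ?p = "x \<otimes> w"
  have 1: "x [^] k \<otimes> ?p [^] m = x [^] k" for m :: nat
  proof (induction m)
    case (Suc m)
    have "x [^] k \<otimes> ?p = x [^] k" using assms by (simp add: m_assoc)
    moreover have "x [^] k \<otimes> ?p [^] Suc m = x [^] k \<otimes> ?p [^] m \<otimes> ?p" using assms by (simp add: m_assoc)
    ultimately show ?case using Suc by simp
  qed (use assms in simp)
  have 2: "?p [^] k = x [^] k \<otimes> w [^] k" using pow_mult_distrib[OF assms(3,1,2)] .
  have 3: "?p [^] k = w [^] k \<otimes> x [^] k"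
    using pow_mult_distrib[OF assms(3)[symmetric] assms(2,1)] assms(3) by simp
  have "?p [^] k \<otimes> ?p [^] k = w [^] k \<otimes> (x [^] k \<otimes> ?p [^] k)"
    using 3 assms(1,2) by (metis m_assoc nat_pow_closed m_closed)
  hence "?p [^] k \<otimes> ?p [^] k = ?p [^] k" using 1[of k] 3[symmetric] by simp
  thus ?thesis using 1[of k, symmetric] 2 3 assms(1,2)
    by (intro bexI[of _ "?p [^] k"] conjI bexI[of _ "w [^] k"]) (assumption | simp only: m_closed nat_pow_closed)+
qed

definition strongly_pi_regular :: bool where
  "strongly_pi_regular \<longleftrightarrow> (\<forall>x \<in> carrier R. \<exists>w \<in> carrier R. \<exists>k::nat.
     x \<otimes> w = w \<otimes> x \<and> x [^] k = x [^] Suc k \<otimes> w)"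

text \<open>The Fitting idempotent is trivial, so every element is a unit or nilpotent. If
  \<open>w\<close> is a unit, \<open>d\<close> can be changed into 1. Otherwise \<open>w\<close> is
  nilpotent, \<open>z d = 1 - w\<close> is a unit, and \<open>d\<close>, having a left inverse,
  cannot be nilpotent.\<close>

lemma stable_range_local:
  assumes pi: "strongly_pi_regular" and triv: "\<And>e. e \<in> carrier R \<Longrightarrow> e \<otimes> e = e \<Longrightarrow> e = \<zero> \<or> e = \<one>"
  shows "stable_range_one R"
  unfolding stable_range_one_def
proof (intro ballI impI)
  fix d z w assume dzw: "d \<in> carrier R" "z \<in> carrier R" "w \<in> carrier R" "z \<otimes> d \<oplus> w = \<one>"
  have dich: "x \<in> Units R \<or> (\<exists>k::nat. x [^] k = \<zero>)" if x: "x \<in> carrier R" for x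
  proof -
    obtain w and k :: nat where w: "w \<in> carrier R" "x \<otimes> w = w \<otimes> x" "x [^] k = x [^] Suc k \<otimes> w"
      using pi x unfolding strongly_pi_regular_def by blast
    obtain e q where e: "e \<in> carrier R" "e \<otimes> e = e" "x [^] k = x [^] k \<otimes> e"
      "q \<in> carrier R" "e = q \<otimes> x [^] k" "e = x [^] k \<otimes> q"
      using nat_pow_regular[OF x w] by blast
    \<comment> \<open>For \<open>k = 0\<close> the idempotent says nothing about \<open>x\<close>,
      but the equation between the zeroth power of \<open>x\<close> and \<open>x w\<close>
      does.\<close>
    consider "e = \<zero>" | "e = \<one>" "k = 0" | j where "e = \<one>" "k = Suc j"
      using triv[OF e(1,2)] by (cases k) auto
    thus ?thesis
    proof cases
      case 1
      thus ?thesis using e x by (metis nat_pow_closed r_null)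
    next
      case 2
      hence "\<one> = x \<otimes> w" using w x by simp
      thus ?thesis using w x unfolding Units_def by force
    next
      case 3
      have "x \<otimes> (x [^] j \<otimes> q) = \<one>" "(q \<otimes> x [^] j) \<otimes> x = \<one>"
        using e 3 x by (metis m_assoc nat_pow_Suc2 nat_pow_closed, metis m_assoc nat_pow_Suc nat_pow_closed)
      thus ?thesis using inv_unique[of "q \<otimes> x [^] j" x "x [^] j \<otimes> q"] x e
        unfolding Units_def by (auto intro!: disjI1)
    qed
  qed
  have "\<exists>t \<in> carrier R. d \<oplus> t \<otimes> w = \<one>" if w: "w \<in> Units R"
  proof
    show "d \<oplus> (\<one> \<ominus> d) \<otimes> inv w \<otimes> w = \<one>"
      using w dzw(1) by (simp add: m_assoc) (simp add: nc_simps)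
  qed (use w dzw in auto)
  moreover have "d \<in> Units R" if wn: "w \<notin> Units R"
  proof (rule ccontr)
    assume "d \<notin> Units R"
    then obtain k :: nat where k: "d [^] k = \<zero>" using dich[OF dzw(1)] by blast
    obtain l :: nat where l: "w [^] l = \<zero>" using dich[OF dzw(3)] wn by blast
    have zd: "z \<otimes> d = \<one> \<oplus> \<ominus> w"
      using dzw by (metis a_minus_def add.inv_solve_right m_closed one_closed)
    have "(\<ominus> w) [^] l = \<zero>" using pow_uminus_cases[of w l] l dzw by auto
    hence "\<one> \<oplus> \<ominus> w \<in> Units R" using unipotent_Units dzw by auto
    then obtain q where q: "q \<in> carrier R" "q \<otimes> (z \<otimes> d) = \<one>"
      using zd by (metis Units_inv_closed Units_l_inv)
    have "(q \<otimes> z) [^] j \<otimes> d [^] j = \<one>" for j :: nat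
    proof (induction j)
      case (Suc j)
      have "(q \<otimes> z) [^] Suc j \<otimes> d [^] Suc j = (q \<otimes> z) [^] j \<otimes> (q \<otimes> (z \<otimes> d)) \<otimes> d [^] j"
        using q(1) dzw(1,2) by (metis m_assoc m_closed nat_pow_Suc nat_pow_Suc2 nat_pow_closed)
      thus ?case using q Suc dzw by simp
    qed simp
    \<comment> \<open>The zero ring is not excluded; there \<open>d\<close> equals 1 and is a unit
      after all.\<close>
    from this[of k] have "\<one> = \<zero>" using k q dzw by simp
    hence "d = \<one>" using dzw by (metis l_one l_null)
    thus False using \<open>d \<notin> Units R\<close> by simp
  qed
  ultimately show "\<exists>t\<in>carrier R. d \<oplus> t \<otimes> w \<in> Units R"
    using dzw by (metis Units_one_closed l_null r_zero zero_closed)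
qed

definition orthogonal_idempotents :: "'a set \<Rightarrow> bool" where
  "orthogonal_idempotents S \<longleftrightarrow> finite S \<and> S \<subseteq> carrier R - {\<zero>} \<and>
     (\<forall>e \<in> S. e \<otimes> e = e) \<and> (\<forall>e \<in> S. \<forall>f \<in> S. e \<noteq> f \<longrightarrow> e \<otimes> f = \<zero>)"

lemma corner_strongly_pi_regular:
  assumes "strongly_pi_regular" "e \<in> carrier R" "e \<otimes> e = e"
  shows "ring.strongly_pi_regular (corner R e)"
proof -
  interpret C: ring "corner R e" by (rule corner_ring[OF assms(2,3)])
  show ?thesis unfolding C.strongly_pi_regular_def
  proof
    fix x assume x: "x \<in> carrier (corner R e)"
    then obtain w and k :: nat where w: "w \<in> carrier R" "x \<otimes> w = w \<otimes> x" "x [^] k = x [^] Suc k \<otimes> w"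
      using assms unfolding strongly_pi_regular_def by auto
    have er: "\<And>y. y \<in> carrier R \<Longrightarrow> e \<otimes> (e \<otimes> y) = e \<otimes> y" using assms by (metis m_assoc)
    have xr: "x \<in> carrier R" "e \<otimes> x = x" "x \<otimes> e = x" using x by auto
    have "x \<otimes> (e \<otimes> w \<otimes> e) = (x \<otimes> e) \<otimes> w \<otimes> e" "(e \<otimes> w \<otimes> e) \<otimes> x = e \<otimes> w \<otimes> (e \<otimes> x)"
      using xr(1) w(1) assms(2) by (simp_all add: m_assoc)
    moreover have "x \<otimes> w \<otimes> e = w \<otimes> (x \<otimes> e)" "e \<otimes> w \<otimes> x = (e \<otimes> x) \<otimes> w"
      using xr(1) w(1,2) assms(2) m_assoc[of w x e] m_assoc[of e w x] m_assoc[of e x w] by simp_all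
    ultimately have c: "x \<otimes> (e \<otimes> w \<otimes> e) = (e \<otimes> w \<otimes> e) \<otimes> x"
      using xr w(2) by simp
    have xk: "x [^] Suc j \<otimes> e = x [^] Suc j" for j
      using xr assms by (simp add: m_assoc)
    \<comment> \<open>The exponent is raised by one because \<open>corner_pow\<close> covers
      positive powers only: the zeroth power in the corner is \<open>e\<close>.\<close>
    have "x [^] Suc k = x [^] Suc (Suc k) \<otimes> w"
      using w xr by (metis nat_pow_Suc2 m_assoc nat_pow_closed)
    hence "x [^] Suc k = x [^] Suc (Suc k) \<otimes> (e \<otimes> w \<otimes> e)"
      using xk[of k] xk[of "Suc k"] xr(1) w(1) assms(2) by (metis m_assoc m_closed nat_pow_closed)
    thus "\<exists>w\<in>carrier (corner R e). \<exists>k::nat.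
        x \<otimes>\<^bsub>corner R e\<^esub> w = w \<otimes>\<^bsub>corner R e\<^esub> x \<and>
        x [^]\<^bsub>corner R e\<^esub> k = x [^]\<^bsub>corner R e\<^esub> Suc k \<otimes>\<^bsub>corner R e\<^esub> w"
      using c corner_pow[OF assms(2,3) x] w(1) assms er
      by (intro bexI[of _ "e \<otimes> w \<otimes> e"] exI[of _ "Suc k"]) (simp_all add: m_assoc)
  qed
qed

end

text \<open>Adjoining \<open>1 - e\<close> shows that proper corners admit strictly smaller
  orthogonal families. Their maximal size is the induction measure in the next theorem.\<close>

lemma (in ring) corner_orthogonal_idempotents:
  assumes "e \<in> carrier R" "e \<otimes> e = e" "e \<noteq> \<one>" "ring.orthogonal_idempotents (corner R e) S"
  shows "\<exists>T. orthogonal_idempotents T \<and> card T = Suc (card S)"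
proof -
  interpret C: ring "corner R e" by (rule corner_ring[OF assms(1,2)])
  have S: "finite S" "\<And>x. x \<in> S \<Longrightarrow> x \<in> carrier R \<and> e \<otimes> x = x \<and> x \<otimes> e = x \<and> x \<noteq> \<zero> \<and> x \<otimes> x = x"
    "\<And>x y. x \<in> S \<Longrightarrow> y \<in> S \<Longrightarrow> x \<noteq> y \<Longrightarrow> x \<otimes> y = \<zero>"
    using assms(4) unfolding C.orthogonal_idempotents_def by auto
  let ?f = "\<one> \<ominus> e"
  have f: "?f \<in> carrier R" "?f \<otimes> ?f = ?f" using assms by (simp_all add: nc_simps)
  have f0: "?f \<noteq> \<zero>" using assms by (simp add: r_right_minus_eq)
  have fx: "?f \<otimes> x = \<zero>" "x \<otimes> ?f = \<zero>" if "x \<in> S" for x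
    using S(2)[OF that] assms(1) by (simp_all add: nc_simps)
  have "?f \<notin> S" using fx(1) f f0 by metis
  moreover have "orthogonal_idempotents (insert ?f S)"
    unfolding orthogonal_idempotents_def using S f f0 fx by auto
  ultimately show ?thesis using S(1) by (intro exI[of _ "insert ?f S"]) auto
qed

text \<open>Nontrivial idempotents are split off until only the trivial ones are left; the corners
  are assembled by \<open>stable_range_corners\<close>.\<close>

theorem stable_range_one_strongly_pi_regular:
  assumes "ring R" "ring.strongly_pi_regular R" "\<And>S. ring.orthogonal_idempotents R S \<Longrightarrow> card S \<le> n"
  shows "stable_range_one R"
  using assms
proof (induction n arbitrary: R)
  case 0
  interpret ring R by fact
  have "e = \<zero>\<^bsub>R\<^esub>" if e: "e \<in> carrier R" "e \<otimes>\<^bsub>R\<^esub> e = e" for e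
  proof (rule ccontr)
    assume "e \<noteq> \<zero>\<^bsub>R\<^esub>"
    hence "orthogonal_idempotents {e}" using e unfolding orthogonal_idempotents_def by auto
    from 0(3)[OF this] show False by simp
  qed
  thus ?case using stable_range_local 0 by blast
next
  case (Suc n)
  interpret ring R by fact
  show ?case
  proof (cases "\<forall>e \<in> carrier R. e \<otimes>\<^bsub>R\<^esub> e = e \<longrightarrow> e = \<zero>\<^bsub>R\<^esub> \<or> e = \<one>\<^bsub>R\<^esub>")
    case True
    thus ?thesis using stable_range_local Suc by blast
  next
    case False
    then obtain e where e: "e \<in> carrier R" "e \<otimes>\<^bsub>R\<^esub> e = e" "e \<noteq> \<zero>\<^bsub>R\<^esub>" "e \<noteq> \<one>\<^bsub>R\<^esub>" by blast
    have *: "stable_range_one (corner R g)" if g: "g \<in> carrier R" "g \<otimes>\<^bsub>R\<^esub> g = g" "g \<noteq> \<one>\<^bsub>R\<^esub>" for g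
    proof (rule Suc.IH)
      show "ring (corner R g)" by (rule corner_ring[OF g(1,2)])
      show "ring.strongly_pi_regular (corner R g)"
        by (rule corner_strongly_pi_regular[OF Suc(3) g(1,2)])
      fix S assume "ring.orthogonal_idempotents (corner R g) S"
      from corner_orthogonal_idempotents[OF g this] Suc(4) show "card S \<le> n" by fastforce
    qed
    have "\<one>\<^bsub>R\<^esub> \<ominus>\<^bsub>R\<^esub> e \<in> carrier R" "(\<one>\<^bsub>R\<^esub> \<ominus>\<^bsub>R\<^esub> e) \<otimes>\<^bsub>R\<^esub> (\<one>\<^bsub>R\<^esub> \<ominus>\<^bsub>R\<^esub> e) = \<one>\<^bsub>R\<^esub> \<ominus>\<^bsub>R\<^esub> e"
      using e by (simp_all add: nc_simps)
    moreover have "\<one>\<^bsub>R\<^esub> \<ominus>\<^bsub>R\<^esub> e \<noteq> \<one>\<^bsub>R\<^esub>"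
    proof
      assume "\<one>\<^bsub>R\<^esub> \<ominus>\<^bsub>R\<^esub> e = \<one>\<^bsub>R\<^esub>"
      hence "e \<otimes>\<^bsub>R\<^esub> (\<one>\<^bsub>R\<^esub> \<ominus>\<^bsub>R\<^esub> e) = e" using e by simp
      thus False using e by (simp add: nc_simps)
    qed
    ultimately show ?thesis using stable_range_corners[OF e(1,2)] * e by blast
  qed
qed

section \<open>Algebras that are finitely generated as modules\<close>

lemma (in ideal) finsum_mem:
  assumes "\<And>i. i \<in> A \<Longrightarrow> f i \<in> I" shows "finsum R f A \<in> I"
proof (cases "finite A")
  case True
  thus ?thesis using assms
    by (induction A) (auto simp: additive_subgroup.zero_closed a_closed intro!: additive_subgroup.a_closed[OF is_additive_subgroup])
qed (simp add: additive_subgroup.zero_closed)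

text \<open>Gaussian elimination by cross-multiplication instead of division, with a pivot
  \<open>c k j\<close> outside \<open>P\<close>; multiplying by the pivot keeps a coefficient
  outside \<open>P\<close> since \<open>P\<close> is prime. In this form the lemma serves both for
  maximal \<open>P\<close> and for the zero ideal.\<close>

lemma (in cring) linear_dependence_mod_prime:
  assumes P: "primeideal P R" and "finite J" "finite I" "card J < card I"
    and "\<And>i j. i \<in> I \<Longrightarrow> j \<in> J \<Longrightarrow> c i j \<in> carrier R"
  shows "\<exists>r \<in> I \<rightarrow> carrier R. (\<exists>i \<in> I. r i \<notin> P) \<and> (\<forall>j \<in> J. (\<Oplus>i\<in>I. r i \<otimes> c i j) \<in> P)"
  using assms(2-)
proof (induction J arbitrary: I c rule: finite_induct)
  case empty
  then obtain i where "i \<in> I" by fastforce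
  moreover have "\<one> \<notin> P"
    using primeideal.I_notcarr[OF P] ideal.one_imp_carrier[OF primeideal.axioms(1)[OF P]] by auto
  ultimately show ?case by (intro bexI[of _ "\<lambda>_. \<one>"]) auto
next
  case (insert j J)
  interpret P: primeideal P R by fact
  show ?case
  proof (cases "\<forall>i \<in> I. c i j \<in> P")
    case True
    have "card J < card I" using insert by simp
    from insert.IH[OF insert.prems(1) this, of c] insert.prems
    obtain r where r: "r \<in> I \<rightarrow> carrier R" "\<exists>i\<in>I. r i \<notin> P" "\<forall>j\<in>J. (\<Oplus>i\<in>I. r i \<otimes> c i j) \<in> P"
      by auto
    moreover have "(\<Oplus>i\<in>I. r i \<otimes> c i j) \<in> P"
      using True r(1) by (intro P.finsum_mem P.I_l_closed) auto
    ultimately show ?thesis by auto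
  next
    case False
    then obtain k where k: "k \<in> I" "c k j \<notin> P" by blast
    let ?I = "I - {k}"
    define c' where "c' i l = c k j \<otimes> c i l \<ominus> c i j \<otimes> c k l" for i l
    have cc: "\<And>i l. i \<in> I \<Longrightarrow> l \<in> insert j J \<Longrightarrow> c i l \<in> carrier R" using insert by auto
    have "card J < card ?I" using insert k by (simp add: card_Diff_singleton)
    moreover have "finite ?I" using insert by simp
    moreover have "\<And>i l. i \<in> ?I \<Longrightarrow> l \<in> J \<Longrightarrow> c' i l \<in> carrier R"
      using cc k unfolding c'_def by auto
    ultimately obtain r where r: "r \<in> ?I \<rightarrow> carrier R" "\<exists>i\<in>?I. r i \<notin> P" "\<forall>l\<in>J. (\<Oplus>i\<in>?I. r i \<otimes> c' i l) \<in> P"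
      using insert.IH[of ?I c'] by auto
    have rc: "\<And>i. i \<in> ?I \<Longrightarrow> r i \<in> carrier R" using r by auto
    define S where "S = (\<Oplus>i\<in>?I. r i \<otimes> c i j)"
    have S: "S \<in> carrier R" unfolding S_def using rc cc by (intro finsum_closed) auto
    \<comment> \<open>The solution for the remaining rows is scaled by the pivot, and the
      coefficient at \<open>k\<close> makes the \<open>j\<close>-th coordinate vanish exactly, not
      only modulo \<open>P\<close>.\<close>
    define r' where "r' i = (if i = k then \<ominus> S else c k j \<otimes> r i)" for i
    have r': "r' \<in> I \<rightarrow> carrier R" unfolding r'_def using S rc cc k by auto
    have eq: "(\<Oplus>i\<in>I. r' i \<otimes> c i l) = (\<Oplus>i\<in>?I. r i \<otimes> c' i l)" if l: "l \<in> insert j J" for l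
    proof -
      have "(\<Oplus>i\<in>I. r' i \<otimes> c i l) = (\<Oplus>i\<in>insert k ?I. r' i \<otimes> c i l)"
        using k by (simp add: insert_absorb)
      also have "\<dots> = r' k \<otimes> c k l \<oplus> (\<Oplus>i\<in>?I. r' i \<otimes> c i l)"
        using insert.prems r' cc k l by (intro finsum_insert) auto
      also have "(\<Oplus>i\<in>?I. r' i \<otimes> c i l) = (\<Oplus>i\<in>?I. c k j \<otimes> (r i \<otimes> c i l))"
        using rc cc k l by (intro finsum_cong') (auto simp: r'_def m_assoc)
      also have "r' k \<otimes> c k l = (\<Oplus>i\<in>?I. \<ominus> (r i \<otimes> c i j \<otimes> c k l))"
      proof -
        have "r' k \<otimes> c k l = S \<otimes> (\<ominus> c k l)" unfolding r'_def using S cc k l by (simp add: l_minus r_minus)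
        also have "\<dots> = (\<Oplus>i\<in>?I. (r i \<otimes> c i j) \<otimes> (\<ominus> c k l))"
          unfolding S_def using rc cc k l insert.prems by (intro finsum_ldistr) auto
        also have "\<dots> = (\<Oplus>i\<in>?I. \<ominus> (r i \<otimes> c i j \<otimes> c k l))"
          using rc cc k l by (intro finsum_cong') (auto simp: r_minus)
        finally show ?thesis .
      qed
      also have "(\<Oplus>i\<in>?I. \<ominus> (r i \<otimes> c i j \<otimes> c k l)) \<oplus> (\<Oplus>i\<in>?I. c k j \<otimes> (r i \<otimes> c i l))
          = (\<Oplus>i\<in>?I. \<ominus> (r i \<otimes> c i j \<otimes> c k l) \<oplus> c k j \<otimes> (r i \<otimes> c i l))"
        using rc cc k l by (intro finsum_addf[symmetric]) auto
      also have "\<dots> = (\<Oplus>i\<in>?I. r i \<otimes> c' i l)"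
      proof (rule finsum_cong')
        fix i assume i: "i \<in> ?I"
        hence "r i \<in> carrier R" "c i j \<in> carrier R" "c k l \<in> carrier R" "c k j \<in> carrier R" "c i l \<in> carrier R"
          using rc cc k l by auto
        thus "\<ominus> (r i \<otimes> c i j \<otimes> c k l) \<oplus> c k j \<otimes> (r i \<otimes> c i l) = r i \<otimes> c' i l"
          unfolding c'_def by algebra
      qed (use rc cc k l in \<open>auto simp: c'_def\<close>)
      finally show ?thesis .
    qed
    have "(\<Oplus>i\<in>I. r' i \<otimes> c i l) \<in> P" if l: "l \<in> insert j J" for l
    proof (cases "l = j")
      case True
      have "r i \<otimes> c' i j = \<zero>" if "i \<in> ?I" for i
        unfolding c'_def using rc[OF that] cc that k by (simp add: m_comm r_neg a_minus_def)
      hence "(\<Oplus>i\<in>?I. r i \<otimes> c' i j) = (\<Oplus>i\<in>?I. \<zero>)" by (intro finsum_cong') auto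
      thus ?thesis using eq[OF l] True by (simp add: P.zero_closed)
    next
      case False
      thus ?thesis using eq[OF l] r(3) l by auto
    qed
    moreover have "\<exists>i\<in>I. r' i \<notin> P"
    proof -
      obtain i where i: "i \<in> ?I" "r i \<notin> P" using r by blast
      hence "c k j \<otimes> r i \<notin> P" using P.I_prime[of "c k j" "r i"] k cc rc by auto
      thus ?thesis using i unfolding r'_def by auto
    qed
    ultimately show ?thesis using r' by blast
  qed
qed

lemma (in cring) maximalideal_inverse:
  assumes "maximalideal P R" "s \<in> carrier R - P"
  shows "\<exists>t \<in> carrier R - P. \<exists>p \<in> P. s \<otimes> t = \<one> \<oplus> p"
proof -
  interpret P: maximalideal P R by fact
  have sc: "s \<in> carrier R" "s \<notin> P" using assms by auto
  have id: "ideal (PIdl s <+> P) R"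
    using add_ideals[OF cgenideal_ideal[OF sc(1)] P.is_ideal] .
  have "P \<subseteq> PIdl s <+> P"
  proof
    fix x assume x: "x \<in> P"
    hence "\<zero> \<oplus> x = x" using P.Icarr by simp
    moreover have "\<zero> \<in> PIdl s" using cgenideal_ideal[OF sc(1)] additive_subgroup.zero_closed ideal.axioms(1) by blast
    ultimately show "x \<in> PIdl s <+> P" using x unfolding set_add_def' by blast
  qed
  moreover have "s \<oplus> \<zero> \<in> PIdl s <+> P"
    using cgenideal_self[OF sc(1)] P.zero_closed unfolding set_add_def' by blast
  ultimately have "PIdl s <+> P = carrier R"
    using P.I_maximal[OF id] sc ideal.Icarr[OF id] by auto
  hence "\<one> \<in> PIdl s <+> P" by simp
  then obtain x p where xp: "x \<in> carrier R" "p \<in> P" "\<one> = x \<otimes> s \<oplus> p"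
    unfolding set_add_def' cgenideal_def by auto
  hence p: "p \<in> carrier R" using P.Icarr by simp
  have st: "s \<otimes> x = \<one> \<oplus> \<ominus> p"
    using xp sc p by (metis a_minus_def add.inv_solve_right m_closed m_comm one_closed)
  have np: "\<ominus> p \<in> P" using xp(2) P.a_inv_closed by simp
  have "x \<notin> P"
  proof
    assume "x \<in> P"
    hence "x \<otimes> s \<oplus> p \<in> P" using xp sc P.I_r_closed P.a_closed by auto
    hence "\<one> \<in> P" using xp by simp
    thus False using P.I_notcarr P.one_imp_carrier by auto
  qed
  thus ?thesis using st np xp(1) by blast
qed

text \<open>An algebra is given by its structure map into the centre. The same locale then serves
  for \<open>End_ring C U\<close> over \<open>R\<close> and for the endomorphism ring of
  \<open>A\<close> over \<open>K\<close>, the latter regarded as an algebra over \<open>K\<close> as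
  well as over \<open>R\<close>.\<close>

locale central_algebra = R: cring R + L?: ring L
  for R :: "('r, 'x) ring_scheme" and L :: "('l, 'y) ring_scheme" (structure) +
  fixes \<rho> :: "'r \<Rightarrow> 'l"
  assumes rho_hom: "\<rho> \<in> ring_hom R L"
    and rho_central: "\<lbrakk> r \<in> carrier R; x \<in> carrier L \<rbrakk> \<Longrightarrow> \<rho> r \<otimes> x = x \<otimes> \<rho> r"
begin

lemma rho_simps [simp]:
  "r \<in> carrier R \<Longrightarrow> \<rho> r \<in> carrier L"
  "\<lbrakk> r \<in> carrier R; s \<in> carrier R \<rbrakk> \<Longrightarrow> \<rho> (r \<otimes>\<^bsub>R\<^esub> s) = \<rho> r \<otimes> \<rho> s"
  "\<lbrakk> r \<in> carrier R; s \<in> carrier R \<rbrakk> \<Longrightarrow> \<rho> (r \<oplus>\<^bsub>R\<^esub> s) = \<rho> r \<oplus> \<rho> s"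
  "\<rho> \<one>\<^bsub>R\<^esub> = \<one>" "\<rho> \<zero>\<^bsub>R\<^esub> = \<zero>"
  using ring_hom_memE[OF rho_hom] ring_hom_zero[OF rho_hom R.ring_axioms L.ring_axioms] by auto

lemma rho_minus [simp]:
  assumes "r \<in> carrier R" shows "\<rho> (\<ominus>\<^bsub>R\<^esub> r) = \<ominus> \<rho> r"
proof (rule L.minus_equality[symmetric])
  show "\<rho> (\<ominus>\<^bsub>R\<^esub> r) \<oplus> \<rho> r = \<zero>"
    using assms by (simp add: rho_simps(3)[symmetric] R.l_neg del: rho_simps(3))
qed (use assms in auto)

lemma rho_comm:
  "\<lbrakk> r \<in> carrier R; x \<in> carrier L \<rbrakk> \<Longrightarrow> x \<otimes> \<rho> r = \<rho> r \<otimes> x"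
  "\<lbrakk> r \<in> carrier R; x \<in> carrier L; y \<in> carrier L \<rbrakk> \<Longrightarrow> x \<otimes> (\<rho> r \<otimes> y) = \<rho> r \<otimes> (x \<otimes> y)"
  using rho_central by (auto, metis L.m_assoc rho_simps(1))

definition lin_comb :: "'l set \<Rightarrow> ('l \<Rightarrow> 'r) \<Rightarrow> 'l" where
  "lin_comb G c = (\<Oplus>g\<in>G. \<rho> (c g) \<otimes> g)"

text \<open>For an ideal \<open>P\<close> of \<open>R\<close> and a generating set \<open>G\<close> this is the ideal \<open>P L\<close>.\<close>

definition span :: "'l set \<Rightarrow> 'r set \<Rightarrow> 'l set" where
  "span G P = lin_comb G ` (G \<rightarrow> P)"

definition generates :: "'l set \<Rightarrow> bool" where
  "generates G \<longleftrightarrow> finite G \<and> G \<subseteq> carrier L \<and> carrier L \<subseteq> span G (carrier R)"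

text \<open>Horner evaluation with the constant coefficient first. The order is opposite to that of
  \<open>R.eval\<close>, whence the \<open>rev\<close> in later statements.\<close>

primrec peval :: "'l \<Rightarrow> 'r list \<Rightarrow> 'l" where
  "peval x [] = \<zero>"
| "peval x (r # rs) = \<rho> r \<oplus> x \<otimes> peval x rs"

text \<open>Invertibility of \<open>x\<close> in the localization at \<open>P\<close>, with
  denominators cleared. Torsion is accounted for, since \<open>y\<close> and \<open>s\<close> may be
  multiplied by a common factor outside \<open>P\<close>.\<close>

definition p_unit :: "'r set \<Rightarrow> 'l \<Rightarrow> bool" where
  "p_unit P x \<longleftrightarrow> (\<exists>y \<in> carrier L. \<exists>s \<in> carrier R - P. y \<otimes> x = \<rho> s \<and> x \<otimes> y = \<rho> s)"

lemma lin_comb_closed [simp]: "\<lbrakk> G \<subseteq> carrier L; c \<in> G \<rightarrow> carrier R \<rbrakk> \<Longrightarrow> lin_comb G c \<in> carrier L"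
  unfolding lin_comb_def by (intro finsum_closed) (auto simp: Pi_def subset_iff)

lemma lin_comb_add:
  assumes "G \<subseteq> carrier L" "c \<in> G \<rightarrow> carrier R" "d \<in> G \<rightarrow> carrier R"
  shows "lin_comb G (\<lambda>g. c g \<oplus>\<^bsub>R\<^esub> d g) = lin_comb G c \<oplus> lin_comb G d"
proof -
  have "lin_comb G (\<lambda>g. c g \<oplus>\<^bsub>R\<^esub> d g) = (\<Oplus>g\<in>G. \<rho> (c g) \<otimes> g \<oplus> \<rho> (d g) \<otimes> g)"
    unfolding lin_comb_def using assms
    by (intro finsum_cong') (auto simp: l_distr Pi_def subset_iff)
  also have "\<dots> = lin_comb G c \<oplus> lin_comb G d"
    unfolding lin_comb_def using assms by (intro finsum_addf) (auto simp: Pi_def subset_iff)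
  finally show ?thesis .
qed

lemma lin_comb_smult:
  assumes "G \<subseteq> carrier L" "finite G" "c \<in> G \<rightarrow> carrier R" "r \<in> carrier R"
  shows "lin_comb G (\<lambda>g. r \<otimes>\<^bsub>R\<^esub> c g) = \<rho> r \<otimes> lin_comb G c"
proof -
  have "lin_comb G (\<lambda>g. r \<otimes>\<^bsub>R\<^esub> c g) = (\<Oplus>g\<in>G. \<rho> r \<otimes> (\<rho> (c g) \<otimes> g))"
    unfolding lin_comb_def using assms
    by (intro finsum_cong') (auto simp: m_assoc Pi_def subset_iff)
  also have "\<dots> = \<rho> r \<otimes> lin_comb G c"
    unfolding lin_comb_def using assms by (intro finsum_rdistr[symmetric]) (auto simp: Pi_def subset_iff)
  finally show ?thesis .
qed

lemma span_add:
  assumes "G \<subseteq> carrier L" "ideal P R" "x \<in> span G P" "y \<in> span G P" shows "x \<oplus> y \<in> span G P"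
proof -
  interpret P: ideal P R by fact
  obtain c d where "c \<in> G \<rightarrow> P" "d \<in> G \<rightarrow> P" "x = lin_comb G c" "y = lin_comb G d"
    using assms unfolding span_def by auto
  moreover from this have "c \<in> G \<rightarrow> carrier R" "d \<in> G \<rightarrow> carrier R" using P.Icarr by (auto simp: Pi_def)
  ultimately show ?thesis unfolding span_def using lin_comb_add[OF assms(1)] P.a_closed
    by (intro image_eqI[of _ _ "\<lambda>g. c g \<oplus>\<^bsub>R\<^esub> d g"]) auto
qed

lemma span_smult:
  assumes "G \<subseteq> carrier L" "finite G" "ideal P R" "x \<in> span G (carrier R)" "p \<in> P"
  shows "\<rho> p \<otimes> x \<in> span G P"
proof -
  interpret P: ideal P R by fact
  obtain c where "c \<in> G \<rightarrow> carrier R" "x = lin_comb G c" using assms unfolding span_def by auto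
  thus ?thesis unfolding span_def using lin_comb_smult[OF assms(1,2)] P.I_r_closed[OF assms(5)] assms(5) P.Icarr
    by (intro image_eqI[of _ _ "\<lambda>g. p \<otimes>\<^bsub>R\<^esub> c g"]) auto
qed

lemma span_smult':
  assumes "G \<subseteq> carrier L" "finite G" "ideal P R" "x \<in> span G P" "r \<in> carrier R"
  shows "\<rho> r \<otimes> x \<in> span G P"
proof -
  interpret P: ideal P R by fact
  obtain c where "c \<in> G \<rightarrow> P" "x = lin_comb G c" using assms unfolding span_def by auto
  moreover from this have "c \<in> G \<rightarrow> carrier R" using P.Icarr by (auto simp: Pi_def)
  ultimately show ?thesis unfolding span_def using lin_comb_smult[OF assms(1,2) _ assms(5)] P.I_l_closed assms(5)
    by (intro image_eqI[of _ _ "\<lambda>g. r \<otimes>\<^bsub>R\<^esub> c g"]) (auto simp: Pi_def)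
qed

lemma span_carrier:
  assumes "G \<subseteq> carrier L" "ideal P R" "x \<in> span G P" shows "x \<in> carrier L"
  using assms ideal.Icarr[OF assms(2)] unfolding span_def by (auto intro!: lin_comb_closed)

lemma span_ideal:
  assumes G: "generates G" and P: "ideal P R" shows "ideal (span G P) L"
proof -
  interpret P: ideal P R by fact
  have g: "finite G" "G \<subseteq> carrier L" "carrier L \<subseteq> span G (carrier R)" using G unfolding generates_def by auto
  have z: "\<zero> \<in> span G P" unfolding span_def
  proof (rule image_eqI[of _ _ "\<lambda>_. \<zero>\<^bsub>R\<^esub>"])
    have "lin_comb G (\<lambda>_. \<zero>\<^bsub>R\<^esub>) = (\<Oplus>x\<in>G. \<zero>)"
      unfolding lin_comb_def using g by (intro finsum_cong') auto
    thus "\<zero> = lin_comb G (\<lambda>_. \<zero>\<^bsub>R\<^esub>)" by simp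
  qed (use P.zero_closed in auto)
  have fs: "finsum L h A \<in> span G P" if "finite A" "\<And>a. a \<in> A \<Longrightarrow> h a \<in> span G P" for A :: "'l set" and h
    using that by (induction A) (auto simp: z span_add[OF g(2) P] span_carrier[OF g(2) P] Pi_def)
  have neg: "\<ominus> x \<in> span G P" if "x \<in> span G P" for x
  proof -
    have "\<rho> (\<ominus>\<^bsub>R\<^esub> \<one>\<^bsub>R\<^esub>) \<otimes> x \<in> span G P" using span_smult'[OF g(2,1) P that] by blast
    thus ?thesis using span_carrier[OF g(2) P that] by (simp add: l_minus)
  qed
  have mult: "y \<otimes> x \<in> span G P" "x \<otimes> y \<in> span G P" if xy: "x \<in> span G P" "y \<in> carrier L" for x y
  proof -
    obtain c where c: "c \<in> G \<rightarrow> P" "x = lin_comb G c" using xy unfolding span_def by auto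
    hence cR: "c \<in> G \<rightarrow> carrier R" using P.Icarr by (auto simp: Pi_def)
    have "y \<otimes> x = (\<Oplus>g\<in>G. y \<otimes> (\<rho> (c g) \<otimes> g))" "x \<otimes> y = (\<Oplus>g\<in>G. (\<rho> (c g) \<otimes> g) \<otimes> y)"
      unfolding c lin_comb_def using cR g(1,2) xy(2)
      by (auto intro!: finsum_rdistr finsum_ldistr simp: Pi_def subset_iff)
    moreover have "(\<Oplus>g\<in>G. y \<otimes> (\<rho> (c g) \<otimes> g)) \<in> span G P" "(\<Oplus>g\<in>G. (\<rho> (c g) \<otimes> g) \<otimes> y) \<in> span G P"
    proof (rule_tac [!] fs[OF g(1)])
      fix a assume a: "a \<in> G"
      hence ac: "a \<in> carrier L" "c a \<in> P" "c a \<in> carrier R" using g c cR by auto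
      show "y \<otimes> (\<rho> (c a) \<otimes> a) \<in> span G P"
        using span_smult[OF g(2,1) P, of "y \<otimes> a"] ac xy(2) g(3) rho_comm(2)[of "c a" y a] by auto
      show "(\<rho> (c a) \<otimes> a) \<otimes> y \<in> span G P"
        using span_smult[OF g(2,1) P, of "a \<otimes> y"] ac xy(2) g(3) by (auto simp: m_assoc)
    qed
    ultimately show "y \<otimes> x \<in> span G P" "x \<otimes> y \<in> span G P" by simp_all
  qed
  show ?thesis
  proof (rule idealI[OF L.ring_axioms])
    show "subgroup (span G P) (add_monoid L)"
      by (rule group.subgroupI[OF L.add.group_axioms]) (use z neg span_add[OF g(2) P] span_carrier[OF g(2) P] in \<open>auto simp: a_inv_def[symmetric]\<close>)
  qed (use mult in auto)
qed

lemma peval_closed [simp]: "\<lbrakk> x \<in> carrier L; set rs \<subseteq> carrier R \<rbrakk> \<Longrightarrow> peval x rs \<in> carrier L"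
  by (induction rs) auto

lemma peval_comm: "\<lbrakk> x \<in> carrier L; set rs \<subseteq> carrier R \<rbrakk> \<Longrightarrow> x \<otimes> peval x rs = peval x rs \<otimes> x"
proof (induction rs)
  case (Cons r rs)
  have c: "\<rho> r \<otimes> x = x \<otimes> \<rho> r" "\<rho> r \<in> carrier L" "peval x rs \<in> carrier L" using Cons rho_central by auto
  have "x \<otimes> (x \<otimes> peval x rs) = (x \<otimes> peval x rs) \<otimes> x"
    using Cons c by (metis m_assoc set_subset_Cons subset_trans)
  thus ?case using Cons c by (simp add: r_distr l_distr)
qed simp

lemma peval_append:
  assumes "x \<in> carrier L" "set rs \<subseteq> carrier R" "r \<in> carrier R"
  shows "peval x (rs @ [r]) = peval x rs \<oplus> \<rho> r \<otimes> x [^] length rs"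
  using assms(2)
proof (induction rs)
  case (Cons s rs)
  have c: "\<rho> r \<in> carrier L" "\<rho> s \<in> carrier L" "peval x rs \<in> carrier L" using Cons assms by auto
  have "x \<otimes> (\<rho> r \<otimes> x [^] length rs) = \<rho> r \<otimes> x [^] Suc (length rs)"
    using rho_comm(2)[of r x "x [^] length rs"] assms nat_pow_Suc2[of x] by simp
  thus ?case using Cons c assms by (simp add: r_distr a_assoc)
qed (use assms in simp)

lemma peval_sum:
  assumes "x \<in> carrier L" "r \<in> {..<n} \<rightarrow> carrier R"
  shows "peval x (map r [0..<n]) = (\<Oplus>i\<in>{..<n}. \<rho> (r i) \<otimes> x [^] i)"
  using assms(2)
proof (induction n)
  case (Suc n)
  have rn: "r n \<in> carrier R" "set (map r [0..<n]) \<subseteq> carrier R" "r \<in> {..<n} \<rightarrow> carrier R" using Suc by auto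
  have "peval x (map r [0..<Suc n]) = (\<Oplus>i\<in>{..<n}. \<rho> (r i) \<otimes> x [^] i) \<oplus> \<rho> (r n) \<otimes> x [^] n"
    using peval_append[OF assms(1) rn(2,1)] Suc.IH[OF rn(3)] by simp
  also have "\<dots> = (\<Oplus>i\<in>insert n {..<n}. \<rho> (r i) \<otimes> x [^] i)"
    using rn assms by (subst finsum_insert) (auto simp: Pi_def intro!: a_comm finsum_closed)
  finally show ?case by (simp add: lessThan_Suc)
qed simp

lemma linear_dependence:
  assumes G: "generates G" and P: "primeideal P R" and "finite I" "card G < card I" "\<And>i. i \<in> I \<Longrightarrow> v i \<in> carrier L"
  shows "\<exists>r \<in> I \<rightarrow> carrier R. (\<exists>i \<in> I. r i \<notin> P) \<and> (\<Oplus>i\<in>I. \<rho> (r i) \<otimes> v i) \<in> span G P"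
proof -
  interpret P: primeideal P R by fact
  have g: "finite G" "G \<subseteq> carrier L" "carrier L \<subseteq> span G (carrier R)" using G unfolding generates_def by auto
  have "\<forall>i \<in> I. \<exists>c. c \<in> G \<rightarrow> carrier R \<and> v i = lin_comb G c"
    using assms(5) g(3) unfolding span_def by blast
  then obtain c where c: "\<And>i. i \<in> I \<Longrightarrow> c i \<in> G \<rightarrow> carrier R" "\<And>i. i \<in> I \<Longrightarrow> v i = lin_comb G (c i)"
    by metis
  obtain r where r: "r \<in> I \<rightarrow> carrier R" "\<exists>i \<in> I. r i \<notin> P" "\<forall>j \<in> G. (\<Oplus>\<^bsub>R\<^esub>i\<in>I. r i \<otimes>\<^bsub>R\<^esub> c i j) \<in> P"
    using R.linear_dependence_mod_prime[OF P g(1) assms(3,4), of c] c(1) by blast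
  have "(\<Oplus>i\<in>I'. \<rho> (r i) \<otimes> v i) = lin_comb G (\<lambda>j. \<Oplus>\<^bsub>R\<^esub>i\<in>I'. r i \<otimes>\<^bsub>R\<^esub> c i j)" if "finite I'" "I' \<subseteq> I" for I'
    using that
  proof (induction I' rule: finite_induct)
    case empty
    have "lin_comb G (\<lambda>_. \<zero>\<^bsub>R\<^esub>) = (\<Oplus>x\<in>G. \<zero>)"
      unfolding lin_comb_def using g by (intro finsum_cong') auto
    thus ?case by simp
  next
    case (insert i I')
    have rc: "\<And>k j. k \<in> insert i I' \<Longrightarrow> j \<in> G \<Longrightarrow> r k \<otimes>\<^bsub>R\<^esub> c k j \<in> carrier R"
      using insert r(1) c(1) by (auto simp: Pi_def subset_iff)
    have i: "i \<in> I" using insert by simp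
    have vc: "\<And>k. k \<in> insert i I' \<Longrightarrow> \<rho> (r k) \<otimes> v k \<in> carrier L"
      using insert r(1) assms(5) by (auto simp: Pi_def subset_iff)
    have "(\<Oplus>i\<in>insert i I'. \<rho> (r i) \<otimes> v i) = \<rho> (r i) \<otimes> v i \<oplus> (\<Oplus>i\<in>I'. \<rho> (r i) \<otimes> v i)"
      using insert vc by (intro finsum_insert) auto
    also have "\<rho> (r i) \<otimes> v i = lin_comb G (\<lambda>j. r i \<otimes>\<^bsub>R\<^esub> c i j)"
      using c[OF i] lin_comb_smult[OF g(2,1) c(1)[OF i], of "r i", symmetric] r(1) i by auto
    also have "(\<Oplus>i\<in>I'. \<rho> (r i) \<otimes> v i) = lin_comb G (\<lambda>j. \<Oplus>\<^bsub>R\<^esub>i\<in>I'. r i \<otimes>\<^bsub>R\<^esub> c i j)"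
      using insert by simp
    also have "lin_comb G (\<lambda>j. r i \<otimes>\<^bsub>R\<^esub> c i j) \<oplus> lin_comb G (\<lambda>j. \<Oplus>\<^bsub>R\<^esub>i\<in>I'. r i \<otimes>\<^bsub>R\<^esub> c i j)
      = lin_comb G (\<lambda>j. r i \<otimes>\<^bsub>R\<^esub> c i j \<oplus>\<^bsub>R\<^esub> (\<Oplus>\<^bsub>R\<^esub>i\<in>I'. r i \<otimes>\<^bsub>R\<^esub> c i j))"
      using rc g by (intro lin_comb_add[symmetric]) (auto intro!: R.finsum_closed)
    also have "\<dots> = lin_comb G (\<lambda>j. \<Oplus>\<^bsub>R\<^esub>i\<in>insert i I'. r i \<otimes>\<^bsub>R\<^esub> c i j)"
    proof -
      have e: "r i \<otimes>\<^bsub>R\<^esub> c i j \<oplus>\<^bsub>R\<^esub> (\<Oplus>\<^bsub>R\<^esub>i\<in>I'. r i \<otimes>\<^bsub>R\<^esub> c i j) = (\<Oplus>\<^bsub>R\<^esub>i\<in>insert i I'. r i \<otimes>\<^bsub>R\<^esub> c i j)" if "j \<in> G" for j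
        using insert rc that by (intro R.finsum_insert[symmetric]) auto
      show ?thesis unfolding lin_comb_def
        using rc e g by (intro finsum_cong') (auto intro!: R.finsum_closed m_closed rho_simps(1))
    qed
    finally show ?case .
  qed
  from this[OF assms(3)] have "(\<Oplus>i\<in>I. \<rho> (r i) \<otimes> v i) \<in> span G P"
    unfolding span_def using r(3) by (intro image_eqI[of _ _ "\<lambda>j. \<Oplus>\<^bsub>R\<^esub>i\<in>I. r i \<otimes>\<^bsub>R\<^esub> c i j"]) auto
  thus ?thesis using r by blast
qed

text \<open>There are more powers of \<open>x\<close> than generators, so they are dependent modulo
  \<open>P\<close>. This stands in for the Cayley-Hamilton theorem; some coefficient, not
  necessarily the leading one, is outside \<open>P\<close>.\<close>

lemma polynomial_relation:
  assumes "generates G" "primeideal P R" "x \<in> carrier L"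
  shows "\<exists>rs. set rs \<subseteq> carrier R \<and> \<not> set rs \<subseteq> P \<and> peval x rs \<in> span G P"
proof -
  let ?n = "Suc (card G)"
  obtain r where r: "r \<in> {..<?n} \<rightarrow> carrier R" "\<exists>i \<in> {..<?n}. r i \<notin> P"
    "(\<Oplus>i\<in>{..<?n}. \<rho> (r i) \<otimes> x [^] i) \<in> span G P"
    using linear_dependence[OF assms(1,2), of "{..<?n}" "\<lambda>i. x [^] i"] assms(3) by auto
  have "set (map r [0..<?n]) = r ` {..<?n}" by (auto simp del: upt_Suc)
  thus ?thesis using peval_sum[OF assms(3) r(1)] r by (intro exI[of _ "map r [0..<?n]"]) (auto simp del: upt_Suc)
qed

text \<open>Nakayama's lemma at \<open>P\<close>, without localizing. Instead of taking a
  determinant, the generators are eliminated one after the other. Diagonal coefficients stay outside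
  \<open>P\<close> and all other ones inside, so no pivot is ever lost.\<close>

lemma nakayama:
  assumes P: "primeideal P R" and "finite G" "G \<subseteq> carrier L"
    and N: "\<And>x y. x \<in> N \<Longrightarrow> y \<in> N \<Longrightarrow> x \<oplus> y \<in> N" "\<And>r x. r \<in> carrier R \<Longrightarrow> x \<in> N \<Longrightarrow> \<rho> r \<otimes> x \<in> N"
      "N \<subseteq> carrier L"
    and "\<And>g. g \<in> G \<Longrightarrow> \<exists>s \<in> carrier R - P. \<exists>c \<in> G \<rightarrow> P. \<rho> s \<otimes> g \<oplus> lin_comb G c \<in> N"
  shows "\<exists>r \<in> carrier R - P. \<forall>g \<in> G. \<rho> r \<otimes> g \<in> N"
  using assms(2,3,7)
proof (induction G rule: finite_induct)
  case empty
  have "\<one>\<^bsub>R\<^esub> \<notin> P"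
    using primeideal.I_notcarr[OF P] ideal.one_imp_carrier[OF primeideal.axioms(1)[OF P]] by auto
  thus ?case by auto
next
  case (insert a G)
  interpret P: primeideal P R by fact
  have PR: "\<And>p. p \<in> P \<Longrightarrow> p \<in> carrier R" using P.Icarr by auto
  have a: "a \<in> carrier L" and G: "G \<subseteq> carrier L" using insert by auto
  have ins: "lin_comb (insert a G) c = \<rho> (c a) \<otimes> a \<oplus> lin_comb G c" if "c \<in> insert a G \<rightarrow> P" for c
    unfolding lin_comb_def using insert that PR by (intro finsum_insert) (auto simp: Pi_def subset_iff)
  obtain s0 c0 where s0: "s0 \<in> carrier R - P" "c0 \<in> insert a G \<rightarrow> P" "\<rho> s0 \<otimes> a \<oplus> lin_comb (insert a G) c0 \<in> N"
    using insert.prems by blast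
  \<comment> \<open>The pivot: it is outside \<open>P\<close> because \<open>s0\<close> is and
    \<open>c0 a\<close> lies in \<open>P\<close>.\<close>
  define s where "s = s0 \<oplus>\<^bsub>R\<^esub> c0 a"
  have c0a: "c0 a \<in> P" "c0 a \<in> carrier R" using s0 PR by auto
  have c0: "c0 \<in> G \<rightarrow> P" "c0 \<in> G \<rightarrow> carrier R" using s0(2) PR by (auto simp: Pi_def)
  have s: "s \<in> carrier R" "s \<notin> P"
  proof -
    show "s \<in> carrier R" unfolding s_def using s0 c0a by auto
    have "s0 = s \<ominus>\<^bsub>R\<^esub> c0 a" unfolding s_def using s0 c0a by (simp add: R.nc_simps)
    thus "s \<notin> P" using s0 c0a P.a_closed P.a_inv_closed by (auto simp: a_minus_def)
  qed
  have *: "\<rho> s \<otimes> a \<oplus> lin_comb G c0 \<in> N"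
  proof -
    have "\<rho> s0 \<otimes> a \<oplus> (\<rho> (c0 a) \<otimes> a \<oplus> lin_comb G c0) = \<rho> s \<otimes> a \<oplus> lin_comb G c0"
      unfolding s_def using s0(1) c0a a G c0 by (simp add: l_distr a_assoc)
    thus ?thesis using s0(3) ins[OF s0(2)] by simp
  qed
  have H: "\<exists>t \<in> carrier R - P. \<exists>d \<in> G \<rightarrow> P. \<rho> t \<otimes> g \<oplus> lin_comb G d \<in> N" if g: "g \<in> G" for g
  proof -
    obtain t c where t: "t \<in> carrier R - P" "c \<in> insert a G \<rightarrow> P" "\<rho> t \<otimes> g \<oplus> lin_comb (insert a G) c \<in> N"
      using insert.prems g by blast
    have ca: "c a \<in> P" "c a \<in> carrier R" using t PR by auto
    have c: "c \<in> G \<rightarrow> P" "c \<in> G \<rightarrow> carrier R" using t(2) PR by (auto simp: Pi_def)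
    have gc: "g \<in> carrier L" using g G by auto
    define d where "d h = s \<otimes>\<^bsub>R\<^esub> c h \<oplus>\<^bsub>R\<^esub> (\<ominus>\<^bsub>R\<^esub> c a) \<otimes>\<^bsub>R\<^esub> c0 h" for h
    have d: "d \<in> G \<rightarrow> P" unfolding d_def using c c0 ca s P.a_closed P.I_l_closed
      by (auto simp: Pi_def)
    have m: "(\<lambda>h. s \<otimes>\<^bsub>R\<^esub> c h) \<in> G \<rightarrow> carrier R" "(\<lambda>h. (\<ominus>\<^bsub>R\<^esub> c a) \<otimes>\<^bsub>R\<^esub> c0 h) \<in> G \<rightarrow> carrier R"
      using c(2) c0(2) s ca by (auto simp: Pi_def)
    have "lin_comb G d = \<rho> s \<otimes> lin_comb G c \<oplus> \<ominus> \<rho> (c a) \<otimes> lin_comb G c0"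
      unfolding d_def using lin_comb_add[OF G m] lin_comb_smult[OF G insert.hyps(1)] c c0 s ca by simp
    hence "\<rho> (s \<otimes>\<^bsub>R\<^esub> t) \<otimes> g \<oplus> lin_comb G d
        = \<rho> s \<otimes> (\<rho> t \<otimes> g \<oplus> lin_comb (insert a G) c) \<oplus> \<rho> (\<ominus>\<^bsub>R\<^esub> c a) \<otimes> (\<rho> s \<otimes> a \<oplus> lin_comb G c0)"
      unfolding ins[OF t(2)] using t(1) s ca a gc G c(2) c0(2) rho_comm(1)[of s "\<rho> (c a)"] rho_comm(2)[of s "\<rho> (c a)" a]
      by (simp add: nc_simps)
    hence "\<rho> (s \<otimes>\<^bsub>R\<^esub> t) \<otimes> g \<oplus> lin_comb G d \<in> N"
      using N(1)[OF N(2)[OF s(1) t(3)] N(2)[OF _ *, of "\<ominus>\<^bsub>R\<^esub> c a"]] ca by simp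
    moreover have "s \<otimes>\<^bsub>R\<^esub> t \<in> carrier R - P" using s t P.I_prime by auto
    ultimately show ?thesis using d by blast
  qed
  have "\<exists>r \<in> carrier R - P. \<forall>g \<in> G. \<rho> r \<otimes> g \<in> N"
    by (rule insert.IH[OF G]) (rule H)
  then obtain r where r: "r \<in> carrier R - P" "\<forall>g\<in>G. \<rho> r \<otimes> g \<in> N" by (rule bexE)
  have rN: "\<rho> (r \<otimes>\<^bsub>R\<^esub> s) \<otimes> g \<in> N" if "g \<in> G" for g
  proof -
    have "g \<in> carrier L" "r \<in> carrier R" using that G r by auto
    hence "\<rho> s \<otimes> (\<rho> r \<otimes> g) = \<rho> (r \<otimes>\<^bsub>R\<^esub> s) \<otimes> g"
      using s rho_comm(2)[of r "\<rho> s" g] by (simp add: m_assoc)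
    thus ?thesis using r(2) that N(2) s by metis
  qed
  \<comment> \<open>\<open>N\<close> is not assumed to contain zero, so the empty combination is set
    apart.\<close>
  have "\<rho> r \<otimes> lin_comb G' c0 \<in> N \<or> G' = {}" if "finite G'" "G' \<subseteq> G" for G'
    using that
  proof (induction G' rule: finite_induct)
    case (insert b G')
    have b: "b \<in> G" "b \<in> carrier L" "c0 b \<in> carrier R" and G': "G' \<subseteq> G" "G' \<subseteq> carrier L" "c0 \<in> G' \<rightarrow> carrier R"
      using insert G c0 by auto
    have e: "lin_comb (insert b G') c0 = \<rho> (c0 b) \<otimes> b \<oplus> lin_comb G' c0"
      unfolding lin_comb_def using insert b G' by (intro finsum_insert) (auto simp: Pi_def subset_iff)
    have "\<rho> r \<otimes> (\<rho> (c0 b) \<otimes> b) = \<rho> (c0 b) \<otimes> (\<rho> r \<otimes> b)" using rho_comm(2)[of "c0 b" "\<rho> r" b] r b by simp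
    hence 1: "\<rho> r \<otimes> (\<rho> (c0 b) \<otimes> b) \<in> N" using N(2) r(2) b by simp
    show ?case
    proof (cases "G' = {}")
      case True
      thus ?thesis using 1 e b by (simp add: lin_comb_def)
    next
      case False
      hence "\<rho> r \<otimes> lin_comb G' c0 \<in> N" using insert.IH G' by blast
      thus ?thesis using 1 e b r G' N(1) by (simp add: r_distr)
    qed
  qed simp
  from this[OF insert.hyps(1)] have A1: "\<rho> r \<otimes> lin_comb G c0 \<in> N \<or> G = {}" by simp
  have A2: "\<rho> r \<otimes> (\<rho> s \<otimes> a \<oplus> lin_comb G c0) \<in> N" using * N(2) r by auto
  have "\<rho> (r \<otimes>\<^bsub>R\<^esub> s) \<otimes> a \<in> N"
  proof (cases "G = {}")
    case False
    have "\<rho> (r \<otimes>\<^bsub>R\<^esub> s) \<otimes> a = \<rho> r \<otimes> (\<rho> s \<otimes> a \<oplus> lin_comb G c0) \<oplus> \<rho> (\<ominus>\<^bsub>R\<^esub> \<one>\<^bsub>R\<^esub>) \<otimes> (\<rho> r \<otimes> lin_comb G c0)"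
      using r s a G c0 by (simp add: nc_simps)
    also have "\<dots> \<in> N" 
      using A1 A2 False N(1)[OF A2 N(2)[of "\<ominus>\<^bsub>R\<^esub> \<one>\<^bsub>R\<^esub>" "\<rho> r \<otimes> lin_comb G c0"]] by blast
    finally show ?thesis .
  next
    case True
    thus ?thesis using A2 r s a by (simp add: lin_comb_def m_assoc)
  qed
  moreover have "r \<otimes>\<^bsub>R\<^esub> s \<in> carrier R - P" using r s P.I_prime by auto
  ultimately show ?case using rN by blast
qed

text \<open>A left and a right inverse in the localization agree; with denominators cleared this is
  the equation \<open>r' y = r y'\<close>.\<close>

lemma p_unit_two_sided:
  assumes P: "primeideal P R" and x: "x \<in> carrier L"
    and y: "r \<in> carrier R - P" "y \<in> carrier L" "y \<otimes> x = \<rho> r"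
    and y': "r' \<in> carrier R - P" "y' \<in> carrier L" "x \<otimes> y' = \<rho> r'"
  shows "p_unit P x"
proof -
  have "\<rho> r' \<otimes> y = y \<otimes> (x \<otimes> y')" using rho_comm(1)[of r' y] y y' by simp
  also have "\<dots> = \<rho> r \<otimes> y'" using x y(2) y'(2) by (simp add: m_assoc[symmetric] y(3))
  finally have e: "\<rho> r' \<otimes> y = \<rho> r \<otimes> y'" .
  have "(\<rho> r' \<otimes> y) \<otimes> x = \<rho> (r' \<otimes>\<^bsub>R\<^esub> r)" using x y y' by (simp add: m_assoc)
  moreover have "x \<otimes> (\<rho> r' \<otimes> y) = \<rho> (r' \<otimes>\<^bsub>R\<^esub> r)"
    unfolding e using x y y' rho_comm(2)[of r x y'] rho_comm(1)[of r "\<rho> r'"] by simp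
  moreover have "r' \<otimes>\<^bsub>R\<^esub> r \<in> carrier R - P" using y(1) y'(1) primeideal.I_prime[OF P] by auto
  ultimately show ?thesis unfolding p_unit_def using y y' by (intro bexI[of _ "\<rho> r' \<otimes> y"] bexI[of _ "r' \<otimes>\<^bsub>R\<^esub> r"]) auto
qed

text \<open>\<open>P L\<close> lies in the Jacobson radical of the localization: every
  \<open>a\<close> differs from \<open>a x\<close> and from \<open>x a\<close> by an element of
  \<open>P L\<close>, so by Nakayama's lemma both \<open>L x\<close> and \<open>x L\<close> contain
  a scalar outside \<open>P\<close>.\<close>

lemma one_mod_p_unit:
  assumes G: "generates G" and P: "primeideal P R" and x: "x \<in> carrier L" "\<one> \<ominus> x \<in> span G P"
  shows "p_unit P x"
proof -
  interpret P: primeideal P R by fact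
  have g: "finite G" "G \<subseteq> carrier L" "carrier L \<subseteq> span G (carrier R)" using G unfolding generates_def by auto
  interpret S: ideal "span G P" L by (rule span_ideal[OF G P.is_ideal])
  have one: "\<one>\<^bsub>R\<^esub> \<in> carrier R - P" using P.I_notcarr P.one_imp_carrier by auto
  obtain c where c: "c \<in> G \<rightarrow> carrier R" "\<one> = lin_comb G c"
    using g(3) one_closed unfolding span_def by blast
  have lr: "\<exists>r \<in> carrier R - P. \<rho> r \<in> N"
    if N: "\<And>x y. x \<in> N \<Longrightarrow> y \<in> N \<Longrightarrow> x \<oplus> y \<in> N" "\<And>r x. r \<in> carrier R \<Longrightarrow> x \<in> N \<Longrightarrow> \<rho> r \<otimes> x \<in> N"
      "N \<subseteq> carrier L" "\<zero> \<in> N" and sub: "\<And>a. a \<in> carrier L \<Longrightarrow> \<exists>b \<in> span G P. a \<oplus> b \<in> N" for N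
  proof -
    have "\<exists>s \<in> carrier R - P. \<exists>c \<in> G \<rightarrow> P. \<rho> s \<otimes> a \<oplus> lin_comb G c \<in> N" if a: "a \<in> G" for a
    proof -
      have ac: "a \<in> carrier L" using a g by auto
      obtain b where b: "b \<in> span G P" "a \<oplus> b \<in> N" using sub ac by blast
      then obtain d where d: "d \<in> G \<rightarrow> P" "b = lin_comb G d" unfolding span_def by blast
      hence "\<rho> \<one>\<^bsub>R\<^esub> \<otimes> a \<oplus> lin_comb G d \<in> N" using b ac by simp
      thus ?thesis using one d by blast
    qed
    from nakayama[OF P g(1,2) N(1,2,3) this]
    obtain r where r: "r \<in> carrier R - P" "\<forall>g\<in>G. \<rho> r \<otimes> g \<in> N" by auto
    have "\<rho> r \<otimes> lin_comb G' c \<in> N" if "finite G'" "G' \<subseteq> G" for G'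
      using that
    proof (induction G' rule: finite_induct)
      case empty
      thus ?case using N r by (simp add: lin_comb_def)
    next
      case (insert b G')
      have b: "b \<in> G" "b \<in> carrier L" "c b \<in> carrier R" and G': "G' \<subseteq> G" "G' \<subseteq> carrier L" "c \<in> G' \<rightarrow> carrier R"
        using insert g c by auto
      have e: "lin_comb (insert b G') c = \<rho> (c b) \<otimes> b \<oplus> lin_comb G' c"
        unfolding lin_comb_def using insert b G' by (intro finsum_insert) (auto simp: Pi_def subset_iff)
      have "\<rho> r \<otimes> (\<rho> (c b) \<otimes> b) = \<rho> (c b) \<otimes> (\<rho> r \<otimes> b)" using rho_comm(2)[of "c b" "\<rho> r" b] r b by simp
      hence "\<rho> r \<otimes> (\<rho> (c b) \<otimes> b) \<in> N" using N(2) r(2) b by simp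
      moreover have "\<rho> r \<otimes> lin_comb G' c \<in> N" using insert.IH G' by blast
      ultimately show ?case using e b r G' N(1) by (simp add: r_distr)
    qed
    from this[OF g(1)] have "\<rho> r \<in> N" using r c(2)[symmetric] by simp
    thus ?thesis using r by blast
  qed
  have sx: "x \<ominus> \<one> \<in> span G P"
    using S.a_inv_closed[OF x(2)] x(1) by (simp add: nc_simps)
  have "\<exists>r \<in> carrier R - P. \<rho> r \<in> (\<lambda>y. y \<otimes> x) ` carrier L"
  proof (rule lr)
    fix a b assume "a \<in> (\<lambda>y. y \<otimes> x) ` carrier L" "b \<in> (\<lambda>y. y \<otimes> x) ` carrier L"
    then obtain y z where "y \<in> carrier L" "z \<in> carrier L" "a = y \<otimes> x" "b = z \<otimes> x" by auto
    thus "a \<oplus> b \<in> (\<lambda>y. y \<otimes> x) ` carrier L" using x by (intro image_eqI[of _ _ "y \<oplus> z"]) (auto simp: l_distr)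
  next
    fix r a assume "r \<in> carrier R" "a \<in> (\<lambda>y. y \<otimes> x) ` carrier L"
    then obtain y where "r \<in> carrier R" "y \<in> carrier L" "a = y \<otimes> x" by auto
    thus "\<rho> r \<otimes> a \<in> (\<lambda>y. y \<otimes> x) ` carrier L" using x by (intro image_eqI[of _ _ "\<rho> r \<otimes> y"]) (auto simp: m_assoc)
  next
    show "\<zero> \<in> (\<lambda>y. y \<otimes> x) ` carrier L" using x by (intro image_eqI[of _ _ \<zero>]) auto
    fix a assume a: "a \<in> carrier L"
    have "a \<oplus> a \<otimes> (x \<ominus> \<one>) = a \<otimes> x" using a x(1) by (simp add: nc_simps)
    thus "\<exists>b \<in> span G P. a \<oplus> b \<in> (\<lambda>y. y \<otimes> x) ` carrier L"
      using S.I_l_closed[OF sx a] a by (intro bexI[of _ "a \<otimes> (x \<ominus> \<one>)"]) auto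
  qed (use x in auto)
  then obtain r y where y: "r \<in> carrier R - P" "y \<in> carrier L" "y \<otimes> x = \<rho> r" by (metis imageE)
  have "\<exists>r \<in> carrier R - P. \<rho> r \<in> (\<lambda>y. x \<otimes> y) ` carrier L"
  proof (rule lr)
    fix a b assume "a \<in> (\<lambda>y. x \<otimes> y) ` carrier L" "b \<in> (\<lambda>y. x \<otimes> y) ` carrier L"
    then obtain y z where "y \<in> carrier L" "z \<in> carrier L" "a = x \<otimes> y" "b = x \<otimes> z" by auto
    thus "a \<oplus> b \<in> (\<lambda>y. x \<otimes> y) ` carrier L" using x by (intro image_eqI[of _ _ "y \<oplus> z"]) (auto simp: r_distr)
  next
    fix r a assume "r \<in> carrier R" "a \<in> (\<lambda>y. x \<otimes> y) ` carrier L"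
    then obtain y where "r \<in> carrier R" "y \<in> carrier L" "a = x \<otimes> y" by auto
    thus "\<rho> r \<otimes> a \<in> (\<lambda>y. x \<otimes> y) ` carrier L" using x rho_comm(2)[of r x y]
      by (intro image_eqI[of _ _ "\<rho> r \<otimes> y"]) auto
  next
    show "\<zero> \<in> (\<lambda>y. x \<otimes> y) ` carrier L" using x by (intro image_eqI[of _ _ \<zero>]) auto
    fix a assume a: "a \<in> carrier L"
    have "a \<oplus> (x \<ominus> \<one>) \<otimes> a = x \<otimes> a" using a x(1) by (simp add: nc_simps)
    thus "\<exists>b \<in> span G P. a \<oplus> b \<in> (\<lambda>y. x \<otimes> y) ` carrier L"
      using S.I_r_closed[OF sx a] a by (intro bexI[of _ "(x \<ominus> \<one>) \<otimes> a"]) auto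
  qed (use x in auto)
  then obtain r' y' where y': "r' \<in> carrier R - P" "y' \<in> carrier L" "x \<otimes> y' = \<rho> r'" by (metis imageE)
  show ?thesis by (rule p_unit_two_sided[OF P x(1) y y'])
qed

text \<open>Multiplication by an inverse \<open>t\<close> of \<open>s\<close> modulo
  \<open>P\<close> reduces this to the case \<open>s = 1\<close>.\<close>

lemma p_unit_mod:
  assumes G: "generates G" and P: "maximalideal P R"
    and x: "x \<in> carrier L" "s \<in> carrier R - P" "x \<ominus> \<rho> s \<in> span G P"
  shows "p_unit P x"
proof -
  have pr: "primeideal P R" using R.maximalideal_prime[OF P] .
  interpret P: primeideal P R by fact
  have g: "finite G" "G \<subseteq> carrier L" "carrier L \<subseteq> span G (carrier R)" using G unfolding generates_def by auto
  interpret S: ideal "span G P" L by (rule span_ideal[OF G P.is_ideal])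
  obtain t p where t: "t \<in> carrier R - P" "p \<in> P" "s \<otimes>\<^bsub>R\<^esub> t = \<one>\<^bsub>R\<^esub> \<oplus>\<^bsub>R\<^esub> p"
    using R.maximalideal_inverse[OF P x(2)] by blast
  have c: "s \<in> carrier R" "t \<in> carrier R" "p \<in> carrier R" using t x P.Icarr by auto
  have "\<rho> p \<otimes> \<one> \<in> span G P" using span_smult[OF g(2,1) P.is_ideal _ t(2)] g by auto
  moreover have "\<rho> t \<otimes> (x \<ominus> \<rho> s) \<in> span G P" using S.I_l_closed[OF x(3)] c by auto
  ultimately have m: "\<ominus> (\<rho> t \<otimes> (x \<ominus> \<rho> s) \<oplus> \<rho> p \<otimes> \<one>) \<in> span G P"
    by (intro S.a_inv_closed S.a_closed)
  have "\<rho> s \<otimes> \<rho> t = \<one> \<oplus> \<rho> p" using arg_cong[OF t(3), of \<rho>] c by simp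
  hence "\<rho> t \<otimes> \<rho> s = \<one> \<oplus> \<rho> p" using rho_comm(1)[of s "\<rho> t"] c by simp
  hence "\<one> \<ominus> \<rho> t \<otimes> x = \<ominus> (\<rho> t \<otimes> (x \<ominus> \<rho> s) \<oplus> \<rho> p \<otimes> \<one>)"
    using c x(1) by (simp add: nc_simps)
  hence "p_unit P (\<rho> t \<otimes> x)" using m c x(1) by (intro one_mod_p_unit[OF G pr]) auto
  then obtain y r where y: "y \<in> carrier L" "r \<in> carrier R - P" "y \<otimes> (\<rho> t \<otimes> x) = \<rho> r" "\<rho> t \<otimes> x \<otimes> y = \<rho> r"
    unfolding p_unit_def by blast
  hence "(\<rho> t \<otimes> y) \<otimes> x = \<rho> r" "x \<otimes> (\<rho> t \<otimes> y) = \<rho> r"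
    using c x(1) rho_comm[of t] by (auto simp: m_assoc)
  thus ?thesis unfolding p_unit_def using y(1,2) c
    by (intro bexI[of _ "\<rho> t \<otimes> y"] bexI[of _ r]) auto
qed

section \<open>Stable range one at a maximal ideal\<close>

context
  fixes G P
  assumes G: "generates G" and P: "maximalideal P R"
begin

lemma prime_P: "primeideal P R"
  using R.maximalideal_prime[OF P] .

lemma span_cancel:
  assumes "s \<in> carrier R - P" "x \<in> carrier L" "\<rho> s \<otimes> x \<in> span G P" shows "x \<in> span G P"
proof -
  interpret P: primeideal P R by (rule prime_P)
  have g: "finite G" "G \<subseteq> carrier L" "carrier L \<subseteq> span G (carrier R)" using G unfolding generates_def by auto
  interpret S: ideal "span G P" L by (rule span_ideal[OF G P.is_ideal])
  obtain t p where t: "t \<in> carrier R - P" "p \<in> P" "s \<otimes>\<^bsub>R\<^esub> t = \<one>\<^bsub>R\<^esub> \<oplus>\<^bsub>R\<^esub> p"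
    using R.maximalideal_inverse[OF P assms(1)] by blast
  have c: "s \<in> carrier R" "t \<in> carrier R" "p \<in> carrier R" using t assms P.Icarr by auto
  have "\<rho> p \<otimes> x \<in> span G P" using span_smult[OF g(2,1) P.is_ideal _ t(2)] g assms by auto
  moreover have "\<rho> t \<otimes> (\<rho> s \<otimes> x) \<in> span G P" using S.I_l_closed[OF assms(3)] c by auto
  ultimately have m: "\<rho> t \<otimes> (\<rho> s \<otimes> x) \<oplus> \<ominus> (\<rho> p \<otimes> x) \<in> span G P"
    by (intro S.a_inv_closed S.a_closed)
  have "\<rho> s \<otimes> \<rho> t = \<one> \<oplus> \<rho> p" using arg_cong[OF t(3), of \<rho>] c by simp
  hence "\<rho> t \<otimes> \<rho> s = \<one> \<oplus> \<rho> p" using rho_comm(1)[of s "\<rho> t"] c by simp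
  hence "\<rho> t \<otimes> (\<rho> s \<otimes> x) = (\<one> \<oplus> \<rho> p) \<otimes> x" using c assms by (simp add: m_assoc[symmetric])
  thus ?thesis using m c assms by (simp add: nc_simps)
qed

text \<open>Low coefficients that lie in \<open>P\<close> are dropped, and \<open>m\<close> counts
  them. The first coefficient outside \<open>P\<close> is invertible modulo \<open>P\<close>, and
  dividing by it expresses \<open>x [^] m\<close> as a multiple of the next power, the cofactor
  being a polynomial in \<open>x\<close>.\<close>

lemma pi_regular_mod:
  assumes "x \<in> carrier L" "set rs \<subseteq> carrier R" "\<not> set rs \<subseteq> P" "x [^] (m::nat) \<otimes> peval x rs \<in> span G P"
  shows "\<exists>w \<in> carrier L. \<exists>k::nat. x \<otimes> w = w \<otimes> x \<and> x [^] k \<ominus> x [^] Suc k \<otimes> w \<in> span G P"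
  using assms(2-)
proof (induction rs arbitrary: m)
  case (Cons r rs)
  interpret P: primeideal P R by (rule prime_P)
  have g: "finite G" "G \<subseteq> carrier L" "carrier L \<subseteq> span G (carrier R)" using G unfolding generates_def by auto
  interpret S: ideal "span G P" L by (rule span_ideal[OF G P.is_ideal])
  let ?w = "peval x rs"
  have c: "r \<in> carrier R" "set rs \<subseteq> carrier R" "?w \<in> carrier L" using Cons assms by auto
  have xw: "x \<otimes> ?w = ?w \<otimes> x" using peval_comm assms c by simp
  have e: "x [^] m \<otimes> peval x (r # rs) = \<rho> r \<otimes> x [^] m \<oplus> x [^] Suc m \<otimes> ?w"
    using c assms(1) rho_comm(1)[of r "x [^] m"] by (simp add: r_distr m_assoc)
  show ?case
  proof (cases "r \<in> P")
    case True
    have "\<rho> r \<otimes> x [^] m \<in> span G P" 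
      by (intro span_smult[OF g(2,1) P.is_ideal _ True]) (use g(3) assms(1) in auto)
    hence "(\<rho> r \<otimes> x [^] m \<oplus> x [^] Suc m \<otimes> ?w) \<oplus> \<ominus> (\<rho> r \<otimes> x [^] m) \<in> span G P"
      using Cons.prems(3) e S.a_closed S.a_inv_closed by metis
    moreover have "(\<rho> r \<otimes> x [^] m \<oplus> x [^] Suc m \<otimes> ?w) \<oplus> \<ominus> (\<rho> r \<otimes> x [^] m) = x [^] Suc m \<otimes> ?w"
      using c assms(1) by (simp add: a_assoc a_comm a_lcomm r_neg l_neg r_neg1 r_neg2 cancel_deep)
    ultimately show ?thesis using Cons.IH[of "Suc m"] Cons.prems True c by auto
  next
    case False
    obtain t p where t: "t \<in> carrier R - P" "p \<in> P" "r \<otimes>\<^bsub>R\<^esub> t = \<one>\<^bsub>R\<^esub> \<oplus>\<^bsub>R\<^esub> p"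
      using R.maximalideal_inverse[OF P, of r] c False by blast
    have tc: "t \<in> carrier R" "p \<in> carrier R" using t P.Icarr by auto
    have "\<rho> p \<otimes> x [^] m \<in> span G P"
      by (intro span_smult[OF g(2,1) P.is_ideal _ t(2)]) (use g(3) assms(1) in auto)
    moreover have "\<rho> t \<otimes> (\<rho> r \<otimes> x [^] m \<oplus> x [^] Suc m \<otimes> ?w) \<in> span G P"
      using S.I_l_closed[of _ "\<rho> t"] Cons.prems(3) e tc by auto
    ultimately have m: "\<rho> t \<otimes> (\<rho> r \<otimes> x [^] m \<oplus> x [^] Suc m \<otimes> ?w) \<oplus> \<ominus> (\<rho> p \<otimes> x [^] m) \<in> span G P"
      by (intro S.a_inv_closed S.a_closed)
    have "\<rho> r \<otimes> \<rho> t = \<one> \<oplus> \<rho> p" using arg_cong[OF t(3), of \<rho>] c tc by simp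
    hence rt: "\<rho> t \<otimes> \<rho> r = \<one> \<oplus> \<rho> p" using rho_comm(1)[of r "\<rho> t"] c tc by simp
    have "\<rho> t \<otimes> (\<rho> r \<otimes> x [^] m) = (\<one> \<oplus> \<rho> p) \<otimes> x [^] m"
      using rt c tc assms(1) by (simp add: m_assoc[symmetric])
    moreover have "\<rho> t \<otimes> (x [^] Suc m \<otimes> ?w) = x [^] Suc m \<otimes> (\<rho> t \<otimes> ?w)"
      using rho_comm(2)[of t "x [^] Suc m" ?w] c tc assms(1) by simp
    ultimately have "\<rho> t \<otimes> (\<rho> r \<otimes> x [^] m \<oplus> x [^] Suc m \<otimes> ?w) \<oplus> \<ominus> (\<rho> p \<otimes> x [^] m)
      = x [^] m \<ominus> x [^] Suc m \<otimes> (\<ominus> (\<rho> t \<otimes> ?w))"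
      using c tc assms(1) by (simp add: r_distr del: nat_pow_Suc)
        (simp add: l_distr r_minus a_minus_def a_assoc a_comm a_lcomm r_neg l_neg r_neg1 r_neg2 cancel_deep del: nat_pow_Suc)
    moreover have "x \<otimes> (\<ominus> (\<rho> t \<otimes> ?w)) = (\<ominus> (\<rho> t \<otimes> ?w)) \<otimes> x"
      using xw c tc assms(1) rho_comm(2)[of t x ?w] by (simp add: r_minus l_minus m_assoc)
    ultimately show ?thesis using m c tc by (intro bexI[of _ "\<ominus> (\<rho> t \<otimes> ?w)"] exI[of _ m]) auto
  qed
qed simp

text \<open>Modulo \<open>P\<close> the algebra is finite dimensional over the residue field: a
  polynomial relation makes each element strongly pi-regular, and nonzero orthogonal idempotents are
  linearly independent, so there are at most \<open>card G\<close> of them.\<close>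

lemma stable_range_Quot: "stable_range_one (L Quot (span G P))"
proof (rule stable_range_one_strongly_pi_regular)
  interpret P: primeideal P R by (rule prime_P)
  have g: "finite G" "G \<subseteq> carrier L" "carrier L \<subseteq> span G (carrier R)" using G unfolding generates_def by auto
  interpret S: ideal "span G P" L by (rule span_ideal[OF G P.is_ideal])
  let ?B = "L Quot (span G P)" and ?h = "(+>) (span G P)"
  interpret B: ring ?B by (rule S.quotient_is_ring)
  show "ring ?B" by (rule B.ring_axioms)
  have h: "?h \<in> ring_hom L ?B" by (rule S.rcos_ring_hom)
  interpret h: ring_hom_ring L ?B ?h by (rule S.rcos_ring_hom_ring)
  have surj: "\<exists>x \<in> carrier L. a = ?h x" if "a \<in> carrier ?B" for a
    using that unfolding FactRing_def A_RCOSETS_def' by auto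
  have eq: "?h x = ?h y \<longleftrightarrow> x \<ominus> y \<in> span G P" if "x \<in> carrier L" "y \<in> carrier L" for x y
    using quotient_eq_iff_same_a_r_cos[OF S.is_ideal that] by simp
  show "B.strongly_pi_regular"
    unfolding B.strongly_pi_regular_def
  proof
    fix a assume "a \<in> carrier ?B"
    then obtain x where x: "x \<in> carrier L" "a = ?h x" using surj by blast
    obtain rs where rs: "set rs \<subseteq> carrier R" "\<not> set rs \<subseteq> P" "peval x rs \<in> span G P"
      using polynomial_relation[OF G prime_P x(1)] by blast
    have "x [^] (0::nat) \<otimes> peval x rs \<in> span G P" using rs x by simp
    from pi_regular_mod[OF x(1) rs(1,2) this]
    obtain w and k :: nat where w: "w \<in> carrier L" "x \<otimes> w = w \<otimes> x" "x [^] k \<ominus> x [^] Suc k \<otimes> w \<in> span G P"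
      by blast
    have "a \<otimes>\<^bsub>?B\<^esub> ?h w = ?h w \<otimes>\<^bsub>?B\<^esub> a"
      using w x h.hom_mult by metis
    moreover have "?h (x [^] k) = ?h (x [^] Suc k \<otimes> w)"
      by (intro iffD2[OF eq] w(3)) (use w(1) x(1) in simp_all)
    hence "a [^]\<^bsub>?B\<^esub> k = a [^]\<^bsub>?B\<^esub> Suc k \<otimes>\<^bsub>?B\<^esub> ?h w"
      unfolding x(2) using x(1) w(1) by (simp add: h.hom_nat_pow)
    ultimately show "\<exists>w\<in>carrier ?B. \<exists>k::nat. a \<otimes>\<^bsub>?B\<^esub> w = w \<otimes>\<^bsub>?B\<^esub> a \<and>
        a [^]\<^bsub>?B\<^esub> k = a [^]\<^bsub>?B\<^esub> Suc k \<otimes>\<^bsub>?B\<^esub> w"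
      using w h.hom_closed by blast
  qed
  fix S assume S: "B.orthogonal_idempotents S"
  show "card S \<le> card G"
  proof (rule ccontr)
    assume "\<not> card S \<le> card G"
    hence lt: "card G < card S" by simp
    have Sf: "finite S" "\<And>e. e \<in> S \<Longrightarrow> e \<in> carrier ?B \<and> e \<noteq> \<zero>\<^bsub>?B\<^esub> \<and> e \<otimes>\<^bsub>?B\<^esub> e = e"
      "\<And>e f. e \<in> S \<Longrightarrow> f \<in> S \<Longrightarrow> e \<noteq> f \<Longrightarrow> e \<otimes>\<^bsub>?B\<^esub> f = \<zero>\<^bsub>?B\<^esub>"
      using S unfolding B.orthogonal_idempotents_def by auto
    have "\<forall>e \<in> S. \<exists>x. x \<in> carrier L \<and> e = ?h x" using Sf surj by blast
    then obtain v where v: "\<And>e. e \<in> S \<Longrightarrow> v e \<in> carrier L" "\<And>e. e \<in> S \<Longrightarrow> ?h (v e) = e" by metis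
    from linear_dependence[OF G prime_P Sf(1) lt v(1)]
    obtain r where r: "r \<in> S \<rightarrow> carrier R" "(\<exists>e \<in> S. r e \<notin> P) \<and> (\<Oplus>e\<in>S. \<rho> (r e) \<otimes> v e) \<in> span G P"
      by (rule bexE)
    from r(2) have r3: "(\<Oplus>e\<in>S. \<rho> (r e) \<otimes> v e) \<in> span G P" by (rule conjunct2)
    from r(2) obtain e where e: "e \<in> S" "r e \<notin> P" by blast
    have rc: "\<And>f. f \<in> S \<Longrightarrow> \<rho> (r f) \<in> carrier L" using rho_simps(1)[OF Pi_mem[OF r(1)]] .
    have hz: "?h x = \<zero>\<^bsub>?B\<^esub> \<longleftrightarrow> x \<in> span G P" if "x \<in> carrier L" for x
      using eq[OF that zero_closed] that h.hom_zero by (simp add: nc_simps)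
    \<comment> \<open>Multiplication by the lift of \<open>e\<close> kills all terms of the
      dependence but the one at \<open>e\<close>, whose coefficient is outside
      \<open>P\<close>.\<close>
    have "?h (v e \<otimes> (\<Oplus>f\<in>S. \<rho> (r f) \<otimes> v f)) = \<zero>\<^bsub>?B\<^esub>"
      using hz S.I_l_closed[OF r3 v(1)[OF e(1)]] S.Icarr by blast
    also have "v e \<otimes> (\<Oplus>f\<in>S. \<rho> (r f) \<otimes> v f) = (\<Oplus>f\<in>S. v e \<otimes> (\<rho> (r f) \<otimes> v f))"
      using rc v(1) Sf(1) e by (intro finsum_rdistr) auto
    also have "?h \<dots> = (\<Oplus>\<^bsub>?B\<^esub>f\<in>S. ?h (v e \<otimes> (\<rho> (r f) \<otimes> v f)))"
      using rc v(1) e by (subst h.hom_finsum) (auto simp: comp_def)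
    also have "\<dots> = (\<Oplus>\<^bsub>?B\<^esub>f\<in>S. if e = f then ?h (\<rho> (r e) \<otimes> v e) else \<zero>\<^bsub>?B\<^esub>)"
    proof (rule B.finsum_cong')
      fix f assume f: "f \<in> S"
      have "?h (v e \<otimes> (\<rho> (r f) \<otimes> v f)) = ?h (\<rho> (r f) \<otimes> (v e \<otimes> v f))"
        using rho_comm(2)[OF Pi_mem[OF r(1) f] v(1)[OF e(1)] v(1)[OF f]] by simp
      also have "\<dots> = ?h (\<rho> (r f)) \<otimes>\<^bsub>?B\<^esub> (e \<otimes>\<^bsub>?B\<^esub> f)"
        using rc[OF f] v e(1) f by simp
      also have "\<dots> = (if e = f then ?h (\<rho> (r e) \<otimes> v e) else \<zero>\<^bsub>?B\<^esub>)"
        using Sf e f v(1)[OF f] v(2)[OF f] rc[OF f] by (cases "e = f") auto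
      finally show "?h (v e \<otimes> (\<rho> (r f) \<otimes> v f)) = (if e = f then ?h (\<rho> (r e) \<otimes> v e) else \<zero>\<^bsub>?B\<^esub>)" .
    qed (use rc[OF e(1)] v e Sf(2) in auto)
    also have "\<dots> = ?h (\<rho> (r e) \<otimes> v e)"
      by (rule B.finsum_singleton[of e S "\<lambda>_. ?h (\<rho> (r e) \<otimes> v e)"]) (use e Sf(1,2) rc[OF e(1)] v in auto)
    finally have "\<rho> (r e) \<otimes> v e \<in> span G P"
      by (rule iffD1[OF hz, rotated]) (use rc[OF e(1)] v(1)[OF e(1)] in simp)
    hence "v e \<in> span G P" using span_cancel[of "r e" "v e"] Pi_mem[OF r(1) e(1)] e v(1) by simp
    hence "e = \<zero>\<^bsub>?B\<^esub>" using hz[OF v(1)[OF e(1)]] v(2)[OF e(1)] by simp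
    thus False using Sf e by blast
  qed
qed

text \<open>The property lifts from the quotient by \<open>P L\<close> because units do. The
  \<open>y\<close> found there inverts only modulo \<open>P L\<close>, but then \<open>y ?x\<close>
  and \<open>?x y\<close> are invertible at \<open>P\<close>, which yields a left and a right
  inverse of \<open>?x\<close>.\<close>

theorem p_unit_stable_range:
  assumes "d \<in> carrier L" "z \<in> carrier L" "w \<in> carrier L" "s \<in> carrier R - P" "z \<otimes> d \<oplus> w = \<rho> s"
  shows "\<exists>t \<in> carrier L. p_unit P (d \<oplus> t \<otimes> w)"
proof -
  interpret P: primeideal P R by (rule prime_P)
  have g: "finite G" "G \<subseteq> carrier L" "carrier L \<subseteq> span G (carrier R)" using G unfolding generates_def by auto
  interpret S: ideal "span G P" L by (rule span_ideal[OF G P.is_ideal])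
  let ?B = "L Quot (span G P)" and ?h = "(+>) (span G P)"
  interpret B: ring ?B by (rule S.quotient_is_ring)
  interpret h: ring_hom_ring L ?B ?h by (rule S.rcos_ring_hom_ring)
  have surj: "\<exists>x \<in> carrier L. a = ?h x" if "a \<in> carrier ?B" for a
    using that unfolding FactRing_def A_RCOSETS_def' by auto
  have eq: "?h x = ?h y \<longleftrightarrow> x \<ominus> y \<in> span G P" if "x \<in> carrier L" "y \<in> carrier L" for x y
    using quotient_eq_iff_same_a_r_cos[OF S.is_ideal that] by simp
  obtain u p where u: "u \<in> carrier R - P" "p \<in> P" "s \<otimes>\<^bsub>R\<^esub> u = \<one>\<^bsub>R\<^esub> \<oplus>\<^bsub>R\<^esub> p"
    using R.maximalideal_inverse[OF P assms(4)] by blast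
  have c: "s \<in> carrier R" "u \<in> carrier R" "p \<in> carrier R" using assms u P.Icarr by auto
  have "\<rho> s \<otimes> \<rho> u = \<one> \<oplus> \<rho> p" using arg_cong[OF u(3), of \<rho>] c by simp
  hence "\<rho> u \<otimes> (z \<otimes> d \<oplus> w) = \<one> \<oplus> \<rho> p" using rho_comm(1)[of s "\<rho> u"] c assms by simp
  hence "\<rho> u \<otimes> z \<otimes> d \<oplus> \<rho> u \<otimes> w = \<one> \<oplus> \<rho> p" using c assms(1-3) by (simp add: r_distr m_assoc)
  moreover have "\<rho> p \<otimes> \<one> \<in> span G P" using span_smult[OF g(2,1) P.is_ideal _ u(2)] g by auto
  ultimately have "?h (\<rho> u \<otimes> z \<otimes> d \<oplus> \<rho> u \<otimes> w) = ?h \<one>"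
    using eq[of "\<one> \<oplus> \<rho> p" \<one>] c by (simp add: nc_simps)
  hence "?h (\<rho> u \<otimes> z) \<otimes>\<^bsub>?B\<^esub> ?h d \<oplus>\<^bsub>?B\<^esub> ?h (\<rho> u \<otimes> w) = \<one>\<^bsub>?B\<^esub>"
    using c assms(1-3) by simp
  then obtain a where a: "a \<in> carrier ?B" "?h d \<oplus>\<^bsub>?B\<^esub> a \<otimes>\<^bsub>?B\<^esub> ?h (\<rho> u \<otimes> w) \<in> Units ?B"
    using stable_range_Quot c assms(1-3) unfolding stable_range_one_def
    by (metis h.hom_closed m_closed rho_simps(1))
  obtain t where t: "t \<in> carrier L" "a = ?h t" using surj a by blast
  let ?x = "d \<oplus> t \<otimes> (\<rho> u \<otimes> w)"
  have x: "?x \<in> carrier L" using t c assms by simp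
  have "?h ?x \<in> Units ?B" using a t c assms(1-3) by simp
  then obtain b where b: "b \<in> carrier ?B" "b \<otimes>\<^bsub>?B\<^esub> ?h ?x = \<one>\<^bsub>?B\<^esub>" "?h ?x \<otimes>\<^bsub>?B\<^esub> b = \<one>\<^bsub>?B\<^esub>"
    unfolding Units_def by blast
  obtain y where y: "y \<in> carrier L" "b = ?h y" using surj b by blast
  have hy: "?h (y \<otimes> ?x) = ?h \<one>" "?h (?x \<otimes> y) = ?h \<one>"
    using b x y h.hom_mult[of y ?x] h.hom_mult[of ?x y] h.hom_one by simp_all
  have "y \<otimes> ?x \<ominus> \<rho> \<one>\<^bsub>R\<^esub> \<in> span G P" "?x \<otimes> y \<ominus> \<rho> \<one>\<^bsub>R\<^esub> \<in> span G P"
    using iffD1[OF eq hy(1)] iffD1[OF eq hy(2)] x y(1) by (simp_all del: h.hom_mult h.hom_add)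
  moreover have one: "\<one>\<^bsub>R\<^esub> \<in> carrier R - P" using P.I_notcarr P.one_imp_carrier by auto
  ultimately have "p_unit P (y \<otimes> ?x)" "p_unit P (?x \<otimes> y)"
    using x y by (auto intro!: p_unit_mod[OF G P _ one])
  then obtain a b r r' where ab: "a \<in> carrier L" "b \<in> carrier L" "r \<in> carrier R - P" "r' \<in> carrier R - P"
    "a \<otimes> (y \<otimes> ?x) = \<rho> r" "?x \<otimes> y \<otimes> b = \<rho> r'"
    unfolding p_unit_def by blast
  hence "p_unit P ?x" using x y(1)
    by (intro p_unit_two_sided[OF prime_P x, of r "a \<otimes> y" r' "y \<otimes> b"]) (auto simp: m_assoc)
  moreover have "?x = d \<oplus> (t \<otimes> \<rho> u) \<otimes> w" using t c assms by (simp add: m_assoc)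
  ultimately show ?thesis using t c by auto
qed

end

end

section \<open>One-dimensional noetherian domains\<close>

lemma (in cring) ideal_criterion:
  assumes "I \<subseteq> carrier R" "\<zero> \<in> I" "\<And>x y. x \<in> I \<Longrightarrow> y \<in> I \<Longrightarrow> x \<oplus> y \<in> I"
    and "\<And>r x. r \<in> carrier R \<Longrightarrow> x \<in> I \<Longrightarrow> r \<otimes> x \<in> I"
  shows "ideal I R"
proof (rule idealI[OF ring_axioms])
  show "subgroup I (add_monoid R)"
  proof (rule group.subgroupI[OF add.group_axioms])
    fix x assume x: "x \<in> I"
    have "(\<ominus> \<one>) \<otimes> x \<in> I" using assms(4)[OF _ x, of "\<ominus> \<one>"] by simp
    moreover have "(\<ominus> \<one>) \<otimes> x = \<ominus> x" using x assms(1) by (auto simp: l_minus)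
    ultimately show "inv\<^bsub>add_monoid R\<^esub> x \<in> I" by (simp add: a_inv_def)
  qed (use assms in auto)
  fix a x assume ax: "a \<in> I" "x \<in> carrier R"
  show "x \<otimes> a \<in> I" by (rule assms(4)[OF ax(2,1)])
  thus "a \<otimes> x \<in> I" using ax assms(1) m_comm[of a x] by auto
qed

lemma (in noetherian_ring) maximal_ideal_in_family:
  assumes "F \<noteq> {}" "\<And>I. I \<in> F \<Longrightarrow> ideal I R"
  shows "\<exists>M \<in> F. \<forall>I \<in> F. M \<subseteq> I \<longrightarrow> I = M"
proof (rule subset_Zorn_nonempty[OF assms(1)])
  fix C assume C: "C \<noteq> {}" "subset.chain F C"
  hence "subset.chain {I. ideal I R} C"
    using assms(2) unfolding pred_on.chain_def by auto
  from ideal_chain_is_trivial[OF C(1) this] C(2) show "\<Union>C \<in> F"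
    unfolding pred_on.chain_def by auto
qed

lemma (in noetherian_ring) exists_maximalideal:
  assumes "ideal I R" "I \<noteq> carrier R"
  shows "\<exists>P. maximalideal P R \<and> I \<subseteq> P"
proof -
  let ?F = "{J. ideal J R \<and> I \<subseteq> J \<and> J \<noteq> carrier R}"
  have "\<exists>M \<in> ?F. \<forall>J \<in> ?F. M \<subseteq> J \<longrightarrow> J = M"
    using assms by (intro maximal_ideal_in_family) auto
  then obtain M where "M \<in> ?F" "\<forall>J \<in> ?F. M \<subseteq> J \<longrightarrow> J = M" by (rule bexE)
  hence M: "ideal M R" "I \<subseteq> M" "M \<noteq> carrier R"
    "\<And>J. ideal J R \<Longrightarrow> I \<subseteq> J \<Longrightarrow> J \<noteq> carrier R \<Longrightarrow> M \<subseteq> J \<Longrightarrow> J = M" by simp_all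
  have "maximalideal M R"
    by (rule maximalidealI[OF M(1)]) (use M in blast)+
  thus ?thesis using M by blast
qed

locale one_dimensional_domain = noetherian_domain R for R (structure) +
  assumes prime_maximal: "\<lbrakk> primeideal P R; P \<noteq> {\<zero>} \<rbrakk> \<Longrightarrow> maximalideal P R"
begin

text \<open>The contraction to \<open>R\<close> of the ideal that \<open>a\<close> generates in the localization at \<open>P\<close>.\<close>

definition local_multiples :: "'a \<Rightarrow> 'a set \<Rightarrow> 'a set" where
  "local_multiples a P = {y \<in> carrier R. \<exists>s \<in> carrier R - P. \<exists>c \<in> carrier R. s \<otimes> y = a \<otimes> c}"

lemma local_multiplesI:
  "\<lbrakk> s \<otimes> y = a \<otimes> c; y \<in> carrier R; s \<in> carrier R - P; c \<in> carrier R \<rbrakk> \<Longrightarrow> y \<in> local_multiples a P"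
  unfolding local_multiples_def by blast

lemma local_multiples_ideal:
  assumes P: "primeideal P R" and a: "a \<in> carrier R" shows "ideal (local_multiples a P) R"
proof (rule ideal_criterion)
  interpret P: primeideal P R by fact
  have one: "\<one> \<in> carrier R - P" using P.I_notcarr P.one_imp_carrier by auto
  show "local_multiples a P \<subseteq> carrier R" unfolding local_multiples_def by auto
  show "\<zero> \<in> local_multiples a P"
    using one a by (intro local_multiplesI[of \<one> \<zero> a \<zero>]) auto
  fix x y assume "x \<in> local_multiples a P" "y \<in> local_multiples a P"
  then obtain s c t d where sc: "x \<in> carrier R" "y \<in> carrier R" "s \<in> carrier R - P" "t \<in> carrier R - P"
    "c \<in> carrier R" "d \<in> carrier R" "s \<otimes> x = a \<otimes> c" "t \<otimes> y = a \<otimes> d"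
    unfolding local_multiples_def by auto
  have "(s \<otimes> t) \<otimes> (x \<oplus> y) = t \<otimes> (s \<otimes> x) \<oplus> s \<otimes> (t \<otimes> y)"
    using sc(1-6) by (simp add: r_distr m_ac)
  also have "\<dots> = a \<otimes> (t \<otimes> c \<oplus> s \<otimes> d)"
    unfolding sc(7,8) using a sc(1-6) by (simp add: r_distr m_ac)
  finally show "x \<oplus> y \<in> local_multiples a P"
    by (rule local_multiplesI) (use sc(1-6) P.I_prime[of s t] in auto)
next
  fix r x assume r: "r \<in> carrier R" and "x \<in> local_multiples a P"
  then obtain s c where sc: "x \<in> carrier R" "s \<in> carrier R - P" "c \<in> carrier R" "s \<otimes> x = a \<otimes> c"
    unfolding local_multiples_def by auto
  have "s \<otimes> (r \<otimes> x) = r \<otimes> (s \<otimes> x)" using sc(1-3) r by (simp add: m_ac)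
  also have "\<dots> = a \<otimes> (r \<otimes> c)" unfolding sc(4) using a sc(1-3) r by (simp add: m_ac)
  finally show "r \<otimes> x \<in> local_multiples a P"
    by (rule local_multiplesI) (use sc(1-3) r in auto)
qed

lemma local_multiples_self:
  assumes "primeideal P R" "a \<in> carrier R" shows "a \<in> local_multiples a P"
proof -
  interpret P: primeideal P R by fact
  have "\<one> \<in> carrier R - P" using P.I_notcarr P.one_imp_carrier by auto
  thus ?thesis using assms by (intro local_multiplesI[of \<one> a a \<one>]) auto
qed

text \<open>In dimension one, \<open>P\<close> is the only prime ideal of the localization that
  contains \<open>a\<close>. An ideal maximal among those that contain
  \<open>local_multiples a P\<close> and avoid the powers of \<open>x\<close> times elements outside
  \<open>P\<close> is prime and nonzero, hence maximal, and it is contained in \<open>P\<close>. So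
  it equals \<open>P\<close> and contains \<open>x\<close> after all.\<close>

lemma pow_in_local_multiples:
  assumes P: "maximalideal P R" and a: "a \<in> carrier R" "a \<noteq> \<zero>" and x: "x \<in> P"
  shows "\<exists>k::nat. x [^] k \<in> local_multiples a P"
proof (rule ccontr)
  assume no: "\<nexists>k::nat. x [^] k \<in> local_multiples a P"
  have pr: "primeideal P R" using maximalideal_prime[OF P] .
  interpret P: primeideal P R by fact
  have xc: "x \<in> carrier R" using x P.Icarr by auto
  have one: "\<one> \<in> carrier R - P" using P.I_notcarr P.one_imp_carrier by auto
  \<comment> \<open>The multiplicative set generated by \<open>x\<close> and the complement of
    \<open>P\<close>.\<close>
  define T where "T = {x [^] (k::nat) \<otimes> s | k s. s \<in> carrier R - P}"
  have Tm: "u \<otimes> v \<in> T" if uv: "u \<in> T" "v \<in> T" for u v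
  proof -
    obtain k l s t where kl: "u = x [^] (k::nat) \<otimes> s" "v = x [^] (l::nat) \<otimes> t" "s \<in> carrier R - P" "t \<in> carrier R - P"
      using uv unfolding T_def by blast
    have "u \<otimes> v = x [^] (k + l) \<otimes> (s \<otimes> t)"
      using kl xc by (simp add: nat_pow_mult[symmetric] m_ac)
    moreover have "s \<otimes> t \<in> carrier R - P" using kl P.I_prime by auto
    ultimately show ?thesis unfolding T_def by blast
  qed
  have "T \<inter> local_multiples a P = {}"
  proof (rule ccontr)
    assume "T \<inter> local_multiples a P \<noteq> {}"
    then obtain y where "y \<in> T" "y \<in> local_multiples a P" by blast
    then obtain k s t c where *: "s \<in> carrier R - P" "t \<in> carrier R - P" "c \<in> carrier R"
      "t \<otimes> (x [^] (k::nat) \<otimes> s) = a \<otimes> c"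
      unfolding T_def local_multiples_def by blast
    have "t \<otimes> (x [^] k \<otimes> s) = (t \<otimes> s) \<otimes> x [^] k" using *(1,2) xc by (simp add: m_ac)
    hence e: "(t \<otimes> s) \<otimes> x [^] k = a \<otimes> c" using *(4) by simp
    have "t \<otimes> s \<in> carrier R - P" using * P.I_prime by auto
    hence "x [^] k \<in> local_multiples a P"
      by (intro local_multiplesI[OF e]) (use xc *(3) in auto)
    thus False using no by blast
  qed
  let ?F = "{J. ideal J R \<and> local_multiples a P \<subseteq> J \<and> T \<inter> J = {}}"
  have "\<exists>M \<in> ?F. \<forall>J \<in> ?F. M \<subseteq> J \<longrightarrow> J = M"
    using local_multiples_ideal[OF pr a(1)] \<open>T \<inter> local_multiples a P = {}\<close>
    by (intro maximal_ideal_in_family) auto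
  then obtain Q where "Q \<in> ?F" "\<forall>J \<in> ?F. Q \<subseteq> J \<longrightarrow> J = Q" by (rule bexE)
  hence Q: "ideal Q R" "local_multiples a P \<subseteq> Q" "T \<inter> Q = {}"
    "\<And>J. ideal J R \<Longrightarrow> local_multiples a P \<subseteq> J \<Longrightarrow> T \<inter> J = {} \<Longrightarrow> Q \<subseteq> J \<Longrightarrow> J = Q" by simp_all
  interpret Q: ideal Q R by fact
  have one_T: "\<one> \<in> T" unfolding T_def using one by (auto intro!: exI[of _ "0::nat"] exI[of _ \<one>])
  have meet: "\<exists>q \<in> Q. \<exists>r \<in> carrier R. q \<oplus> r \<otimes> u \<in> T" if u: "u \<in> carrier R" "u \<notin> Q" for u
  proof -
    let ?J = "{q \<oplus> r \<otimes> u | q r. q \<in> Q \<and> r \<in> carrier R}"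
    have J: "ideal ?J R"
    proof (rule ideal_criterion)
      show "?J \<subseteq> carrier R" using u Q.Icarr by auto
      show "\<zero> \<in> ?J" using u Q.zero_closed by (auto intro!: exI[of _ \<zero>])
      fix y z assume "y \<in> ?J" "z \<in> ?J"
      then obtain q r q' r' where "q \<in> Q" "r \<in> carrier R" "q' \<in> Q" "r' \<in> carrier R"
        "y = q \<oplus> r \<otimes> u" "z = q' \<oplus> r' \<otimes> u" by blast
      moreover from this have "y \<oplus> z = (q \<oplus> q') \<oplus> (r \<oplus> r') \<otimes> u"
        using u Q.Icarr by (simp add: l_distr a_ac)
      ultimately show "y \<oplus> z \<in> ?J" using Q.a_closed by blast
    next
      fix t y assume "t \<in> carrier R" "y \<in> ?J"
      then obtain q r where "t \<in> carrier R" "q \<in> Q" "r \<in> carrier R" "y = q \<oplus> r \<otimes> u" by blast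
      moreover from this have "t \<otimes> y = t \<otimes> q \<oplus> (t \<otimes> r) \<otimes> u"
        using u Q.Icarr by (simp add: r_distr m_assoc)
      ultimately show "t \<otimes> y \<in> ?J" using Q.I_l_closed by blast
    qed
    have QJ: "Q \<subseteq> ?J"
    proof
      fix q assume "q \<in> Q"
      moreover from this have "q = q \<oplus> \<zero> \<otimes> u" using u Q.Icarr by simp
      ultimately show "q \<in> ?J" by blast
    qed
    have uJ: "u \<in> ?J"
    proof -
      have "u = \<zero> \<oplus> \<one> \<otimes> u" using u by simp
      thus ?thesis using Q.zero_closed by blast
    qed
    have "T \<inter> ?J \<noteq> {}"
    proof
      assume "T \<inter> ?J = {}"
      with Q(4)[OF J subset_trans[OF Q(2) QJ] _ QJ] have "?J = Q" by simp
      thus False using u uJ by simp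
    qed
    thus ?thesis by blast
  qed
  have "primeideal Q R"
  proof (rule primeidealI[OF Q(1)])
    show "cring R" by (rule is_cring)
    show "carrier R \<noteq> Q" using one_T Q(3) by auto
    fix u v assume uv: "u \<in> carrier R" "v \<in> carrier R" "u \<otimes> v \<in> Q"
    show "u \<in> Q \<or> v \<in> Q"
    proof (rule ccontr)
      assume "\<not> (u \<in> Q \<or> v \<in> Q)"
      then obtain q r q' r' where qr: "q \<in> Q" "r \<in> carrier R" "q \<oplus> r \<otimes> u \<in> T"
        "q' \<in> Q" "r' \<in> carrier R" "q' \<oplus> r' \<otimes> v \<in> T" using meet uv by metis
      have c: "q \<in> carrier R" "q' \<in> carrier R" using qr Q.Icarr by auto
      have "(q \<oplus> r \<otimes> u) \<otimes> (q' \<oplus> r' \<otimes> v) = q' \<otimes> (q \<oplus> r \<otimes> u) \<oplus> (q \<otimes> (r' \<otimes> v) \<oplus> (r \<otimes> r') \<otimes> (u \<otimes> v))"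
        using c qr(2,5) uv(1,2) by algebra
      also have "\<dots> \<in> Q"
        using Q.a_closed[OF Q.I_r_closed[OF qr(4), of "q \<oplus> r \<otimes> u"]
            Q.a_closed[OF Q.I_r_closed[OF qr(1), of "r' \<otimes> v"] Q.I_l_closed[OF uv(3), of "r \<otimes> r'"]]]
          qr(2,5) uv(1,2) c by simp
      finally show False using Tm qr Q(3) by blast
    qed
  qed
  moreover have "Q \<noteq> {\<zero>}" using Q(2) local_multiples_self[OF pr a(1)] a(2) by auto
  ultimately have mQ: "maximalideal Q R" using prime_maximal by blast
  have "Q \<subseteq> P"
  proof
    fix y assume y: "y \<in> Q"
    show "y \<in> P"
    proof (rule ccontr)
      assume "y \<notin> P"
      hence "x [^] (0::nat) \<otimes> y \<in> T" unfolding T_def using y Q.Icarr by blast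
      thus False using y Q(3) Q.Icarr by auto
    qed
  qed
  hence "P = Q" using maximalideal.I_maximal[OF mQ P.is_ideal] P.I_notcarr P.a_subset by auto
  moreover have "x [^] (1::nat) \<otimes> \<one> \<in> T" unfolding T_def using one by blast
  ultimately show False using x Q(3) xc by auto
qed

text \<open>For \<open>x\<close> in \<open>P\<close> but not in \<open>Q\<close>, some power of
  \<open>x\<close> lies in \<open>local_multiples a P\<close>, and no power lies in the prime ideal
  \<open>Q\<close>.\<close>

lemma local_multiples_not_subset:
  assumes P: "maximalideal P R" and Q: "maximalideal Q R" and "P \<noteq> Q" and a: "a \<in> carrier R" "a \<noteq> \<zero>"
  shows "\<not> local_multiples a P \<subseteq> Q"
proof
  assume sub: "local_multiples a P \<subseteq> Q"
  interpret P: maximalideal P R by fact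
  interpret Q: primeideal Q R by (rule maximalideal_prime[OF Q])
  have "\<not> P \<subseteq> Q"
    using P.I_maximal[OF Q.is_ideal] Q.I_notcarr Q.a_subset assms(3) by auto
  then obtain x where x: "x \<in> P" "x \<notin> Q" by blast
  obtain k :: nat where "x [^] k \<in> local_multiples a P"
    using pow_in_local_multiples[OF P a x(1)] by blast
  hence k: "x [^] k \<in> Q" using sub by blast
  have xc: "x \<in> carrier R" using x P.Icarr by auto
  have "x [^] k \<notin> Q" for k :: nat
  proof (induction k)
    case 0
    show ?case using Q.one_imp_carrier Q.I_notcarr by auto
  next
    case (Suc k)
    thus ?case using Q.I_prime[of "x [^] k" x] xc x by auto
  qed
  thus False using k by blast
qed

text \<open>For nonzero \<open>a\<close>, the intersection of the primary components of the ideal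
  \<open>aR\<close> at all maximal ideals other than \<open>P\<close>.\<close>

definition away_multiples :: "'a \<Rightarrow> 'a set \<Rightarrow> 'a set" where
  "away_multiples a P = {y \<in> carrier R. \<forall>Q. maximalideal Q R \<longrightarrow> Q \<noteq> P \<longrightarrow> y \<in> local_multiples a Q}"

lemma away_multiples_ideal:
  assumes "a \<in> carrier R" shows "ideal (away_multiples a P) R"
proof (rule ideal_criterion)
  have l: "ideal (local_multiples a Q) R" if "maximalideal Q R" for Q
    using local_multiples_ideal[OF maximalideal_prime[OF that] assms] .
  show "away_multiples a P \<subseteq> carrier R" unfolding away_multiples_def by auto
  show "\<zero> \<in> away_multiples a P" unfolding away_multiples_def
    using additive_subgroup.zero_closed[OF ideal.axioms(1)[OF l]] by auto
  show "x \<oplus> y \<in> away_multiples a P" if "x \<in> away_multiples a P" "y \<in> away_multiples a P" for x y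
    using that additive_subgroup.a_closed[OF ideal.axioms(1)[OF l]] unfolding away_multiples_def by auto
  show "r \<otimes> x \<in> away_multiples a P" if "r \<in> carrier R" "x \<in> away_multiples a P" for r x
    using that ideal.I_l_closed[OF l] unfolding away_multiples_def by auto
qed

text \<open>Since \<open>local_multiples a P\<close> is finitely generated, a single
  \<open>s\<close> outside \<open>P\<close> multiplies it into \<open>aR\<close>. This
  \<open>s\<close> works at every other \<open>Q\<close>: some \<open>x\<close> of
  \<open>local_multiples a P\<close> is outside \<open>Q\<close>, and the product of
  \<open>s\<close> and \<open>x\<close> is a multiple of \<open>a\<close>.\<close>

lemma away_multiples_not_subset:
  assumes P: "maximalideal P R" and a: "a \<in> carrier R" "a \<noteq> \<zero>"
  shows "\<not> away_multiples a P \<subseteq> P"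
proof -
  have pr: "primeideal P R" using maximalideal_prime[OF P] .
  interpret P: primeideal P R by fact
  have one: "\<one> \<in> carrier R - P" using P.I_notcarr P.one_imp_carrier by auto
  obtain A where A: "A \<subseteq> carrier R" "finite A" "local_multiples a P = Idl A"
    using finetely_gen[OF local_multiples_ideal[OF pr a(1)]] by blast
  have fs: "\<exists>s \<in> carrier R - P. \<forall>y \<in> B. \<exists>c \<in> carrier R. s \<otimes> y = a \<otimes> c" if "finite B" "B \<subseteq> local_multiples a P" for B
    using that
  proof (induction B rule: finite_induct)
    case empty
    thus ?case using one by auto
  next
    case (insert b B)
    then obtain s where s: "s \<in> carrier R - P" "\<forall>y \<in> B. \<exists>c \<in> carrier R. s \<otimes> y = a \<otimes> c" by blast
    obtain t c where t: "b \<in> carrier R" "t \<in> carrier R - P" "c \<in> carrier R" "t \<otimes> b = a \<otimes> c"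
      using insert unfolding local_multiples_def by auto
    have "(s \<otimes> t) \<otimes> b = a \<otimes> (s \<otimes> c)"
    proof -
      have "(s \<otimes> t) \<otimes> b = s \<otimes> (t \<otimes> b)" using s t by (simp add: m_assoc)
      thus ?thesis unfolding t(4) using s t a by (simp add: m_ac)
    qed
    moreover have "\<exists>d \<in> carrier R. (s \<otimes> t) \<otimes> y = a \<otimes> d" if y: "y \<in> B" for y
    proof -
      obtain d where d: "d \<in> carrier R" "s \<otimes> y = a \<otimes> d" using s y by blast
      have "y \<in> carrier R" using y insert unfolding local_multiples_def by auto
      hence "(s \<otimes> t) \<otimes> y = t \<otimes> (s \<otimes> y)" using s t by (simp add: m_ac)
      hence "(s \<otimes> t) \<otimes> y = a \<otimes> (t \<otimes> d)" unfolding d(2) using s t a d(1) by (simp add: m_ac)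
      thus ?thesis using t d by blast
    qed
    moreover have "s \<otimes> t \<in> carrier R - P" using s t P.I_prime by auto
    ultimately show ?case using s t by (intro bexI[of _ "s \<otimes> t"]) auto
  qed
  have "A \<subseteq> local_multiples a P" using A genideal_self by blast
  from fs[OF A(2) this]
  obtain s where s: "s \<in> carrier R - P" "\<forall>y \<in> A. \<exists>c \<in> carrier R. s \<otimes> y = a \<otimes> c" by (rule bexE)
  let ?J = "{y \<in> carrier R. \<exists>c \<in> carrier R. s \<otimes> y = a \<otimes> c}"
  have "ideal ?J R"
  proof (rule ideal_criterion)
    show "\<zero> \<in> ?J" using a s by (auto intro!: bexI[of _ \<zero>])
    fix x y assume "x \<in> ?J" "y \<in> ?J"
    then obtain c d where "x \<in> carrier R" "y \<in> carrier R" "c \<in> carrier R" "d \<in> carrier R"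
      "s \<otimes> x = a \<otimes> c" "s \<otimes> y = a \<otimes> d" by auto
    thus "x \<oplus> y \<in> ?J" using a s by (auto simp: r_distr intro!: bexI[of _ "c \<oplus> d"])
  next
    fix r x assume "r \<in> carrier R" "x \<in> ?J"
    then obtain c where c: "r \<in> carrier R" "x \<in> carrier R" "c \<in> carrier R" "s \<otimes> x = a \<otimes> c" by auto
    have "s \<otimes> (r \<otimes> x) = r \<otimes> (s \<otimes> x)" using c(1-3) s by (simp add: m_ac)
    also have "\<dots> = a \<otimes> (r \<otimes> c)" unfolding c(4) using c(1-3) a by (simp add: m_ac)
    finally show "r \<otimes> x \<in> ?J" using c by auto
  qed auto
  moreover have "A \<subseteq> ?J" using s A by auto
  ultimately have sub: "local_multiples a P \<subseteq> ?J" unfolding A(3) by (rule genideal_minimal)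
  have "s \<in> local_multiples a Q" if Q: "maximalideal Q R" "Q \<noteq> P" for Q
  proof -
    obtain x where x: "x \<in> local_multiples a P" "x \<notin> Q"
      using local_multiples_not_subset[OF P Q(1) Q(2)[symmetric] a] by blast
    hence xJ: "x \<in> ?J" using sub by blast
    then obtain c where "x \<in> carrier R" "c \<in> carrier R" "s \<otimes> x = a \<otimes> c" by auto
    thus ?thesis using s x(2) m_comm[of s x] by (intro local_multiplesI[of x s a c]) auto
  qed
  hence "s \<in> away_multiples a P" unfolding away_multiples_def using s by auto
  thus ?thesis using s by blast
qed

text \<open>The substitute for the factorization \<open>aR = P\<^sup>k J\<close> with \<open>J\<close> prime to \<open>P\<close>.\<close>

lemma local_away_split:
  assumes P: "maximalideal P R" and a: "a \<in> carrier R" "a \<noteq> \<zero>"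
  shows "\<exists>r \<in> away_multiples a P. \<one> \<ominus> r \<in> local_multiples a P"
proof -
  let ?I = "local_multiples a P" and ?J = "away_multiples a P"
  interpret I: ideal ?I R by (rule local_multiples_ideal[OF maximalideal_prime[OF P] a(1)])
  interpret J: ideal ?J R by (rule away_multiples_ideal[OF a(1)])
  have IJ: "ideal (?I <+>\<^bsub>R\<^esub> ?J) R" by (rule add_ideals[OF I.is_ideal J.is_ideal])
  have "?I \<subseteq> ?I <+>\<^bsub>R\<^esub> ?J" "?J \<subseteq> ?I <+>\<^bsub>R\<^esub> ?J"
  proof -
    show "?I \<subseteq> ?I <+>\<^bsub>R\<^esub> ?J"
    proof
      fix x assume "x \<in> ?I"
      moreover from this have "x = x \<oplus> \<zero>" using I.Icarr by simp
      ultimately show "x \<in> ?I <+>\<^bsub>R\<^esub> ?J" using J.zero_closed unfolding set_add_def' by blast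
    qed
    show "?J \<subseteq> ?I <+>\<^bsub>R\<^esub> ?J"
    proof
      fix x assume "x \<in> ?J"
      moreover from this have "x = \<zero> \<oplus> x" using J.Icarr by simp
      ultimately show "x \<in> ?I <+>\<^bsub>R\<^esub> ?J" using I.zero_closed unfolding set_add_def' by blast
    qed
  qed
  \<comment> \<open>The first summand is not contained in any \<open>Q\<close> other than
    \<open>P\<close>, the second not in \<open>P\<close> itself.\<close>
  hence "\<not> (?I <+>\<^bsub>R\<^esub> ?J) \<subseteq> Q" if "maximalideal Q R" for Q
    using that local_multiples_not_subset[OF P that _ a] away_multiples_not_subset[OF P a] by blast
  hence "?I <+>\<^bsub>R\<^esub> ?J = carrier R" using exists_maximalideal[OF IJ] by blast
  hence "\<one> \<in> ?I <+>\<^bsub>R\<^esub> ?J" by simp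
  then obtain i r where ir: "i \<in> ?I" "r \<in> ?J" "\<one> = i \<oplus> r" unfolding set_add_def' by auto
  hence "\<one> \<ominus> r = i" using I.Icarr J.Icarr by (simp add: nc_simps)
  hence "\<one> \<ominus> r \<in> ?I" using ir(1) by simp
  thus ?thesis using ir(2) by blast
qed

text \<open>Consider the ideals generated by \<open>away_multiples a P\<close> for finitely many
  \<open>P\<close> containing \<open>a\<close>, and a maximal one among them, belonging to
  \<open>T\<close>. Another maximal ideal \<open>P\<close> containing \<open>a\<close> would contain
  this ideal but not \<open>away_multiples a P\<close>, so adding \<open>P\<close> to
  \<open>T\<close> would enlarge it.\<close>

lemma finite_maximalideals:
  assumes a: "a \<in> carrier R" "a \<noteq> \<zero>" shows "finite {P. maximalideal P R \<and> a \<in> P}"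
proof -
  let ?S = "{P. maximalideal P R \<and> a \<in> P}"
  define F where "F = {Idl (\<Union>P \<in> T. away_multiples a P) | T. T \<subseteq> ?S \<and> finite T}"
  have Fi: "ideal I R" if "I \<in> F" for I
    using that unfolding F_def away_multiples_def by (auto intro!: genideal_ideal)
  have "F \<noteq> {}" unfolding F_def by auto
  from maximal_ideal_in_family[OF this Fi]
  obtain M where M: "M \<in> F" "\<forall>I \<in> F. M \<subseteq> I \<longrightarrow> I = M" by (rule bexE)
  then obtain T where T: "M = Idl (\<Union>P \<in> T. away_multiples a P)" "T \<subseteq> ?S" "finite T"
    unfolding F_def by blast
  have c: "(\<Union>P \<in> T'. away_multiples a P) \<subseteq> carrier R" for T' unfolding away_multiples_def by auto
  have "?S \<subseteq> T"
  proof
    fix P assume P: "P \<in> ?S"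
    show "P \<in> T"
    proof (rule ccontr)
      assume "P \<notin> T"
      have "Idl (\<Union>Q \<in> insert P T. away_multiples a Q) \<in> F"
        unfolding F_def using T(2,3) P by (intro CollectI exI[of _ "insert P T"]) simp
      moreover have "M \<subseteq> Idl (\<Union>Q \<in> insert P T. away_multiples a Q)"
        unfolding T(1) using genideal_self[OF c, of "insert P T"]
        by (intro genideal_minimal genideal_ideal c) blast
      ultimately have "Idl (\<Union>Q \<in> insert P T. away_multiples a Q) = M" using M by blast
      hence "away_multiples a P \<subseteq> M" using genideal_self[OF c, of "insert P T"] by blast
      moreover have "M \<subseteq> P"
        unfolding T(1)
      proof (rule genideal_minimal)
        show iP: "ideal P R" using P maximalideal.axioms(1) by blast
        show "(\<Union>Q \<in> T. away_multiples a Q) \<subseteq> P"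
        proof
          fix y assume "y \<in> (\<Union>Q \<in> T. away_multiples a Q)"
          then obtain Q where Q: "Q \<in> T" "y \<in> away_multiples a Q" by blast
          hence "y \<in> local_multiples a P"
            using \<open>P \<notin> T\<close> P unfolding away_multiples_def by auto
          then obtain s c where s: "y \<in> carrier R" "s \<in> carrier R - P" "c \<in> carrier R" "s \<otimes> y = a \<otimes> c"
            unfolding local_multiples_def by auto
          interpret P: primeideal P R using P maximalideal_prime by blast
          have "a \<otimes> c \<in> P" using P s P.I_r_closed by auto
          thus "y \<in> P" using s P.I_prime[of s y] by auto
        qed
      qed
      ultimately show False using away_multiples_not_subset[of P a] P a by blast
    qed
  qed
  thus ?thesis using T finite_subset by blast
qed

end

section \<open>Extension of scalars to a localization\<close>

locale fractions_at = dedekind_domain R K \<iota>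
  for R :: "('r, 'x) ring_scheme" and K :: "('k, 'y) ring_scheme" and \<iota> :: "'r \<Rightarrow> 'k" +
  fixes P :: "'r set"
  assumes prime_P: "primeideal P R"
begin

abbreviation "T \<equiv> local_ring R K \<iota> P"
abbreviation "q s \<equiv> inv\<^bsub>K\<^esub> (\<iota> s)"

sublocale P: primeideal P R by (rule prime_P)

lemma iota_simps [simp]:
  "r \<in> carrier R \<Longrightarrow> \<iota> r \<in> carrier K"
  "\<lbrakk> r \<in> carrier R; s \<in> carrier R \<rbrakk> \<Longrightarrow> \<iota> (r \<otimes>\<^bsub>R\<^esub> s) = \<iota> r \<otimes>\<^bsub>K\<^esub> \<iota> s"
  "\<lbrakk> r \<in> carrier R; s \<in> carrier R \<rbrakk> \<Longrightarrow> \<iota> (r \<oplus>\<^bsub>R\<^esub> s) = \<iota> r \<oplus>\<^bsub>K\<^esub> \<iota> s"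
  "\<iota> \<one>\<^bsub>R\<^esub> = \<one>\<^bsub>K\<^esub>" "\<iota> \<zero>\<^bsub>R\<^esub> = \<zero>\<^bsub>K\<^esub>"
  using ring_hom_memE[OF emb_hom] ring_hom_zero[OF emb_hom R.ring_axioms K.ring_axioms] by auto

lemma iota_eq: "\<lbrakk> r \<in> carrier R; s \<in> carrier R; \<iota> r = \<iota> s \<rbrakk> \<Longrightarrow> r = s"
  using emb_inj by (auto dest: inj_onD)

lemma iota_Units: "\<lbrakk> r \<in> carrier R; r \<noteq> \<zero>\<^bsub>R\<^esub> \<rbrakk> \<Longrightarrow> \<iota> r \<in> Units K"
  using iota_eq[of r "\<zero>\<^bsub>R\<^esub>"] K.field_Units by auto

lemma W_carrier: "s \<in> carrier R - P \<Longrightarrow> s \<in> carrier R" "s \<in> carrier R - P \<Longrightarrow> s \<noteq> \<zero>\<^bsub>R\<^esub>"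
  using P.zero_closed by auto

lemma W_one: "\<one>\<^bsub>R\<^esub> \<in> carrier R - P"
  using P.I_notcarr P.one_imp_carrier by auto

lemma W_mult: "\<lbrakk> s \<in> carrier R - P; t \<in> carrier R - P \<rbrakk> \<Longrightarrow> s \<otimes>\<^bsub>R\<^esub> t \<in> carrier R - P"
  using P.I_prime by auto

lemma q_simps:
  assumes "s \<in> carrier R - P"
  shows "q s \<in> carrier K" "\<iota> s \<otimes>\<^bsub>K\<^esub> q s = \<one>\<^bsub>K\<^esub>" "q s \<otimes>\<^bsub>K\<^esub> \<iota> s = \<one>\<^bsub>K\<^esub>"
  using iota_Units[OF W_carrier[OF assms]] by auto

lemma q_mult:
  assumes "s \<in> carrier R - P" "t \<in> carrier R - P"
  shows "q (s \<otimes>\<^bsub>R\<^esub> t) = q s \<otimes>\<^bsub>K\<^esub> q t"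
  using K.Units_inv_mult[OF iota_Units[OF W_carrier[OF assms(1)]] iota_Units[OF W_carrier[OF assms(2)]]]
    assms q_simps K.m_comm by auto

lemma T_simps [simp]:
  "s \<otimes>\<^bsub>T\<^esub> t = s \<otimes>\<^bsub>K\<^esub> t" "s \<oplus>\<^bsub>T\<^esub> t = s \<oplus>\<^bsub>K\<^esub> t" "\<one>\<^bsub>T\<^esub> = \<one>\<^bsub>K\<^esub>"
  unfolding local_ring_def by simp_all

lemma T_carrier: "carrier T = {\<iota> a \<otimes>\<^bsub>K\<^esub> q s | a s. a \<in> carrier R \<and> s \<in> carrier R - P}"
  unfolding local_ring_def by simp

lemma T_sub_K: "x \<in> carrier T \<Longrightarrow> x \<in> carrier K"
  unfolding T_carrier using q_simps by auto

lemma frac_T: "\<lbrakk> a \<in> carrier R; s \<in> carrier R - P \<rbrakk> \<Longrightarrow> \<iota> a \<otimes>\<^bsub>K\<^esub> q s \<in> carrier T"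
  unfolding T_carrier by auto

lemma q_T: "s \<in> carrier R - P \<Longrightarrow> q s \<in> carrier T"
  using frac_T[of "\<one>\<^bsub>R\<^esub>" s] q_simps by simp

lemma frac_mult:
  assumes "a \<in> carrier R" "b \<in> carrier R" "s \<in> carrier R - P" "t \<in> carrier R - P"
  shows "(\<iota> a \<otimes>\<^bsub>K\<^esub> q s) \<otimes>\<^bsub>K\<^esub> (\<iota> b \<otimes>\<^bsub>K\<^esub> q t) = \<iota> (a \<otimes>\<^bsub>R\<^esub> b) \<otimes>\<^bsub>K\<^esub> q (s \<otimes>\<^bsub>R\<^esub> t)"
  using assms q_simps unfolding q_mult[OF assms(3,4)] by (simp add: K.m_ac)

lemma frac_expand:
  assumes "a \<in> carrier R" "s \<in> carrier R - P" "t \<in> carrier R - P"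
  shows "\<iota> (t \<otimes>\<^bsub>R\<^esub> a) \<otimes>\<^bsub>K\<^esub> q (s \<otimes>\<^bsub>R\<^esub> t) = \<iota> a \<otimes>\<^bsub>K\<^esub> q s"
proof -
  have c: "\<iota> a \<in> carrier K" "q s \<in> carrier K" "q t \<in> carrier K" "\<iota> t \<in> carrier K" using assms q_simps by auto
  have "\<iota> (t \<otimes>\<^bsub>R\<^esub> a) \<otimes>\<^bsub>K\<^esub> q (s \<otimes>\<^bsub>R\<^esub> t) = (\<iota> t \<otimes>\<^bsub>K\<^esub> q t) \<otimes>\<^bsub>K\<^esub> (\<iota> a \<otimes>\<^bsub>K\<^esub> q s)"
    unfolding q_mult[OF assms(2,3)] using assms c by (simp add: K.m_ac)
  thus ?thesis using assms c q_simps by simp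
qed

lemma T_mult_closed:
  assumes "s \<in> carrier T" "t \<in> carrier T" shows "s \<otimes>\<^bsub>K\<^esub> t \<in> carrier T"
proof -
  obtain a u b v where *: "a \<in> carrier R" "u \<in> carrier R - P" "b \<in> carrier R" "v \<in> carrier R - P"
    "s = \<iota> a \<otimes>\<^bsub>K\<^esub> q u" "t = \<iota> b \<otimes>\<^bsub>K\<^esub> q v" using assms unfolding T_carrier by blast
  show ?thesis unfolding *(5,6) frac_mult[OF *(1,3,2,4)]
    by (rule frac_T) (use * W_mult in auto)
qed

lemma T_add_closed:
  assumes "s \<in> carrier T" "t \<in> carrier T" shows "s \<oplus>\<^bsub>K\<^esub> t \<in> carrier T"
proof -
  obtain a u b v where *: "a \<in> carrier R" "u \<in> carrier R - P" "b \<in> carrier R" "v \<in> carrier R - P"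
    "s = \<iota> a \<otimes>\<^bsub>K\<^esub> q u" "t = \<iota> b \<otimes>\<^bsub>K\<^esub> q v" using assms unfolding T_carrier by blast
  have "s = \<iota> (v \<otimes>\<^bsub>R\<^esub> a) \<otimes>\<^bsub>K\<^esub> q (u \<otimes>\<^bsub>R\<^esub> v)" "t = \<iota> (u \<otimes>\<^bsub>R\<^esub> b) \<otimes>\<^bsub>K\<^esub> q (u \<otimes>\<^bsub>R\<^esub> v)"
    using frac_expand[of a u v] frac_expand[of b v u] * R.m_comm[of u v] by auto
  hence "s \<oplus>\<^bsub>K\<^esub> t = \<iota> (v \<otimes>\<^bsub>R\<^esub> a \<oplus>\<^bsub>R\<^esub> u \<otimes>\<^bsub>R\<^esub> b) \<otimes>\<^bsub>K\<^esub> q (u \<otimes>\<^bsub>R\<^esub> v)"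
    using * q_simps(1)[OF W_mult[OF *(2,4)]] by (simp add: K.l_distr)
  thus ?thesis using frac_T[of "v \<otimes>\<^bsub>R\<^esub> a \<oplus>\<^bsub>R\<^esub> u \<otimes>\<^bsub>R\<^esub> b" "u \<otimes>\<^bsub>R\<^esub> v"] * W_mult by simp
qed

lemma iota_T: "a \<in> carrier R \<Longrightarrow> \<iota> a \<in> carrier T"
  using frac_T[OF _ W_one] by simp

lemma local_ring_zero: "P = {\<zero>\<^bsub>R\<^esub>} \<Longrightarrow> T = K"
proof -
  assume P: "P = {\<zero>\<^bsub>R\<^esub>}"
  have "carrier T = carrier K"
  proof
    show "carrier T \<subseteq> carrier K" using T_sub_K by blast
    show "carrier K \<subseteq> carrier T"
    proof
      fix x assume "x \<in> carrier K"
      from fractions[OF this] show "x \<in> carrier T" unfolding T_carrier using P by auto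
    qed
  qed
  moreover have "T = K\<lparr>carrier := carrier T\<rparr>" unfolding local_ring_def by simp
  ultimately show "T = K" by simp
qed

end

section \<open>The tensor product as a module of fractions\<close>

locale tensor_module = fractions_at R K \<iota> P + M: module R M
  for R :: "('r, 'x) ring_scheme" and K :: "('k, 'y) ring_scheme" and \<iota> :: "'r \<Rightarrow> 'k" and P
    and M :: "('r, 'm) module"
begin

abbreviation "N \<equiv> tensor_kernel R T \<iota> M"
abbreviation "cls \<equiv> tensor_class R T \<iota> M"
abbreviation "rels \<equiv> tensor_relations R T \<iota> M"

lemma rels_cases [consumes 1]:
  assumes "u \<in> rels"
  obtains (add_left) s s' x where "s \<in> carrier T" "s' \<in> carrier T" "x \<in> carrier M"
      "u = frag_of (s \<oplus>\<^bsub>K\<^esub> s', x) - frag_of (s, x) - frag_of (s', x)"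
    | (add_right) s x y where "s \<in> carrier T" "x \<in> carrier M" "y \<in> carrier M"
      "u = frag_of (s, x \<oplus>\<^bsub>M\<^esub> y) - frag_of (s, x) - frag_of (s, y)"
    | (balance) s r x where "s \<in> carrier T" "r \<in> carrier R" "x \<in> carrier M"
      "u = frag_of (s \<otimes>\<^bsub>K\<^esub> \<iota> r, x) - frag_of (s, r \<odot>\<^bsub>M\<^esub> x)"
  using assms unfolding tensor_relations_def by auto

lemma keys_diff_subset:
  "\<lbrakk> Poly_Mapping.keys a \<subseteq> A; Poly_Mapping.keys b \<subseteq> A \<rbrakk> \<Longrightarrow> Poly_Mapping.keys (a - b :: 'z \<Rightarrow>\<^sub>0 int) \<subseteq> A"
  using keys_diff[of a b] by blast

lemma rels_keys:
  assumes "u \<in> rels" shows "Poly_Mapping.keys u \<subseteq> carrier T \<times> carrier M"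
  using assms
proof (cases rule: rels_cases)
  case (add_left s s' x)
  show ?thesis unfolding add_left(4)
    by (intro keys_diff_subset) (use add_left T_add_closed in auto)
next
  case (add_right s x y)
  show ?thesis unfolding add_right(4)
    by (intro keys_diff_subset) (use add_right in auto)
next
  case (balance s r x)
  show ?thesis unfolding balance(4)
    by (intro keys_diff_subset) (use balance T_mult_closed iota_T in auto)
qed

lemma N_induct [consumes 1, case_names zero rel neg add]:
  assumes "u \<in> N" "Q 0" "\<And>u. u \<in> rels \<Longrightarrow> Q u" "\<And>u. u \<in> rels \<Longrightarrow> Q (- u)"
    and "\<And>u v. u \<in> N \<Longrightarrow> v \<in> N \<Longrightarrow> Q u \<Longrightarrow> Q v \<Longrightarrow> Q (u + v)"
  shows "Q u"
  using assms(1) unfolding tensor_kernel_def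
proof (induction rule: generate.induct)
  case (inv h)
  thus ?case using assms(4) rels_keys[OF inv] by (simp add: tensor_free_def)
qed (use assms in \<open>auto simp: tensor_free_def tensor_kernel_def\<close>)

lemma N_closed:
  shows N_zero: "0 \<in> N" and N_add: "u \<in> N \<Longrightarrow> v \<in> N \<Longrightarrow> u + v \<in> N"
    and N_rel: "u \<in> rels \<Longrightarrow> u \<in> N" and N_uminus: "u \<in> N \<Longrightarrow> - u \<in> N"
proof -
  show 0: "0 \<in> N" using generate.one[of "tensor_free T M"] unfolding tensor_kernel_def tensor_free_def by simp
  show a: "u + v \<in> N" if "u \<in> N" "v \<in> N" for u v
    using generate.eng[of u "tensor_free T M" rels v] that unfolding tensor_kernel_def tensor_free_def by simp
  show r: "u \<in> rels \<Longrightarrow> u \<in> N" for u unfolding tensor_kernel_def by (rule generate.incl)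
  have nr: "- u \<in> N" if "u \<in> rels" for u
    using generate.inv[OF that, of "tensor_free T M"] rels_keys[OF that] unfolding tensor_kernel_def tensor_free_def by simp
  show "- u \<in> N" if "u \<in> N" for u
    using that
  proof (induction rule: N_induct)
    case (add u v)
    thus ?case using a[of "- u" "- v"] by simp
  qed (use 0 r nr in auto)
qed

lemma N_diff: "u \<in> N \<Longrightarrow> v \<in> N \<Longrightarrow> u - v \<in> N"
  using N_add[OF _ N_uminus] by simp

lemma N_keys: "u \<in> N \<Longrightarrow> Poly_Mapping.keys u \<subseteq> carrier T \<times> carrier M"
proof (induction rule: N_induct)
  case (add u v)
  thus ?case using keys_add[of u v] by blast
qed (use rels_keys in auto)

lemma cls_alt: "cls u = (\<lambda>k. k + u) ` N"
  unfolding tensor_class_def r_coset_def tensor_free_def by auto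

lemma cls_mem: "v \<in> cls u \<longleftrightarrow> v - u \<in> N"
  unfolding cls_alt by (auto simp: image_iff intro!: bexI[of _ "v - u"])

lemma cls_self: "u \<in> cls u"
  by (simp add: cls_mem N_zero)

lemma cls_eq: "cls u = cls v \<longleftrightarrow> u - v \<in> N"
proof
  assume "cls u = cls v"
  thus "u - v \<in> N" using cls_self[of u] by (simp add: cls_mem)
next
  assume uv: "u - v \<in> N"
  have "w - u \<in> N \<longleftrightarrow> w - v \<in> N" for w
    using N_add[OF _ uv, of "w - u"] N_diff[OF _ uv, of "w - v"] by auto
  thus "cls u = cls v" by (auto simp: cls_mem)
qed

lemma cls_add_rel:
  assumes "s \<in> carrier T" "t \<in> carrier T" "x \<in> carrier M"
  shows "cls (frag_of (s \<oplus>\<^bsub>K\<^esub> t, x)) = cls (frag_of (s, x) + frag_of (t, x))"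
  unfolding cls_eq using assms N_rel[of "frag_of (s \<oplus>\<^bsub>K\<^esub> t, x) - frag_of (s, x) - frag_of (t, x)"]
  unfolding tensor_relations_def by (auto simp: algebra_simps)

lemma rel1: "\<lbrakk> s \<in> carrier T; t \<in> carrier T; x \<in> carrier M \<rbrakk> \<Longrightarrow>
    frag_of (s \<oplus>\<^bsub>K\<^esub> t, x) - frag_of (s, x) - frag_of (t, x) \<in> N"
  by (rule N_rel) (auto simp: tensor_relations_def)

lemma rel2': "\<lbrakk> s \<in> carrier T; x \<in> carrier M; y \<in> carrier M \<rbrakk> \<Longrightarrow>
    frag_of (s, x \<oplus>\<^bsub>M\<^esub> y) - frag_of (s, x) - frag_of (s, y) \<in> N"
  by (rule N_rel) (auto simp: tensor_relations_def)

lemma rel2: "\<lbrakk> s \<in> carrier T; x \<in> carrier M; y \<in> carrier M \<rbrakk> \<Longrightarrow>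
    frag_of (s, x \<oplus>\<^bsub>M\<^esub> y) - (frag_of (s, x) + frag_of (s, y)) \<in> N"
  using N_rel[of "frag_of (s, x \<oplus>\<^bsub>M\<^esub> y) - frag_of (s, x) - frag_of (s, y)"]
  unfolding tensor_relations_def by (auto simp: algebra_simps)

lemma rel3: "\<lbrakk> s \<in> carrier T; r \<in> carrier R; x \<in> carrier M \<rbrakk> \<Longrightarrow>
    frag_of (s \<otimes>\<^bsub>K\<^esub> \<iota> r, x) - frag_of (s, r \<odot>\<^bsub>M\<^esub> x) \<in> N"
  by (rule N_rel) (auto simp: tensor_relations_def)

lemma frag_zero: "s \<in> carrier T \<Longrightarrow> frag_of (s, \<zero>\<^bsub>M\<^esub>) \<in> N"
  using N_uminus[OF rel2[of s "\<zero>\<^bsub>M\<^esub>" "\<zero>\<^bsub>M\<^esub>"]] by simp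

lemma frag_minus: "\<lbrakk> s \<in> carrier T; x \<in> carrier M \<rbrakk> \<Longrightarrow> frag_of (s, \<ominus>\<^bsub>M\<^esub> x) + frag_of (s, x) \<in> N"
  using N_diff[OF frag_zero[of s] rel2[of s "\<ominus>\<^bsub>M\<^esub> x" x]] by (simp add: M.l_neg add.commute)

text \<open>The fraction with numerator \<open>x\<close> and denominator \<open>s\<close>.\<close>

definition frc :: "'r \<Rightarrow> 'm \<Rightarrow> ('k \<times> 'm \<Rightarrow>\<^sub>0 int) set" where
  "frc s x = cls (frag_of (q s, x))"

lemma expand_N:
  assumes "s \<in> carrier R - P" "t \<in> carrier R - P" "x \<in> carrier M"
  shows "frag_of (q s, x) - frag_of (q (s \<otimes>\<^bsub>R\<^esub> t), t \<odot>\<^bsub>M\<^esub> x) \<in> N"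
proof -
  have "q (s \<otimes>\<^bsub>R\<^esub> t) \<otimes>\<^bsub>K\<^esub> \<iota> t = q s"
    unfolding q_mult[OF assms(1,2)] using assms q_simps by (simp add: K.m_assoc)
  thus ?thesis using rel3[OF q_T[OF W_mult[OF assms(1,2)]] W_carrier(1)[OF assms(2)] assms(3)] by simp
qed

lemma frc_expand:
  "\<lbrakk> s \<in> carrier R - P; t \<in> carrier R - P; x \<in> carrier M \<rbrakk> \<Longrightarrow> frc s x = frc (s \<otimes>\<^bsub>R\<^esub> t) (t \<odot>\<^bsub>M\<^esub> x)"
  unfolding frc_def cls_eq by (rule expand_N)

text \<open>Common denominators. The step concerns \<open>u - v\<close> because the induction over
  the free abelian group builds its elements by subtraction.\<close>

lemma frc_exists:
  assumes "Poly_Mapping.keys u \<subseteq> carrier T \<times> carrier M"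
  shows "\<exists>s \<in> carrier R - P. \<exists>x \<in> carrier M. cls u = frc s x"
  using assms
proof (rule free_Abelian_group_induct)
  show "\<exists>s \<in> carrier R - P. \<exists>x \<in> carrier M. cls 0 = frc s x" unfolding frc_def cls_eq using W_one N_uminus[OF frag_zero[OF q_T[OF W_one]]]
    by (intro bexI[of _ "\<one>\<^bsub>R\<^esub>"] bexI[of _ "\<zero>\<^bsub>M\<^esub>"]) auto
next
  fix u v assume "\<exists>s \<in> carrier R - P. \<exists>x \<in> carrier M. cls u = frc s x"
    "\<exists>s \<in> carrier R - P. \<exists>x \<in> carrier M. cls v = frc s x"
  then obtain s x t y where sx: "s \<in> carrier R - P" "x \<in> carrier M" "cls u = frc s x"
    and ty: "t \<in> carrier R - P" "y \<in> carrier M" "cls v = frc t y" by blast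
  let ?d = "q (s \<otimes>\<^bsub>R\<^esub> t)" and ?x = "t \<odot>\<^bsub>M\<^esub> x" and ?y = "s \<odot>\<^bsub>M\<^esub> y"
  have d: "?d \<in> carrier T" by (rule q_T[OF W_mult[OF sx(1) ty(1)]])
  have c: "?x \<in> carrier M" "?y \<in> carrier M" using sx ty by auto
  have 1: "u - frag_of (?d, ?x) \<in> N"
    using sx frc_expand[OF sx(1) ty(1) sx(2)] unfolding frc_def cls_eq[symmetric] by simp
  have 2: "v - frag_of (?d, ?y) \<in> N"
    using ty frc_expand[OF ty(1) sx(1) ty(2)] sx R.m_comm[of s t] unfolding frc_def cls_eq[symmetric] by simp
  have 3: "frag_of (?d, ?x \<oplus>\<^bsub>M\<^esub> \<ominus>\<^bsub>M\<^esub> ?y) - (frag_of (?d, ?x) + frag_of (?d, \<ominus>\<^bsub>M\<^esub> ?y)) \<in> N"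
    using rel2[OF d] c by simp
  have 4: "frag_of (?d, \<ominus>\<^bsub>M\<^esub> ?y) + frag_of (?d, ?y) \<in> N" using frag_minus[OF d] c by simp
  have "(u - frag_of (?d, ?x)) - (v - frag_of (?d, ?y))
      - (frag_of (?d, ?x \<oplus>\<^bsub>M\<^esub> \<ominus>\<^bsub>M\<^esub> ?y) - (frag_of (?d, ?x) + frag_of (?d, \<ominus>\<^bsub>M\<^esub> ?y)))
      - (frag_of (?d, \<ominus>\<^bsub>M\<^esub> ?y) + frag_of (?d, ?y)) \<in> N"
    by (rule N_diff[OF N_diff[OF N_diff[OF 1 2] 3] 4])
  hence "(u - v) - frag_of (?d, ?x \<oplus>\<^bsub>M\<^esub> \<ominus>\<^bsub>M\<^esub> ?y) \<in> N" by (simp add: algebra_simps)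
  thus "\<exists>s \<in> carrier R - P. \<exists>x \<in> carrier M. cls (u - v) = frc s x"
    unfolding frc_def cls_eq using sx ty c W_mult
    by (intro bexI[of _ "s \<otimes>\<^bsub>R\<^esub> t"] bexI[of _ "?x \<oplus>\<^bsub>M\<^esub> \<ominus>\<^bsub>M\<^esub> ?y"]) auto
next
  fix a assume "a \<in> carrier T \<times> carrier M"
  then obtain b s x where *: "b \<in> carrier R" "s \<in> carrier R - P" "x \<in> carrier M" "a = (\<iota> b \<otimes>\<^bsub>K\<^esub> q s, x)"
    unfolding T_carrier by auto
  have "\<iota> b \<otimes>\<^bsub>K\<^esub> q s = q s \<otimes>\<^bsub>K\<^esub> \<iota> b" using * q_simps by (simp add: K.m_comm)
  hence "cls (frag_of a) = frc s (b \<odot>\<^bsub>M\<^esub> x)"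
    unfolding frc_def cls_eq using rel3[OF q_T[OF *(2)] *(1,3)] * by simp
  thus "\<exists>s \<in> carrier R - P. \<exists>x \<in> carrier M. cls (frag_of a) = frc s x" using * by blast
qed

text \<open>Equality of fractions is detected by the partial maps \<open>s \<otimes> x \<mapsto> (ts) x\<close>, defined where
  \<open>t\<close> clears the denominator \<open>s\<close>.\<close>

definition clear :: "'r \<Rightarrow> 'k \<times> 'm \<Rightarrow> 'm" where
  "clear t p = (if \<exists>r \<in> carrier R. \<iota> t \<otimes>\<^bsub>K\<^esub> fst p = \<iota> r \<and> snd p \<in> carrier M
     then (THE r. r \<in> carrier R \<and> \<iota> t \<otimes>\<^bsub>K\<^esub> fst p = \<iota> r) \<odot>\<^bsub>M\<^esub> snd p else \<zero>\<^bsub>M\<^esub>)"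

lemma clear_eq:
  assumes "r \<in> carrier R" "\<iota> t \<otimes>\<^bsub>K\<^esub> s = \<iota> r" "x \<in> carrier M"
  shows "clear t (s, x) = r \<odot>\<^bsub>M\<^esub> x"
proof -
  have "(THE r. r \<in> carrier R \<and> \<iota> t \<otimes>\<^bsub>K\<^esub> s = \<iota> r) = r"
    using assms by (intro the_equality) (auto intro: iota_eq)
  thus ?thesis unfolding clear_def using assms by auto
qed

lemma clear_closed: "clear t p \<in> carrier M"
proof (cases "\<exists>r \<in> carrier R. \<iota> t \<otimes>\<^bsub>K\<^esub> fst p = \<iota> r \<and> snd p \<in> carrier M")
  case True
  then obtain r where "r \<in> carrier R" "\<iota> t \<otimes>\<^bsub>K\<^esub> fst p = \<iota> r" "snd p \<in> carrier M" by blast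
  thus ?thesis using clear_eq[of r t "fst p" "snd p"] by simp
next
  case False
  thus ?thesis unfolding clear_def by (subst if_not_P) auto
qed

definition ext :: "'r \<Rightarrow> ('k \<times> 'm \<Rightarrow>\<^sub>0 int) \<Rightarrow> 'm" where
  "ext t = (SOME h. h \<in> hom (tensor_free T M) (add_monoid M) \<and>
     (\<forall>p \<in> carrier T \<times> carrier M. h (frag_of p) = clear t p))"

lemma ext_hom: "ext t \<in> hom (tensor_free T M) (add_monoid M)"
  and ext_frag: "p \<in> carrier T \<times> carrier M \<Longrightarrow> ext t (frag_of p) = clear t p"
proof -
  have "\<exists>h. h \<in> hom (tensor_free T M) (add_monoid M) \<and> (\<forall>p \<in> carrier T \<times> carrier M. h (frag_of p) = clear t p)"
    unfolding tensor_free_def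
    by (rule comm_group.free_Abelian_group_universal[OF M.a_comm_group, of "clear t" "carrier T \<times> carrier M"])
      (auto simp: clear_closed)
  from someI_ex[OF this]
  show "ext t \<in> hom (tensor_free T M) (add_monoid M)"
    "p \<in> carrier T \<times> carrier M \<Longrightarrow> ext t (frag_of p) = clear t p"
    unfolding ext_def[symmetric] by auto
qed

lemma ext_closed: "Poly_Mapping.keys u \<subseteq> carrier T \<times> carrier M \<Longrightarrow> ext t u \<in> carrier M"
  using ext_hom[of t] unfolding hom_def tensor_free_def by auto

lemma ext_add: "\<lbrakk> Poly_Mapping.keys u \<subseteq> carrier T \<times> carrier M; Poly_Mapping.keys v \<subseteq> carrier T \<times> carrier M \<rbrakk>
    \<Longrightarrow> ext t (u + v) = ext t u \<oplus>\<^bsub>M\<^esub> ext t v"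
  using ext_hom[of t] unfolding hom_def tensor_free_def by auto

lemma ext_zero: "ext t 0 = \<zero>\<^bsub>M\<^esub>"
proof -
  have "ext t 0 \<oplus>\<^bsub>M\<^esub> ext t 0 = ext t 0" using ext_add[of 0 0 t] by simp
  thus ?thesis using ext_closed[of 0 t] M.add.l_cancel_one' by (metis M.r_zero empty_subsetI keys_zero M.add.l_cancel M.zero_closed)
qed

lemma ext_diff:
  assumes "Poly_Mapping.keys u \<subseteq> carrier T \<times> carrier M" "Poly_Mapping.keys v \<subseteq> carrier T \<times> carrier M"
  shows "ext t (u - v) = ext t u \<ominus>\<^bsub>M\<^esub> ext t v"
proof -
  have k: "Poly_Mapping.keys (u - v) \<subseteq> carrier T \<times> carrier M" using keys_diff[of u v] assms by blast
  have "ext t u = ext t (u - v) \<oplus>\<^bsub>M\<^esub> ext t v" using ext_add[OF k assms(2)] by simp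
  thus ?thesis using ext_closed[OF k] ext_closed[OF assms(2)]
    by (metis M.minus_eq M.add.inv_solve_right M.add.m_closed)
qed

text \<open>No single \<open>ext t\<close> vanishes on all relations, but a given relation involves
  few denominators and is killed as soon as \<open>t\<close> clears them. The multiples
  \<open>c t\<close> are included so that the multipliers of several relations can be replaced by
  their product in \<open>ext_N\<close>.\<close>

lemma ext_rel:
  assumes "u \<in> rels" shows "\<exists>t \<in> carrier R - P. \<forall>c \<in> carrier R. ext (c \<otimes>\<^bsub>R\<^esub> t) u = \<zero>\<^bsub>M\<^esub>"
proof -
  have clr: "\<exists>a \<in> carrier R. \<exists>t \<in> carrier R - P. \<forall>c \<in> carrier R. \<iota> (c \<otimes>\<^bsub>R\<^esub> t) \<otimes>\<^bsub>K\<^esub> s = \<iota> (c \<otimes>\<^bsub>R\<^esub> a)" if sT: "s \<in> carrier T" for s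
  proof -
    obtain a t where at: "a \<in> carrier R" "t \<in> carrier R - P" "s = \<iota> a \<otimes>\<^bsub>K\<^esub> q t" using sT unfolding T_carrier by blast
    have "\<iota> (c \<otimes>\<^bsub>R\<^esub> t) \<otimes>\<^bsub>K\<^esub> s = \<iota> (c \<otimes>\<^bsub>R\<^esub> a)" if c: "c \<in> carrier R" for c
    proof -
      have "\<iota> (c \<otimes>\<^bsub>R\<^esub> t) \<otimes>\<^bsub>K\<^esub> s = (\<iota> t \<otimes>\<^bsub>K\<^esub> q t) \<otimes>\<^bsub>K\<^esub> (\<iota> c \<otimes>\<^bsub>K\<^esub> \<iota> a)"
        using at c q_simps(1)[OF at(2)] by (simp add: K.m_ac)
      thus ?thesis using at c q_simps[OF at(2)] by simp
    qed
    thus ?thesis using at by blast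
  qed
  note dk = keys_diff_subset
  from assms show ?thesis
  proof (cases rule: rels_cases)
    case 1: (add_left s s' x)
    obtain a t where at: "a \<in> carrier R" "t \<in> carrier R - P"
      "\<And>c. c \<in> carrier R \<Longrightarrow> \<iota> (c \<otimes>\<^bsub>R\<^esub> t) \<otimes>\<^bsub>K\<^esub> s = \<iota> (c \<otimes>\<^bsub>R\<^esub> a)" using clr[OF 1(1)] by blast
    obtain a' t' where at': "a' \<in> carrier R" "t' \<in> carrier R - P"
      "\<And>c. c \<in> carrier R \<Longrightarrow> \<iota> (c \<otimes>\<^bsub>R\<^esub> t') \<otimes>\<^bsub>K\<^esub> s' = \<iota> (c \<otimes>\<^bsub>R\<^esub> a')" using clr[OF 1(2)] by blast
    have "ext (c \<otimes>\<^bsub>R\<^esub> (t \<otimes>\<^bsub>R\<^esub> t')) u = \<zero>\<^bsub>M\<^esub>" if c: "c \<in> carrier R" for c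
    proof -
      let ?c = "c \<otimes>\<^bsub>R\<^esub> (t \<otimes>\<^bsub>R\<^esub> t')" and ?r = "(c \<otimes>\<^bsub>R\<^esub> t') \<otimes>\<^bsub>R\<^esub> a" and ?r' = "(c \<otimes>\<^bsub>R\<^esub> t) \<otimes>\<^bsub>R\<^esub> a'"
      have tc: "t \<in> carrier R" "t' \<in> carrier R" using at at' by auto
      have "?c = (c \<otimes>\<^bsub>R\<^esub> t') \<otimes>\<^bsub>R\<^esub> t" "?c = (c \<otimes>\<^bsub>R\<^esub> t) \<otimes>\<^bsub>R\<^esub> t'" using tc c by (simp_all add: R.m_ac)
      hence e: "\<iota> ?c \<otimes>\<^bsub>K\<^esub> s = \<iota> ?r" "\<iota> ?c \<otimes>\<^bsub>K\<^esub> s' = \<iota> ?r'" "?r \<in> carrier R" "?r' \<in> carrier R" "?c \<in> carrier R"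
        using at(3)[of "c \<otimes>\<^bsub>R\<^esub> t'"] at'(3)[of "c \<otimes>\<^bsub>R\<^esub> t"] at(1) at'(1) tc c by auto
      have e3: "\<iota> ?c \<otimes>\<^bsub>K\<^esub> (s \<oplus>\<^bsub>K\<^esub> s') = \<iota> (?r \<oplus>\<^bsub>R\<^esub> ?r')"
        using e T_sub_K 1(1,2) by (simp add: K.r_distr del: iota_simps(2))
      have "ext ?c u = clear ?c (s \<oplus>\<^bsub>K\<^esub> s', x) \<ominus>\<^bsub>M\<^esub> clear ?c (s, x) \<ominus>\<^bsub>M\<^esub> clear ?c (s', x)"
        unfolding 1(4) using 1(1-3) T_add_closed[OF 1(1,2)] by (simp add: ext_diff ext_frag dk)
      also have "\<dots> = (?r \<oplus>\<^bsub>R\<^esub> ?r') \<odot>\<^bsub>M\<^esub> x \<ominus>\<^bsub>M\<^esub> ?r \<odot>\<^bsub>M\<^esub> x \<ominus>\<^bsub>M\<^esub> ?r' \<odot>\<^bsub>M\<^esub> x"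
        using clear_eq[OF e(3,1) 1(3)] clear_eq[OF e(4,2) 1(3)] clear_eq[OF _ e3 1(3)] e(3,4) by simp
      also have "\<dots> = (?r \<odot>\<^bsub>M\<^esub> x \<oplus>\<^bsub>M\<^esub> \<ominus>\<^bsub>M\<^esub> (?r \<odot>\<^bsub>M\<^esub> x)) \<oplus>\<^bsub>M\<^esub> (?r' \<odot>\<^bsub>M\<^esub> x \<oplus>\<^bsub>M\<^esub> \<ominus>\<^bsub>M\<^esub> (?r' \<odot>\<^bsub>M\<^esub> x))"
        using e 1(3) by (simp add: M.smult_l_distr M.minus_eq M.a_ac)
      also have "\<dots> = \<zero>\<^bsub>M\<^esub>" using e 1(3) by (simp add: M.r_neg)
      finally show ?thesis .
    qed
    thus ?thesis using W_mult[OF at(2) at'(2)] by blast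
  next
    case 2: (add_right s x y)
    obtain a t where at: "a \<in> carrier R" "t \<in> carrier R - P"
      "\<And>c. c \<in> carrier R \<Longrightarrow> \<iota> (c \<otimes>\<^bsub>R\<^esub> t) \<otimes>\<^bsub>K\<^esub> s = \<iota> (c \<otimes>\<^bsub>R\<^esub> a)" using clr[OF 2(1)] by blast
    have "ext (c \<otimes>\<^bsub>R\<^esub> t) u = \<zero>\<^bsub>M\<^esub>" if c: "c \<in> carrier R" for c
    proof -
      let ?c = "c \<otimes>\<^bsub>R\<^esub> t" and ?r = "c \<otimes>\<^bsub>R\<^esub> a"
      have e: "\<iota> ?c \<otimes>\<^bsub>K\<^esub> s = \<iota> ?r" "?r \<in> carrier R" using at c by auto
      have "ext ?c u = clear ?c (s, x \<oplus>\<^bsub>M\<^esub> y) \<ominus>\<^bsub>M\<^esub> clear ?c (s, x) \<ominus>\<^bsub>M\<^esub> clear ?c (s, y)"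
        unfolding 2(4) using 2(1-3) by (simp add: ext_diff ext_frag dk)
      also have "\<dots> = ?r \<odot>\<^bsub>M\<^esub> (x \<oplus>\<^bsub>M\<^esub> y) \<ominus>\<^bsub>M\<^esub> ?r \<odot>\<^bsub>M\<^esub> x \<ominus>\<^bsub>M\<^esub> ?r \<odot>\<^bsub>M\<^esub> y"
        using clear_eq[OF e(2,1)] 2 by simp
      also have "\<dots> = (?r \<odot>\<^bsub>M\<^esub> x \<oplus>\<^bsub>M\<^esub> \<ominus>\<^bsub>M\<^esub> (?r \<odot>\<^bsub>M\<^esub> x)) \<oplus>\<^bsub>M\<^esub> (?r \<odot>\<^bsub>M\<^esub> y \<oplus>\<^bsub>M\<^esub> \<ominus>\<^bsub>M\<^esub> (?r \<odot>\<^bsub>M\<^esub> y))"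
        using e 2 by (simp add: M.smult_r_distr M.minus_eq M.a_ac)
      also have "\<dots> = \<zero>\<^bsub>M\<^esub>" using e 2 by (simp add: M.r_neg)
      finally show ?thesis .
    qed
    thus ?thesis using at(2) by blast
  next
    case 3: (balance s r x)
    obtain a t where at: "a \<in> carrier R" "t \<in> carrier R - P"
      "\<And>c. c \<in> carrier R \<Longrightarrow> \<iota> (c \<otimes>\<^bsub>R\<^esub> t) \<otimes>\<^bsub>K\<^esub> s = \<iota> (c \<otimes>\<^bsub>R\<^esub> a)" using clr[OF 3(1)] by blast
    have "ext (c \<otimes>\<^bsub>R\<^esub> t) u = \<zero>\<^bsub>M\<^esub>" if c: "c \<in> carrier R" for c
    proof -
      let ?c = "c \<otimes>\<^bsub>R\<^esub> t" and ?r = "c \<otimes>\<^bsub>R\<^esub> a"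
      have e: "\<iota> ?c \<otimes>\<^bsub>K\<^esub> s = \<iota> ?r" "?r \<in> carrier R" "?c \<in> carrier R" using at c by auto
      have e2: "\<iota> ?c \<otimes>\<^bsub>K\<^esub> (s \<otimes>\<^bsub>K\<^esub> \<iota> r) = \<iota> (?r \<otimes>\<^bsub>R\<^esub> r)"
      proof -
        have "\<iota> ?c \<otimes>\<^bsub>K\<^esub> (s \<otimes>\<^bsub>K\<^esub> \<iota> r) = (\<iota> ?c \<otimes>\<^bsub>K\<^esub> s) \<otimes>\<^bsub>K\<^esub> \<iota> r"
          using e(3) T_sub_K[OF 3(1)] 3(2) by (simp add: K.m_assoc del: iota_simps(2))
        thus ?thesis unfolding e(1) using e(2) 3(2) by simp
      qed
      have "ext ?c u = clear ?c (s \<otimes>\<^bsub>K\<^esub> \<iota> r, x) \<ominus>\<^bsub>M\<^esub> clear ?c (s, r \<odot>\<^bsub>M\<^esub> x)"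
        unfolding 3(4) using 3(1-3) T_mult_closed iota_T by (simp add: ext_diff ext_frag)
      also have "\<dots> = (?r \<otimes>\<^bsub>R\<^esub> r) \<odot>\<^bsub>M\<^esub> x \<ominus>\<^bsub>M\<^esub> ?r \<odot>\<^bsub>M\<^esub> (r \<odot>\<^bsub>M\<^esub> x)"
        using clear_eq[OF e(2,1), of "r \<odot>\<^bsub>M\<^esub> x"] clear_eq[OF _ e2, of x] e(2) 3 by simp
      also have "\<dots> = \<zero>\<^bsub>M\<^esub>" using e 3 by (simp add: M.smult_assoc1 M.minus_eq M.r_neg)
      finally show ?thesis .
    qed
    thus ?thesis using at(2) by blast
  qed
qed

lemma ext_N: "u \<in> N \<Longrightarrow> \<exists>t \<in> carrier R - P. \<forall>c \<in> carrier R. ext (c \<otimes>\<^bsub>R\<^esub> t) u = \<zero>\<^bsub>M\<^esub>"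
proof (induction rule: N_induct)
  case zero
  show ?case using W_one ext_zero by blast
next
  case (rel u)
  thus ?case by (rule ext_rel)
next
  case (neg u)
  then obtain t where t: "t \<in> carrier R - P" "\<And>c. c \<in> carrier R \<Longrightarrow> ext (c \<otimes>\<^bsub>R\<^esub> t) u = \<zero>\<^bsub>M\<^esub>" using ext_rel by blast
  have "ext (c \<otimes>\<^bsub>R\<^esub> t) (- u) = \<zero>\<^bsub>M\<^esub>" if "c \<in> carrier R" for c
    using ext_diff[of 0 u "c \<otimes>\<^bsub>R\<^esub> t"] rels_keys[OF neg] t(2)[OF that] ext_zero by (simp add: M.minus_eq)
  thus ?case using t by blast
next
  case (add u v)
  then obtain t t' where t: "t \<in> carrier R - P" "\<And>c. c \<in> carrier R \<Longrightarrow> ext (c \<otimes>\<^bsub>R\<^esub> t) u = \<zero>\<^bsub>M\<^esub>"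
    and t': "t' \<in> carrier R - P" "\<And>c. c \<in> carrier R \<Longrightarrow> ext (c \<otimes>\<^bsub>R\<^esub> t') v = \<zero>\<^bsub>M\<^esub>" by blast
  have "ext (c \<otimes>\<^bsub>R\<^esub> (t \<otimes>\<^bsub>R\<^esub> t')) (u + v) = \<zero>\<^bsub>M\<^esub>" if c: "c \<in> carrier R" for c
  proof -
    have "c \<otimes>\<^bsub>R\<^esub> (t \<otimes>\<^bsub>R\<^esub> t') = (c \<otimes>\<^bsub>R\<^esub> t') \<otimes>\<^bsub>R\<^esub> t" "c \<otimes>\<^bsub>R\<^esub> (t \<otimes>\<^bsub>R\<^esub> t') = (c \<otimes>\<^bsub>R\<^esub> t) \<otimes>\<^bsub>R\<^esub> t'"
      using c t t' by (simp_all add: R.m_ac)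
    hence "ext (c \<otimes>\<^bsub>R\<^esub> (t \<otimes>\<^bsub>R\<^esub> t')) u = \<zero>\<^bsub>M\<^esub>" "ext (c \<otimes>\<^bsub>R\<^esub> (t \<otimes>\<^bsub>R\<^esub> t')) v = \<zero>\<^bsub>M\<^esub>"
      using t(2)[of "c \<otimes>\<^bsub>R\<^esub> t'"] t'(2)[of "c \<otimes>\<^bsub>R\<^esub> t"] c t(1) t'(1) by auto
    thus ?thesis using ext_add N_keys add by simp
  qed
  thus ?case using W_mult[OF t(1) t'(1)] by blast
qed

lemma frc_eqD:
  assumes "s \<in> carrier R - P" "x \<in> carrier M" "t \<in> carrier R - P" "y \<in> carrier M" "frc s x = frc t y"
  shows "\<exists>w \<in> carrier R - P. (w \<otimes>\<^bsub>R\<^esub> t) \<odot>\<^bsub>M\<^esub> x = (w \<otimes>\<^bsub>R\<^esub> s) \<odot>\<^bsub>M\<^esub> y"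
proof -
  have "frag_of (q s, x) - frag_of (q t, y) \<in> N" using assms(5) unfolding frc_def cls_eq .
  then obtain w where w: "w \<in> carrier R - P"
    "\<And>c. c \<in> carrier R \<Longrightarrow> ext (c \<otimes>\<^bsub>R\<^esub> w) (frag_of (q s, x) - frag_of (q t, y)) = \<zero>\<^bsub>M\<^esub>" using ext_N by blast
  have c: "s \<in> carrier R" "t \<in> carrier R" "w \<in> carrier R" using assms w by auto
  \<comment> \<open>The factor \<open>s t\<close> clears both fractions, turning them into
    \<open>t x\<close> and \<open>s y\<close>; the factor \<open>w\<close> kills the relations
    between them.\<close>
  let ?c = "(s \<otimes>\<^bsub>R\<^esub> t) \<otimes>\<^bsub>R\<^esub> w"
  have e: "\<iota> ?c \<otimes>\<^bsub>K\<^esub> q s = \<iota> (w \<otimes>\<^bsub>R\<^esub> t)" "\<iota> ?c \<otimes>\<^bsub>K\<^esub> q t = \<iota> (w \<otimes>\<^bsub>R\<^esub> s)"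
  proof -
    have "\<iota> ?c \<otimes>\<^bsub>K\<^esub> q s = (\<iota> s \<otimes>\<^bsub>K\<^esub> q s) \<otimes>\<^bsub>K\<^esub> \<iota> (w \<otimes>\<^bsub>R\<^esub> t)"
      using c q_simps(1)[OF assms(1)] by (simp add: K.m_ac)
    thus "\<iota> ?c \<otimes>\<^bsub>K\<^esub> q s = \<iota> (w \<otimes>\<^bsub>R\<^esub> t)" using c q_simps[OF assms(1)] by simp
    have "\<iota> ?c \<otimes>\<^bsub>K\<^esub> q t = (\<iota> t \<otimes>\<^bsub>K\<^esub> q t) \<otimes>\<^bsub>K\<^esub> \<iota> (w \<otimes>\<^bsub>R\<^esub> s)"
      using c q_simps(1)[OF assms(3)] by (simp add: K.m_ac)
    thus "\<iota> ?c \<otimes>\<^bsub>K\<^esub> q t = \<iota> (w \<otimes>\<^bsub>R\<^esub> s)" using c q_simps[OF assms(3)] by simp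
  qed
  have "\<zero>\<^bsub>M\<^esub> = clear ?c (q s, x) \<ominus>\<^bsub>M\<^esub> clear ?c (q t, y)"
    using w(2)[of "s \<otimes>\<^bsub>R\<^esub> t"] c assms q_T by (simp add: ext_diff ext_frag)
  also have "\<dots> = (w \<otimes>\<^bsub>R\<^esub> t) \<odot>\<^bsub>M\<^esub> x \<ominus>\<^bsub>M\<^esub> (w \<otimes>\<^bsub>R\<^esub> s) \<odot>\<^bsub>M\<^esub> y"
    using clear_eq[OF _ e(1), of x] clear_eq[OF _ e(2), of y] c assms by simp
  finally have "(w \<otimes>\<^bsub>R\<^esub> t) \<odot>\<^bsub>M\<^esub> x \<ominus>\<^bsub>M\<^esub> (w \<otimes>\<^bsub>R\<^esub> s) \<odot>\<^bsub>M\<^esub> y = \<zero>\<^bsub>M\<^esub>" by simp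
  moreover have "a = (a \<ominus>\<^bsub>M\<^esub> b) \<oplus>\<^bsub>M\<^esub> b" if "a \<in> carrier M" "b \<in> carrier M" for a b
    using that by (simp add: M.minus_eq M.a_assoc M.l_neg)
  from this[of "(w \<otimes>\<^bsub>R\<^esub> t) \<odot>\<^bsub>M\<^esub> x" "(w \<otimes>\<^bsub>R\<^esub> s) \<odot>\<^bsub>M\<^esub> y"]
  have "(w \<otimes>\<^bsub>R\<^esub> t) \<odot>\<^bsub>M\<^esub> x = ((w \<otimes>\<^bsub>R\<^esub> t) \<odot>\<^bsub>M\<^esub> x \<ominus>\<^bsub>M\<^esub> (w \<otimes>\<^bsub>R\<^esub> s) \<odot>\<^bsub>M\<^esub> y) \<oplus>\<^bsub>M\<^esub> (w \<otimes>\<^bsub>R\<^esub> s) \<odot>\<^bsub>M\<^esub> y"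
    using c assms by simp
  ultimately have "(w \<otimes>\<^bsub>R\<^esub> t) \<odot>\<^bsub>M\<^esub> x = (w \<otimes>\<^bsub>R\<^esub> s) \<odot>\<^bsub>M\<^esub> y" using c assms by simp
  thus ?thesis using w by blast
qed

abbreviation "TM \<equiv> extend_scalars R T \<iota> M"

lemma TM_carrier: "carrier TM = {cls u | u. Poly_Mapping.keys u \<subseteq> carrier T \<times> carrier M}"
  unfolding extend_scalars_def Let_def FactGroup_def RCOSETS_def tensor_class_def by (auto simp: tensor_free_def)

lemma TM_frc: "m \<in> carrier TM \<Longrightarrow> \<exists>s \<in> carrier R - P. \<exists>x \<in> carrier M. m = frc s x"
  using frc_exists unfolding TM_carrier by auto

lemma frc_TM: "\<lbrakk> s \<in> carrier R - P; x \<in> carrier M \<rbrakk> \<Longrightarrow> frc s x \<in> carrier TM"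
  unfolding TM_carrier frc_def using q_T by auto

lemma TM_add: "cls u \<oplus>\<^bsub>TM\<^esub> cls v = cls (u + v)"
proof -
  have "cls u \<oplus>\<^bsub>TM\<^esub> cls v = (\<Union>a \<in> cls u. \<Union>b \<in> cls v. {a + b})"
    unfolding extend_scalars_def Let_def FactGroup_def set_mult_def by (simp add: tensor_free_def)
  also have "\<dots> = cls (u + v)"
  proof
    show "(\<Union>a \<in> cls u. \<Union>b \<in> cls v. {a + b}) \<subseteq> cls (u + v)"
    proof
      fix w assume "w \<in> (\<Union>a \<in> cls u. \<Union>b \<in> cls v. {a + b})"
      then obtain a b where "a - u \<in> N" "b - v \<in> N" "w = a + b" by (auto simp: cls_mem)
      thus "w \<in> cls (u + v)" using N_add[of "a - u" "b - v"] by (simp add: cls_mem algebra_simps)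
    qed
    show "cls (u + v) \<subseteq> (\<Union>a \<in> cls u. \<Union>b \<in> cls v. {a + b})"
    proof
      fix w assume "w \<in> cls (u + v)"
      hence "w - v \<in> cls u" by (simp add: cls_mem algebra_simps)
      thus "w \<in> (\<Union>a \<in> cls u. \<Union>b \<in> cls v. {a + b})"
        by (auto intro!: bexI[of _ "w - v"] bexI[OF _ cls_self[of v]])
    qed
  qed
  finally show ?thesis .
qed

lemma TM_zero: "\<zero>\<^bsub>TM\<^esub> = cls 0"
  unfolding extend_scalars_def Let_def FactGroup_def by (simp add: cls_alt)

lemma TM_abelian_group: "abelian_group TM"
proof (rule abelian_groupI)
  fix x y z assume "x \<in> carrier TM" "y \<in> carrier TM" "z \<in> carrier TM"
  then obtain u v w where uvw: "Poly_Mapping.keys u \<subseteq> carrier T \<times> carrier M" "x = cls u"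
    "Poly_Mapping.keys v \<subseteq> carrier T \<times> carrier M" "y = cls v" "Poly_Mapping.keys w \<subseteq> carrier T \<times> carrier M" "z = cls w"
    unfolding TM_carrier by blast
  have "Poly_Mapping.keys (u + v) \<subseteq> carrier T \<times> carrier M" using keys_add[of u v] uvw by blast
  thus "x \<oplus>\<^bsub>TM\<^esub> y \<in> carrier TM" unfolding uvw TM_add unfolding TM_carrier by blast
  show "x \<oplus>\<^bsub>TM\<^esub> y \<oplus>\<^bsub>TM\<^esub> z = x \<oplus>\<^bsub>TM\<^esub> (y \<oplus>\<^bsub>TM\<^esub> z)" "x \<oplus>\<^bsub>TM\<^esub> y = y \<oplus>\<^bsub>TM\<^esub> x" "\<zero>\<^bsub>TM\<^esub> \<oplus>\<^bsub>TM\<^esub> x = x"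
    unfolding uvw TM_zero TM_add by (simp_all add: ac_simps)
  have "Poly_Mapping.keys (- u) \<subseteq> carrier T \<times> carrier M" using uvw(1) by simp
  hence "cls (- u) \<in> carrier TM" "cls (- u) \<oplus>\<^bsub>TM\<^esub> x = \<zero>\<^bsub>TM\<^esub>"
    unfolding uvw TM_zero TM_add unfolding TM_carrier by (blast, simp)
  thus "\<exists>y \<in> carrier TM. y \<oplus>\<^bsub>TM\<^esub> x = \<zero>\<^bsub>TM\<^esub>" by blast
qed (auto simp: TM_carrier TM_zero intro!: exI[of _ 0])

lemma frc_add: "\<lbrakk> s \<in> carrier R - P; x \<in> carrier M; y \<in> carrier M \<rbrakk> \<Longrightarrow> frc s x \<oplus>\<^bsub>TM\<^esub> frc s y = frc s (x \<oplus>\<^bsub>M\<^esub> y)"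
  unfolding frc_def TM_add cls_eq using N_uminus[OF rel2[OF q_T]] by simp

end

subsection \<open>Morphisms with denominators\<close>

locale base_changed_category = fractions_at R K \<iota> P + lc: linear_category R C
  for R :: "('r, 'x) ring_scheme" and K :: "('k, 'y) ring_scheme" and \<iota> :: "'r \<Rightarrow> 'k" and P
    and C :: "('r, 'o, 'm) lin_cat"
begin

abbreviation "B \<equiv> base_change R T \<iota> C"

lemma tensor_module: "\<lbrakk> U \<in> Obj C; V \<in> Obj C \<rbrakk> \<Longrightarrow> tensor_module R K \<iota> P (Hom C U V)"
  using lc.hom_module fractions_at_axioms by (simp add: tensor_module_def)

abbreviation "HN U V \<equiv> tensor_kernel R T \<iota> (Hom C U V)"
abbreviation "hcls U V \<equiv> tensor_class R T \<iota> (Hom C U V)"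

definition hfrc :: "'o \<Rightarrow> 'o \<Rightarrow> 'r \<Rightarrow> 'm \<Rightarrow> ('k \<times> 'm \<Rightarrow>\<^sub>0 int) set" where
  "hfrc U V s x = hcls U V (frag_of (q s, x))"

lemma hfrc_eq: "\<lbrakk> U \<in> Obj C; V \<in> Obj C \<rbrakk> \<Longrightarrow> hfrc U V = tensor_module.frc R K \<iota> P (Hom C U V)"
  using tensor_module.frc_def[OF tensor_module] unfolding hfrc_def by (intro ext) simp

abbreviation "frags U V \<equiv> {u :: 'k \<times> 'm \<Rightarrow>\<^sub>0 int. Poly_Mapping.keys u \<subseteq> carrier T \<times> carrier (Hom C U V)}"

definition fcomp :: "'o \<Rightarrow> 'o \<Rightarrow> 'o \<Rightarrow> ('k \<times> 'm \<Rightarrow>\<^sub>0 int) \<Rightarrow> ('k \<times> 'm \<Rightarrow>\<^sub>0 int) \<Rightarrow> ('k \<times> 'm \<Rightarrow>\<^sub>0 int)" where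
  "fcomp U V W g f = frag_extend (\<lambda>(s, y). frag_extend (\<lambda>(t, x). frag_of (s \<otimes>\<^bsub>K\<^esub> t, Comp C U V W y x)) f) g"

lemma fcomp_frag: "fcomp U V W (frag_of (s, y)) (frag_of (t, x)) = frag_of (s \<otimes>\<^bsub>K\<^esub> t, Comp C U V W y x)"
  unfolding fcomp_def by simp

lemma fcomp_diff_left: "fcomp U V W (g - g') f = fcomp U V W g f - fcomp U V W g' f"
  unfolding fcomp_def by (simp add: frag_extend_diff)

lemma fcomp_diff_right: "fcomp U V W g (f - f') = fcomp U V W g f - fcomp U V W g f'"
proof -
  have "Poly_Mapping.keys g \<subseteq> UNIV" by simp
  thus ?thesis
  proof (induction rule: frag_induction)
    case (diff a b)
    thus ?case by (simp add: fcomp_diff_left)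
  qed (auto simp: fcomp_def frag_extend_diff)
qed

lemma fcomp_zero: "fcomp U V W 0 f = 0" "fcomp U V W g 0 = 0"
  using fcomp_diff_left[of U V W 0 0 f] fcomp_diff_right[of U V W g 0 0] by simp_all

lemma fcomp_minus: "fcomp U V W (- g) f = - fcomp U V W g f" "fcomp U V W g (- f) = - fcomp U V W g f"
  using fcomp_diff_left[of U V W 0 g f] fcomp_diff_right[of U V W g 0 f] by (simp_all add: fcomp_zero)

lemma fcomp_add: "fcomp U V W (g + g') f = fcomp U V W g f + fcomp U V W g' f"
  "fcomp U V W g (f + f') = fcomp U V W g f + fcomp U V W g f'"
  using fcomp_diff_left[of U V W g "- g'" f] fcomp_diff_right[of U V W g f "- f'"] by (simp_all add: fcomp_minus)

context
  fixes U V W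
  assumes obj: "U \<in> Obj C" "V \<in> Obj C" "W \<in> Obj C"
begin

interpretation UV: tensor_module R K \<iota> P "Hom C U V" by (rule tensor_module[OF obj(1,2)])
interpretation VW: tensor_module R K \<iota> P "Hom C V W" by (rule tensor_module[OF obj(2,3)])
interpretation UW: tensor_module R K \<iota> P "Hom C U W" by (rule tensor_module[OF obj(1,3)])

text \<open>Composition is bilinear over \<open>R\<close>, so it carries each type of relation to a
  relation of the same type. With the next lemma this makes composition independent of the
  representatives.\<close>

lemma fcomp_N_right:
  assumes "g \<in> frags V W" "f \<in> HN U V" shows "fcomp U V W g f \<in> HN U W"
proof -
  have "Poly_Mapping.keys g \<subseteq> carrier T \<times> carrier (Hom C V W)" using assms by simp
  thus ?thesis
  proof (rule free_Abelian_group_induct)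
    fix p assume "p \<in> carrier T \<times> carrier (Hom C V W)"
    then obtain s y where p: "p = (s, y)" "s \<in> carrier T" "y \<in> carrier (Hom C V W)" by auto
    have rel: "fcomp U V W (frag_of (s, y)) u \<in> HN U W" if u: "u \<in> UV.rels" for u
      using u
    proof (cases rule: UV.rels_cases)
      case (add_left t t' x)
      have "s \<otimes>\<^bsub>K\<^esub> (t \<oplus>\<^bsub>K\<^esub> t') = s \<otimes>\<^bsub>K\<^esub> t \<oplus>\<^bsub>K\<^esub> s \<otimes>\<^bsub>K\<^esub> t'"
        using add_left p T_sub_K by (simp add: K.r_distr)
      thus ?thesis unfolding add_left(4) fcomp_diff_right fcomp_frag
        using add_left p T_mult_closed lc.comp_closed[OF obj] UW.rel1 by simp
    next
      case (add_right t x x')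
      thus ?thesis unfolding add_right(4) fcomp_diff_right fcomp_frag
        using p T_mult_closed lc.comp_closed[OF obj] lc.comp_add_right[OF obj] UW.rel2' by simp
    next
      case (balance t r x)
      have "s \<otimes>\<^bsub>K\<^esub> (t \<otimes>\<^bsub>K\<^esub> \<iota> r) = (s \<otimes>\<^bsub>K\<^esub> t) \<otimes>\<^bsub>K\<^esub> \<iota> r"
        using balance p T_sub_K by (simp add: K.m_assoc)
      moreover have "Comp C U V W y (r \<odot>\<^bsub>Hom C U V\<^esub> x) = r \<odot>\<^bsub>Hom C U W\<^esub> Comp C U V W y x"
        using lc.comp_smult_right[OF obj] balance p by simp
      ultimately show ?thesis unfolding balance(4) fcomp_diff_right fcomp_frag
        using UW.rel3[of "s \<otimes>\<^bsub>K\<^esub> t" r "Comp C U V W y x"] balance p T_mult_closed lc.comp_closed[OF obj] by simp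
    qed
    show "fcomp U V W (frag_of p) f \<in> HN U W" unfolding p(1)
      using assms(2)
    proof (induction rule: UV.N_induct)
      case (neg u)
      thus ?case using rel UW.N_uminus by (simp add: fcomp_minus)
    qed (auto simp: fcomp_zero fcomp_add UW.N_zero rel intro: UW.N_add)
  qed (auto simp: fcomp_zero fcomp_diff_left UW.N_zero intro: UW.N_diff)
qed

lemma fcomp_N_left:
  assumes "g \<in> HN V W" "f \<in> frags U V" shows "fcomp U V W g f \<in> HN U W"
proof -
  have "Poly_Mapping.keys f \<subseteq> carrier T \<times> carrier (Hom C U V)" using assms by simp
  thus ?thesis
  proof (rule free_Abelian_group_induct)
    fix p assume "p \<in> carrier T \<times> carrier (Hom C U V)"
    then obtain t x where p: "p = (t, x)" "t \<in> carrier T" "x \<in> carrier (Hom C U V)" by auto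
    have rel: "fcomp U V W u (frag_of (t, x)) \<in> HN U W" if u: "u \<in> VW.rels" for u
      using u
    proof (cases rule: VW.rels_cases)
      case (add_left s s' y)
      have "(s \<oplus>\<^bsub>K\<^esub> s') \<otimes>\<^bsub>K\<^esub> t = s \<otimes>\<^bsub>K\<^esub> t \<oplus>\<^bsub>K\<^esub> s' \<otimes>\<^bsub>K\<^esub> t"
        using add_left p T_sub_K by (simp add: K.l_distr)
      thus ?thesis unfolding add_left(4) fcomp_diff_left fcomp_frag
        using add_left p T_mult_closed lc.comp_closed[OF obj] UW.rel1 by simp
    next
      case (add_right s y y')
      thus ?thesis unfolding add_right(4) fcomp_diff_left fcomp_frag
        using p T_mult_closed lc.comp_closed[OF obj] lc.comp_add_left[OF obj] UW.rel2' by simp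
    next
      case (balance s r y)
      have "(s \<otimes>\<^bsub>K\<^esub> \<iota> r) \<otimes>\<^bsub>K\<^esub> t = (s \<otimes>\<^bsub>K\<^esub> t) \<otimes>\<^bsub>K\<^esub> \<iota> r"
        using balance p T_sub_K by (simp add: K.m_ac)
      moreover have "Comp C U V W (r \<odot>\<^bsub>Hom C V W\<^esub> y) x = r \<odot>\<^bsub>Hom C U W\<^esub> Comp C U V W y x"
        using lc.comp_smult_left[OF obj] balance p by simp
      ultimately show ?thesis unfolding balance(4) fcomp_diff_left fcomp_frag
        using UW.rel3[of "s \<otimes>\<^bsub>K\<^esub> t" r "Comp C U V W y x"] balance p T_mult_closed lc.comp_closed[OF obj] by simp
    qed
    show "fcomp U V W g (frag_of p) \<in> HN U W" unfolding p(1)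
      using assms(1)
    proof (induction rule: VW.N_induct)
      case (neg u)
      thus ?case using rel UW.N_uminus by (simp add: fcomp_minus)
    qed (auto simp: fcomp_zero fcomp_add UW.N_zero rel intro: UW.N_add)
  qed (auto simp: fcomp_zero fcomp_diff_right UW.N_zero intro: UW.N_diff)
qed

text \<open>All representatives give the same coset, so the union in the definition of
  \<open>base_change\<close> collapses; that the cosets are nonempty is needed here.\<close>

lemma Comp_cls:
  assumes "g \<in> frags V W" "f \<in> frags U V"
  shows "Comp B U V W (hcls V W g) (hcls U V f) = hcls U W (fcomp U V W g f)"
proof -
  have *: "hcls U W (fcomp U V W g' f') = hcls U W (fcomp U V W g f)" if "g' \<in> hcls V W g" "f' \<in> hcls U V f" for g' f'
  proof -
    have n: "g' - g \<in> HN V W" "f' - f \<in> HN U V" using that VW.cls_mem UV.cls_mem by auto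
    have k: "g' \<in> frags V W"
      using VW.N_keys[OF n(1)] assms(1) keys_add[of "g' - g" g] by auto
    have "fcomp U V W g' (f' - f) + fcomp U V W (g' - g) f \<in> HN U W"
      by (intro UW.N_add fcomp_N_right[OF k n(2)] fcomp_N_left[OF n(1) assms(2)])
    thus ?thesis unfolding UW.cls_eq by (simp add: fcomp_diff_left fcomp_diff_right)
  qed
  have "Comp B U V W (hcls V W g) (hcls U V f)
      = (\<Union>g' \<in> hcls V W g. \<Union>f' \<in> hcls U V f. hcls U W (fcomp U V W g' f'))"
    unfolding base_change_def fcomp_def by simp
  also have "\<dots> = (\<Union>g' \<in> hcls V W g. \<Union>f' \<in> hcls U V f. hcls U W (fcomp U V W g f))"
    by (intro SUP_cong refl *)
  also have "\<dots> = hcls U W (fcomp U V W g f)"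
  proof -
    have "hcls V W g \<noteq> {}" "hcls U V f \<noteq> {}" using VW.cls_self[of g] UV.cls_self[of f] by blast+
    thus ?thesis by simp
  qed
  finally show ?thesis .
qed

lemma Comp_hfrc:
  assumes "s \<in> carrier R - P" "t \<in> carrier R - P" "y \<in> carrier (Hom C V W)" "x \<in> carrier (Hom C U V)"
  shows "Comp B U V W (hfrc V W t y) (hfrc U V s x) = hfrc U W (t \<otimes>\<^bsub>R\<^esub> s) (Comp C U V W y x)"
  unfolding hfrc_def q_mult[OF assms(2,1)] using assms q_T by (subst Comp_cls) (auto simp: fcomp_frag)

end

lemma Hom_B: "Hom B U V = extend_scalars R T \<iota> (Hom C U V)"
  unfolding base_change_def by simp

lemma Id_B: "Id B U = hfrc U U \<one>\<^bsub>R\<^esub> (Id C U)"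
  unfolding base_change_def hfrc_def by simp

lemma Obj_B [simp]: "Obj B = Obj C"
  unfolding base_change_def by simp

text \<open>A pair of mutually inverse fractions is cleared of denominators; each of the two
  identities then holds after multiplication by a further scalar outside \<open>P\<close>.\<close>

lemma isomorphic_base_change:
  assumes obj: "U \<in> Obj C" "V \<in> Obj C" and "isomorphic_in B U V"
  shows "\<exists>f \<in> carrier (Hom C U V). \<exists>g \<in> carrier (Hom C V U). \<exists>s \<in> carrier R - P.
    Comp C U V U g f = s \<odot>\<^bsub>Hom C U U\<^esub> Id C U \<and> Comp C V U V f g = s \<odot>\<^bsub>Hom C V V\<^esub> Id C V"
proof -
  interpret UV: tensor_module R K \<iota> P "Hom C U V" by (rule tensor_module[OF obj])
  interpret VU: tensor_module R K \<iota> P "Hom C V U" by (rule tensor_module[OF obj(2,1)])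
  interpret UU: tensor_module R K \<iota> P "Hom C U U" by (rule tensor_module[OF obj(1,1)])
  interpret VV: tensor_module R K \<iota> P "Hom C V V" by (rule tensor_module[OF obj(2,2)])
  obtain F G where FG: "F \<in> carrier (Hom B U V)" "G \<in> carrier (Hom B V U)"
    "Comp B U V U G F = Id B U" "Comp B V U V F G = Id B V"
    using assms unfolding isomorphic_in_def by blast
  obtain s f where f: "s \<in> carrier R - P" "f \<in> carrier (Hom C U V)" "F = hfrc U V s f"
    using UV.TM_frc[OF FG(1)[unfolded Hom_B]] unfolding hfrc_eq[OF obj] by (elim bexE)
  obtain t g where g: "t \<in> carrier R - P" "g \<in> carrier (Hom C V U)" "G = hfrc V U t g"
    using VU.TM_frc[OF FG(2)[unfolded Hom_B]] unfolding hfrc_eq[OF obj(2,1)] by (elim bexE)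
  have gf: "Comp C U V U g f \<in> carrier (Hom C U U)" "Comp C V U V f g \<in> carrier (Hom C V V)"
    using lc.comp_closed obj f g by auto
  have i: "Id C U \<in> carrier (Hom C U U)" "Id C V \<in> carrier (Hom C V V)" using lc.id_closed obj by auto
  have e: "hfrc U U (t \<otimes>\<^bsub>R\<^esub> s) (Comp C U V U g f) = hfrc U U \<one>\<^bsub>R\<^esub> (Id C U)"
    "hfrc V V (s \<otimes>\<^bsub>R\<^esub> t) (Comp C V U V f g) = hfrc V V \<one>\<^bsub>R\<^esub> (Id C V)"
    using FG(3) FG(4) Comp_hfrc[OF obj obj(1) f(1) g(1) g(2) f(2)] Comp_hfrc[OF obj(2,1,2) g(1) f(1) f(2) g(2)]
    unfolding Id_B f(3) g(3) by simp_all
  obtain w v where w: "w \<in> carrier R - P" "(w \<otimes>\<^bsub>R\<^esub> \<one>\<^bsub>R\<^esub>) \<odot>\<^bsub>Hom C U U\<^esub> Comp C U V U g f = (w \<otimes>\<^bsub>R\<^esub> (t \<otimes>\<^bsub>R\<^esub> s)) \<odot>\<^bsub>Hom C U U\<^esub> Id C U"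
    and v: "v \<in> carrier R - P" "(v \<otimes>\<^bsub>R\<^esub> \<one>\<^bsub>R\<^esub>) \<odot>\<^bsub>Hom C V V\<^esub> Comp C V U V f g = (v \<otimes>\<^bsub>R\<^esub> (s \<otimes>\<^bsub>R\<^esub> t)) \<odot>\<^bsub>Hom C V V\<^esub> Id C V"
    using UU.frc_eqD[OF W_mult[OF g(1) f(1)] gf(1) W_one i(1) e(1)[unfolded hfrc_eq[OF obj(1,1)]]]
      VV.frc_eqD[OF W_mult[OF f(1) g(1)] gf(2) W_one i(2) e(2)[unfolded hfrc_eq[OF obj(2,2)]]]
    by (elim bexE)
  have c: "w \<in> carrier R" "v \<in> carrier R" "s \<in> carrier R" "t \<in> carrier R" using w v f g by auto
  \<comment> \<open>The identities come with different scalars \<open>w\<close> and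
    \<open>v\<close>; absorbing both into \<open>f\<close> gives them a common right-hand
    side.\<close>
  let ?s = "(v \<otimes>\<^bsub>R\<^esub> w) \<otimes>\<^bsub>R\<^esub> (t \<otimes>\<^bsub>R\<^esub> s)" and ?f = "(v \<otimes>\<^bsub>R\<^esub> w) \<odot>\<^bsub>Hom C U V\<^esub> f"
  have "Comp C U V U g ?f = v \<odot>\<^bsub>Hom C U U\<^esub> (w \<odot>\<^bsub>Hom C U U\<^esub> Comp C U V U g f)"
    using lc.comp_smult_right[of U V U] obj c f g gf UU.M.smult_assoc1 by simp
  also have "\<dots> = v \<odot>\<^bsub>Hom C U U\<^esub> ((w \<otimes>\<^bsub>R\<^esub> (t \<otimes>\<^bsub>R\<^esub> s)) \<odot>\<^bsub>Hom C U U\<^esub> Id C U)" using w c by simp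
  also have "\<dots> = ?s \<odot>\<^bsub>Hom C U U\<^esub> Id C U"
    using UU.M.smult_assoc1[of v "w \<otimes>\<^bsub>R\<^esub> (t \<otimes>\<^bsub>R\<^esub> s)" "Id C U"] c i by (simp add: R.m_assoc)
  finally have 1: "Comp C U V U g ?f = ?s \<odot>\<^bsub>Hom C U U\<^esub> Id C U" .
  have "Comp C V U V ?f g = (w \<otimes>\<^bsub>R\<^esub> v) \<odot>\<^bsub>Hom C V V\<^esub> Comp C V U V f g"
    using lc.comp_smult_left[of V U V] obj c f g gf R.m_comm[of v w] by simp
  also have "\<dots> = w \<odot>\<^bsub>Hom C V V\<^esub> (v \<odot>\<^bsub>Hom C V V\<^esub> Comp C V U V f g)"
    using c gf VV.M.smult_assoc1 by simp
  also have "\<dots> = w \<odot>\<^bsub>Hom C V V\<^esub> ((v \<otimes>\<^bsub>R\<^esub> (s \<otimes>\<^bsub>R\<^esub> t)) \<odot>\<^bsub>Hom C V V\<^esub> Id C V)" using v c by simp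
  also have "\<dots> = (w \<otimes>\<^bsub>R\<^esub> (v \<otimes>\<^bsub>R\<^esub> (s \<otimes>\<^bsub>R\<^esub> t))) \<odot>\<^bsub>Hom C V V\<^esub> Id C V"
    using VV.M.smult_assoc1[of w "v \<otimes>\<^bsub>R\<^esub> (s \<otimes>\<^bsub>R\<^esub> t)" "Id C V"] c i by simp
  also have "w \<otimes>\<^bsub>R\<^esub> (v \<otimes>\<^bsub>R\<^esub> (s \<otimes>\<^bsub>R\<^esub> t)) = ?s" using c by (simp add: R.m_ac)
  finally have 2: "Comp C V U V ?f g = ?s \<odot>\<^bsub>Hom C V V\<^esub> Id C V" .
  have s: "?s \<in> carrier R - P" by (intro W_mult w v f g)
  have fc: "?f \<in> carrier (Hom C U V)" using f(2) c by simp
  show ?thesis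
    by (rule bexI[OF _ fc], rule bexI[OF _ g(2)], rule bexI[OF _ s], rule conjI[OF 1 2])
qed

end

lemma End_ring_simps [simp]:
  "carrier (End_ring C' U) = carrier (Hom C' U U)" "monoid.mult (End_ring C' U) = Comp C' U U U"
  "\<one>\<^bsub>End_ring C' U\<^esub> = Id C' U" "\<zero>\<^bsub>End_ring C' U\<^esub> = \<zero>\<^bsub>Hom C' U U\<^esub>"
  "add (End_ring C' U) = add (Hom C' U U)"
  by (simp_all add: End_ring_def)

lemma abelian_group_End: "abelian_group (Hom C' U U) \<Longrightarrow> abelian_group (End_ring C' U)"
proof (rule abelian_groupI)
  assume "abelian_group (Hom C' U U)"
  then interpret abelian_group "Hom C' U U" .
  fix x y z assume "x \<in> carrier (End_ring C' U)" "y \<in> carrier (End_ring C' U)" "z \<in> carrier (End_ring C' U)"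
  thus "x \<oplus>\<^bsub>End_ring C' U\<^esub> y \<in> carrier (End_ring C' U)" "x \<oplus>\<^bsub>End_ring C' U\<^esub> y = y \<oplus>\<^bsub>End_ring C' U\<^esub> x"
    "x \<oplus>\<^bsub>End_ring C' U\<^esub> y \<oplus>\<^bsub>End_ring C' U\<^esub> z = x \<oplus>\<^bsub>End_ring C' U\<^esub> (y \<oplus>\<^bsub>End_ring C' U\<^esub> z)"
    "\<zero>\<^bsub>End_ring C' U\<^esub> \<oplus>\<^bsub>End_ring C' U\<^esub> x = x"
    "\<exists>y \<in> carrier (End_ring C' U). y \<oplus>\<^bsub>End_ring C' U\<^esub> x = \<zero>\<^bsub>End_ring C' U\<^esub>"
    using a_ac l_neg by (auto intro!: bexI[of _ "\<ominus>\<^bsub>Hom C' U U\<^esub> x"])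
qed (simp add: abelian_group.axioms(1) abelian_monoid.zero_closed)

context base_changed_category
begin

lemma hfrc_closed:
  "\<lbrakk> U \<in> Obj C; V \<in> Obj C; s \<in> carrier R - P; x \<in> carrier (Hom C U V) \<rbrakk> \<Longrightarrow> hfrc U V s x \<in> carrier (Hom B U V)"
  using tensor_module.frc_TM[OF tensor_module] unfolding Hom_B by (simp add: hfrc_eq)

lemma hfrc_exists:
  assumes "U \<in> Obj C" "V \<in> Obj C" "m \<in> carrier (Hom B U V)"
  shows "\<exists>s \<in> carrier R - P. \<exists>x \<in> carrier (Hom C U V). m = hfrc U V s x"
  using tensor_module.TM_frc[OF tensor_module[OF assms(1,2)] assms(3)[unfolded Hom_B]]
  unfolding hfrc_eq[OF assms(1,2)] .

lemma hfrc_expand: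
  assumes "U \<in> Obj C" "V \<in> Obj C" "s \<in> carrier R - P" "t \<in> carrier R - P" "x \<in> carrier (Hom C U V)"
  shows "hfrc U V s x = hfrc U V (s \<otimes>\<^bsub>R\<^esub> t) (t \<odot>\<^bsub>Hom C U V\<^esub> x)"
  unfolding hfrc_eq[OF assms(1,2)] by (rule tensor_module.frc_expand[OF tensor_module[OF assms(1,2)] assms(3-5)])

lemma hfrc_add:
  "\<lbrakk> U \<in> Obj C; V \<in> Obj C; s \<in> carrier R - P; x \<in> carrier (Hom C U V); y \<in> carrier (Hom C U V) \<rbrakk>
    \<Longrightarrow> hfrc U V s x \<oplus>\<^bsub>Hom B U V\<^esub> hfrc U V s y = hfrc U V s (x \<oplus>\<^bsub>Hom C U V\<^esub> y)"
  using tensor_module.frc_add[OF tensor_module] unfolding Hom_B by (simp add: hfrc_eq)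

lemma hfrc_common:
  assumes obj: "U \<in> Obj C" "V \<in> Obj C" and m: "m \<in> carrier (Hom B U V)" "m' \<in> carrier (Hom B U V)"
  shows "\<exists>s \<in> carrier R - P. \<exists>x \<in> carrier (Hom C U V). \<exists>y \<in> carrier (Hom C U V).
    m = hfrc U V s x \<and> m' = hfrc U V s y"
proof -
  interpret M: module R "Hom C U V" using lc.hom_module obj by simp
  obtain s x where s: "s \<in> carrier R - P" "x \<in> carrier (Hom C U V)" "m = hfrc U V s x"
    using hfrc_exists[OF obj m(1)] by (elim bexE)
  obtain t y where t: "t \<in> carrier R - P" "y \<in> carrier (Hom C U V)" "m' = hfrc U V t y"
    using hfrc_exists[OF obj m(2)] by (elim bexE)
  have "m = hfrc U V (s \<otimes>\<^bsub>R\<^esub> t) (t \<odot>\<^bsub>Hom C U V\<^esub> x)" "m' = hfrc U V (s \<otimes>\<^bsub>R\<^esub> t) (s \<odot>\<^bsub>Hom C U V\<^esub> y)"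
    using hfrc_expand[OF obj s(1) t(1) s(2)] hfrc_expand[OF obj t(1) s(1) t(2)] s t R.m_comm[of s t] by auto
  moreover have "t \<odot>\<^bsub>Hom C U V\<^esub> x \<in> carrier (Hom C U V)" "s \<odot>\<^bsub>Hom C U V\<^esub> y \<in> carrier (Hom C U V)"
    using s t by auto
  ultimately show ?thesis using W_mult[OF s(1) t(1)]
    by (intro bexI[of _ "s \<otimes>\<^bsub>R\<^esub> t"] bexI[of _ "t \<odot>\<^bsub>Hom C U V\<^esub> x"] bexI[of _ "s \<odot>\<^bsub>Hom C U V\<^esub> y"] conjI)
qed

lemma abelian_group_B: "\<lbrakk> U \<in> Obj C; V \<in> Obj C \<rbrakk> \<Longrightarrow> abelian_group (Hom B U V)"
  using tensor_module.TM_abelian_group[OF tensor_module] unfolding Hom_B .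

lemma ring_End_B:
  assumes U: "U \<in> Obj C" shows "ring (End_ring B U)"
proof (rule ringI)
  let ?E = "End_ring B U"
  note c = lc.comp_closed[OF U U U] and ch = Comp_hfrc[OF U U U]
  have i: "Id C U \<in> carrier (Hom C U U)" by (rule lc.id_closed[OF U])
  show "abelian_group ?E" by (rule abelian_group_End[OF abelian_group_B[OF U U]])
  show "monoid ?E"
  proof (rule monoidI)
    show "\<one>\<^bsub>?E\<^esub> \<in> carrier ?E" unfolding End_ring_simps Id_B by (rule hfrc_closed[OF U U W_one i])
    fix x assume "x \<in> carrier ?E"
    then obtain s a where x: "s \<in> carrier R - P" "a \<in> carrier (Hom C U U)" "x = hfrc U U s a"
      using hfrc_exists[OF U U] unfolding End_ring_simps by meson
    show "\<one>\<^bsub>?E\<^esub> \<otimes>\<^bsub>?E\<^esub> x = x" "x \<otimes>\<^bsub>?E\<^esub> \<one>\<^bsub>?E\<^esub> = x"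
      unfolding x End_ring_simps Id_B ch[OF x(1) W_one i x(2)] ch[OF W_one x(1) x(2) i]
      using x U lc.comp_id_left lc.comp_id_right by simp_all
    fix y assume "y \<in> carrier ?E"
    then obtain t b where y: "t \<in> carrier R - P" "b \<in> carrier (Hom C U U)" "y = hfrc U U t b"
      using hfrc_exists[OF U U] unfolding End_ring_simps by meson
    show "x \<otimes>\<^bsub>?E\<^esub> y \<in> carrier ?E"
      unfolding x y End_ring_simps ch[OF y(1) x(1) x(2) y(2)] by (intro hfrc_closed U W_mult x y c)
    fix z assume "z \<in> carrier ?E"
    then obtain u d where z: "u \<in> carrier R - P" "d \<in> carrier (Hom C U U)" "z = hfrc U U u d"
      using hfrc_exists[OF U U] unfolding End_ring_simps by meson
    show "x \<otimes>\<^bsub>?E\<^esub> y \<otimes>\<^bsub>?E\<^esub> z = x \<otimes>\<^bsub>?E\<^esub> (y \<otimes>\<^bsub>?E\<^esub> z)"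
      unfolding x y z End_ring_simps ch[OF y(1) x(1) x(2) y(2)] ch[OF z(1) y(1) y(2) z(2)]
        ch[OF z(1) W_mult[OF x(1) y(1)] c[OF y(2) x(2)] z(2)] ch[OF W_mult[OF y(1) z(1)] x(1) x(2) c[OF z(2) y(2)]]
      using lc.comp_assoc[OF U U U U] x y z by (simp add: R.m_assoc)
  qed
  fix x y z assume xyz: "x \<in> carrier ?E" "y \<in> carrier ?E" "z \<in> carrier ?E"
  obtain s a b where xy: "s \<in> carrier R - P" "a \<in> carrier (Hom C U U)" "b \<in> carrier (Hom C U U)" "x = hfrc U U s a" "y = hfrc U U s b"
    using hfrc_common[OF U U, of x y] xyz unfolding End_ring_simps by meson
  obtain u d where z: "u \<in> carrier R - P" "d \<in> carrier (Hom C U U)" "z = hfrc U U u d"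
    using hfrc_exists[OF U U, of z] xyz unfolding End_ring_simps by meson
  interpret M: module R "Hom C U U" by (rule lc.hom_module[OF U U])
  have ab: "a \<oplus>\<^bsub>Hom C U U\<^esub> b \<in> carrier (Hom C U U)" using xy by simp
  show "(x \<oplus>\<^bsub>?E\<^esub> y) \<otimes>\<^bsub>?E\<^esub> z = x \<otimes>\<^bsub>?E\<^esub> z \<oplus>\<^bsub>?E\<^esub> y \<otimes>\<^bsub>?E\<^esub> z"
    unfolding xy(4,5) z(3) End_ring_simps hfrc_add[OF U U xy(1,2,3)] ch[OF z(1) xy(1) ab z(2)]
      ch[OF z(1) xy(1,2) z(2)] ch[OF z(1) xy(1,3) z(2)] hfrc_add[OF U U W_mult[OF xy(1) z(1)] c[OF z(2) xy(2)] c[OF z(2) xy(3)]]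
    using lc.comp_add_left[OF U U U z(2) xy(2,3)] by simp
  show "z \<otimes>\<^bsub>?E\<^esub> (x \<oplus>\<^bsub>?E\<^esub> y) = z \<otimes>\<^bsub>?E\<^esub> x \<oplus>\<^bsub>?E\<^esub> z \<otimes>\<^bsub>?E\<^esub> y"
    unfolding xy(4,5) z(3) End_ring_simps hfrc_add[OF U U xy(1,2,3)] ch[OF xy(1) z(1,2) ab]
      ch[OF xy(1) z(1,2) xy(2)] ch[OF xy(1) z(1,2) xy(3)] hfrc_add[OF U U W_mult[OF z(1) xy(1)] c[OF xy(2) z(2)] c[OF xy(3) z(2)]]
    using lc.comp_add_right[OF U U U xy(2,3) z(2)] by simp
qed

section \<open>Scalars in the base-changed endomorphism ring\<close>

definition scalar :: "'o \<Rightarrow> 'k \<Rightarrow> ('k \<times> 'm \<Rightarrow>\<^sub>0 int) set" where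
  "scalar U k = hcls U U (frag_of (k, Id C U))"

lemma scalar_hom:
  assumes U: "U \<in> Obj C" shows "scalar U \<in> ring_hom T (End_ring B U)"
proof (rule ring_hom_memI)
  interpret UU: tensor_module R K \<iota> P "Hom C U U" by (rule tensor_module[OF U U])
  have i: "Id C U \<in> carrier (Hom C U U)" by (rule lc.id_closed[OF U])
  show "scalar U k \<in> carrier (End_ring B U)" if "k \<in> carrier T" for k
    unfolding scalar_def End_ring_simps Hom_B UU.TM_carrier using that i by auto
  show "scalar U (k \<otimes>\<^bsub>T\<^esub> l) = scalar U k \<otimes>\<^bsub>End_ring B U\<^esub> scalar U l" if "k \<in> carrier T" "l \<in> carrier T" for k l
    unfolding scalar_def End_ring_simps using that i lc.comp_id_left[OF U U i]
    by (subst Comp_cls[OF U U U]) (auto simp: fcomp_frag)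
  show "scalar U (k \<oplus>\<^bsub>T\<^esub> l) = scalar U k \<oplus>\<^bsub>End_ring B U\<^esub> scalar U l" if "k \<in> carrier T" "l \<in> carrier T" for k l
    unfolding scalar_def End_ring_simps Hom_B UU.TM_add T_simps by (rule UU.cls_add_rel[OF that i])
  show "scalar U \<one>\<^bsub>T\<^esub> = \<one>\<^bsub>End_ring B U\<^esub>"
    unfolding scalar_def End_ring_simps Id_B hfrc_def by simp
qed

lemma Comp_scalar:
  assumes U: "U \<in> Obj C" and k: "k \<in> carrier T" and s: "s \<in> carrier R - P" and x: "x \<in> carrier (Hom C U U)"
  shows "Comp B U U U (scalar U k) (hfrc U U s x) = hcls U U (frag_of (k \<otimes>\<^bsub>K\<^esub> q s, x))"
    "Comp B U U U (hfrc U U s x) (scalar U k) = hcls U U (frag_of (k \<otimes>\<^bsub>K\<^esub> q s, x))"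
proof -
  have i: "Id C U \<in> carrier (Hom C U U)" by (rule lc.id_closed[OF U])
  show "Comp B U U U (scalar U k) (hfrc U U s x) = hcls U U (frag_of (k \<otimes>\<^bsub>K\<^esub> q s, x))"
    unfolding scalar_def hfrc_def using k i x q_T[OF s] lc.comp_id_left[OF U U x]
    by (subst Comp_cls[OF U U U]) (auto simp: fcomp_frag)
  have "q s \<otimes>\<^bsub>K\<^esub> k = k \<otimes>\<^bsub>K\<^esub> q s" using T_sub_K k q_simps(1)[OF s] by (simp add: K.m_comm)
  thus "Comp B U U U (hfrc U U s x) (scalar U k) = hcls U U (frag_of (k \<otimes>\<^bsub>K\<^esub> q s, x))"
    unfolding scalar_def hfrc_def using k i x q_T[OF s] lc.comp_id_right[OF U U x]
    by (subst Comp_cls[OF U U U]) (auto simp: fcomp_frag)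
qed

lemma scalar_iota:
  assumes U: "U \<in> Obj C" and r: "r \<in> carrier R"
  shows "scalar U (\<iota> r) = hfrc U U \<one>\<^bsub>R\<^esub> (r \<odot>\<^bsub>Hom C U U\<^esub> Id C U)"
proof -
  interpret UU: tensor_module R K \<iota> P "Hom C U U" by (rule tensor_module[OF U U])
  show ?thesis unfolding scalar_def hfrc_def UU.cls_eq
    using UU.rel3[OF q_T[OF W_one] r lc.id_closed[OF U]] r by simp
qed

lemma scalar_central:
  assumes U: "U \<in> Obj C" and k: "k \<in> carrier T" and m: "m \<in> carrier (End_ring B U)"
  shows "scalar U k \<otimes>\<^bsub>End_ring B U\<^esub> m = m \<otimes>\<^bsub>End_ring B U\<^esub> scalar U k"
proof -
  obtain s x where "s \<in> carrier R - P" "x \<in> carrier (Hom C U U)" "m = hfrc U U s x"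
    using hfrc_exists[OF U U] m unfolding End_ring_simps by meson
  thus ?thesis using Comp_scalar[OF U k] by simp
qed

lemma hfrc_eq_scalar:
  assumes U: "U \<in> Obj C" and s: "s \<in> carrier R - P" and x: "x \<in> carrier (Hom C U U)"
  shows "hfrc U U s x = scalar U (q s) \<otimes>\<^bsub>End_ring B U\<^esub> hfrc U U \<one>\<^bsub>R\<^esub> x"
  using Comp_scalar(1)[OF U q_T[OF s] W_one x] q_simps(1)[OF s] unfolding hfrc_def by simp

lemma hfrc_eqD:
  assumes "U \<in> Obj C" "V \<in> Obj C" "s \<in> carrier R - P" "x \<in> carrier (Hom C U V)"
    "t \<in> carrier R - P" "y \<in> carrier (Hom C U V)" "hfrc U V s x = hfrc U V t y"
  shows "\<exists>w \<in> carrier R - P. (w \<otimes>\<^bsub>R\<^esub> t) \<odot>\<^bsub>Hom C U V\<^esub> x = (w \<otimes>\<^bsub>R\<^esub> s) \<odot>\<^bsub>Hom C U V\<^esub> y"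
  using tensor_module.frc_eqD[OF tensor_module[OF assms(1,2)] assms(3-6)] assms(7) unfolding hfrc_eq[OF assms(1,2)] .

end

section \<open>Commutators of units modulo the prime radical\<close>

context ring
begin

lemma ideal_sum_prod_subset:
  assumes P: "ideal P R" and I: "ideal I R" and J: "ideal J R" and IJ: "I \<cdot> J \<subseteq> P"
    and xy: "x \<in> P <+>\<^bsub>R\<^esub> I" "y \<in> P <+>\<^bsub>R\<^esub> J"
  shows "x \<otimes> y \<in> P"
proof -
  interpret P: ideal P R by fact
  interpret I: ideal I R by fact
  interpret J: ideal J R by fact
  obtain p i q j where *: "p \<in> P" "i \<in> I" "q \<in> P" "j \<in> J" "x = p \<oplus> i" "y = q \<oplus> j"
    using xy unfolding set_add_def' by auto
  have c: "p \<in> carrier R" "i \<in> carrier R" "q \<in> carrier R" "j \<in> carrier R"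
    using * P.Icarr I.Icarr J.Icarr by auto
  have ij: "i \<otimes> j \<in> P" using ideal_prod.prod[of i I j J] * IJ by auto
  have "x \<otimes> y = p \<otimes> (q \<oplus> j) \<oplus> (i \<otimes> q \<oplus> i \<otimes> j)"
    unfolding * using c by (simp add: nc_simps)
  thus ?thesis using * c ij P.I_l_closed P.I_r_closed by simp
qed

text \<open>An ideal that is maximal among those missing all powers of \<open>x\<close> is prime.\<close>

lemma prime_radical_nilpotent:
  assumes "x \<in> prime_radical R" shows "\<exists>k::nat. x [^] k = \<zero>"
proof (rule ccontr)
  assume no: "\<nexists>k::nat. x [^] k = \<zero>"
  have x: "x \<in> carrier R" "\<And>P. nc_prime_ideal P R \<Longrightarrow> x \<in> P"
    using assms unfolding prime_radical_def by auto
  let ?F = "{I. ideal I R \<and> (\<forall>k::nat. x [^] k \<notin> I)}"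
  have z: "{\<zero>} \<in> ?F" using no zeroideal by auto
  have "\<exists>M \<in> ?F. \<forall>I \<in> ?F. M \<subseteq> I \<longrightarrow> I = M"
  proof (rule subset_Zorn_nonempty)
    show "?F \<noteq> {}" using z by blast
    fix C assume C: "C \<noteq> {}" "subset.chain ?F C"
    hence "subset.chain {I. ideal I R} C" unfolding pred_on.chain_def by auto
    from chain_Union_is_ideal[OF this] C(1) have "ideal (\<Union>C) R" by simp
    moreover have "\<forall>k::nat. x [^] k \<notin> \<Union>C" using C(2) unfolding pred_on.chain_def by blast
    ultimately show "\<Union>C \<in> ?F" by blast
  qed
  then obtain P where P0: "P \<in> ?F" "\<forall>I \<in> ?F. P \<subseteq> I \<longrightarrow> I = P" by (rule bexE)
  hence P: "ideal P R" "\<And>k::nat. x [^] k \<notin> P" by auto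
  interpret P: ideal P R by fact
  have "nc_prime_ideal P R"
    unfolding nc_prime_ideal_def
  proof (intro conjI allI impI P(1))
    show "P \<noteq> carrier R" using P(2)[of 0] by auto
    fix I J assume IJ: "ideal I R" "ideal J R" "I \<cdot> J \<subseteq> P"
    have meet: "\<exists>k::nat. x [^] k \<in> P <+>\<^bsub>R\<^esub> I" if I: "ideal I R" "\<not> I \<subseteq> P" for I
    proof (rule ccontr)
      assume n: "\<nexists>k::nat. x [^] k \<in> P <+>\<^bsub>R\<^esub> I"
      interpret I: ideal I R by fact
      have id: "ideal (P <+>\<^bsub>R\<^esub> I) R" by (rule add_ideals[OF P(1) I(1)])
      have "P <+>\<^bsub>R\<^esub> I \<in> ?F" using id n by auto
      moreover have PI: "P \<subseteq> P <+>\<^bsub>R\<^esub> I"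
      proof
        fix p assume "p \<in> P"
        moreover from this have "p = p \<oplus> \<zero>" using P.Icarr by simp
        ultimately show "p \<in> P <+>\<^bsub>R\<^esub> I" using I.zero_closed unfolding set_add_def' by blast
      qed
      ultimately have "P <+>\<^bsub>R\<^esub> I = P" using P0(2) by blast
      moreover have "I \<subseteq> P <+>\<^bsub>R\<^esub> I"
      proof
        fix p assume "p \<in> I"
        moreover from this have "p = \<zero> \<oplus> p" using I.Icarr by simp
        ultimately show "p \<in> P <+>\<^bsub>R\<^esub> I" using P.zero_closed unfolding set_add_def' by blast
      qed
      ultimately show False using I(2) by simp
    qed
    show "I \<subseteq> P \<or> J \<subseteq> P"
    proof (rule ccontr)
      assume "\<not> (I \<subseteq> P \<or> J \<subseteq> P)"
      then obtain k l :: nat where kl: "x [^] k \<in> P <+>\<^bsub>R\<^esub> I" "x [^] l \<in> P <+>\<^bsub>R\<^esub> J"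
        using meet IJ by meson
      have "x [^] k \<otimes> x [^] l \<in> P" by (rule ideal_sum_prod_subset[OF P(1) IJ kl])
      thus False using P(2)[of "k + l"] x(1) by (simp add: nat_pow_mult)
    qed
  qed
  hence "x [^] (1::nat) \<in> P" using x by simp
  thus False using P(2) by blast
qed

lemma prime_radical_ideal: "ideal (prime_radical R) R"
proof (rule idealI[OF ring_axioms])
  have P: "ideal P R" if "nc_prime_ideal P R" for P using that unfolding nc_prime_ideal_def by auto
  show "subgroup (prime_radical R) (add_monoid R)"
  proof (rule group.subgroupI[OF add.group_axioms])
    fix a assume a: "a \<in> prime_radical R"
    hence "\<ominus> a \<in> prime_radical R" unfolding prime_radical_def
      using additive_subgroup.a_inv_closed[OF ideal.axioms(1)[OF P]] by auto
    thus "inv\<^bsub>add_monoid R\<^esub> a \<in> prime_radical R" by (simp add: a_inv_def)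
  next
    have "\<zero> \<in> prime_radical R" unfolding prime_radical_def
      using additive_subgroup.zero_closed[OF ideal.axioms(1)[OF P]] by auto
    thus "prime_radical R \<noteq> {}" by blast
  next
    fix a b assume "a \<in> prime_radical R" "b \<in> prime_radical R"
    thus "a \<otimes>\<^bsub>add_monoid R\<^esub> b \<in> prime_radical R" unfolding prime_radical_def
      using additive_subgroup.a_closed[OF ideal.axioms(1)[OF P]] by auto
  qed (auto simp: prime_radical_def)
  fix a x assume "a \<in> prime_radical R" "x \<in> carrier R"
  thus "x \<otimes> a \<in> prime_radical R" "a \<otimes> x \<in> prime_radical R"
    unfolding prime_radical_def using ideal.I_l_closed[OF P] ideal.I_r_closed[OF P] by auto
qed

text \<open>Unipotent elements lift along quotients by nil ideals.\<close>

lemma commutators_unipotent_Quot: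
  assumes I: "ideal I R" and nil: "\<And>x. x \<in> I \<Longrightarrow> \<exists>k::nat. x [^] k = \<zero>"
    and cu: "commutators_unipotent (R Quot I)"
  shows "commutators_unipotent R"
  unfolding commutators_unipotent_def
proof (intro ballI)
  interpret I: ideal I R by fact
  let ?Q = "R Quot I" and ?h = "(+>) I"
  interpret Q: ring ?Q by (rule I.quotient_is_ring)
  interpret h: ring_hom_ring R ?Q ?h by (rule I.rcos_ring_hom_ring)
  have surj: "\<exists>x \<in> carrier R. a = ?h x" if "a \<in> carrier ?Q" for a
    using that unfolding FactRing_def A_RCOSETS_def' by auto
  have eq: "?h x = ?h y \<longleftrightarrow> x \<ominus> y \<in> I" if "x \<in> carrier R" "y \<in> carrier R" for x y
    using quotient_eq_iff_same_a_r_cos[OF I.is_ideal that] by simp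
  have hz: "?h x = \<zero>\<^bsub>?Q\<^esub> \<longleftrightarrow> x \<in> I" if "x \<in> carrier R" for x
    using eq[OF that zero_closed] that h.hom_zero by (simp add: nc_simps)
  have lift: "\<exists>y \<in> unipotent_products R. a = ?h y" if "a \<in> unipotent_products ?Q" for a
    using that
  proof (induction rule: unipotent_products.induct)
    case one
    show ?case using unipotent_products.one[of R] h.hom_one by metis
  next
    case (step a n k)
    obtain y where y: "y \<in> unipotent_products R" "a = ?h y" using step.IH by (elim bexE)
    obtain m where m: "m \<in> carrier R" "n = ?h m" using surj[OF step.hyps(2)] by (elim bexE)
    \<comment> \<open>A lift of a nilpotent element has a power in the nil ideal, so it is nilpotent
      itself, with a larger exponent.\<close>
    have "?h (m [^] k) = \<zero>\<^bsub>?Q\<^esub>" using step.hyps(3) m by (simp add: h.hom_nat_pow)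
    hence mI: "m [^] k \<in> I" using hz m by simp
    obtain l :: nat where l: "(m [^] k) [^] l = \<zero>" using nil[OF mI] by (elim exE)
    hence "m [^] (k * l) = \<zero>" using m by (simp add: nat_pow_pow)
    hence "y \<otimes> (\<one> \<oplus> m) \<in> unipotent_products R" by (rule unipotent_products.step[OF y(1) m(1)])
    moreover have "a \<otimes>\<^bsub>?Q\<^esub> (\<one>\<^bsub>?Q\<^esub> \<oplus>\<^bsub>?Q\<^esub> n) = ?h (y \<otimes> (\<one> \<oplus> m))"
      using y m unipotent_products_Units[OF y(1)] by simp
    ultimately show ?case by (rule bexI[rotated])
  qed
  fix x y assume xy: "x \<in> Units R" "y \<in> Units R"
  have hu: "?h u \<in> Units ?Q" "inv\<^bsub>?Q\<^esub> (?h u) = ?h (inv u)" if "u \<in> Units R" for u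
  proof -
    have "?h (inv u) \<otimes>\<^bsub>?Q\<^esub> ?h u = ?h (inv u \<otimes> u)" "?h u \<otimes>\<^bsub>?Q\<^esub> ?h (inv u) = ?h (u \<otimes> inv u)"
      using that by (simp_all del: Units_l_inv Units_r_inv)
    hence *: "?h (inv u) \<otimes>\<^bsub>?Q\<^esub> ?h u = \<one>\<^bsub>?Q\<^esub>" "?h u \<otimes>\<^bsub>?Q\<^esub> ?h (inv u) = \<one>\<^bsub>?Q\<^esub>" "?h u \<in> carrier ?Q" "?h (inv u) \<in> carrier ?Q"
      using that by simp_all
    thus "?h u \<in> Units ?Q" unfolding Units_def by blast
    show "inv\<^bsub>?Q\<^esub> (?h u) = ?h (inv u)" using * by (intro Q.inv_unique'[symmetric])
  qed
  let ?c = "x \<otimes> y \<otimes> inv x \<otimes> inv y"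
  have cU: "?c \<in> Units R" using xy by auto
  have "?h ?c = ?h x \<otimes>\<^bsub>?Q\<^esub> ?h y \<otimes>\<^bsub>?Q\<^esub> inv\<^bsub>?Q\<^esub> (?h x) \<otimes>\<^bsub>?Q\<^esub> inv\<^bsub>?Q\<^esub> (?h y)"
    using xy hu by simp
  also have "\<dots> \<in> unipotent_products ?Q" using cu hu xy unfolding commutators_unipotent_def by blast
  finally obtain u where u: "u \<in> unipotent_products R" "?h ?c = ?h u" using lift by blast
  have uU: "u \<in> Units R" using unipotent_products_Units[OF u(1)] .
  have "?c \<ominus> u \<in> I" using u(2) eq uU cU by simp
  hence i: "(?c \<ominus> u) \<otimes> inv u \<in> I" using uU by (intro I.I_r_closed) auto
  \<comment> \<open>The commutator agrees with the lifted product \<open>u\<close> up to a factor 1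
    plus an element of \<open>I\<close>, which is unipotent.\<close>
  have "?c = (\<one> \<oplus> (?c \<ominus> u) \<otimes> inv u) \<otimes> u"
  proof -
    have "(\<one> \<oplus> (?c \<ominus> u) \<otimes> inv u) \<otimes> u = u \<oplus> (?c \<ominus> u) \<otimes> (inv u \<otimes> u)"
      using uU cU by (simp add: l_distr m_assoc del: Units_l_inv)
    thus ?thesis using uU cU by (simp add: a_minus_def a_assoc a_comm a_lcomm l_neg r_neg r_neg1 r_neg2 cancel_deep)
  qed
  moreover have "\<one> \<oplus> (?c \<ominus> u) \<otimes> inv u \<in> unipotent_products R"
    using nil[OF i] I.Icarr[OF i] unipotent_in_unipotent_products by blast
  ultimately show "?c \<in> unipotent_products R" using unipotent_products_mult[OF u(1)] by metis
qed

end

lemma unipotent_products_hom: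
  assumes h: "ring_hom_ring R S h" and x: "x \<in> unipotent_products R"
  shows "h x \<in> unipotent_products S"
proof -
  interpret ring_hom_ring R S h by fact
  show ?thesis using x
  proof (induction rule: unipotent_products.induct)
    case one
    thus ?case using unipotent_products.one[of S] by simp
  next
    case (step x n k)
    have "h n [^]\<^bsub>S\<^esub> k = \<zero>\<^bsub>S\<^esub>" using step.hyps hom_nat_pow[of n k] by simp
    thus ?case using unipotent_products.step[OF step.IH, of "h n" k] step.hyps R.unipotent_products_Units[OF step.hyps(1)] by simp
  qed
qed

lemma commutators_unipotent_iso:
  assumes R: "ring R" and S: "ring S" and h: "h \<in> ring_iso R S" and cu: "commutators_unipotent S"
  shows "commutators_unipotent R"
  unfolding commutators_unipotent_def
proof (intro ballI)
  interpret R: ring R by fact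
  interpret S: ring S by fact
  interpret h: ring_hom_ring R S h by (rule ring_hom_ringI2[OF R S]) (use h in \<open>auto simp: ring_iso_def\<close>)
  define g where "g = inv_into (carrier R) h"
  have gi: "g \<in> ring_iso S R" unfolding g_def by (rule ring_iso_set_sym[OF R h])
  interpret g: ring_hom_ring S R g by (rule ring_hom_ringI2[OF S R]) (use gi in \<open>auto simp: ring_iso_def\<close>)
  have gh: "g (h x) = x" if "x \<in> carrier R" for x
    unfolding g_def using h that by (intro inv_into_f_f) (auto simp: ring_iso_def bij_betw_def)
  fix x y assume xy: "x \<in> Units R" "y \<in> Units R"
  have hu: "h u \<in> Units S" "inv\<^bsub>S\<^esub> (h u) = h (inv\<^bsub>R\<^esub> u)" if "u \<in> Units R" for u
  proof -
    have "h (inv\<^bsub>R\<^esub> u) \<otimes>\<^bsub>S\<^esub> h u = h (inv\<^bsub>R\<^esub> u \<otimes>\<^bsub>R\<^esub> u)" "h u \<otimes>\<^bsub>S\<^esub> h (inv\<^bsub>R\<^esub> u) = h (u \<otimes>\<^bsub>R\<^esub> inv\<^bsub>R\<^esub> u)"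
      using that by (simp_all del: R.Units_l_inv R.Units_r_inv)
    hence *: "h (inv\<^bsub>R\<^esub> u) \<otimes>\<^bsub>S\<^esub> h u = \<one>\<^bsub>S\<^esub>" "h u \<otimes>\<^bsub>S\<^esub> h (inv\<^bsub>R\<^esub> u) = \<one>\<^bsub>S\<^esub>" "h u \<in> carrier S" "h (inv\<^bsub>R\<^esub> u) \<in> carrier S"
      using that by simp_all
    thus "h u \<in> Units S" unfolding Units_def by blast
    show "inv\<^bsub>S\<^esub> (h u) = h (inv\<^bsub>R\<^esub> u)" using * by (intro S.inv_unique'[symmetric])
  qed
  have "h x \<otimes>\<^bsub>S\<^esub> h y \<otimes>\<^bsub>S\<^esub> inv\<^bsub>S\<^esub> (h x) \<otimes>\<^bsub>S\<^esub> inv\<^bsub>S\<^esub> (h y) \<in> unipotent_products S"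
    using cu hu(1)[OF xy(1)] hu(1)[OF xy(2)] unfolding commutators_unipotent_def by blast
  hence "h (x \<otimes>\<^bsub>R\<^esub> y \<otimes>\<^bsub>R\<^esub> inv\<^bsub>R\<^esub> x \<otimes>\<^bsub>R\<^esub> inv\<^bsub>R\<^esub> y) \<in> unipotent_products S"
    unfolding hu(2)[OF xy(1)] hu(2)[OF xy(2)] using xy by simp
  from unipotent_products_hom[OF g.ring_hom_ring_axioms this]
  show "x \<otimes>\<^bsub>R\<^esub> y \<otimes>\<^bsub>R\<^esub> inv\<^bsub>R\<^esub> x \<otimes>\<^bsub>R\<^esub> inv\<^bsub>R\<^esub> y \<in> unipotent_products R"
    using gh xy by simp
qed

lemma RDirProd_simps [simp]:
  "carrier (RDirProd R S) = carrier R \<times> carrier S"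
  "(a, b) \<otimes>\<^bsub>RDirProd R S\<^esub> (c, d) = (a \<otimes>\<^bsub>R\<^esub> c, b \<otimes>\<^bsub>S\<^esub> d)"
  "(a, b) \<oplus>\<^bsub>RDirProd R S\<^esub> (c, d) = (a \<oplus>\<^bsub>R\<^esub> c, b \<oplus>\<^bsub>S\<^esub> d)"
  "\<one>\<^bsub>RDirProd R S\<^esub> = (\<one>\<^bsub>R\<^esub>, \<one>\<^bsub>S\<^esub>)" "\<zero>\<^bsub>RDirProd R S\<^esub> = (\<zero>\<^bsub>R\<^esub>, \<zero>\<^bsub>S\<^esub>)"
  by (simp_all add: RDirProd_def DirProd_def monoid.defs)

lemma RDirProd_pow: "(a, b) [^]\<^bsub>RDirProd R S\<^esub> (k::nat) = (a [^]\<^bsub>R\<^esub> k, b [^]\<^bsub>S\<^esub> k)"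
  by (induction k) (simp_all add: nat_pow_def)

lemma commutators_unipotent_RDirProd:
  assumes R: "ring R" and S: "ring S" and cu: "commutators_unipotent R" "commutators_unipotent S"
  shows "commutators_unipotent (RDirProd R S)"
  unfolding commutators_unipotent_def
proof (intro ballI)
  interpret R: ring R by fact
  interpret S: ring S by fact
  let ?D = "RDirProd R S"
  interpret D: ring ?D by (rule RDirProd_ring[OF R S])
  have un: "fst u \<in> Units R" "snd u \<in> Units S" "inv\<^bsub>?D\<^esub> u = (inv\<^bsub>R\<^esub> fst u, inv\<^bsub>S\<^esub> snd u)" if uU: "u \<in> Units ?D" for u
  proof -
    obtain a b where u: "u = (a, b)" by force
    obtain v where v: "v \<in> carrier ?D" "v \<otimes>\<^bsub>?D\<^esub> u = \<one>\<^bsub>?D\<^esub>" "u \<otimes>\<^bsub>?D\<^esub> v = \<one>\<^bsub>?D\<^esub>" "u \<in> carrier ?D"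
      using uU unfolding Units_def by blast
    obtain c d where cd: "v = (c, d)" by force
    have *: "a \<in> carrier R" "b \<in> carrier S" "c \<in> carrier R" "d \<in> carrier S" "c \<otimes>\<^bsub>R\<^esub> a = \<one>\<^bsub>R\<^esub>" "a \<otimes>\<^bsub>R\<^esub> c = \<one>\<^bsub>R\<^esub>"
      "d \<otimes>\<^bsub>S\<^esub> b = \<one>\<^bsub>S\<^esub>" "b \<otimes>\<^bsub>S\<^esub> d = \<one>\<^bsub>S\<^esub>" using v unfolding u cd by auto
    show "fst u \<in> Units R" "snd u \<in> Units S" unfolding u Units_def using * by auto
    have "c = inv\<^bsub>R\<^esub> a" "d = inv\<^bsub>S\<^esub> b" using R.inv_unique'[of a c] S.inv_unique'[of b d] * by auto
    moreover have "v = inv\<^bsub>?D\<^esub> u" by (rule D.inv_unique'[OF v(4,1,3,2)])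
    ultimately show "inv\<^bsub>?D\<^esub> u = (inv\<^bsub>R\<^esub> fst u, inv\<^bsub>S\<^esub> snd u)" unfolding u cd by simp
  qed
  have l: "(a, \<one>\<^bsub>S\<^esub>) \<in> unipotent_products ?D" if "a \<in> unipotent_products R" for a
    using that
  proof (induction rule: unipotent_products.induct)
    case one
    show ?case using unipotent_products.one[of ?D] by simp
  next
    case (step a n k)
    \<comment> \<open>With exponent zero the second component would be 1 instead of 0, hence
      \<open>Suc k\<close>.\<close>
    have "(n, \<zero>\<^bsub>S\<^esub>) [^]\<^bsub>?D\<^esub> Suc k = \<zero>\<^bsub>?D\<^esub>" using step.hyps(2,3) by (simp add: RDirProd_pow)
    from unipotent_products.step[OF step.IH _ this] step.hyps(2) show ?case by simp
  qed
  have r: "(\<one>\<^bsub>R\<^esub>, b) \<in> unipotent_products ?D" if "b \<in> unipotent_products S" for b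
    using that
  proof (induction rule: unipotent_products.induct)
    case one
    show ?case using unipotent_products.one[of ?D] by simp
  next
    case (step a n k)
    have "(\<zero>\<^bsub>R\<^esub>, n) [^]\<^bsub>?D\<^esub> Suc k = \<zero>\<^bsub>?D\<^esub>" using step.hyps(2,3) by (simp add: RDirProd_pow)
    from unipotent_products.step[OF step.IH _ this] step.hyps(2) show ?case by simp
  qed
  fix x y assume xy: "x \<in> Units ?D" "y \<in> Units ?D"
  obtain a b where x: "x = (a, b)" by force
  obtain c d where y: "y = (c, d)" by force
  have u: "a \<in> Units R" "b \<in> Units S" "c \<in> Units R" "d \<in> Units S" using un(1,2)[OF xy(1)] un(1,2)[OF xy(2)] x y by auto
  let ?f = "a \<otimes>\<^bsub>R\<^esub> c \<otimes>\<^bsub>R\<^esub> inv\<^bsub>R\<^esub> a \<otimes>\<^bsub>R\<^esub> inv\<^bsub>R\<^esub> c" and ?g = "b \<otimes>\<^bsub>S\<^esub> d \<otimes>\<^bsub>S\<^esub> inv\<^bsub>S\<^esub> b \<otimes>\<^bsub>S\<^esub> inv\<^bsub>S\<^esub> d"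
  have fg: "?f \<in> unipotent_products R" "?g \<in> unipotent_products S" using cu u unfolding commutators_unipotent_def by auto
  have "x \<otimes>\<^bsub>?D\<^esub> y \<otimes>\<^bsub>?D\<^esub> inv\<^bsub>?D\<^esub> x \<otimes>\<^bsub>?D\<^esub> inv\<^bsub>?D\<^esub> y = (?f, ?g)"
    unfolding un(3)[OF xy(1)] un(3)[OF xy(2)] unfolding x y by simp
  also have "(?f, ?g) = (?f, \<one>\<^bsub>S\<^esub>) \<otimes>\<^bsub>?D\<^esub> (\<one>\<^bsub>R\<^esub>, ?g)" using u by simp
  also have "\<dots> \<in> unipotent_products ?D" by (rule D.unipotent_products_mult[OF r[OF fg(2)] l[OF fg(1)]])
  finally show "x \<otimes>\<^bsub>?D\<^esub> y \<otimes>\<^bsub>?D\<^esub> inv\<^bsub>?D\<^esub> x \<otimes>\<^bsub>?D\<^esub> inv\<^bsub>?D\<^esub> y \<in> unipotent_products ?D" .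
qed

lemma commutators_unipotent_RDirProd_list:
  assumes "\<And>S. S \<in> set Rs \<Longrightarrow> ring S \<and> commutators_unipotent S"
  shows "ring (RDirProd_list Rs) \<and> commutators_unipotent (RDirProd_list Rs)"
  using assms
proof (induction Rs)
  case Nil
  have "commutators_unipotent (nil_ring :: 'a list ring)"
    unfolding commutators_unipotent_def
  proof (intro ballI)
    fix x y assume "x \<in> Units (nil_ring :: 'a list ring)" "y \<in> Units (nil_ring :: 'a list ring)"
    interpret ring "nil_ring :: 'a list ring" by (rule RDirProd_list_is_ring[of "[]", simplified])
    have "x \<otimes>\<^bsub>nil_ring\<^esub> y \<otimes>\<^bsub>nil_ring\<^esub> inv\<^bsub>nil_ring\<^esub> x \<otimes>\<^bsub>nil_ring\<^esub> inv\<^bsub>nil_ring\<^esub> y \<in> carrier (nil_ring :: 'a list ring)"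
      using \<open>x \<in> _\<close> \<open>y \<in> _\<close> by blast
    moreover have "\<one>\<^bsub>nil_ring\<^esub> \<in> carrier (nil_ring :: 'a list ring)" by (rule one_closed)
    moreover have "a = b" if "a \<in> carrier (nil_ring :: 'a list ring)" "b \<in> carrier (nil_ring :: 'a list ring)" for a b :: "'a list"
      using that by (simp add: monoid.defs)
    ultimately show "x \<otimes>\<^bsub>nil_ring\<^esub> y \<otimes>\<^bsub>nil_ring\<^esub> inv\<^bsub>nil_ring\<^esub> x \<otimes>\<^bsub>nil_ring\<^esub> inv\<^bsub>nil_ring\<^esub> y \<in> unipotent_products (nil_ring :: 'a list ring)"
      using unipotent_products.one by metis
  qed
  thus ?case using RDirProd_list_is_ring[of "[]", simplified] by simp
next
  case (Cons S Rs)
  have S: "ring S" "commutators_unipotent S" and L: "ring (RDirProd_list Rs)" "commutators_unipotent (RDirProd_list Rs)"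
    using Cons by auto
  let ?D = "RDirProd S (RDirProd_list Rs)" and ?f = "\<lambda>(a, as). a # as"
  have D: "ring ?D" "commutators_unipotent ?D"
    using RDirProd_ring[OF S(1) L(1)] commutators_unipotent_RDirProd[OF S(1) L(1) S(2) L(2)] by auto
  have e: "RDirProd_list (S # Rs) = image_ring ?f ?D" unfolding RDirProd_list_def by simp
  have inj: "inj_on ?f (carrier ?D)" by (auto simp: inj_on_def)
  have iso: "?f \<in> ring_iso ?D (image_ring ?f ?D)" by (rule inj_imp_image_ring_iso[OF inj])
  have ring: "ring (image_ring ?f ?D)" using ring.inj_imp_image_ring_is_ring[OF D(1) inj] .
  have "inv_into (carrier ?D) ?f \<in> ring_iso (image_ring ?f ?D) ?D" by (rule ring_iso_set_sym[OF D(1) iso])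
  from commutators_unipotent_iso[OF ring D(1) this D(2)] show ?case using ring unfolding e by simp
qed

subsection \<open>Matrix rings\<close>

context ring
begin

lemma unit_class_unipotent:
  assumes "u \<in> unipotent_products R" "x \<in> Units R"
  shows "unit_class R (u \<otimes> x) = unit_class R x" "unit_class R (x \<otimes> u) = unit_class R x"
proof -
  have u: "u \<in> Units R" by (rule unipotent_products_Units[OF assms(1)])
  have "u \<otimes> x \<otimes> inv x = u" using u assms(2) by (simp add: m_assoc)
  thus "unit_class R (u \<otimes> x) = unit_class R x"
    using unit_class_eq_iff[of "u \<otimes> x" x] u assms by simp
  show "unit_class R (x \<otimes> u) = unit_class R x"
    using unit_class_eq_iff[of "x \<otimes> u" x] u assms unipotent_products_conj by simp
qed

lemma square_zero_unipotent:
  assumes "n \<in> carrier R" "n \<otimes> n = \<zero>" shows "\<one> \<oplus> n \<in> unipotent_products R"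
  using unipotent_in_unipotent_products[of n 2] assms by (simp add: numeral_2_eq_2)

end

text \<open>An axiomatic form of the matrix rings over a skewfield: \<open>e i\<close> are the
  diagonal idempotents, and the nonzero elements of each Peirce component are invertible as maps
  between the indices. The two faithfulness conditions express that the \<open>e i\<close> exhaust
  the identity, without a sum.\<close>

locale matrix_units = ring R for R (structure) +
  fixes n :: nat and e :: "nat \<Rightarrow> 'a"
  assumes e_closed [simp]: "i < n \<Longrightarrow> e i \<in> carrier R"
    and e_idem: "i < n \<Longrightarrow> e i \<otimes> e i = e i"
    and e_orth: "\<lbrakk> i < n; j < n; i \<noteq> j \<rbrakk> \<Longrightarrow> e i \<otimes> e j = \<zero>"
    and e_nonzero: "i < n \<Longrightarrow> e i \<noteq> \<zero>"
    and faithful_left: "\<lbrakk> x \<in> carrier R; \<And>i. i < n \<Longrightarrow> e i \<otimes> x = \<zero> \<rbrakk> \<Longrightarrow> x = \<zero>"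
    and faithful_right: "\<lbrakk> x \<in> carrier R; \<And>i. i < n \<Longrightarrow> x \<otimes> e i = \<zero> \<rbrakk> \<Longrightarrow> x = \<zero>"
    and inverse: "\<lbrakk> i < n; j < n; z \<in> carrier R; e i \<otimes> z = z; z \<otimes> e j = z; z \<noteq> \<zero> \<rbrakk>
      \<Longrightarrow> \<exists>w \<in> carrier R. e j \<otimes> w = w \<and> w \<otimes> e i = w \<and> w \<otimes> z = e j \<and> z \<otimes> w = e i"
    and connected: "\<lbrakk> i < n; j < n \<rbrakk> \<Longrightarrow> \<exists>z \<in> carrier R. e i \<otimes> z = z \<and> z \<otimes> e j = z \<and> z \<noteq> \<zero>"
begin

text \<open>A block matrix with the identity at the indices in \<open>J\<close> and an arbitrary
  block at the others.\<close>

definition fixes_idempotents :: "nat set \<Rightarrow> 'a \<Rightarrow> bool" where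
  "fixes_idempotents J y \<longleftrightarrow> (\<forall>l \<in> J. e l \<otimes> y = e l \<and> y \<otimes> e l = e l)"

lemma off_diagonal:
  assumes "i < n" "j < n" "i \<noteq> j" "w \<in> carrier R" "e i \<otimes> w = w" "w \<otimes> e j = w"
  shows "\<one> \<oplus> w \<in> unipotent_products R" "\<one> \<oplus> w \<in> Units R"
proof -
  have "w \<otimes> w = \<zero>" by (rule zero_prod[of w "e j" "e i" w]) (use assms e_orth in auto)
  thus "\<one> \<oplus> w \<in> unipotent_products R" by (rule square_zero_unipotent[OF assms(4)])
  thus "\<one> \<oplus> w \<in> Units R" by (rule unipotent_products_Units)
qed

lemma fixes_left:
  assumes y: "fixes_idempotents J y" "y \<in> carrier R" and J: "J \<subseteq> {..<n}"
    and p: "p < n" "p \<notin> J" and w: "w \<in> carrier R" "e p \<otimes> w = w" "\<And>l. l \<in> J \<Longrightarrow> w \<otimes> e l = \<zero>"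
  shows "fixes_idempotents J ((\<one> \<oplus> w) \<otimes> y)"
  unfolding fixes_idempotents_def
proof
  fix l assume l: "l \<in> J"
  have ln: "l < n" "l \<noteq> p" using l J p by auto
  have yl: "e l \<otimes> y = e l" "y \<otimes> e l = e l" using y l unfolding fixes_idempotents_def by auto
  have "e l \<otimes> w = \<zero>" by (rule zero_prod[of _ "e l" "e p" w]) (use ln p w e_idem e_orth in auto)
  hence "e l \<otimes> ((\<one> \<oplus> w) \<otimes> y) = e l"
    using ln y w(1) yl m_assoc[of "e l" w y] by (simp add: l_distr r_distr)
  moreover have "(\<one> \<oplus> w) \<otimes> y \<otimes> e l = e l"
    using ln y w(1) yl w(3)[OF l] m_assoc[of "\<one> \<oplus> w" y "e l"] by (simp add: l_distr)
  ultimately show "e l \<otimes> ((\<one> \<oplus> w) \<otimes> y) = e l \<and> (\<one> \<oplus> w) \<otimes> y \<otimes> e l = e l" by simp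
qed

text \<open>Scaling a row is not a unipotent operation. Instead, a multiple of row \<open>i\<close>
  is added to row \<open>j\<close>, which brings the diagonal entry at \<open>j\<close> to 1 by
  means of an entry off the diagonal; then column \<open>j\<close> and row \<open>j\<close> are
  cleared.\<close>

lemma elimination_step:
  assumes J: "J \<subseteq> {..<n}" "j < n" "j \<notin> J" and i: "i < n" "i \<notin> J" "i \<noteq> j"
    and y: "y \<in> Units R" "fixes_idempotents J y" and nz: "e i \<otimes> y \<otimes> e j \<noteq> \<zero>"
  shows "\<exists>z \<in> Units R. unit_class R z = unit_class R y \<and> fixes_idempotents (insert j J) z"
proof -
  have yc: "y \<in> carrier R" using y by simp
  have yl: "e l \<otimes> y = e l" "y \<otimes> e l = e l" if "l \<in> J" for l
    using y(2) that unfolding fixes_idempotents_def by auto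
  have c: "e i \<otimes> y \<otimes> e j \<in> carrier R" "e i \<otimes> (e i \<otimes> y \<otimes> e j) = e i \<otimes> y \<otimes> e j" "e i \<otimes> y \<otimes> e j \<otimes> e j = e i \<otimes> y \<otimes> e j"
    using i J yc e_idem by (auto simp: m_assoc, auto simp: m_assoc[symmetric])
  obtain w0 where w0: "w0 \<in> carrier R" "e j \<otimes> w0 = w0" "w0 \<otimes> e i = w0" "w0 \<otimes> (e i \<otimes> y \<otimes> e j) = e j"
    using inverse[OF i(1) J(2) c nz] by (elim bexE conjE)
  \<comment> \<open>\<open>w0\<close> inverts the entry at \<open>(i, j)\<close>, so adding
    \<open>w\<close> times the matrix changes the diagonal entry by exactly its difference from
    \<open>e j\<close>.\<close>
  define w where "w = (e j \<ominus> e j \<otimes> y \<otimes> e j) \<otimes> w0"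
  have d: "e j \<ominus> e j \<otimes> y \<otimes> e j \<in> carrier R" using J yc by simp
  have wc: "w \<in> carrier R" unfolding w_def using d w0 by simp
  have ed: "e j \<otimes> (e j \<ominus> e j \<otimes> y \<otimes> e j) = e j \<ominus> e j \<otimes> y \<otimes> e j"
    using J yc e_idem m_assoc[of "e j" "e j" "y \<otimes> e j"] by (simp add: a_minus_def r_distr r_minus m_assoc)
  have w: "e j \<otimes> w = w" "w \<otimes> e i = w"
    unfolding w_def using ed d w0 J i m_assoc[of "e j" "e j \<ominus> e j \<otimes> y \<otimes> e j" w0] m_assoc[of _ w0 "e i"] by auto
  define y1 where "y1 = (\<one> \<oplus> w) \<otimes> y"
  have u1: "\<one> \<oplus> w \<in> unipotent_products R" "\<one> \<oplus> w \<in> Units R"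
    using off_diagonal[OF J(2) i(1) _ wc w] i by auto
  have y1: "y1 \<in> Units R" "y1 \<in> carrier R" "unit_class R y1 = unit_class R y"
    unfolding y1_def using u1 y unit_class_unipotent by auto
  have we: "w \<otimes> e l = \<zero>" if "l \<in> J" for l
    by (rule zero_prod[of w "e i" "e l"]) (use that J i wc w e_idem e_orth in auto)
  have f1: "fixes_idempotents J y1" unfolding y1_def
    by (rule fixes_left[OF y(2) yc J(1) J(2) J(3) wc w(1) we])
  have wy: "w \<otimes> y \<otimes> e j = e j \<ominus> e j \<otimes> y \<otimes> e j"
  proof -
    have "w \<otimes> y \<otimes> e j = (w \<otimes> e i) \<otimes> y \<otimes> e j" using w by simp
    also have "\<dots> = (e j \<ominus> e j \<otimes> y \<otimes> e j) \<otimes> (w0 \<otimes> (e i \<otimes> y \<otimes> e j))"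
      unfolding w_def using d w0(1) i J yc by (simp add: m_assoc)
    also have "\<dots> = e j \<ominus> e j \<otimes> y \<otimes> e j"
      unfolding w0(4) using J yc e_idem by (simp add: a_minus_def l_distr l_minus m_assoc)
    finally show ?thesis .
  qed
  have jj: "e j \<otimes> y1 \<otimes> e j = e j"
  proof -
    have "e j \<otimes> y1 \<otimes> e j = e j \<otimes> y \<otimes> e j \<oplus> (e j \<otimes> w) \<otimes> y \<otimes> e j"
      unfolding y1_def using J yc wc by (simp add: l_distr r_distr m_assoc)
    thus ?thesis unfolding w(1) wy using J yc by (simp add: a_minus_def a_assoc a_comm a_lcomm r_neg l_neg r_neg1 r_neg2 cancel_deep)
  qed
  have ejc: "e j \<in> carrier R" using J by simp
  \<comment> \<open>The part of column \<open>j\<close> off the diagonal. It has square zero because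
    its row \<open>j\<close> vanishes; \<open>b\<close> below plays the same role for row
    \<open>j\<close>.\<close>
  define a where "a = y1 \<otimes> e j \<ominus> e j"
  have a: "a \<in> carrier R" "a \<otimes> e j = a" "e j \<otimes> a = \<zero>"
    unfolding a_def using ejc y1(2) e_idem[OF J(2)] jj m_assoc[of "e j" y1 "e j"]
    by (simp_all add: a_minus_def l_distr r_distr l_minus r_minus m_assoc r_neg)
  have aa: "a \<otimes> a = \<zero>" using a ejc m_assoc[of a "e j" a] by simp
  have um: "\<one> \<ominus> a \<in> unipotent_products R" unfolding a_minus_def
    using square_zero_unipotent[of "\<ominus> a"] a aa by (simp add: l_minus r_minus)
  define y2 where "y2 = (\<one> \<ominus> a) \<otimes> y1"
  have y2: "y2 \<in> Units R" "y2 \<in> carrier R" "unit_class R y2 = unit_class R y1"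
    unfolding y2_def using um y1 unit_class_unipotent unipotent_products_Units[OF um] by auto
  have y1e: "y1 \<otimes> e j = e j \<oplus> a" unfolding a_def using y1(2) ejc
    by (simp add: a_minus_def a_assoc a_comm a_lcomm r_neg l_neg r_neg1 r_neg2 cancel_deep)
  have y2e: "y2 \<otimes> e j = e j"
  proof -
    have "y2 \<otimes> e j = (\<one> \<ominus> a) \<otimes> (e j \<oplus> a)" unfolding y2_def y1e[symmetric] using y1(2) a ejc by (simp add: m_assoc)
    also have "\<dots> = e j \<oplus> a \<ominus> a \<otimes> e j \<ominus> a \<otimes> a" using a(1) ejc
      by (simp add: a_minus_def l_distr r_distr l_minus minus_add a_assoc a_comm a_lcomm)
    finally show ?thesis using a aa ejc by (simp add: a_minus_def a_assoc r_neg)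
  qed
  have ey2: "e j \<otimes> y2 = e j \<otimes> y1"
  proof -
    have "e j \<otimes> y2 = e j \<otimes> y1 \<ominus> (e j \<otimes> a) \<otimes> y1" unfolding y2_def using a(1) ejc y1(2)
      by (simp add: a_minus_def l_distr r_distr l_minus r_minus m_assoc)
    thus ?thesis using a y1 ejc by (simp add: a_minus_def)
  qed
  define b where "b = e j \<otimes> y2 \<ominus> e j"
  have b: "b \<in> carrier R" "e j \<otimes> b = b" "b \<otimes> e j = \<zero>"
    unfolding b_def using ejc y2(2) e_idem[OF J(2)] y2e m_assoc[of "e j" "e j" y2]
    by (simp_all add: a_minus_def l_distr r_distr l_minus r_minus m_assoc r_neg)
  have bb: "b \<otimes> b = \<zero>" using b ejc m_assoc[of b "e j" b] by simp
  have ub: "\<one> \<ominus> b \<in> unipotent_products R" unfolding a_minus_def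
    using square_zero_unipotent[of "\<ominus> b"] b bb by (simp add: l_minus r_minus)
  define y3 where "y3 = y2 \<otimes> (\<one> \<ominus> b)"
  have y3: "y3 \<in> Units R" "y3 \<in> carrier R" "unit_class R y3 = unit_class R y2"
    unfolding y3_def using ub y2 unit_class_unipotent unipotent_products_Units[OF ub] by auto
  have y2b: "e j \<otimes> y2 = e j \<oplus> b" unfolding b_def using y2(2) ejc
    by (simp add: a_minus_def a_assoc a_comm a_lcomm r_neg l_neg r_neg1 r_neg2 cancel_deep)
  have ey3: "e j \<otimes> y3 = e j"
  proof -
    have "e j \<otimes> y3 = (e j \<oplus> b) \<otimes> (\<one> \<ominus> b)" unfolding y3_def y2b[symmetric] using y2(2) b ejc by (simp add: m_assoc)
    also have "\<dots> = e j \<oplus> b \<ominus> e j \<otimes> b \<ominus> b \<otimes> b" using b(1) ejc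
      by (simp add: a_minus_def l_distr r_distr r_minus minus_add a_assoc a_comm a_lcomm)
    finally show ?thesis using b bb ejc by (simp add: a_minus_def a_assoc r_neg)
  qed
  have y3e: "y3 \<otimes> e j = e j"
  proof -
    have "y3 \<otimes> e j = y2 \<otimes> e j \<ominus> y2 \<otimes> (b \<otimes> e j)" unfolding y3_def using b(1) ejc y2(2)
      by (simp add: a_minus_def l_distr r_distr l_minus r_minus m_assoc)
    thus ?thesis using b y2 y2e ejc by (simp add: a_minus_def)
  qed
  have y1l: "e l \<otimes> y1 = e l" "y1 \<otimes> e l = e l" if "l \<in> J" for l
    using f1 that unfolding fixes_idempotents_def by auto
  have lj: "e l \<in> carrier R" "e l \<otimes> e j = \<zero>" "e j \<otimes> e l = \<zero>" if "l \<in> J" for l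
    using that J e_orth by auto
  have la: "e l \<otimes> a = \<zero>" "a \<otimes> e l = \<zero>" if "l \<in> J" for l
  proof -
    have "e l \<otimes> a = (e l \<otimes> y1) \<otimes> e j \<ominus> e l \<otimes> e j" unfolding a_def using lj(1)[OF that] ejc y1(2)
      by (simp add: a_minus_def r_distr r_minus m_assoc)
    thus "e l \<otimes> a = \<zero>" using lj[OF that] y1l[OF that] by (simp add: a_minus_def)
    show "a \<otimes> e l = \<zero>" by (rule zero_prod[of a "e j" "e l"]) (use that a lj ejc J e_idem in auto)
  qed
  have y2l: "e l \<otimes> y2 = e l" "y2 \<otimes> e l = e l" if "l \<in> J" for l
  proof -
    have "e l \<otimes> y2 = e l \<otimes> y1 \<ominus> (e l \<otimes> a) \<otimes> y1" "y2 \<otimes> e l = y1 \<otimes> e l \<ominus> a \<otimes> (y1 \<otimes> e l)"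
      unfolding y2_def using lj[OF that] a(1) y1(2)
      by (simp_all add: a_minus_def l_distr r_distr l_minus r_minus m_assoc)
    thus "e l \<otimes> y2 = e l" "y2 \<otimes> e l = e l" using la[OF that] y1l[OF that] lj[OF that] y1(2) by (simp_all add: a_minus_def)
  qed
  have lb: "e l \<otimes> b = \<zero>" "b \<otimes> e l = \<zero>" if "l \<in> J" for l
  proof -
    have "b \<otimes> e l = e j \<otimes> (y2 \<otimes> e l) \<ominus> e j \<otimes> e l" unfolding b_def using lj(1)[OF that] ejc y2(2)
      by (simp add: a_minus_def l_distr l_minus m_assoc)
    thus "b \<otimes> e l = \<zero>" using lj[OF that] y2l[OF that] by (simp add: a_minus_def)
    show "e l \<otimes> b = \<zero>" by (rule zero_prod[of "e l" "e l" "e j" b]) (use that b lj ejc J e_idem in auto)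
  qed
  have "e l \<otimes> y3 = e l \<and> y3 \<otimes> e l = e l" if "l \<in> J" for l
  proof -
    have "e l \<otimes> y3 = e l \<otimes> y2 \<ominus> (e l \<otimes> y2) \<otimes> b" "y3 \<otimes> e l = y2 \<otimes> e l \<ominus> y2 \<otimes> (b \<otimes> e l)"
      unfolding y3_def using lj[OF that] b(1) y2(2)
      by (simp_all add: a_minus_def l_distr r_distr l_minus r_minus m_assoc)
    thus ?thesis using lb[OF that] y2l[OF that] lj[OF that] y2(2) by (simp add: a_minus_def)
  qed
  hence "fixes_idempotents (insert j J) y3" unfolding fixes_idempotents_def using ey3 y3e by auto
  thus ?thesis using y1(3) y2(3) y3 by (intro bexI[of _ y3]) auto
qed

text \<open>One index is always left over, and the class of the matrix ends up in its block. If
  column \<open>j\<close> has its only usable entry on the diagonal, that entry is first copied to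
  another row, which must exist; this is why \<open>J\<close> has to stay proper.\<close>

lemma elimination:
  assumes "finite J" "J \<subseteq> {..<n}" "J \<noteq> {..<n}" "x \<in> Units R"
  shows "\<exists>y \<in> Units R. unit_class R y = unit_class R x \<and> fixes_idempotents J y"
  using assms(1-3)
proof (induction J rule: finite_induct)
  case empty
  show ?case using assms(4) by (auto simp: fixes_idempotents_def)
next
  case (insert j J)
  have J: "J \<subseteq> {..<n}" "j < n" "j \<notin> J" "J \<noteq> {..<n}" using insert by auto
  obtain y where y: "y \<in> Units R" "unit_class R y = unit_class R x" "fixes_idempotents J y"
    using insert.IH[OF J(1,4)] by (elim bexE conjE)
  have yc: "y \<in> carrier R" "e j \<in> carrier R" using y J by auto
  have "\<exists>y' \<in> Units R. unit_class R y' = unit_class R y \<and> fixes_idempotents J y' \<and>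
      (\<exists>i<n. i \<notin> J \<and> i \<noteq> j \<and> e i \<otimes> y' \<otimes> e j \<noteq> \<zero>)"
  proof (cases "\<exists>i<n. i \<notin> J \<and> i \<noteq> j \<and> e i \<otimes> y \<otimes> e j \<noteq> \<zero>")
    case True
    thus ?thesis using y by blast
  next
    case False
    have "y \<otimes> e j \<noteq> \<zero>"
    proof
      assume "y \<otimes> e j = \<zero>"
      hence "inv y \<otimes> (y \<otimes> e j) = \<zero>" using y by simp
      hence "e j = \<zero>" using y yc m_assoc[of "inv y" y "e j"] by simp
      thus False using e_nonzero J by blast
    qed
    then obtain i where i: "i < n" "e i \<otimes> (y \<otimes> e j) \<noteq> \<zero>" using faithful_left[of "y \<otimes> e j"] yc by auto
    have "i \<notin> J"
    proof
      assume "i \<in> J"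
      hence "e i \<otimes> y \<otimes> e j = \<zero>" using y(3) e_orth[OF i(1) J(2)] J unfolding fixes_idempotents_def by auto
      thus False using i yc m_assoc[of "e i" y "e j"] by simp
    qed
    hence nz: "e j \<otimes> y \<otimes> e j \<noteq> \<zero>" using False i yc m_assoc[of "e i" y "e j"] by auto
    \<comment> \<open>A row outside \<open>J\<close> and different from \<open>j\<close> to receive
      the copy of the diagonal entry.\<close>
    obtain k where k: "k < n" "k \<notin> J" "k \<noteq> j" using insert.prems by blast
    obtain z where z: "z \<in> carrier R" "e k \<otimes> z = z" "z \<otimes> e j = z" "z \<noteq> \<zero>"
      using connected[OF k(1) J(2)] by (elim bexE conjE)
    have c: "e j \<otimes> y \<otimes> e j \<in> carrier R" "e j \<otimes> (e j \<otimes> y \<otimes> e j) = e j \<otimes> y \<otimes> e j" "e j \<otimes> y \<otimes> e j \<otimes> e j = e j \<otimes> y \<otimes> e j"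
      using yc e_idem[OF J(2)] m_assoc[of "e j" "e j" "y \<otimes> e j"] by (auto simp: m_assoc)
    obtain w where w: "w \<in> carrier R" "(e j \<otimes> y \<otimes> e j) \<otimes> w = e j"
      using inverse[OF J(2) J(2) c nz] by (elim bexE conjE)
    have zl: "z \<otimes> e l = \<zero>" if "l \<in> J" for l
      by (rule zero_prod[of z "e j" "e l"]) (use that J z e_idem e_orth in auto)
    let ?y = "(\<one> \<oplus> z) \<otimes> y"
    have u: "\<one> \<oplus> z \<in> unipotent_products R" "\<one> \<oplus> z \<in> Units R" using off_diagonal[OF k(1) J(2) k(3) z(1-3)] .
    have f: "fixes_idempotents J ?y" by (rule fixes_left[OF y(3) yc(1) J(1) k(1,2) z(1,2) zl])
    have ek: "e k \<in> carrier R" using k by simp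
    have "e k \<otimes> y \<otimes> e j = \<zero>" using False k by blast
    moreover have "e k \<otimes> ?y \<otimes> e j = e k \<otimes> y \<otimes> e j \<oplus> (e k \<otimes> z) \<otimes> y \<otimes> e j"
      using ek yc z(1) by (simp add: l_distr r_distr m_assoc)
    ultimately have "e k \<otimes> ?y \<otimes> e j = (z \<otimes> e j) \<otimes> y \<otimes> e j" using z ek yc by simp
    also have "\<dots> = z \<otimes> (e j \<otimes> y \<otimes> e j)" using z(1) yc by (simp add: m_assoc)
    finally have ky: "e k \<otimes> ?y \<otimes> e j = z \<otimes> (e j \<otimes> y \<otimes> e j)" .
    have "e k \<otimes> ?y \<otimes> e j \<noteq> \<zero>"
    proof
      assume "e k \<otimes> ?y \<otimes> e j = \<zero>"
      hence "z \<otimes> (e j \<otimes> y \<otimes> e j) \<otimes> w = \<zero>" using ky w by simp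
      hence "z \<otimes> e j = \<zero>" using w z(1) c(1) m_assoc[of z "e j \<otimes> y \<otimes> e j" w] by simp
      thus False using z by simp
    qed
    thus ?thesis using u y f unit_class_unipotent(1)[OF u(1) y(1)] k by (intro bexI[of _ ?y]) auto
  qed
  then obtain y' i where y': "y' \<in> Units R" "unit_class R y' = unit_class R y" "fixes_idempotents J y'"
    "i < n" "i \<notin> J" "i \<noteq> j" "e i \<otimes> y' \<otimes> e j \<noteq> \<zero>" by (elim bexE conjE exE)
  from elimination_step[OF J(1-3) y'(4-6) y'(1,3,7)] y y' show ?case by auto
qed

text \<open>Modulo unipotent products, \<open>x\<close> can be concentrated at the index 0 and
  \<open>y\<close> at the index 1. Matrices that differ from 1 only at different diagonal places
  commute. This uses two distinct indices.\<close>

lemma matrix_units_commutators: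
  assumes n: "1 < n" shows "commutators_unipotent R"
proof (rule commutators_unipotentI, rule group.group_comm_groupI[OF unit_class_group])
  fix X' Y assume "X' \<in> carrier (unit_class_group R)" "Y \<in> carrier (unit_class_group R)"
  then obtain x y where x: "x \<in> Units R" "X' = unit_class R x" and y: "y \<in> Units R" "Y = unit_class R y"
    unfolding FactGroup_def RCOSETS_def unit_class_def by (auto simp: units_of_carrier)
 have ne: "{..<n} - {k} \<noteq> {..<n}" if "k < n" for k using that by auto
  obtain x' where x': "x' \<in> Units R" "unit_class R x' = unit_class R x" "fixes_idempotents ({..<n} - {0}) x'"
    using elimination[OF _ _ ne x(1), of 0] n by auto
  obtain y' where y': "y' \<in> Units R" "unit_class R y' = unit_class R y" "fixes_idempotents ({..<n} - {1}) y'"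
    using elimination[OF _ _ ne y(1), of 1] n by auto
  have vanish: "u \<otimes> v = \<zero>"
    if u: "u \<in> carrier R" "\<And>l. l < n \<Longrightarrow> l \<noteq> k \<Longrightarrow> u \<otimes> e l = \<zero>" and v: "v \<in> carrier R" "e k \<otimes> v = \<zero>" and k: "k < n" for u v k
  proof -
    have kc: "e k \<in> carrier R" using k by simp
    have "u \<ominus> u \<otimes> e k = \<zero>"
    proof (rule faithful_right)
      fix l assume l: "l < n"
      show "(u \<ominus> u \<otimes> e k) \<otimes> e l = \<zero>"
      proof (cases "l = k")
        case True
        thus ?thesis using u kc e_idem[OF k] by (simp add: a_minus_def l_distr l_minus m_assoc r_neg)
      next
        case False
        thus ?thesis using u kc l e_orth[OF k l] by (simp add: a_minus_def l_distr l_minus m_assoc)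
      qed
    qed (use u kc in simp)
    hence "u = u \<otimes> e k" using u kc by (simp add: r_right_minus_eq)
    hence "u \<otimes> v = u \<otimes> (e k \<otimes> v)" using u(1) v(1) kc by (metis m_assoc)
    thus ?thesis using u v by simp
  qed
  have c: "x' \<in> carrier R" "y' \<in> carrier R" using x' y' by auto
  have xe: "(x' \<ominus> \<one>) \<otimes> e l = \<zero>" "e l \<otimes> (x' \<ominus> \<one>) = \<zero>" if "l < n" "l \<noteq> 0" for l
    using x'(3) that c unfolding fixes_idempotents_def by (auto simp: a_minus_def l_distr r_distr l_minus r_minus r_neg)
  have ye: "(y' \<ominus> \<one>) \<otimes> e l = \<zero>" "e l \<otimes> (y' \<ominus> \<one>) = \<zero>" if "l < n" "l \<noteq> 1" for l
    using y'(3) that c unfolding fixes_idempotents_def by (auto simp: a_minus_def l_distr r_distr l_minus r_minus r_neg)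
  have 1: "(x' \<ominus> \<one>) \<otimes> (y' \<ominus> \<one>) = \<zero>"
    by (rule vanish[of _ 0]) (use xe ye(2)[of 0] n c in auto)
  have 2: "(y' \<ominus> \<one>) \<otimes> (x' \<ominus> \<one>) = \<zero>"
    by (rule vanish[of _ 1]) (use ye xe(2)[of 1] n c in auto)
  have e: "x' \<otimes> y' = (x' \<ominus> \<one>) \<otimes> (y' \<ominus> \<one>) \<oplus> (x' \<oplus> y' \<ominus> \<one>)" "y' \<otimes> x' = (y' \<ominus> \<one>) \<otimes> (x' \<ominus> \<one>) \<oplus> (x' \<oplus> y' \<ominus> \<one>)"
    using c by (simp_all add: nc_simps)
  have comm: "x' \<otimes> y' = y' \<otimes> x'" unfolding e 1 2 ..
  show "X' \<otimes>\<^bsub>unit_class_group R\<^esub> Y = Y \<otimes>\<^bsub>unit_class_group R\<^esub> X'"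
    unfolding x(2) y(2) x'(2)[symmetric] y'(2)[symmetric] unit_class_mult[OF x'(1) y'(1), symmetric]
      unit_class_mult[OF y'(1) x'(1), symmetric] comm ..
qed

end

section \<open>Matrix rings over rings and skewfields\<close>

lemma (in abelian_monoid) finsum_swap:
  assumes "finite A" "finite B" "\<And>a b. a \<in> A \<Longrightarrow> b \<in> B \<Longrightarrow> f a b \<in> carrier G"
  shows "(\<Oplus>a\<in>A. \<Oplus>b\<in>B. f a b) = (\<Oplus>b\<in>B. \<Oplus>a\<in>A. f a b)"
  using assms(1,3)
proof (induction A rule: finite_induct)
  case (insert x A)
  have c: "\<And>a b. a \<in> insert x A \<Longrightarrow> b \<in> B \<Longrightarrow> f a b \<in> carrier G" using insert by auto
  have "(\<Oplus>a\<in>insert x A. \<Oplus>b\<in>B. f a b) = (\<Oplus>b\<in>B. f x b) \<oplus> (\<Oplus>a\<in>A. \<Oplus>b\<in>B. f a b)"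
    using insert c by (intro finsum_insert) (auto intro!: finsum_closed)
  also have "\<dots> = (\<Oplus>b\<in>B. f x b) \<oplus> (\<Oplus>b\<in>B. \<Oplus>a\<in>A. f a b)" using insert by simp
  also have "\<dots> = (\<Oplus>b\<in>B. f x b \<oplus> (\<Oplus>a\<in>A. f a b))"
    using c by (intro finsum_addf[symmetric]) (auto intro!: finsum_closed)
  also have "\<dots> = (\<Oplus>b\<in>B. \<Oplus>a\<in>insert x A. f a b)"
  proof (rule finsum_cong')
    fix b assume "b \<in> B"
    thus "f x b \<oplus> (\<Oplus>a\<in>A. f a b) = (\<Oplus>a\<in>insert x A. f a b)"
      using insert c by (intro finsum_insert[symmetric]) auto
  qed (use c in \<open>auto intro!: finsum_closed\<close>)
  finally show ?case .
qed simp

context ring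
begin

abbreviation "MR n \<equiv> matrix_ring n R"

lemma MR_simps [simp]:
  "carrier (MR n) = {..<n} \<times> {..<n} \<rightarrow>\<^sub>E carrier R"
  "\<lbrakk> i < n; j < n \<rbrakk> \<Longrightarrow> (M \<otimes>\<^bsub>MR n\<^esub> N) (i, j) = (\<Oplus>k\<in>{..<n}. M (i, k) \<otimes> N (k, j))"
  "\<lbrakk> i < n; j < n \<rbrakk> \<Longrightarrow> \<one>\<^bsub>MR n\<^esub> (i, j) = (if i = j then \<one> else \<zero>)"
  "\<lbrakk> i < n; j < n \<rbrakk> \<Longrightarrow> \<zero>\<^bsub>MR n\<^esub> (i, j) = \<zero>"
  "\<lbrakk> i < n; j < n \<rbrakk> \<Longrightarrow> (M \<oplus>\<^bsub>MR n\<^esub> N) (i, j) = M (i, j) \<oplus> N (i, j)"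
  by (simp_all add: matrix_ring_def)

lemma MR_entry: "\<lbrakk> M \<in> {..<n} \<times> {..<n} \<rightarrow>\<^sub>E carrier R; i < n; j < n \<rbrakk> \<Longrightarrow> M (i, j) \<in> carrier R"
  by (auto simp: PiE_def Pi_def)

lemma MR_eqI:
  "\<lbrakk> M \<in> carrier (MR n); N \<in> carrier (MR n); \<And>i j. i < n \<Longrightarrow> j < n \<Longrightarrow> M (i, j) = N (i, j) \<rbrakk> \<Longrightarrow> M = N"
  by (rule PiE_ext[of _ "{..<n} \<times> {..<n}" "\<lambda>_. carrier R"]) auto

lemma MR_closed:
  shows "\<lbrakk> M \<in> carrier (MR n); N \<in> carrier (MR n) \<rbrakk> \<Longrightarrow> M \<otimes>\<^bsub>MR n\<^esub> N \<in> carrier (MR n)"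
    and "\<lbrakk> M \<in> carrier (MR n); N \<in> carrier (MR n) \<rbrakk> \<Longrightarrow> M \<oplus>\<^bsub>MR n\<^esub> N \<in> carrier (MR n)"
    and "\<one>\<^bsub>MR n\<^esub> \<in> carrier (MR n)" and "\<zero>\<^bsub>MR n\<^esub> \<in> carrier (MR n)"
  by (auto simp: matrix_ring_def restrict_PiE_iff MR_entry intro!: finsum_closed)

lemma MR_ring: "ring (MR n)"
proof (rule ringI)
  note cl = MR_closed and me = MR_entry[of _ n]
  show "abelian_group (MR n)"
  proof (rule abelian_groupI)
    fix L M N assume LMN: "L \<in> carrier (MR n)" "M \<in> carrier (MR n)" "N \<in> carrier (MR n)"
    hence c: "\<And>i j. i < n \<Longrightarrow> j < n \<Longrightarrow> L (i, j) \<in> carrier R \<and> M (i, j) \<in> carrier R \<and> N (i, j) \<in> carrier R"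
      using me by auto
    show "L \<oplus>\<^bsub>MR n\<^esub> M \<in> carrier (MR n)" by (rule cl(2)[OF LMN(1,2)])
    show "L \<oplus>\<^bsub>MR n\<^esub> M \<oplus>\<^bsub>MR n\<^esub> N = L \<oplus>\<^bsub>MR n\<^esub> (M \<oplus>\<^bsub>MR n\<^esub> N)"
      by (rule MR_eqI[where n = n]) (use LMN c cl in \<open>auto simp del: MR_simps(1) simp: a_assoc\<close>)
    show "L \<oplus>\<^bsub>MR n\<^esub> M = M \<oplus>\<^bsub>MR n\<^esub> L"
      by (rule MR_eqI[where n = n]) (use LMN c cl in \<open>auto simp del: MR_simps(1) simp: a_comm\<close>)
    show "\<zero>\<^bsub>MR n\<^esub> \<oplus>\<^bsub>MR n\<^esub> L = L"
      by (rule MR_eqI[where n = n]) (use LMN c cl in \<open>auto simp del: MR_simps(1)\<close>)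
    let ?m = "\<lambda>(i, j) \<in> {..<n} \<times> {..<n}. \<ominus> L (i, j)"
    have m: "?m \<in> carrier (MR n)" using c by (auto simp: restrict_PiE_iff)
    have "?m \<oplus>\<^bsub>MR n\<^esub> L = \<zero>\<^bsub>MR n\<^esub>"
      by (rule MR_eqI[where n = n]) (use LMN c cl m in \<open>auto simp del: MR_simps(1) simp: l_neg\<close>)
    thus "\<exists>y \<in> carrier (MR n). y \<oplus>\<^bsub>MR n\<^esub> L = \<zero>\<^bsub>MR n\<^esub>" using m by (rule bexI)
  qed (rule cl(4))
  show "monoid (MR n)"
  proof (rule monoidI)
    fix L M N assume LMN: "L \<in> carrier (MR n)" "M \<in> carrier (MR n)" "N \<in> carrier (MR n)"
    hence c: "\<And>i j. i < n \<Longrightarrow> j < n \<Longrightarrow> L (i, j) \<in> carrier R" "\<And>i j. i < n \<Longrightarrow> j < n \<Longrightarrow> M (i, j) \<in> carrier R"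
      "\<And>i j. i < n \<Longrightarrow> j < n \<Longrightarrow> N (i, j) \<in> carrier R"
      using me by auto
    show "L \<otimes>\<^bsub>MR n\<^esub> M \<in> carrier (MR n)" by (rule cl(1)[OF LMN(1,2)])
    show "L \<otimes>\<^bsub>MR n\<^esub> M \<otimes>\<^bsub>MR n\<^esub> N = L \<otimes>\<^bsub>MR n\<^esub> (M \<otimes>\<^bsub>MR n\<^esub> N)"
    proof (rule MR_eqI[where n = n])
      fix i j assume ij: "i < n" "j < n"
      have "(L \<otimes>\<^bsub>MR n\<^esub> M \<otimes>\<^bsub>MR n\<^esub> N) (i, j) = (\<Oplus>k\<in>{..<n}. (\<Oplus>l\<in>{..<n}. L (i, l) \<otimes> M (l, k)) \<otimes> N (k, j))"
        using ij c by (auto intro!: finsum_cong' finsum_closed)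
      also have "\<dots> = (\<Oplus>k\<in>{..<n}. \<Oplus>l\<in>{..<n}. L (i, l) \<otimes> M (l, k) \<otimes> N (k, j))"
        using ij c by (intro finsum_cong' finsum_ldistr) (auto intro!: finsum_closed)
      also have "\<dots> = (\<Oplus>l\<in>{..<n}. \<Oplus>k\<in>{..<n}. L (i, l) \<otimes> M (l, k) \<otimes> N (k, j))"
        using ij c by (intro finsum_swap) auto
      also have "\<dots> = (\<Oplus>l\<in>{..<n}. \<Oplus>k\<in>{..<n}. L (i, l) \<otimes> (M (l, k) \<otimes> N (k, j)))"
        using ij c by (intro finsum_cong') (auto intro!: finsum_closed simp: m_assoc)
      also have "\<dots> = (\<Oplus>l\<in>{..<n}. L (i, l) \<otimes> (\<Oplus>k\<in>{..<n}. M (l, k) \<otimes> N (k, j)))"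
        using ij c by (intro finsum_cong' finsum_rdistr[symmetric]) (auto intro!: finsum_closed)
      also have "\<dots> = (L \<otimes>\<^bsub>MR n\<^esub> (M \<otimes>\<^bsub>MR n\<^esub> N)) (i, j)"
        using ij c by (auto intro!: finsum_cong' finsum_closed)
      finally show "(L \<otimes>\<^bsub>MR n\<^esub> M \<otimes>\<^bsub>MR n\<^esub> N) (i, j) = (L \<otimes>\<^bsub>MR n\<^esub> (M \<otimes>\<^bsub>MR n\<^esub> N)) (i, j)" .
    qed (use LMN cl in \<open>auto simp del: MR_simps(1)\<close>)
    show "\<one>\<^bsub>MR n\<^esub> \<otimes>\<^bsub>MR n\<^esub> L = L"
    proof (rule MR_eqI[where n = n])
      fix i j assume ij: "i < n" "j < n"
      have "(\<one>\<^bsub>MR n\<^esub> \<otimes>\<^bsub>MR n\<^esub> L) (i, j) = (\<Oplus>k\<in>{..<n}. if i = k then L (k, j) else \<zero>)"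
        using ij c by (auto intro!: finsum_cong')
      also have "\<dots> = L (i, j)" using ij c by (intro finsum_singleton) auto
      finally show "(\<one>\<^bsub>MR n\<^esub> \<otimes>\<^bsub>MR n\<^esub> L) (i, j) = L (i, j)" .
    qed (use LMN cl in \<open>auto simp del: MR_simps(1)\<close>)
    show "L \<otimes>\<^bsub>MR n\<^esub> \<one>\<^bsub>MR n\<^esub> = L"
    proof (rule MR_eqI[where n = n])
      fix i j assume ij: "i < n" "j < n"
      have "(L \<otimes>\<^bsub>MR n\<^esub> \<one>\<^bsub>MR n\<^esub>) (i, j) = (\<Oplus>k\<in>{..<n}. if j = k then L (i, k) else \<zero>)"
        using ij c by (auto intro!: finsum_cong')
      also have "\<dots> = L (i, j)" using ij c by (intro finsum_singleton) auto
      finally show "(L \<otimes>\<^bsub>MR n\<^esub> \<one>\<^bsub>MR n\<^esub>) (i, j) = L (i, j)" .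
    qed (use LMN cl in \<open>auto simp del: MR_simps(1)\<close>)
  qed (rule cl(3))
  fix L M N assume LMN: "L \<in> carrier (MR n)" "M \<in> carrier (MR n)" "N \<in> carrier (MR n)"
  hence c: "\<And>i j. i < n \<Longrightarrow> j < n \<Longrightarrow> L (i, j) \<in> carrier R" "\<And>i j. i < n \<Longrightarrow> j < n \<Longrightarrow> M (i, j) \<in> carrier R"
    "\<And>i j. i < n \<Longrightarrow> j < n \<Longrightarrow> N (i, j) \<in> carrier R"
    using me by auto
  show "(L \<oplus>\<^bsub>MR n\<^esub> M) \<otimes>\<^bsub>MR n\<^esub> N = L \<otimes>\<^bsub>MR n\<^esub> N \<oplus>\<^bsub>MR n\<^esub> M \<otimes>\<^bsub>MR n\<^esub> N"
  proof (rule MR_eqI[where n = n])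
    fix i j assume ij: "i < n" "j < n"
    have "((L \<oplus>\<^bsub>MR n\<^esub> M) \<otimes>\<^bsub>MR n\<^esub> N) (i, j) = (\<Oplus>k\<in>{..<n}. L (i, k) \<otimes> N (k, j) \<oplus> M (i, k) \<otimes> N (k, j))"
      using ij c by (intro trans[OF MR_simps(2)[OF ij]] finsum_cong') (auto simp: l_distr)
    also have "\<dots> = (\<Oplus>k\<in>{..<n}. L (i, k) \<otimes> N (k, j)) \<oplus> (\<Oplus>k\<in>{..<n}. M (i, k) \<otimes> N (k, j))"
      using ij c by (intro finsum_addf) auto
    also have "\<dots> = (L \<otimes>\<^bsub>MR n\<^esub> N \<oplus>\<^bsub>MR n\<^esub> M \<otimes>\<^bsub>MR n\<^esub> N) (i, j)"
      using ij by (simp only: MR_simps)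
    finally show "((L \<oplus>\<^bsub>MR n\<^esub> M) \<otimes>\<^bsub>MR n\<^esub> N) (i, j) = (L \<otimes>\<^bsub>MR n\<^esub> N \<oplus>\<^bsub>MR n\<^esub> M \<otimes>\<^bsub>MR n\<^esub> N) (i, j)" .
  qed (use LMN cl in \<open>auto simp del: MR_simps(1)\<close>)
  show "N \<otimes>\<^bsub>MR n\<^esub> (L \<oplus>\<^bsub>MR n\<^esub> M) = N \<otimes>\<^bsub>MR n\<^esub> L \<oplus>\<^bsub>MR n\<^esub> N \<otimes>\<^bsub>MR n\<^esub> M"
  proof (rule MR_eqI[where n = n])
    fix i j assume ij: "i < n" "j < n"
    have "(N \<otimes>\<^bsub>MR n\<^esub> (L \<oplus>\<^bsub>MR n\<^esub> M)) (i, j) = (\<Oplus>k\<in>{..<n}. N (i, k) \<otimes> L (k, j) \<oplus> N (i, k) \<otimes> M (k, j))"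
      using ij c by (intro trans[OF MR_simps(2)[OF ij]] finsum_cong') (auto simp: r_distr)
    also have "\<dots> = (\<Oplus>k\<in>{..<n}. N (i, k) \<otimes> L (k, j)) \<oplus> (\<Oplus>k\<in>{..<n}. N (i, k) \<otimes> M (k, j))"
      using ij c by (intro finsum_addf) auto
    also have "\<dots> = (N \<otimes>\<^bsub>MR n\<^esub> L \<oplus>\<^bsub>MR n\<^esub> N \<otimes>\<^bsub>MR n\<^esub> M) (i, j)"
      using ij by (simp only: MR_simps)
    finally show "(N \<otimes>\<^bsub>MR n\<^esub> (L \<oplus>\<^bsub>MR n\<^esub> M)) (i, j) = (N \<otimes>\<^bsub>MR n\<^esub> L \<oplus>\<^bsub>MR n\<^esub> N \<otimes>\<^bsub>MR n\<^esub> M) (i, j)" .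
  qed (use LMN cl in \<open>auto simp del: MR_simps(1)\<close>)
qed

definition mat_unit :: "nat \<Rightarrow> nat \<Rightarrow> nat \<Rightarrow> 'a \<Rightarrow> nat \<times> nat \<Rightarrow> 'a" where
  "mat_unit n i j x = (\<lambda>p \<in> {..<n} \<times> {..<n}. if p = (i, j) then x else \<zero>)"

lemma mat_unit_closed: "x \<in> carrier R \<Longrightarrow> mat_unit n i j x \<in> carrier (MR n)"
  by (auto simp: mat_unit_def)

lemma mat_unit_entry: "\<lbrakk> a < n; b < n \<rbrakk> \<Longrightarrow> mat_unit n i j x (a, b) = (if a = i \<and> b = j then x else \<zero>)"
  by (simp add: mat_unit_def)

lemma mat_unit_left:
  assumes "x \<in> carrier R" "M \<in> carrier (MR n)" "a < n" "b < n" "j < n"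
  shows "(mat_unit n i j x \<otimes>\<^bsub>MR n\<^esub> M) (a, b) = (if a = i then x \<otimes> M (j, b) else \<zero>)"
proof -
  have c: "\<And>i j. i < n \<Longrightarrow> j < n \<Longrightarrow> M (i, j) \<in> carrier R" using assms MR_entry by auto
  have "(mat_unit n i j x \<otimes>\<^bsub>MR n\<^esub> M) (a, b) = (\<Oplus>k\<in>{..<n}. if j = k then (if a = i then x \<otimes> M (k, b) else \<zero>) else \<zero>)"
    using assms c by (auto intro!: finsum_cong' simp: mat_unit_entry)
  also have "\<dots> = (if a = i then x \<otimes> M (j, b) else \<zero>)"
    using assms c by (intro finsum_singleton) auto
  finally show ?thesis .
qed

lemma mat_unit_right:
  assumes "x \<in> carrier R" "M \<in> carrier (MR n)" "a < n" "b < n" "i < n"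
  shows "(M \<otimes>\<^bsub>MR n\<^esub> mat_unit n i j x) (a, b) = (if b = j then M (a, i) \<otimes> x else \<zero>)"
proof -
  have c: "\<And>i j. i < n \<Longrightarrow> j < n \<Longrightarrow> M (i, j) \<in> carrier R" using assms MR_entry by auto
  have "(M \<otimes>\<^bsub>MR n\<^esub> mat_unit n i j x) (a, b) = (\<Oplus>k\<in>{..<n}. if i = k then (if b = j then M (a, k) \<otimes> x else \<zero>) else \<zero>)"
    using assms c by (auto intro!: finsum_cong' simp: mat_unit_entry)
  also have "\<dots> = (if b = j then M (a, i) \<otimes> x else \<zero>)"
    using assms c by (intro finsum_singleton) auto
  finally show ?thesis .
qed

lemma mat_unit_mult:
  assumes "x \<in> carrier R" "y \<in> carrier R" "i < n" "j < n" "k < n" "l < n"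
  shows "mat_unit n i j x \<otimes>\<^bsub>MR n\<^esub> mat_unit n k l y = (if j = k then mat_unit n i l (x \<otimes> y) else \<zero>\<^bsub>MR n\<^esub>)"
proof (rule MR_eqI[where n = n])
  show "mat_unit n i j x \<otimes>\<^bsub>MR n\<^esub> mat_unit n k l y \<in> carrier (MR n)"
    by (intro MR_closed mat_unit_closed assms)
  show "(if j = k then mat_unit n i l (x \<otimes> y) else \<zero>\<^bsub>MR n\<^esub>) \<in> carrier (MR n)"
    using mat_unit_closed MR_closed(4) assms by simp
  fix a b assume ab: "a < n" "b < n"
  show "(mat_unit n i j x \<otimes>\<^bsub>MR n\<^esub> mat_unit n k l y) (a, b) = (if j = k then mat_unit n i l (x \<otimes> y) else \<zero>\<^bsub>MR n\<^esub>) (a, b)"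
    unfolding mat_unit_left[OF assms(1) mat_unit_closed[OF assms(2)] ab assms(4)]
    using ab assms by (simp add: mat_unit_entry)
qed

end

lemma (in skewfield) matrix_units: "matrix_units (matrix_ring n D) n (\<lambda>i. mat_unit n i i \<one>)"
proof (unfold matrix_units_def, intro conjI matrix_units_axioms.intro)
  show "ring (MR n)" by (rule MR_ring)
  interpret M: ring "MR n" by (rule MR_ring)
  show "mat_unit n i i \<one> \<in> carrier (MR n)" for i by (rule mat_unit_closed) simp
  show "mat_unit n i i \<one> \<otimes>\<^bsub>MR n\<^esub> mat_unit n i i \<one> = mat_unit n i i \<one>" if "i < n" for i
    using mat_unit_mult[of \<one> \<one> i n i i i] that by simp
  show "mat_unit n i i \<one> \<otimes>\<^bsub>MR n\<^esub> mat_unit n j j \<one> = \<zero>\<^bsub>MR n\<^esub>" if "i < n" "j < n" "i \<noteq> j" for i j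
    using mat_unit_mult[of \<one> \<one> i n i j j] that by simp
  have nz: "mat_unit n i j x \<noteq> \<zero>\<^bsub>MR n\<^esub>" if "i < n" "j < n" "x \<noteq> \<zero>" for i j x
  proof
    assume "mat_unit n i j x = \<zero>\<^bsub>MR n\<^esub>"
    hence "mat_unit n i j x (i, j) = \<zero>\<^bsub>MR n\<^esub> (i, j)" by simp
    thus False using that by (simp add: mat_unit_entry)
  qed
  show "mat_unit n i i \<one> \<noteq> \<zero>\<^bsub>MR n\<^esub>" if "i < n" for i using nz[OF that that] one_not_zero by simp
  show "x = \<zero>\<^bsub>MR n\<^esub>" if x: "x \<in> carrier (MR n)" "\<And>i. i < n \<Longrightarrow> mat_unit n i i \<one> \<otimes>\<^bsub>MR n\<^esub> x = \<zero>\<^bsub>MR n\<^esub>" for x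
  proof (rule MR_eqI[OF x(1) MR_closed(4)])
    fix a b assume ab: "a < n" "b < n"
    have "(mat_unit n a a \<one> \<otimes>\<^bsub>MR n\<^esub> x) (a, b) = x (a, b)"
      unfolding mat_unit_left[OF one_closed x(1) ab ab(1)] using MR_entry[of x n a b] x(1) ab by simp
    thus "x (a, b) = \<zero>\<^bsub>MR n\<^esub> (a, b)" using x(2)[OF ab(1)] by simp
  qed
  show "x = \<zero>\<^bsub>MR n\<^esub>" if x: "x \<in> carrier (MR n)" "\<And>i. i < n \<Longrightarrow> x \<otimes>\<^bsub>MR n\<^esub> mat_unit n i i \<one> = \<zero>\<^bsub>MR n\<^esub>" for x
  proof (rule MR_eqI[OF x(1) MR_closed(4)])
    fix a b assume ab: "a < n" "b < n"
    have "(x \<otimes>\<^bsub>MR n\<^esub> mat_unit n b b \<one>) (a, b) = x (a, b)"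
      unfolding mat_unit_right[OF one_closed x(1) ab ab(2)] using MR_entry[of x n a b] x(1) ab by simp
    thus "x (a, b) = \<zero>\<^bsub>MR n\<^esub> (a, b)" using x(2)[OF ab(2)] by simp
  qed
  show "\<exists>z \<in> carrier (MR n). mat_unit n i i \<one> \<otimes>\<^bsub>MR n\<^esub> z = z \<and> z \<otimes>\<^bsub>MR n\<^esub> mat_unit n j j \<one> = z \<and> z \<noteq> \<zero>\<^bsub>MR n\<^esub>"
    if ij: "i < n" "j < n" for i j
    using mat_unit_mult[of \<one> \<one> i n i i j] mat_unit_mult[of \<one> \<one> i n j j j] ij nz[OF ij] one_not_zero mat_unit_closed[of \<one> n i j]
    by (intro bexI[of _ "mat_unit n i j \<one>"]) simp_all
  fix i j z assume ij: "i < n" "j < n" and z: "z \<in> carrier (MR n)" "mat_unit n i i \<one> \<otimes>\<^bsub>MR n\<^esub> z = z"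
    "z \<otimes>\<^bsub>MR n\<^esub> mat_unit n j j \<one> = z" "z \<noteq> \<zero>\<^bsub>MR n\<^esub>"
  define x where "x = z (i, j)"
  have x: "x \<in> carrier D" unfolding x_def using z(1) ij MR_entry by simp
  have ze: "z = mat_unit n i j x"
  proof (rule MR_eqI[OF z(1) mat_unit_closed[OF x]])
    fix a b assume ab: "a < n" "b < n"
    have c: "z (a, b) \<in> carrier D" using MR_entry z(1) ab by simp
    have "z (a, b) = (if a = i then z (i, b) else \<zero>)"
      using mat_unit_left[OF one_closed z(1) ab ij(1), of i] MR_entry[of z n i b] z(1) ab ij unfolding z(2) by simp
    moreover have "z (a, b) = (if b = j then z (a, j) else \<zero>)"
      using mat_unit_right[OF one_closed z(1) ab ij(2), of j] MR_entry[of z n a j] z(1) ab ij unfolding z(3) by simp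
    ultimately show "z (a, b) = mat_unit n i j x (a, b)"
      using ab unfolding x_def by (auto simp: mat_unit_entry split: if_splits)
  qed
  have "x \<noteq> \<zero>"
  proof
    assume "x = \<zero>"
    hence "z = \<zero>\<^bsub>MR n\<^esub>"
      by (intro MR_eqI[OF z(1) MR_closed(4)]) (simp add: ze mat_unit_entry)
    thus False using z by simp
  qed
  hence xU: "x \<in> Units D" using x Units_eq by auto
  show "\<exists>w \<in> carrier (MR n). mat_unit n j j \<one> \<otimes>\<^bsub>MR n\<^esub> w = w \<and> w \<otimes>\<^bsub>MR n\<^esub> mat_unit n i i \<one> = w \<and>
      w \<otimes>\<^bsub>MR n\<^esub> z = mat_unit n j j \<one> \<and> z \<otimes>\<^bsub>MR n\<^esub> w = mat_unit n i i \<one>"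
    unfolding ze using xU x ij mat_unit_closed[of "inv x" n j i]
    by (intro bexI[of _ "mat_unit n j i (inv x)"]) (simp_all add: mat_unit_mult)
qed

lemma commutators_unipotent_comm:
  assumes "ring R" "\<And>x y. x \<in> carrier R \<Longrightarrow> y \<in> carrier R \<Longrightarrow> x \<otimes>\<^bsub>R\<^esub> y = y \<otimes>\<^bsub>R\<^esub> x"
  shows "commutators_unipotent R"
  unfolding commutators_unipotent_def
proof (intro ballI)
  interpret ring R by fact
  fix x y assume xy: "x \<in> Units R" "y \<in> Units R"
  have "x \<otimes>\<^bsub>R\<^esub> y \<otimes>\<^bsub>R\<^esub> inv\<^bsub>R\<^esub> x \<otimes>\<^bsub>R\<^esub> inv\<^bsub>R\<^esub> y = y \<otimes>\<^bsub>R\<^esub> (x \<otimes>\<^bsub>R\<^esub> inv\<^bsub>R\<^esub> x) \<otimes>\<^bsub>R\<^esub> inv\<^bsub>R\<^esub> y"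
    using xy assms(2)[of x y] by (simp add: m_assoc del: Units_r_inv)
  thus "x \<otimes>\<^bsub>R\<^esub> y \<otimes>\<^bsub>R\<^esub> inv\<^bsub>R\<^esub> x \<otimes>\<^bsub>R\<^esub> inv\<^bsub>R\<^esub> y \<in> unipotent_products R"
    using xy unipotent_products.one[of R] by simp
qed

text \<open>The two cases of the hypothesis on \<open>D\<close> and \<open>n\<close>: for
  \<open>1 < n\<close> elimination applies, and for \<open>n = 1\<close> the matrix ring is
  commutative, so that commutators are trivial.\<close>

lemma commutators_unipotent_matrix_ring:
  assumes D: "skewfield D" and n: "1 \<le> n" "cring D \<or> 1 < n"
  shows "ring (matrix_ring n D) \<and> commutators_unipotent (matrix_ring n D)"
proof -
  interpret skewfield D by fact
  have R: "ring (MR n)" by (rule MR_ring)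
  have "commutators_unipotent (MR n)"
  proof (cases "1 < n")
    case True
    thus ?thesis by (rule matrix_units.matrix_units_commutators[OF matrix_units])
  next
    case False
    hence n1: "n = 1" and cr: "cring D" using n by auto
    interpret cD: cring D by fact
    show ?thesis
    proof (rule commutators_unipotent_comm[OF R])
      fix M N assume MN: "M \<in> carrier (MR n)" "N \<in> carrier (MR n)"
      show "M \<otimes>\<^bsub>MR n\<^esub> N = N \<otimes>\<^bsub>MR n\<^esub> M"
      proof (rule MR_eqI[where n = n])
        fix i j assume "i < n" "j < n"
        hence ij: "i = 0" "j = 0" using n1 by auto
        have "M (0, 0) \<in> carrier D" "N (0, 0) \<in> carrier D" using MN MR_entry[of _ n 0 0] n1 by auto
        thus "(M \<otimes>\<^bsub>MR n\<^esub> N) (i, j) = (N \<otimes>\<^bsub>MR n\<^esub> M) (i, j)"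
          unfolding ij n1 using cD.m_comm by (simp add: lessThan_Suc)
      qed (use MN MR_closed in \<open>auto simp del: MR_simps(1)\<close>)
    qed
  qed
  thus ?thesis using R by simp
qed

section \<open>The class of a Schur complement\<close>

lemma (in domain) finite_roots:
  assumes rs: "set rs \<subseteq> carrier R" "\<not> set rs \<subseteq> {\<zero>}"
  shows "finite {x \<in> carrier R. eval (rev rs) x = \<zero>}"
proof -
  have normalize_zero: "normalize ps = [] \<Longrightarrow> set ps \<subseteq> {\<zero>}" for ps
    by (induction ps) (auto split: if_splits)
  have "normalize (rev rs) \<in> carrier (poly_ring R)" "normalize (rev rs) \<noteq> []"
    using normalize_gives_polynomial[of "rev rs" "carrier R"] normalize_zero[of "rev rs"] rs
    unfolding univ_poly_carrier[symmetric] by auto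
  from finite_number_of_roots[OF this(1)] this(2) show ?thesis
    using rs(1) eval_normalize[of "rev rs"] by (auto simp: is_root_def elim!: rev_finite_subset)
qed

context central_algebra
begin

text \<open>As \<open>k\<close> is central, \<open>k - y\<close> divides the difference of the
  values of a polynomial at \<open>k\<close> and at \<open>y\<close>. The quotient is a polynomial
  in \<open>y\<close> and hence commutes with \<open>y\<close>, so the factorization yields inverses
  on both sides.\<close>

lemma peval_scalar_diff:
  assumes "set rs \<subseteq> carrier R" "k \<in> carrier R" "y \<in> carrier L"
  shows "\<exists>q \<in> carrier L. y \<otimes> q = q \<otimes> y \<and> \<rho> (R.eval (rev rs) k) \<ominus> peval y rs = (\<rho> k \<ominus> y) \<otimes> q"
  using assms(1)
proof (induction rs)
  case Nil
  show ?case by (rule bexI[of _ "\<zero>"]) (use assms in \<open>simp_all add: a_minus_def\<close>)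
next
  case (Cons r rs)
  then obtain q where q: "q \<in> carrier L" "y \<otimes> q = q \<otimes> y"
    "\<rho> (R.eval (rev rs) k) \<ominus> peval y rs = (\<rho> k \<ominus> y) \<otimes> q" by auto
  have r: "r \<in> carrier R" and rs: "set rs \<subseteq> carrier R" using Cons.prems by auto
  define e where "e = R.eval (rev rs) k"
  have e: "e \<in> carrier R" unfolding e_def using rs assms by (simp add: R.eval_in_carrier)
  have ev: "R.eval (rev (r # rs)) k = e \<otimes>\<^bsub>R\<^esub> k \<oplus>\<^bsub>R\<^esub> r"
    unfolding e_def using R.eval_append_aux[of "rev rs" r k] rs r assms by simp
  note c = q(1) assms(2,3) e r rs
  have yp: "y \<otimes> peval y rs = peval y rs \<otimes> y" using peval_comm assms rs by simp
  have ek: "\<rho> e \<otimes> \<rho> k = \<rho> k \<otimes> \<rho> e" using c by (intro rho_central) auto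
  have "\<rho> k \<otimes> (\<rho> e \<ominus> peval y rs) = \<rho> k \<otimes> ((\<rho> k \<ominus> y) \<otimes> q)"
    using q(3) unfolding e_def by simp
  also have "\<dots> = (\<rho> k \<ominus> y) \<otimes> (\<rho> k \<otimes> q)"
    using c by (intro rho_comm(2)[symmetric]) auto
  finally have *: "\<rho> k \<otimes> (\<rho> e \<ominus> peval y rs) = (\<rho> k \<ominus> y) \<otimes> (\<rho> k \<otimes> q)" .
  \<comment> \<open>For \<open>f = r + X g\<close> this is
    \<open>f(k) - f(y) = k (g(k) - g(y)) + (k - y) g(y)\<close>.\<close>
  have "\<rho> (e \<otimes>\<^bsub>R\<^esub> k \<oplus>\<^bsub>R\<^esub> r) \<ominus> peval y (r # rs) =
      \<rho> k \<otimes> (\<rho> e \<ominus> peval y rs) \<oplus> (\<rho> k \<ominus> y) \<otimes> peval y rs"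
    using c by (simp add: nc_simps ek)
  also have "\<dots> = (\<rho> k \<ominus> y) \<otimes> (\<rho> k \<otimes> q \<oplus> peval y rs)"
    unfolding * using c by (simp add: r_distr)
  finally have main: "\<rho> (R.eval (rev (r # rs)) k) \<ominus> peval y (r # rs) = (\<rho> k \<ominus> y) \<otimes> (\<rho> k \<otimes> q \<oplus> peval y rs)"
    unfolding ev .
  have "y \<otimes> (\<rho> k \<otimes> q \<oplus> peval y rs) = \<rho> k \<otimes> (q \<otimes> y) \<oplus> peval y rs \<otimes> y"
    using c rho_comm(2)[OF assms(2) assms(3) q(1)] by (simp add: r_distr yp q(2))
  also have "\<dots> = (\<rho> k \<otimes> q \<oplus> peval y rs) \<otimes> y" using c by (simp add: l_distr m_assoc)
  finally have comm: "y \<otimes> (\<rho> k \<otimes> q \<oplus> peval y rs) = (\<rho> k \<otimes> q \<oplus> peval y rs) \<otimes> y" .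
  have "\<rho> k \<otimes> q \<oplus> peval y rs \<in> carrier L" using c by simp
  from bexI[where P = "\<lambda>p. y \<otimes> p = p \<otimes> y \<and> \<rho> (R.eval (rev (r # rs)) k) \<ominus> peval y (r # rs) = (\<rho> k \<ominus> y) \<otimes> p", OF conjI[OF comm main] this] show ?case .
qed

text \<open>With \<open>f y = 0\<close>, the value \<open>f k\<close> is a multiple of \<open>k - y\<close>, so \<open>k - y\<close> is invertible unless \<open>k\<close>
  is a root of \<open>f\<close>.\<close>

lemma finite_nonunits:
  assumes field: "field R" and rs: "set rs \<subseteq> carrier R" "\<not> set rs \<subseteq> {\<zero>\<^bsub>R\<^esub>}" and y: "y \<in> carrier L" "peval y rs = \<zero>"
  shows "finite {k \<in> carrier R. \<rho> k \<ominus> y \<notin> Units L}"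
proof -
  interpret K: field R by (rule field)
  have "\<rho> k \<ominus> y \<in> Units L" if k: "k \<in> carrier R" "R.eval (rev rs) k \<noteq> \<zero>\<^bsub>R\<^esub>" for k
  proof -
    define e where "e = R.eval (rev rs) k"
    have e: "e \<in> carrier R" unfolding e_def using rs k by (simp add: R.eval_in_carrier)
    hence eU: "e \<in> Units R" using k K.field_Units e_def by auto
    have "\<rho> e \<otimes> \<rho> (inv\<^bsub>R\<^esub> e) = \<one>" "\<rho> (inv\<^bsub>R\<^esub> e) \<otimes> \<rho> e = \<one>" "inv\<^bsub>R\<^esub> e \<in> carrier R"
      using eU e rho_simps(2)[of e "inv\<^bsub>R\<^esub> e"] rho_simps(2)[of "inv\<^bsub>R\<^esub> e" e]
      by (simp_all del: rho_simps(2) add: rho_simps(2)[symmetric] R.Units_inv_closed)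
    note i = this
    obtain q where q: "q \<in> carrier L" "y \<otimes> q = q \<otimes> y" "\<rho> e \<ominus> peval y rs = (\<rho> k \<ominus> y) \<otimes> q"
      using peval_scalar_diff[OF rs(1) k(1) y(1)] unfolding e_def by (elim bexE conjE)
    have q3: "\<rho> e = (\<rho> k \<ominus> y) \<otimes> q" using q(3) y e by (simp add: a_minus_def)
    have kq: "q \<otimes> (\<rho> k \<ominus> y) = (\<rho> k \<ominus> y) \<otimes> q"
      using q y k rho_comm(1)[OF k(1) q(1)] by (simp add: nc_simps)
    define w i where "w = \<rho> k \<ominus> y" and "i = \<rho> (inv\<^bsub>R\<^esub> e)"
    have w: "w \<in> carrier L" "i \<in> carrier L" "w \<otimes> q = \<rho> e" "q \<otimes> w = \<rho> e" "\<rho> e \<otimes> i = \<one>" "i \<otimes> w = w \<otimes> i"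
      unfolding w_def i_def using i k y q3 kq rho_central[OF i(3), of "\<rho> k \<ominus> y"] by simp_all
    have "w \<otimes> (q \<otimes> i) = \<one>" using w(1,2,3,5) q(1) by (simp add: m_assoc[symmetric])
    moreover have "q \<otimes> i \<otimes> w = (q \<otimes> w) \<otimes> i" using w(1,2,6) q(1) by (simp add: m_assoc)
    hence "q \<otimes> i \<otimes> w = \<one>" using w(4,5) by simp
    ultimately show ?thesis
      unfolding Units_def w_def[symmetric] using w(1,2) q(1) by (intro CollectI conjI bexI[of _ "q \<otimes> i"]) simp_all
  qed
  thus ?thesis by (intro finite_subset[OF _ K.finite_roots[OF rs]]) auto
qed

end

section \<open>Classes of Schur complements\<close>

context ring begin

text \<open>Block inversion: \<open>a'\<close> is the upper left entry of the inverse matrix, and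
  the Schur complement of \<open>d\<close> is its inverse. The equations
  \<open>c a' = - d c'\<close> and \<open>a' b = - b' d\<close> give the two sides.\<close>

lemma schur_complement_unit:
  assumes c: "a \<in> carrier R" "b \<in> carrier R" "c \<in> carrier R" "d \<in> Units R"
      "a' \<in> carrier R" "b' \<in> carrier R" "c' \<in> carrier R"
    and m: "a \<otimes> a' \<oplus> b \<otimes> c' = \<one>" "c \<otimes> a' \<oplus> d \<otimes> c' = \<zero>" "a' \<otimes> a \<oplus> b' \<otimes> c = \<one>" "a' \<otimes> b \<oplus> b' \<otimes> d = \<zero>"
  shows "(a \<ominus> b \<otimes> inv d \<otimes> c) \<otimes> a' = \<one>" "a' \<otimes> (a \<ominus> b \<otimes> inv d \<otimes> c) = \<one>"
proof -
  have d: "d \<in> carrier R" "inv d \<in> carrier R" "d \<otimes> inv d = \<one>" "inv d \<otimes> d = \<one>" using c by auto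
  have 1: "c \<otimes> a' = \<ominus> (d \<otimes> c')" using minus_equality[OF m(2)] c d by (metis minus_equality m_closed m(2) minus_minus)
  have 2: "a' \<otimes> b = \<ominus> (b' \<otimes> d)" using c d by (metis minus_equality m_closed m(4) minus_minus)
  have "(a \<ominus> b \<otimes> inv d \<otimes> c) \<otimes> a' = a \<otimes> a' \<ominus> b \<otimes> (inv d \<otimes> (c \<otimes> a'))"
    using c d by (simp add: nc_simps)
  also have "\<dots> = a \<otimes> a' \<oplus> b \<otimes> c'"
    unfolding 1 using c d by (simp add: a_minus_def r_minus m_assoc[symmetric])
  finally show "(a \<ominus> b \<otimes> inv d \<otimes> c) \<otimes> a' = \<one>" using m by simp
  have "a' \<otimes> (a \<ominus> b \<otimes> inv d \<otimes> c) = a' \<otimes> a \<ominus> (a' \<otimes> b) \<otimes> (inv d \<otimes> c)"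
    using c d by (simp add: nc_simps)
  also have "(a' \<otimes> b) \<otimes> (inv d \<otimes> c) = \<ominus> (b' \<otimes> (d \<otimes> inv d \<otimes> c))"
    unfolding 2 using c d(1,2) by (simp only: l_minus m_assoc m_closed)
  also have "d \<otimes> inv d \<otimes> c = c" using c d by simp
  also have "a' \<otimes> a \<ominus> \<ominus> (b' \<otimes> c) = \<one>"
    using m c d by (simp add: a_minus_def)
  finally show "a' \<otimes> (a \<ominus> b \<otimes> inv d \<otimes> c) = \<one>" .
qed

lemma unit_class_conj:
  assumes "commutators_unipotent R" "x \<in> Units R" "y \<in> Units R"
  shows "unit_class R (x \<otimes> y) = unit_class R (y \<otimes> x)"
proof -
  interpret G: comm_group "unit_class_group R" by (rule unit_class_comm[OF assms(1)])
  show ?thesis using assms(2,3) by (simp add: unit_class_mult unit_class_closed G.m_comm del: mult_FactGroup)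
qed

text \<open>Put \<open>v = 1 + t b d\<^sup>-\<^sup>1\<close>, so that \<open>d + t b = v d\<close>.
  The relation determines \<open>b'\<close> as \<open>- a b d\<^sup>-\<^sup>1\<close>, hence
  \<open>a - b' t = a (1 + b d\<^sup>-\<^sup>1 t)\<close>. As \<open>t\<close> is a unit, the
  bracket is a conjugate of \<open>v\<close> and has the same class.\<close>

lemma schur_class_step:
  assumes CU: "commutators_unipotent R" and b: "b \<in> carrier R" "b' \<in> carrier R"
    and u: "d \<in> Units R" "a \<in> Units R" "t \<in> Units R" "d \<oplus> t \<otimes> b \<in> Units R"
    and rel: "a \<otimes> b \<oplus> b' \<otimes> d = \<zero>"
  shows "a \<ominus> b' \<otimes> t \<in> Units R" "unit_class R (d \<otimes> (a \<ominus> b' \<otimes> t)) = unit_class R ((d \<oplus> t \<otimes> b) \<otimes> a)"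
proof -
  interpret G: comm_group "unit_class_group R" by (rule unit_class_comm[OF CU])
  have c: "d \<in> carrier R" "inv d \<in> carrier R" "d \<otimes> inv d = \<one>" "inv d \<otimes> d = \<one>"
    "a \<in> carrier R" "t \<in> carrier R" "inv t \<in> carrier R" "t \<otimes> inv t = \<one>" "inv t \<otimes> t = \<one>" using u by auto
  define v where "v = (d \<oplus> t \<otimes> b) \<otimes> inv d"
  have v: "v \<in> Units R" unfolding v_def using u by simp
  have vd: "v \<otimes> d = d \<oplus> t \<otimes> b" unfolding v_def using c b by (simp add: m_assoc)
  have v': "v = \<one> \<oplus> t \<otimes> b \<otimes> inv d" unfolding v_def using c b by (simp add: l_distr m_assoc)
  have "b' = b' \<otimes> d \<otimes> inv d" using c b by (simp add: m_assoc)
  also have "b' \<otimes> d = \<ominus> (a \<otimes> b)" using rel c b by (metis minus_equality m_closed a_comm)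
  finally have b': "b' = \<ominus> (a \<otimes> b \<otimes> inv d)" using c b by (simp add: l_minus)
  have av: "a \<ominus> b' \<otimes> t = a \<otimes> (inv t \<otimes> v \<otimes> t)"
  proof -
    have "inv t \<otimes> v \<otimes> t = inv t \<otimes> t \<oplus> (inv t \<otimes> t) \<otimes> (b \<otimes> inv d \<otimes> t)"
      unfolding v' using c(2,6,7) b by (simp add: nc_simps)
    also have "\<dots> = \<one> \<oplus> b \<otimes> inv d \<otimes> t" using c b by simp
    finally show ?thesis unfolding b' using c(1,2,5,6) b by (simp add: nc_simps)
  qed
  have w: "inv t \<otimes> v \<otimes> t \<in> Units R" using u v by simp
  show "a \<ominus> b' \<otimes> t \<in> Units R" unfolding av using u w by simp
  have "unit_class R (inv t \<otimes> v \<otimes> t) = unit_class R (t \<otimes> (inv t \<otimes> v))"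
    using unit_class_conj[OF CU _ u(3), of "inv t \<otimes> v"] u v by simp
  also have "t \<otimes> (inv t \<otimes> v) = v" using u v by (simp add: m_assoc[symmetric])
  finally have cw: "unit_class R (inv t \<otimes> v \<otimes> t) = unit_class R v" .
  show "unit_class R (d \<otimes> (a \<ominus> b' \<otimes> t)) = unit_class R ((d \<oplus> t \<otimes> b) \<otimes> a)"
    unfolding av vd[symmetric] using u v w cw
    by (simp add: unit_class_mult[of "d"] unit_class_mult[of "a"] unit_class_mult[of "v"] unit_class_mult[of "v \<otimes> d"] unit_class_closed G.m_ac del: mult_FactGroup)
qed

end

text \<open>The class of \<open>d + t b\<close> times that of the corresponding Schur complement is a \<open>K\<^sub>1\<close>-valued determinant
  of the given matrix, hence independent of the elementary operation given by \<open>t\<close>; the inverse of the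
  Schur complement is \<open>a - b' t\<close>, for \<open>(a, b')\<close> the first row of the inverse matrix.\<close>

lemma (in central_algebra) schur_class:
  assumes field: "field R" and inf: "infinite (carrier R)"
    and fin: "\<And>y. y \<in> carrier L \<Longrightarrow> finite {k \<in> carrier R. \<rho> k \<ominus> y \<notin> Units L}"
    and CU: "commutators_unipotent L" and c: "a \<in> carrier L" "b \<in> carrier L" "b' \<in> carrier L" "d \<in> carrier L"
      "t1 \<in> carrier L" "t2 \<in> carrier L"
    and u: "d \<oplus> t1 \<otimes> b \<in> Units L" "d \<oplus> t2 \<otimes> b \<in> Units L" "a \<ominus> b' \<otimes> t1 \<in> Units L"
    and rel: "a \<otimes> b \<oplus> b' \<otimes> d = \<zero>"
  shows "a \<ominus> b' \<otimes> t2 \<in> Units L"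
    "unit_class L ((d \<oplus> t1 \<otimes> b) \<otimes> (a \<ominus> b' \<otimes> t2)) = unit_class L ((d \<oplus> t2 \<otimes> b) \<otimes> (a \<ominus> b' \<otimes> t1))"
proof -
  interpret K: field R by (rule field)
  interpret G: comm_group "unit_class_group L" by (rule unit_class_comm[OF CU])
  define d1 where "d1 = d \<oplus> t1 \<otimes> b"
  define d2 where "d2 = d \<oplus> t2 \<otimes> b"
  define a1 where "a1 = a \<ominus> b' \<otimes> t1"
  have d1: "d1 \<in> Units L" "d1 \<in> carrier L" and a1: "a1 \<in> Units L" "a1 \<in> carrier L" and d2: "d2 \<in> Units L"
    using u unfolding d1_def a1_def d2_def by auto
  define z where "z = t2 \<ominus> t1"
  define y where "y = \<ominus> (inv d1 \<otimes> b)"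
  have z: "z \<in> carrier L" and y: "y \<in> carrier L" using c d1 unfolding z_def y_def by auto
  \<comment> \<open>The values to avoid when passing from \<open>t1\<close> to \<open>t2\<close> via
    \<open>t1 + k\<close>: both differences \<open>k\<close> and \<open>z - k\<close> have to be
    units, and so does \<open>d1 + k b\<close>, which is \<open>k d1 (l - y)\<close> for
    \<open>l\<close> inverse to \<open>k\<close>.\<close>
  define S where "S = insert \<zero>\<^bsub>R\<^esub> ({k \<in> carrier R. \<rho> k \<ominus> z \<notin> Units L} \<union> (\<lambda>k. inv\<^bsub>R\<^esub> k) ` {k \<in> carrier R. \<rho> k \<ominus> y \<notin> Units L})"
  have "finite S" unfolding S_def using fin[OF z] fin[OF y] by simp
  then obtain k where k: "k \<in> carrier R" "k \<notin> S" using inf by (meson finite_subset subsetI)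
  have kU: "k \<in> Units R" using k K.field_Units unfolding S_def by auto
  define l where "l = inv\<^bsub>R\<^esub> k"
  have l: "l \<in> carrier R" "inv\<^bsub>R\<^esub> l = k" "k \<otimes>\<^bsub>R\<^esub> l = \<one>\<^bsub>R\<^esub>" "l \<otimes>\<^bsub>R\<^esub> k = \<one>\<^bsub>R\<^esub>"
    unfolding l_def using kU by auto
  have "\<rho> k \<otimes> \<rho> l = \<one>" "\<rho> l \<otimes> \<rho> k = \<one>" using l k rho_simps(2)[of k l] rho_simps(2)[of l k] by (simp_all del: rho_simps(2))
  hence \<rho>k: "\<rho> k \<in> Units L" unfolding Units_def using k l by force
  have kz: "\<rho> k \<ominus> z \<in> Units L" using k unfolding S_def by auto
  have ly: "\<rho> l \<ominus> y \<in> Units L"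
  proof (rule ccontr)
    assume "\<rho> l \<ominus> y \<notin> Units L"
    hence "inv\<^bsub>R\<^esub> l \<in> S" unfolding S_def using l(1) by blast
    thus False using l k by simp
  qed
  have dk: "d1 \<oplus> \<rho> k \<otimes> b = \<rho> k \<otimes> (d1 \<otimes> (\<rho> l \<ominus> y))"
  proof -
    have "\<rho> k \<otimes> (d1 \<otimes> (\<rho> l \<ominus> y)) = \<rho> k \<otimes> (d1 \<otimes> \<rho> l) \<oplus> \<rho> k \<otimes> (d1 \<otimes> inv d1 \<otimes> b)"
      unfolding y_def using k l d1(2) c Units_inv_closed[OF d1(1)] by (simp add: nc_simps)
    also have "\<rho> k \<otimes> (d1 \<otimes> \<rho> l) = (\<rho> k \<otimes> \<rho> l) \<otimes> d1"
      using k l d1 rho_comm(1)[OF l(1) d1(2)] by (simp add: m_assoc)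
    finally show ?thesis using \<open>\<rho> k \<otimes> \<rho> l = \<one>\<close> d1 c by simp
  qed
  have dkU: "d1 \<oplus> \<rho> k \<otimes> b \<in> Units L" unfolding dk using \<rho>k d1 ly by simp
  have rel1: "a1 \<otimes> b \<oplus> b' \<otimes> d1 = \<zero>"
  proof -
    have "a1 \<otimes> b \<oplus> b' \<otimes> d1 = a \<otimes> b \<oplus> b' \<otimes> d" unfolding a1_def d1_def using c by (simp add: nc_simps)
    thus ?thesis using rel by simp
  qed
  note s1 = schur_class_step[OF CU c(2,3) d1(1) a1(1) \<rho>k dkU rel1]
  define d3 where "d3 = d1 \<oplus> \<rho> k \<otimes> b"
  define a3 where "a3 = a1 \<ominus> b' \<otimes> \<rho> k"
  define t3 where "t3 = z \<ominus> \<rho> k"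
  have t3: "t3 \<in> Units L"
  proof -
    have "t3 = \<ominus> (\<rho> k \<ominus> z)" unfolding t3_def using z k by (simp add: nc_simps)
    thus ?thesis using kz by (metis Units_minus_one_closed Units_m_closed Units_closed l_minus l_one one_closed)
  qed
  have d3t: "d3 \<oplus> t3 \<otimes> b = d2" and a3t: "a3 \<ominus> b' \<otimes> t3 = a \<ominus> b' \<otimes> t2"
    unfolding d3_def t3_def d2_def d1_def z_def a3_def a1_def using c k by (simp_all add: nc_simps)
  have rel3: "a3 \<otimes> b \<oplus> b' \<otimes> d3 = \<zero>"
  proof -
    have "a3 \<otimes> b \<oplus> b' \<otimes> d3 = a1 \<otimes> b \<oplus> b' \<otimes> d1" unfolding a3_def d3_def using c k a1 d1 by (simp add: nc_simps)
    thus ?thesis using rel1 by simp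
  qed
  have a3: "a3 \<in> Units L" and d3: "d3 \<in> Units L" using s1(1) dkU unfolding a3_def d3_def by auto
  note s2 = schur_class_step[OF CU c(2,3) d3 a3 t3 d2[folded d3t] rel3, unfolded d3t a3t]
  show a2: "a \<ominus> b' \<otimes> t2 \<in> Units L" by (rule s2(1))
  let ?c = "unit_class L" and ?m = "monoid.mult (unit_class_group L)"
  have e: "?m (?c d1) (?c a3) = ?m (?c d3) (?c a1)" "?m (?c d3) (?c (a \<ominus> b' \<otimes> t2)) = ?m (?c d2) (?c a3)"
    using s1(2) s2(2) d1 d3 a1 a3 a2 d2 unfolding d3_def[symmetric] a3_def[symmetric] by (simp_all add: unit_class_mult del: mult_FactGroup)
  have cl: "?c d1 \<in> carrier (unit_class_group L)" "?c d2 \<in> carrier (unit_class_group L)" "?c d3 \<in> carrier (unit_class_group L)"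
    "?c a1 \<in> carrier (unit_class_group L)" "?c a3 \<in> carrier (unit_class_group L)" "?c (a \<ominus> b' \<otimes> t2) \<in> carrier (unit_class_group L)"
    using d1 d2 d3 a1 a3 a2 by (simp_all add: unit_class_closed)
  have "?m (?c d3) (?m (?c d1) (?c (a \<ominus> b' \<otimes> t2))) = ?m (?c d1) (?m (?c d3) (?c (a \<ominus> b' \<otimes> t2)))"
    using cl by (simp only: G.m_lcomm)
  also have "\<dots> = ?m (?c d2) (?m (?c d1) (?c a3))"
    unfolding e(2) using cl by (simp only: G.m_lcomm)
  also have "\<dots> = ?m (?c d3) (?m (?c d2) (?c a1))"
    unfolding e(1) using cl by (simp only: G.m_lcomm)
  finally have "?m (?c d1) (?c (a \<ominus> b' \<otimes> t2)) = ?m (?c d2) (?c a1)"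
    using cl by (simp only: G.l_cancel G.m_closed)
  thus "?c ((d \<oplus> t1 \<otimes> b) \<otimes> (a \<ominus> b' \<otimes> t2)) = ?c ((d \<oplus> t2 \<otimes> b) \<otimes> (a \<ominus> b' \<otimes> t1))"
    using d1 d2 a1 a2 unfolding d1_def d2_def a1_def by (simp add: unit_class_mult del: mult_FactGroup)
qed

section \<open>Gluing of local units\<close>

text \<open>The last assumption makes \<open>L\<close> an algebra over the field of fractions of
  \<open>R\<close>, in which lattices and their localizations all live as subsets.\<close>

locale lattices = D: one_dimensional_domain R + central_algebra R L \<rho>
  for R :: "('r, 'x) ring_scheme" and L :: "('l, 'y) ring_scheme" (structure) and \<rho> +
  assumes rho_Units: "\<lbrakk> r \<in> carrier R; r \<noteq> \<zero>\<^bsub>R\<^esub> \<rbrakk> \<Longrightarrow> \<rho> r \<in> Units L"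
begin

definition lattice :: "'l set \<Rightarrow> bool" where
  "lattice M \<longleftrightarrow> M \<subseteq> carrier L \<and> (\<forall>x \<in> M. \<forall>y \<in> M. x \<oplus> y \<in> M) \<and> (\<forall>r \<in> carrier R. \<forall>x \<in> M. \<rho> r \<otimes> x \<in> M) \<and>
     (\<forall>x \<in> carrier L. \<exists>r \<in> carrier R - {\<zero>\<^bsub>R\<^esub>}. \<rho> r \<otimes> x \<in> M)"

definition localized :: "'r set \<Rightarrow> 'l set \<Rightarrow> 'l set" where
  "localized P M = {x \<in> carrier L. \<exists>s \<in> carrier R - P. \<rho> s \<otimes> x \<in> M}"

definition local_units :: "'r set \<Rightarrow> 'l set \<Rightarrow> 'l set" where
  "local_units P M = {x \<in> Units L. x \<in> localized P M \<and> inv x \<in> localized P M}"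

lemma latticeD:
  assumes "lattice M"
  shows "x \<in> M \<Longrightarrow> x \<in> carrier L" "\<lbrakk> x \<in> M; y \<in> M \<rbrakk> \<Longrightarrow> x \<oplus> y \<in> M"
    "\<lbrakk> r \<in> carrier R; x \<in> M \<rbrakk> \<Longrightarrow> \<rho> r \<otimes> x \<in> M"
    "x \<in> carrier L \<Longrightarrow> \<exists>r \<in> carrier R - {\<zero>\<^bsub>R\<^esub>}. \<rho> r \<otimes> x \<in> M"
  using assms unfolding lattice_def by auto

lemma localizedI: "\<lbrakk> \<rho> s \<otimes> x \<in> M; s \<in> carrier R - P; x \<in> carrier L \<rbrakk> \<Longrightarrow> x \<in> localized P M"
  unfolding localized_def by auto

lemma localizedE:
  assumes "x \<in> localized P M"
  obtains s where "s \<in> carrier R - P" "\<rho> s \<otimes> x \<in> M" "x \<in> carrier L"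
  using assms unfolding localized_def by auto

lemma prime_mult:
  assumes "maximalideal P R" "s \<in> carrier R - P" "t \<in> carrier R - P" shows "s \<otimes>\<^bsub>R\<^esub> t \<in> carrier R - P"
  using primeideal.I_prime[OF D.maximalideal_prime[OF assms(1)]] assms by auto

lemma one_not_in_maximal: "maximalideal P R \<Longrightarrow> \<one>\<^bsub>R\<^esub> \<in> carrier R - P"
  using maximalideal.I_notcarr ideal.one_imp_carrier[OF maximalideal.axioms(1)] by auto

lemma localized_self: "\<lbrakk> maximalideal P R; lattice M; x \<in> M \<rbrakk> \<Longrightarrow> x \<in> localized P M"
  using latticeD(1) one_not_in_maximal by (intro localizedI[of "\<one>\<^bsub>R\<^esub>"]) auto

lemma localized_add:
  assumes P: "maximalideal P R" and M: "lattice M" and "x \<in> localized P M" "y \<in> localized P M"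
  shows "x \<oplus> y \<in> localized P M"
proof -
  obtain s t where s: "s \<in> carrier R - P" "\<rho> s \<otimes> x \<in> M" "x \<in> carrier L"
    and t: "t \<in> carrier R - P" "\<rho> t \<otimes> y \<in> M" "y \<in> carrier L" using assms(3,4) by (elim localizedE)
  have "\<rho> (s \<otimes>\<^bsub>R\<^esub> t) \<otimes> (x \<oplus> y) = \<rho> t \<otimes> (\<rho> s \<otimes> x) \<oplus> \<rho> s \<otimes> (\<rho> t \<otimes> y)"
    using s t rho_comm(2)[of t "\<rho> s" x] by (simp add: r_distr m_assoc)
  hence "\<rho> (s \<otimes>\<^bsub>R\<^esub> t) \<otimes> (x \<oplus> y) \<in> M" using s t latticeD(2,3)[OF M] by auto
  thus ?thesis by (rule localizedI[OF _ prime_mult[OF P s(1) t(1)]]) (use s t in simp)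
qed

lemma localized_smult:
  assumes M: "lattice M" and "x \<in> localized P M" "r \<in> carrier R"
  shows "\<rho> r \<otimes> x \<in> localized P M"
proof -
  obtain s where s: "s \<in> carrier R - P" "\<rho> s \<otimes> x \<in> M" "x \<in> carrier L" using assms(2) by (elim localizedE)
  have "\<rho> s \<otimes> (\<rho> r \<otimes> x) = \<rho> r \<otimes> (\<rho> s \<otimes> x)" using s assms(3) rho_comm(2)[of r "\<rho> s" x] by simp
  thus ?thesis using s latticeD(3)[OF M assms(3)] assms(3) by (intro localizedI) auto
qed

lemma localized_uminus:
  assumes M: "lattice M" and "x \<in> localized P M" shows "\<ominus> x \<in> localized P M"
proof -
  have "x \<in> carrier L" using assms(2) by (elim localizedE)
  thus ?thesis using localized_smult[OF assms, of "\<ominus>\<^bsub>R\<^esub> \<one>\<^bsub>R\<^esub>"] by (simp add: l_minus)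
qed

lemma localized_mult:
  assumes P: "maximalideal P R" and MN: "M \<subseteq> carrier L" "N \<subseteq> carrier L" "\<And>x y. x \<in> M \<Longrightarrow> y \<in> N \<Longrightarrow> x \<otimes> y \<in> T"
    and "x \<in> localized P M" "y \<in> localized P N"
  shows "x \<otimes> y \<in> localized P T"
proof -
  obtain s t where s: "s \<in> carrier R - P" "\<rho> s \<otimes> x \<in> M" "x \<in> carrier L"
    and t: "t \<in> carrier R - P" "\<rho> t \<otimes> y \<in> N" "y \<in> carrier L" using assms(5,6) by (elim localizedE)
  have "\<rho> (s \<otimes>\<^bsub>R\<^esub> t) \<otimes> (x \<otimes> y) = (\<rho> s \<otimes> x) \<otimes> (\<rho> t \<otimes> y)"
    using s t rho_comm(2)[of t x y] by (simp add: m_assoc)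
  hence "\<rho> (s \<otimes>\<^bsub>R\<^esub> t) \<otimes> (x \<otimes> y) \<in> T" using s t MN(3) by simp
  thus ?thesis by (rule localizedI[OF _ prime_mult[OF P s(1) t(1)]]) (use s t in simp)
qed

text \<open>The ideal of those \<open>r\<close> that multiply \<open>x\<close> into \<open>M\<close>
  lies in no maximal ideal, so it contains 1.\<close>

lemma local_global:
  assumes M: "lattice M" and x: "x \<in> carrier L" "\<And>P. maximalideal P R \<Longrightarrow> x \<in> localized P M"
  shows "x \<in> M"
proof -
  let ?I = "{r \<in> carrier R. \<rho> r \<otimes> x \<in> M}"
  have x0: "\<zero> \<in> M"
  proof -
    obtain r where "r \<in> carrier R" "\<rho> r \<otimes> x \<in> M" using latticeD(4)[OF M x(1)] by auto
    from latticeD(3)[OF M D.zero_closed this(2)] this(1) show ?thesis using x by simp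
  qed
  have I: "ideal ?I R"
    by (rule D.ideal_criterion) (use x x0 latticeD[OF M] in \<open>auto simp: l_distr m_assoc\<close>)
  have "?I = carrier R"
  proof (rule ccontr)
    assume "?I \<noteq> carrier R"
    then obtain P where P: "maximalideal P R" "?I \<subseteq> P" using D.exists_maximalideal[OF I] by auto
    thus False using x(2)[OF P(1)] by (auto elim!: localizedE)
  qed
  hence "\<one>\<^bsub>R\<^esub> \<in> ?I" by simp
  thus ?thesis using x by simp
qed

lemma scaled_pow:
  assumes "m \<in> carrier L" "w \<in> carrier R"
  shows "(\<rho> w \<otimes> m) [^] (k::nat) = \<rho> (w [^]\<^bsub>R\<^esub> k) \<otimes> m [^] k"
proof (induction k)
  case (Suc k)
  thus ?case using assms rho_comm(2)[OF assms(2), of "m [^] k" m] by (simp add: m_assoc)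
qed (use assms in simp)

lemma geometric_sum_scaled_comm:
  assumes "m \<in> carrier L" "w \<in> carrier R"
  shows "m \<otimes> geometric_sum L (\<rho> w \<otimes> m) k = geometric_sum L (\<rho> w \<otimes> m) k \<otimes> m"
proof (induction k)
  case (Suc k)
  have "m \<otimes> (\<rho> w \<otimes> m \<otimes> geometric_sum L (\<rho> w \<otimes> m) k) = \<rho> w \<otimes> m \<otimes> (m \<otimes> geometric_sum L (\<rho> w \<otimes> m) k)"
    using assms rho_comm(2)[OF assms(2,1)] by (simp add: m_assoc)
  also have "\<dots> = \<rho> w \<otimes> m \<otimes> geometric_sum L (\<rho> w \<otimes> m) k \<otimes> m"
    unfolding Suc using assms by (simp add: m_assoc)
  finally show ?case using assms by (simp add: r_distr l_distr)
qed (use assms in simp)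

section \<open>Approximation by unipotent elements and gluing\<close>

context
  fixes W
  assumes W: "lattice W" and W1: "\<one> \<in> W" and Wm: "\<And>x y. x \<in> W \<Longrightarrow> y \<in> W \<Longrightarrow> x \<otimes> y \<in> W"
begin

lemma localized_order_mult:
  "\<lbrakk> maximalideal P R; x \<in> localized P W; y \<in> localized P W \<rbrakk> \<Longrightarrow> x \<otimes> y \<in> localized P W"
  using localized_mult[OF _ _ _ Wm] latticeD(1)[OF W] by blast

lemma local_units_mult:
  assumes "maximalideal P R" "x \<in> local_units P W" "y \<in> local_units P W" shows "x \<otimes> y \<in> local_units P W"
  using assms localized_order_mult unfolding local_units_def by (auto simp: Units_inv_mult)

lemma local_units_inv: "x \<in> local_units P W \<Longrightarrow> inv x \<in> local_units P W"
  unfolding local_units_def by auto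

lemma local_units_one: "maximalideal P R \<Longrightarrow> \<one> \<in> local_units P W"
  unfolding local_units_def using localized_self[OF _ W W1] by auto

text \<open>The terms of the product are scalars in \<open>R\<close> times \<open>z m [^] i\<close>
  with positive \<open>i\<close>. Neither \<open>m\<close> nor the geometric sum itself need be
  integral at \<open>P\<close>; the factor \<open>z\<close> pays for all denominators at
  once.\<close>

lemma scaled_geometric_sum:
  assumes P: "maximalideal P R" and m: "m \<in> carrier L" "w \<in> carrier R" "z \<in> carrier R"
    and z: "\<And>i::nat. 1 \<le> i \<Longrightarrow> \<rho> z \<otimes> m [^] i \<in> localized P W" and "1 \<le> (j::nat)"
  shows "\<rho> z \<otimes> m [^] j \<otimes> geometric_sum L (\<rho> w \<otimes> m) k \<in> localized P W"
  using \<open>1 \<le> j\<close>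
proof (induction k arbitrary: j)
  case 0
  have "\<ominus> (\<rho> z \<otimes> m [^] (1::nat)) \<oplus> \<rho> z \<otimes> m [^] (1::nat) \<in> localized P W"
    using z[of 1] localized_add[OF P W] localized_uminus[OF W] by simp
  hence "\<zero> \<in> localized P W" using m by (simp add: l_neg)
  moreover have "\<rho> z \<otimes> m [^] j \<in> carrier L" using m by simp
  ultimately show ?case by simp
next
  case (Suc k)
  let ?g = "geometric_sum L (\<rho> w \<otimes> m) k"
  have "\<rho> z \<otimes> m [^] j \<otimes> (\<rho> w \<otimes> m \<otimes> ?g) = \<rho> w \<otimes> (\<rho> z \<otimes> (m [^] j \<otimes> m) \<otimes> ?g)"
    using m rho_comm(2)[of w "m [^] j" "m \<otimes> ?g"] rho_comm(2)[of w "\<rho> z" "m [^] j \<otimes> (m \<otimes> ?g)"] by (simp add: m_assoc)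
  also have "m [^] j \<otimes> m = m [^] Suc j" by simp
  finally have "\<rho> z \<otimes> m [^] j \<otimes> geometric_sum L (\<rho> w \<otimes> m) (Suc k)
      = \<rho> z \<otimes> m [^] j \<oplus> \<rho> w \<otimes> (\<rho> z \<otimes> m [^] Suc j \<otimes> ?g)"
    using m by (simp add: r_distr)
  thus ?case using z[OF Suc.prems] Suc.IH[of "Suc j"] localized_add[OF P W] localized_smult[OF W _ m(2)] by simp
qed

lemma scaled_unipotent:
  assumes m: "m \<in> carrier L" "m [^] (k::nat) = \<zero>" "r \<in> carrier R"
  shows "\<one> \<oplus> \<rho> r \<otimes> m \<in> unipotent_products L" "inv (\<one> \<oplus> \<rho> r \<otimes> m) = geometric_sum L (\<rho> (\<ominus>\<^bsub>R\<^esub> r) \<otimes> m) k"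
proof -
  have y: "\<rho> r \<otimes> m \<in> carrier L" "(\<rho> r \<otimes> m) [^] k = \<zero>" using scaled_pow[OF m(1,3)] m by simp_all
  show "\<one> \<oplus> \<rho> r \<otimes> m \<in> unipotent_products L" by (rule unipotent_in_unipotent_products[OF y])
  have e: "\<rho> (\<ominus>\<^bsub>R\<^esub> r) \<otimes> m = \<ominus> (\<rho> r \<otimes> m)" using m by (simp add: l_minus)
  show "inv (\<one> \<oplus> \<rho> r \<otimes> m) = geometric_sum L (\<rho> (\<ominus>\<^bsub>R\<^esub> r) \<otimes> m) k"
    unfolding e using geometric_sum_inverse[OF y] y by (intro inv_unique'[symmetric]) auto
qed

text \<open>The inverse \<open>g\<close> satisfies \<open>g = 1 - r m g\<close>, and the product
  \<open>r m g\<close> is integral at \<open>P\<close> by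
  \<open>scaled_geometric_sum\<close>.\<close>

lemma scaled_unipotent_local_unit:
  assumes P: "maximalideal P R" and m: "m \<in> carrier L" "m [^] (k::nat) = \<zero>" "r \<in> carrier R"
    and r: "\<And>i::nat. 1 \<le> i \<Longrightarrow> \<rho> r \<otimes> m [^] i \<in> localized P W"
  shows "\<one> \<oplus> \<rho> r \<otimes> m \<in> local_units P W"
proof -
  let ?g = "geometric_sum L (\<rho> (\<ominus>\<^bsub>R\<^esub> r) \<otimes> m) k"
  have U: "\<one> \<oplus> \<rho> r \<otimes> m \<in> Units L" using unipotent_products_Units scaled_unipotent(1)[OF m] .
  have g: "?g \<in> carrier L" using m by simp
  have "(\<one> \<oplus> \<rho> r \<otimes> m) \<otimes> ?g = \<one>" using U scaled_unipotent(2)[OF m] by (metis Units_r_inv)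
  hence "?g \<oplus> \<rho> r \<otimes> m \<otimes> ?g = \<one>" using m g by (simp add: l_distr)
  hence "?g = \<one> \<oplus> \<ominus> (\<rho> r \<otimes> m [^] (1::nat) \<otimes> ?g)"
    using m g by (metis (no_types, lifting) a_assoc a_inv_closed m_closed nat_pow_eone r_neg r_zero rho_simps(1))
  hence "?g \<in> localized P W"
    using localized_add[OF P W localized_self[OF P W W1] localized_uminus[OF W scaled_geometric_sum[OF P m(1) _ m(3) r, of "\<ominus>\<^bsub>R\<^esub> r" 1 k]]] m
    by (metis D.a_inv_closed le_refl)
  moreover have "\<one> \<oplus> \<rho> r \<otimes> m \<in> localized P W"
    using localized_add[OF P W localized_self[OF P W W1] r[of 1]] m by simp
  ultimately show ?thesis unfolding local_units_def using U scaled_unipotent(2)[OF m] by simp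
qed

text \<open>With \<open>x = 1 + r m\<close>, \<open>y = 1 + m\<close> and \<open>z = 1 - r\<close>
  one has \<open>y = x + z m\<close>. The two quotients are therefore
  \<open>1 + z m x\<^sup>-\<^sup>1\<close> and \<open>1 - z m y\<^sup>-\<^sup>1\<close>, where both
  inverses are geometric sums and \<open>z\<close> clears the denominators.\<close>

lemma scaled_unipotent_quotient:
  assumes P: "maximalideal P R" and m: "m \<in> carrier L" "m [^] (k::nat) = \<zero>" "r \<in> carrier R"
    and r: "\<And>i::nat. 1 \<le> i \<Longrightarrow> \<rho> (\<one>\<^bsub>R\<^esub> \<ominus>\<^bsub>R\<^esub> r) \<otimes> m [^] i \<in> localized P W"
  shows "inv (\<one> \<oplus> \<rho> r \<otimes> m) \<otimes> (\<one> \<oplus> m) \<in> local_units P W"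
proof -
  define x y where "x = \<one> \<oplus> \<rho> r \<otimes> m" and "y = \<one> \<oplus> m"
  define z where "z = \<one>\<^bsub>R\<^esub> \<ominus>\<^bsub>R\<^esub> r"
  have z: "z \<in> carrier R" unfolding z_def using m by simp
  have xU: "x \<in> Units L" unfolding x_def using unipotent_products_Units scaled_unipotent(1)[OF m] .
  have yU: "y \<in> Units L" unfolding y_def using unipotent_Units[OF m(1,2)] .
  have yx: "y = x \<oplus> \<rho> z \<otimes> m"
    unfolding x_def y_def z_def using m by (simp add: nc_simps D.minus_eq)
  have mem: "\<rho> z \<otimes> m \<otimes> geometric_sum L (\<rho> w \<otimes> m) k \<in> localized P W" if "w \<in> carrier R" for w
    using scaled_geometric_sum[OF P m(1) that z r[folded z_def], of 1 k] m by (metis le_refl nat_pow_eone)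
  have ix: "inv x = geometric_sum L (\<rho> (\<ominus>\<^bsub>R\<^esub> r) \<otimes> m) k" unfolding x_def by (rule scaled_unipotent(2)[OF m])
  have iy: "inv y = geometric_sum L (\<rho> (\<ominus>\<^bsub>R\<^esub> \<one>\<^bsub>R\<^esub>) \<otimes> m) k"
    unfolding y_def using scaled_unipotent(2)[OF m(1,2), of "\<one>\<^bsub>R\<^esub>"] m by simp
  have com: "inv x \<otimes> (\<rho> z \<otimes> m) = \<rho> z \<otimes> m \<otimes> inv x" "inv y \<otimes> (\<rho> z \<otimes> m) = \<rho> z \<otimes> m \<otimes> inv y"
    using geometric_sum_scaled_comm[OF m(1), of _ k] rho_comm(2)[OF z _ m(1)] m z unfolding ix iy
    by (simp_all add: m_assoc del: rho_minus)
  have ic: "inv x \<in> carrier L" "inv y \<in> carrier L" "x \<in> carrier L" "y \<in> carrier L" using xU yU by auto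
  have zm: "\<rho> z \<otimes> m \<in> carrier L" using z m by simp
  have 1: "inv x \<otimes> y = \<one> \<oplus> \<rho> z \<otimes> m \<otimes> inv x"
    unfolding yx using xU ic zm com by (simp add: r_distr)
  have "x = y \<oplus> \<ominus> (\<rho> z \<otimes> m)" unfolding yx using ic zm by (simp add: a_assoc r_neg)
  hence "inv y \<otimes> x = inv y \<otimes> (y \<oplus> \<ominus> (\<rho> z \<otimes> m))" by simp
  also have "\<dots> = \<one> \<oplus> \<ominus> (\<rho> z \<otimes> m \<otimes> inv y)"
    using yU ic zm com by (simp add: r_distr r_minus)
  finally have 2: "inv y \<otimes> x = \<one> \<oplus> \<ominus> (\<rho> z \<otimes> m \<otimes> inv y)" .
  have "inv x \<otimes> y \<in> localized P W"
    unfolding 1 using localized_add[OF P W localized_self[OF P W W1] mem] m unfolding ix by (simp del: rho_minus)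
  moreover have "inv y \<otimes> x \<in> localized P W"
    unfolding 2 using localized_add[OF P W localized_self[OF P W W1] localized_uminus[OF W mem]] m unfolding iy by (simp del: rho_minus)
  ultimately show ?thesis
    unfolding local_units_def x_def[symmetric] y_def[symmetric] using xU yU by (simp add: Units_inv_mult)
qed

lemma common_denominator:
  assumes "m \<in> carrier L"
  shows "\<exists>a \<in> carrier R - {\<zero>\<^bsub>R\<^esub>}. \<forall>i < (k::nat). \<rho> a \<otimes> m [^] i \<in> W"
proof (induction k)
  case (Suc k)
  then obtain a where a: "a \<in> carrier R - {\<zero>\<^bsub>R\<^esub>}" "\<And>i. i < k \<Longrightarrow> \<rho> a \<otimes> m [^] i \<in> W" by auto
  obtain b where b: "b \<in> carrier R - {\<zero>\<^bsub>R\<^esub>}" "\<rho> b \<otimes> m [^] k \<in> W" using latticeD(4)[OF W, of "m [^] k"] assms by auto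
  have "\<rho> (a \<otimes>\<^bsub>R\<^esub> b) \<otimes> m [^] i \<in> W" if "i < Suc k" for i
  proof (cases "i = k")
    case True
    thus ?thesis using latticeD(3)[OF W _ b(2), of a] a(1) b(1) assms by (simp add: m_assoc)
  next
    case False
    hence "\<rho> b \<otimes> (\<rho> a \<otimes> m [^] i) \<in> W" using latticeD(3)[OF W _ a(2), of b i] that b(1) by simp
    thus ?thesis using a(1) b(1) assms rho_comm(2)[of b "\<rho> a" "m [^] i"] by (simp add: m_assoc)
  qed
  moreover have "a \<otimes>\<^bsub>R\<^esub> b \<in> carrier R - {\<zero>\<^bsub>R\<^esub>}" using a(1) b(1) D.integral by auto
  ultimately show ?case by auto
qed (use D.one_not_zero in auto)

text \<open>Approximation: \<open>1 + m\<close> is replaced by \<open>1 + r m\<close>, where \<open>r\<close> is close to 1 at \<open>P\<close> and close to 0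
  at all other places, so close that the denominators of the powers of \<open>m\<close> do not matter.\<close>

lemma unipotent_approximation:
  assumes P: "maximalideal P R" and "x \<in> unipotent_products L"
  shows "\<exists>c \<in> unipotent_products L. inv c \<otimes> x \<in> local_units P W \<and>
    (\<forall>Q. maximalideal Q R \<longrightarrow> Q \<noteq> P \<longrightarrow> c \<in> local_units Q W)"
  using assms(2)
proof induction
  case one
  show ?case by (rule bexI[OF _ unipotent_products.one]) (use local_units_one P in auto)
next
  case (step x n k)
  obtain c where c: "c \<in> unipotent_products L" "inv c \<otimes> x \<in> local_units P W"
    "\<And>Q. maximalideal Q R \<Longrightarrow> Q \<noteq> P \<Longrightarrow> c \<in> local_units Q W" using step.IH by blast
  define v where "v = inv c \<otimes> x"
  have v: "v \<in> Units L" "v \<in> local_units P W" using c(2) unfolding v_def local_units_def by auto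
  have cU: "c \<in> Units L" using c(1) unipotent_products_Units by auto
  have xc: "x \<in> carrier L" using step.hyps(1) unipotent_products_Units by auto
  \<comment> \<open>With \<open>v = c\<^sup>-\<^sup>1 x\<close> one has
    \<open>x (1 + n) = c (1 + m) v\<close>. As \<open>v\<close> is already a unit at
    \<open>P\<close>, only the unipotent factor \<open>1 + m\<close> remains to be
    approximated.\<close>
  define m where "m = v \<otimes> n \<otimes> inv v"
  have m: "m \<in> carrier L" "m [^] k = \<zero>"
    unfolding m_def using unit_conj_pow[OF v(1) step.hyps(2), of k] step.hyps v by simp_all
  obtain a where a: "a \<in> carrier R" "a \<noteq> \<zero>\<^bsub>R\<^esub>" "\<And>i. i < k \<Longrightarrow> \<rho> a \<otimes> m [^] i \<in> W"
    using common_denominator[OF m(1)] by auto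
  have W0: "\<zero> \<in> W" using latticeD(3)[OF W D.zero_closed W1] by simp
  have big: "m [^] i = \<zero>" if "k \<le> i" for i :: nat
    using nat_pow_mult[OF m(1), of k "i - k"] that m by simp
  have aW: "\<rho> a \<otimes> m [^] i \<in> W" for i :: nat
    using a(3)[of i] big[of i] W0 a(1) by (cases "i < k") auto
  \<comment> \<open>In the localization at \<open>Q\<close> such a \<open>y\<close> is a multiple of
    \<open>a\<close>, and \<open>a\<close> clears the denominators of all powers of
    \<open>m\<close>, as there are only finitely many nonzero ones.\<close>
  have mult: "\<rho> y \<otimes> m [^] i \<in> localized Q W" if y0: "y \<in> D.local_multiples a Q" for y Q and i :: nat
  proof -
    obtain s b where y: "y \<in> carrier R" "s \<in> carrier R - Q" "b \<in> carrier R" "s \<otimes>\<^bsub>R\<^esub> y = a \<otimes>\<^bsub>R\<^esub> b"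
      using y0 unfolding D.local_multiples_def by auto
    have "\<rho> s \<otimes> (\<rho> y \<otimes> m [^] i) = \<rho> (s \<otimes>\<^bsub>R\<^esub> y) \<otimes> m [^] i" using y(1,2) m by (simp add: m_assoc)
    also have "\<dots> = \<rho> b \<otimes> (\<rho> a \<otimes> m [^] i)"
      unfolding y(4) using y(3) a(1) m rho_comm(2)[of b "\<rho> a" "m [^] i"] by (simp add: m_assoc)
    finally show ?thesis using latticeD(3)[OF W y(3) aW] y(1,2) m by (intro localizedI[of s]) auto
  qed
  obtain r where r: "r \<in> D.away_multiples a P" "\<one>\<^bsub>R\<^esub> \<ominus>\<^bsub>R\<^esub> r \<in> D.local_multiples a P"
    using D.local_away_split[OF P a(1,2)] by auto
  have rc: "r \<in> carrier R" using r(1) unfolding D.away_multiples_def by auto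
  define e where "e = \<one> \<oplus> \<rho> r \<otimes> m"
  have e: "e \<in> unipotent_products L" unfolding e_def by (rule scaled_unipotent(1)[OF m rc])
  have eU: "e \<in> Units L" using e unipotent_products_Units by auto
  have eQ: "e \<in> local_units Q W" if "maximalideal Q R" "Q \<noteq> P" for Q
    unfolding e_def using r(1) mult that unfolding D.away_multiples_def
    by (intro scaled_unipotent_local_unit[OF that(1) m rc]) auto
  have eP: "inv e \<otimes> (\<one> \<oplus> m) \<in> local_units P W"
    unfolding e_def using mult[OF r(2)] by (intro scaled_unipotent_quotient[OF P m rc]) auto
  have nc: "n \<in> carrier L" by (rule step.hyps)
  have "x \<otimes> (\<one> \<oplus> n) = c \<otimes> (v \<otimes> (\<one> \<oplus> n))"
    unfolding v_def using cU xc nc by (simp add: m_assoc[symmetric])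
  also have "\<dots> = c \<otimes> ((\<one> \<oplus> m) \<otimes> v)" unfolding unipotent_conj[OF v(1) nc] m_def ..
  finally have "inv (c \<otimes> e) \<otimes> (x \<otimes> (\<one> \<oplus> n)) = inv e \<otimes> (inv c \<otimes> c) \<otimes> ((\<one> \<oplus> m) \<otimes> v)"
    using cU eU m v(1) nc xc by (simp add: Units_inv_mult m_assoc del: Units_l_inv)
  also have "\<dots> = (inv e \<otimes> (\<one> \<oplus> m)) \<otimes> v" using cU eU m v(1) by (simp add: m_assoc)
  finally have "inv (c \<otimes> e) \<otimes> (x \<otimes> (\<one> \<oplus> n)) \<in> local_units P W"
    using local_units_mult[OF P eP v(2)] by simp
  moreover have "c \<otimes> e \<in> unipotent_products L" using unipotent_products_mult[OF e c(1)] .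
  ultimately show ?case using local_units_mult c(3) eQ by (intro bexI[of _ "c \<otimes> e"]) auto
qed

text \<open>The unit at one place is good at all but finitely many others. It is corrected at these
  one by one: the equality of classes makes the quotient of the present unit and the wanted one a
  product of unipotent elements, and the correction, obtained by approximation, is a local unit of
  \<open>W\<close> away from the place in question.\<close>

theorem unit_of_local_units:
  assumes M: "lattice M" "lattice M'"
    and WM: "\<And>x y. x \<in> W \<Longrightarrow> y \<in> M \<Longrightarrow> x \<otimes> y \<in> M" "\<And>x y. x \<in> M' \<Longrightarrow> y \<in> W \<Longrightarrow> x \<otimes> y \<in> M'"
    and u: "\<And>P. maximalideal P R \<Longrightarrow> u P \<in> Units L \<and> u P \<in> localized P M \<and> inv (u P) \<in> localized P M'"
    and cls: "\<And>P Q. maximalideal P R \<Longrightarrow> maximalideal Q R \<Longrightarrow> unit_class L (u P) = unit_class L (u Q)"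
  shows "\<exists>v \<in> Units L. v \<in> M \<and> inv v \<in> M'"
proof -
  have "ideal {\<zero>\<^bsub>R\<^esub>} R" by (rule D.zeroideal)
  moreover have "{\<zero>\<^bsub>R\<^esub>} \<noteq> carrier R" using D.one_not_zero D.one_closed by (metis singletonD)
  ultimately obtain P0 where P0: "maximalideal P0 R" using D.exists_maximalideal by blast
  define u0 where "u0 = u P0"
  have u0: "u0 \<in> Units L" using u[OF P0] unfolding u0_def by auto
  obtain r1 where r1: "r1 \<in> carrier R - {\<zero>\<^bsub>R\<^esub>}" "\<rho> r1 \<otimes> u0 \<in> M" using latticeD(4)[OF M(1)] u0 by auto
  obtain r2 where r2: "r2 \<in> carrier R - {\<zero>\<^bsub>R\<^esub>}" "\<rho> r2 \<otimes> inv u0 \<in> M'" using latticeD(4)[OF M(2) Units_inv_closed[OF u0]] by auto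
  \<comment> \<open>Outside \<open>S\<close> the scalars \<open>r1\<close> and \<open>r2\<close> are
    admissible denominators, so \<open>u0\<close> and its inverse already lie in the localized
    lattices.\<close>
  define S where "S = {P. maximalideal P R \<and> r1 \<in> P} \<union> {P. maximalideal P R \<and> r2 \<in> P}"
  have S: "finite S" unfolding S_def using D.finite_maximalideals r1(1) r2(1) by auto
  have "\<exists>v \<in> Units L. unit_class L v = unit_class L u0 \<and>
      (\<forall>Q. maximalideal Q R \<longrightarrow> Q \<notin> S \<or> Q \<in> T \<longrightarrow> v \<in> localized Q M \<and> inv v \<in> localized Q M')"
    if "finite T" "T \<subseteq> {P. maximalideal P R}" for T
    using that
  proof induction
    case empty
    show ?case
      by (rule bexI[OF _ u0]) (use u0 r1 r2 in \<open>auto simp: S_def intro: localizedI[of r1] localizedI[of r2]\<close>)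
  next
    case (insert P T)
    then obtain v where v: "v \<in> Units L" "unit_class L v = unit_class L u0"
      "\<And>Q. maximalideal Q R \<Longrightarrow> Q \<notin> S \<or> Q \<in> T \<Longrightarrow> v \<in> localized Q M \<and> inv v \<in> localized Q M'" by auto
    have P: "maximalideal P R" using insert.prems by auto
    note uP = u[OF P]
    define x where "x = u P \<otimes> inv v"
    have x: "x \<in> unipotent_products L"
      unfolding x_def using unit_class_eq_iff[of "u P" v] uP v cls[OF P P0] unfolding u0_def by auto
    have xU: "x \<in> Units L" using x unipotent_products_Units by auto
    \<comment> \<open>The inverse of \<open>x\<close> is approximated, rather than \<open>x\<close>,
      so that the local unit \<open>d x\<^sup>-\<^sup>1\<close> stands to the left of
      \<open>u P\<close>, the side on which \<open>W\<close> acts on \<open>M\<close>.\<close>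
    obtain c where c: "c \<in> unipotent_products L" "inv c \<otimes> inv x \<in> local_units P W"
      "\<And>Q. maximalideal Q R \<Longrightarrow> Q \<noteq> P \<Longrightarrow> c \<in> local_units Q W"
      using unipotent_approximation[OF P unipotent_products_inv[OF x]] by blast
    define d where "d = inv c"
    have d: "d \<in> unipotent_products L" unfolding d_def by (rule unipotent_products_inv[OF c(1)])
    have dU: "d \<in> Units L" using d unipotent_products_Units by auto
    have dv: "d \<otimes> v \<in> Units L" using dU v by simp
    have "d \<otimes> v \<otimes> inv v = d" using dU v by (simp add: m_assoc)
    hence cl: "unit_class L (d \<otimes> v) = unit_class L u0" using unit_class_eq_iff[OF dv v(1)] d v(2) by simp
    have WL: "W \<subseteq> carrier L" "M \<subseteq> carrier L" "M' \<subseteq> carrier L" using W M unfolding lattice_def by auto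
    have "d \<otimes> v \<in> localized Q M \<and> inv (d \<otimes> v) \<in> localized Q M'"
      if Q: "maximalideal Q R" "Q \<notin> S \<or> Q \<in> insert P T" for Q
    proof (cases "Q = P")
      case True
      define e where "e = d \<otimes> inv x"
      have e: "e \<in> local_units P W" using c(2) unfolding e_def d_def .
      have eU: "e \<in> Units L" using e unfolding local_units_def by auto
      have "e \<otimes> u P = d \<otimes> (inv x \<otimes> x) \<otimes> v"
        unfolding e_def x_def using dU xU uP v by (simp add: Units_inv_mult m_assoc)
      hence eq: "d \<otimes> v = e \<otimes> u P" using xU dU v by simp
      have "inv (e \<otimes> u P) = inv (u P) \<otimes> inv e" using eU uP Units_inv_mult by auto
      thus ?thesis
        unfolding True eq using uP e localized_mult[OF P WL(1,2) WM(1)] localized_mult[OF P WL(3,1) WM(2)]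
        unfolding local_units_def by auto
    next
      case False
      have dQ: "d \<in> local_units Q W" unfolding d_def by (rule local_units_inv[OF c(3)[OF Q(1) False]])
      have "inv (d \<otimes> v) = inv v \<otimes> inv d" using dU v Units_inv_mult by auto
      moreover have "v \<in> localized Q M \<and> inv v \<in> localized Q M'" using v(3)[OF Q(1)] Q(2) False by auto
      ultimately show ?thesis
        using dQ localized_mult[OF Q(1) WL(1,2) WM(1)] localized_mult[OF Q(1) WL(3,1) WM(2)]
        unfolding local_units_def by auto
    qed
    thus ?case using dv cl by blast
  qed
  from this[OF S] obtain v where v: "v \<in> Units L"
    "\<And>Q. maximalideal Q R \<Longrightarrow> v \<in> localized Q M \<and> inv v \<in> localized Q M'"
    unfolding S_def by blast
  thus ?thesis using local_global[OF M(1)] local_global[OF M(2)] by (intro bexI[of _ v]) auto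
qed

end

end

section \<open>Local isomorphisms\<close>

context linear_category
begin

abbreviation "H U V \<equiv> carrier (Hom C U V)"

context
  fixes U V assumes obj: "U \<in> Obj C" "V \<in> Obj C"
begin

interpretation M: module R "Hom C U V" by (rule hom_module[OF obj])

lemma hom_simps [simp]:
  "\<zero>\<^bsub>Hom C U V\<^esub> \<in> H U V"
  "\<lbrakk> f \<in> H U V; g \<in> H U V \<rbrakk> \<Longrightarrow> f \<oplus>\<^bsub>Hom C U V\<^esub> g \<in> H U V"
  "f \<in> H U V \<Longrightarrow> \<ominus>\<^bsub>Hom C U V\<^esub> f \<in> H U V"
  "\<lbrakk> r \<in> carrier R; f \<in> H U V \<rbrakk> \<Longrightarrow> r \<odot>\<^bsub>Hom C U V\<^esub> f \<in> H U V"
  "\<lbrakk> r \<in> carrier R; s \<in> carrier R; f \<in> H U V \<rbrakk> \<Longrightarrow> r \<odot>\<^bsub>Hom C U V\<^esub> (s \<odot>\<^bsub>Hom C U V\<^esub> f) = (r \<otimes>\<^bsub>R\<^esub> s) \<odot>\<^bsub>Hom C U V\<^esub> f"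
  "\<lbrakk> r \<in> carrier R; f \<in> H U V; g \<in> H U V \<rbrakk>
    \<Longrightarrow> r \<odot>\<^bsub>Hom C U V\<^esub> (f \<oplus>\<^bsub>Hom C U V\<^esub> g) = r \<odot>\<^bsub>Hom C U V\<^esub> f \<oplus>\<^bsub>Hom C U V\<^esub> r \<odot>\<^bsub>Hom C U V\<^esub> g"
  "f \<in> H U V \<Longrightarrow> \<one>\<^bsub>R\<^esub> \<odot>\<^bsub>Hom C U V\<^esub> f = f"
  "f \<in> H U V \<Longrightarrow> \<zero>\<^bsub>R\<^esub> \<odot>\<^bsub>Hom C U V\<^esub> f = \<zero>\<^bsub>Hom C U V\<^esub>"
  "r \<in> carrier R \<Longrightarrow> r \<odot>\<^bsub>Hom C U V\<^esub> \<zero>\<^bsub>Hom C U V\<^esub> = \<zero>\<^bsub>Hom C U V\<^esub>"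
  "f \<in> H U V \<Longrightarrow> f \<oplus>\<^bsub>Hom C U V\<^esub> \<zero>\<^bsub>Hom C U V\<^esub> = f"
  "f \<in> H U V \<Longrightarrow> \<zero>\<^bsub>Hom C U V\<^esub> \<oplus>\<^bsub>Hom C U V\<^esub> f = f"
  by (simp_all add: M.smult_assoc1 M.smult_r_distr)

text \<open>Both sides are \<open>e x + (1 - e) z\<close>, seen from either end.\<close>

lemma affine_swap:
  assumes "x \<in> H U V" "z \<in> H U V" "e \<in> carrier R"
  shows "x \<oplus>\<^bsub>Hom C U V\<^esub> (\<one>\<^bsub>R\<^esub> \<ominus>\<^bsub>R\<^esub> e) \<odot>\<^bsub>Hom C U V\<^esub> (z \<ominus>\<^bsub>Hom C U V\<^esub> x)
    = z \<oplus>\<^bsub>Hom C U V\<^esub> e \<odot>\<^bsub>Hom C U V\<^esub> (x \<ominus>\<^bsub>Hom C U V\<^esub> z)"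
proof -
  have cancel: "x \<oplus>\<^bsub>Hom C U V\<^esub> (z \<oplus>\<^bsub>Hom C U V\<^esub> (\<ominus>\<^bsub>Hom C U V\<^esub> x \<oplus>\<^bsub>Hom C U V\<^esub> w)) = z \<oplus>\<^bsub>Hom C U V\<^esub> w"
    if "w \<in> H U V" for w
    using assms that M.a_lcomm[of x z "\<ominus>\<^bsub>Hom C U V\<^esub> x \<oplus>\<^bsub>Hom C U V\<^esub> w"] by (simp add: M.r_neg1 M.r_neg2)
  thus ?thesis
    using assms by (simp add: a_minus_def M.smult_l_distr M.smult_r_distr M.smult_l_minus M.smult_r_minus M.minus_add M.a_ac cancel)
qed

end

lemma hom_group: "\<lbrakk> U \<in> Obj C; V \<in> Obj C \<rbrakk> \<Longrightarrow> abelian_group (Hom C U V)"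
  using hom_module module.axioms(2) by blast

lemma hom_smult_add:
  "\<lbrakk> U \<in> Obj C; V \<in> Obj C; r \<in> carrier R; s \<in> carrier R; f \<in> H U V \<rbrakk>
    \<Longrightarrow> (r \<oplus>\<^bsub>R\<^esub> s) \<odot>\<^bsub>Hom C U V\<^esub> f = r \<odot>\<^bsub>Hom C U V\<^esub> f \<oplus>\<^bsub>Hom C U V\<^esub> s \<odot>\<^bsub>Hom C U V\<^esub> f"
  using module.smult_l_distr[OF hom_module] by blast

lemma comp_zero [simp]:
  assumes "U \<in> Obj C" "V \<in> Obj C" "W \<in> Obj C"
  shows "f \<in> H U V \<Longrightarrow> Comp C U V W \<zero>\<^bsub>Hom C V W\<^esub> f = \<zero>\<^bsub>Hom C U W\<^esub>"
    "g \<in> H V W \<Longrightarrow> Comp C U V W g \<zero>\<^bsub>Hom C U V\<^esub> = \<zero>\<^bsub>Hom C U W\<^esub>"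
  using assms comp_smult_left[of U V W "\<zero>\<^bsub>R\<^esub>" f "\<zero>\<^bsub>Hom C V W\<^esub>"] comp_smult_right[of U V W "\<zero>\<^bsub>R\<^esub>" "\<zero>\<^bsub>Hom C U V\<^esub>" g] comp_closed[of U V W]
  by simp_all

lemmas cat_simps = id_closed comp_closed comp_id_left comp_id_right comp_assoc[symmetric]
  comp_add_left comp_add_right comp_smult_left comp_smult_right

section \<open>Endomorphism algebras and isomorphisms at a prime\<close>

lemma End_algebra:
  assumes U: "U \<in> Obj C" shows "central_algebra R (End_ring C U) (\<lambda>r. r \<odot>\<^bsub>Hom C U U\<^esub> Id C U)"
proof -
  interpret M: module R "Hom C U U" by (rule hom_module[OF U U])
  have "ring (End_ring C U)"
    by (intro ringI abelian_group_End M.abelian_group_axioms monoidI) (use U in \<open>simp_all add: cat_simps\<close>)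
  moreover have "(\<lambda>r. r \<odot>\<^bsub>Hom C U U\<^esub> Id C U) \<in> ring_hom R (End_ring C U)"
    by (rule ring_hom_memI) (use U in \<open>simp_all add: cat_simps M.smult_l_distr m_comm\<close>)
  ultimately show ?thesis
    unfolding central_algebra_def central_algebra_axioms_def
    using is_cring U by (simp add: cat_simps)
qed

lemma End_generates:
  assumes "hom_finite R C" and U: "U \<in> Obj C"
  shows "\<exists>G. central_algebra.generates R (End_ring C U) (\<lambda>r. r \<odot>\<^bsub>Hom C U U\<^esub> Id C U) G"
proof -
  interpret A: central_algebra R "End_ring C U" "\<lambda>r. r \<odot>\<^bsub>Hom C U U\<^esub> Id C U" by (rule End_algebra[OF U])
  obtain G where G: "finite G" "G \<subseteq> H U U"
      "\<And>m. m \<in> H U U \<Longrightarrow> \<exists>c \<in> G \<rightarrow> carrier R. m = (\<Oplus>\<^bsub>Hom C U U\<^esub>x\<in>G. c x \<odot>\<^bsub>Hom C U U\<^esub> x)"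
    using assms unfolding hom_finite_def finitely_generated_module_def by meson
  interpret M: module R "Hom C U U" by (rule hom_module[OF U U])
  have fs: "finsum (End_ring C U) h G = finsum (Hom C U U) h G" for h
    unfolding finsum_def finprod_def by simp
  have "A.lin_comb G c = (\<Oplus>\<^bsub>Hom C U U\<^esub>x\<in>G. c x \<odot>\<^bsub>Hom C U U\<^esub> x)" if "c \<in> G \<rightarrow> carrier R" for c
    unfolding A.lin_comb_def fs using that G(2) U
    by (intro M.finsum_cong') (auto simp: Pi_def subset_iff cat_simps)
  hence "A.generates G" unfolding A.generates_def A.span_def using G by (auto simp: image_iff)
  thus ?thesis by blast
qed

text \<open>An isomorphism over the localization at \<open>P\<close> with denominators cleared, in
  the form that \<open>isomorphic_base_change\<close> provides. It allows to work with morphisms of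
  \<open>C\<close> itself, torsion included.\<close>

definition p_iso where
  "p_iso P U V f \<longleftrightarrow> f \<in> H U V \<and> (\<exists>g \<in> H V U. \<exists>s \<in> carrier R - P.
     Comp C U V U g f = s \<odot>\<^bsub>Hom C U U\<^esub> Id C U \<and> Comp C V U V f g = s \<odot>\<^bsub>Hom C V V\<^esub> Id C V)"

text \<open>A left inverse \<open>g / s\<close> and a right inverse \<open>h / t\<close> coincide,
  since \<open>s h = t g\<close>.\<close>

lemma p_isoI:
  assumes U: "U \<in> Obj C" and V: "V \<in> Obj C" and P: "primeideal P R" and f: "f \<in> H U V"
    and g: "g \<in> H V U" "s \<in> carrier R - P" "Comp C U V U g f = s \<odot>\<^bsub>Hom C U U\<^esub> Id C U"
    and h: "h \<in> H V U" "t \<in> carrier R - P" "Comp C V U V f h = t \<odot>\<^bsub>Hom C V V\<^esub> Id C V"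
  shows "p_iso P U V f"
proof -
  have st: "s \<otimes>\<^bsub>R\<^esub> t \<in> carrier R - P" using primeideal.I_prime[OF P] g(2) h(2) by auto
  have "Comp C V U U (Comp C U V U g f) h = Comp C V V U g (Comp C V U V f h)"
    using U V f g(1) h(1) by (simp add: comp_assoc)
  hence sh: "s \<odot>\<^bsub>Hom C V U\<^esub> h = t \<odot>\<^bsub>Hom C V U\<^esub> g"
    unfolding g(3) h(3) using U V f g(1,2) h(1,2) by (simp add: cat_simps)
  have "Comp C U V U (s \<odot>\<^bsub>Hom C V U\<^esub> h) f = (s \<otimes>\<^bsub>R\<^esub> t) \<odot>\<^bsub>Hom C U U\<^esub> Id C U"
    unfolding sh using U V f g h(2) by (simp add: cat_simps m_comm)
  moreover have "Comp C V U V f (s \<odot>\<^bsub>Hom C V U\<^esub> h) = (s \<otimes>\<^bsub>R\<^esub> t) \<odot>\<^bsub>Hom C V V\<^esub> Id C V"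
    using U V f g(2) h by (simp add: cat_simps)
  moreover have "s \<odot>\<^bsub>Hom C V U\<^esub> h \<in> H V U" using U V g(2) h(1) by simp
  ultimately show ?thesis unfolding p_iso_def using f st by blast
qed

lemma p_iso_trans:
  assumes P: "primeideal P R" and f: "p_iso P U V f" and g: "p_iso P V W g"
    and o: "U \<in> Obj C" "V \<in> Obj C" "W \<in> Obj C"
  shows "\<exists>h. p_iso P U W h"
proof -
  obtain f' s where f': "f \<in> H U V" "f' \<in> H V U" "s \<in> carrier R - P" "Comp C U V U f' f = s \<odot>\<^bsub>Hom C U U\<^esub> Id C U"
      "Comp C V U V f f' = s \<odot>\<^bsub>Hom C V V\<^esub> Id C V"
    using f unfolding p_iso_def by blast
  obtain g' t where g': "g \<in> H V W" "g' \<in> H W V" "t \<in> carrier R - P" "Comp C V W V g' g = t \<odot>\<^bsub>Hom C V V\<^esub> Id C V"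
      "Comp C W V W g g' = t \<odot>\<^bsub>Hom C W W\<^esub> Id C W"
    using g unfolding p_iso_def by blast
  have "Comp C U W U (Comp C W V U f' g') (Comp C U V W g f) = Comp C U V U f' (Comp C U V V (Comp C V W V g' g) f)"
    "Comp C W U W (Comp C U V W g f) (Comp C W V U f' g') = Comp C W V W g (Comp C W V V (Comp C V U V f f') g')"
    using o f'(1,2) g'(1,2) by (simp_all add: cat_simps)
  hence "Comp C U W U (Comp C W V U f' g') (Comp C U V W g f) = (t \<otimes>\<^bsub>R\<^esub> s) \<odot>\<^bsub>Hom C U U\<^esub> Id C U"
    "Comp C W U W (Comp C U V W g f) (Comp C W V U f' g') = (t \<otimes>\<^bsub>R\<^esub> s) \<odot>\<^bsub>Hom C W W\<^esub> Id C W"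
    using o f' g' by (simp_all add: cat_simps m_comm)
  moreover have "t \<otimes>\<^bsub>R\<^esub> s \<in> carrier R - P" using primeideal.I_prime[OF P] f'(3) g'(3) by auto
  moreover have "Comp C W V U f' g' \<in> H W U" "Comp C U V W g f \<in> H U W" using o f'(1,2) g'(1,2) by (simp_all add: cat_simps)
  ultimately show ?thesis unfolding p_iso_def by blast
qed

text \<open>Composing with the inverse \<open>g\<close> of \<open>f\<close> gives \<open>s\<close>
  plus a multiple of \<open>e\<close>, hence an element that is invertible at \<open>P\<close> by
  \<open>p_unit_mod\<close>. So invertibility at \<open>P\<close> depends on \<open>f\<close> only
  modulo \<open>P\<close>.\<close>

lemma p_iso_perturb:
  assumes fin: "hom_finite R C" and U: "U \<in> Obj C" and V: "V \<in> Obj C" and P: "maximalideal P R"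
    and f: "p_iso P U V f" and h: "e \<in> P" "h \<in> H U V"
  shows "p_iso P U V (f \<oplus>\<^bsub>Hom C U V\<^esub> e \<odot>\<^bsub>Hom C U V\<^esub> h)"
proof -
  interpret A: central_algebra R "End_ring C U" "\<lambda>r. r \<odot>\<^bsub>Hom C U U\<^esub> Id C U" by (rule End_algebra[OF U])
  interpret B: central_algebra R "End_ring C V" "\<lambda>r. r \<odot>\<^bsub>Hom C V V\<^esub> Id C V" by (rule End_algebra[OF V])
  interpret P: maximalideal P R by (rule P)
  obtain G1 G2 where G: "A.generates G1" "B.generates G2" using End_generates[OF fin] U V by blast
  obtain g s where g: "f \<in> H U V" "g \<in> H V U" "s \<in> carrier R - P"
      "Comp C U V U g f = s \<odot>\<^bsub>Hom C U U\<^esub> Id C U" "Comp C V U V f g = s \<odot>\<^bsub>Hom C V V\<^esub> Id C V"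
    using f unfolding p_iso_def by blast
  define f' where "f' = f \<oplus>\<^bsub>Hom C U V\<^esub> e \<odot>\<^bsub>Hom C U V\<^esub> h"
  have e: "e \<in> carrier R" using h(1) P.Icarr by auto
  have f': "f' \<in> H U V" unfolding f'_def using U V g e h by simp
  have pu: "p_unit L \<rho> P x" if "central_algebra R L \<rho>" "central_algebra.generates R L \<rho> G" "x \<in> carrier L" "y \<in> carrier L"
      "x = \<rho> s \<oplus>\<^bsub>L\<^esub> \<rho> e \<otimes>\<^bsub>L\<^esub> y" "p_unit = central_algebra.p_unit R" for L \<rho> G x y p_unit
  proof -
    interpret C: central_algebra R L \<rho> by (rule that(1))
    have Gc: "G \<subseteq> carrier L" "finite G" "y \<in> C.span G (carrier R)" using that(2,4) unfolding C.generates_def by auto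
    have "x \<ominus>\<^bsub>L\<^esub> \<rho> s = \<rho> e \<otimes>\<^bsub>L\<^esub> y" unfolding that(5) using that(4) e g(3) by (simp add: C.nc_simps)
    hence "x \<ominus>\<^bsub>L\<^esub> \<rho> s \<in> C.span G P" using C.span_smult[OF Gc(1,2) P.is_ideal Gc(3) h(1)] by simp
    thus ?thesis unfolding that(6) using C.p_unit_mod[OF that(2) P that(3) g(3)] by simp
  qed
  have "A.p_unit P (Comp C U V U g f')"
    by (rule pu[OF A.central_algebra_axioms G(1), of _ "Comp C U V U g h"])
       (use U V g e h f' in \<open>simp_all add: f'_def cat_simps\<close>)
  moreover have "B.p_unit P (Comp C V U V f' g)"
    by (rule pu[OF B.central_algebra_axioms G(2), of _ "Comp C V U V h g"])
       (use U V g e h f' in \<open>simp_all add: f'_def cat_simps\<close>)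
  ultimately obtain y s1 z s2 where y: "y \<in> H U U" "s1 \<in> carrier R - P" "z \<in> H V V" "s2 \<in> carrier R - P"
    "Comp C U U U y (Comp C U V U g f') = s1 \<odot>\<^bsub>Hom C U U\<^esub> Id C U"
    "Comp C V V V (Comp C V U V f' g) z = s2 \<odot>\<^bsub>Hom C V V\<^esub> Id C V"
    unfolding A.p_unit_def B.p_unit_def by auto
  have "p_iso P U V f'"
    by (rule p_isoI[OF U V maximalideal_prime[OF P] f', of "Comp C V U U y g" s1 "Comp C V V U g z" s2])
       (use U V g f' y in \<open>simp_all add: comp_closed comp_assoc\<close>)
  thus ?thesis unfolding f'_def .
qed

text \<open>The \<open>r\<close> for which \<open>f\<close> is invertible up to \<open>r\<close> form an ideal.\<close>

lemma iso_of_p_iso: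
  assumes "noetherian_ring R" and U: "U \<in> Obj C" and V: "V \<in> Obj C" and f: "f \<in> H U V"
    and "\<And>P. maximalideal P R \<Longrightarrow> p_iso P U V f"
  shows "isomorphic_in C U V"
proof -
  interpret N: noetherian_ring R by (rule assms(1))
  let ?Q = "\<lambda>r g. g \<in> H V U \<and> Comp C U V U g f = r \<odot>\<^bsub>Hom C U U\<^esub> Id C U \<and> Comp C V U V f g = r \<odot>\<^bsub>Hom C V V\<^esub> Id C V"
  let ?I = "{r \<in> carrier R. \<exists>g. ?Q r g}"
  have Q0: "?Q \<zero>\<^bsub>R\<^esub> \<zero>\<^bsub>Hom C V U\<^esub>" using U V f by (simp add: cat_simps)
  have Qadd: "?Q (r \<oplus>\<^bsub>R\<^esub> s) (g \<oplus>\<^bsub>Hom C V U\<^esub> h)" if "r \<in> carrier R" "s \<in> carrier R" "?Q r g" "?Q s h" for r s g h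
    using U V f that by (simp add: cat_simps hom_smult_add)
  have Qmult: "?Q (r \<otimes>\<^bsub>R\<^esub> s) (r \<odot>\<^bsub>Hom C V U\<^esub> h)" if "r \<in> carrier R" "s \<in> carrier R" "?Q s h" for r s h
    using U V f that by (simp add: cat_simps)
  have I: "ideal ?I R"
  proof (rule ideal_criterion)
    show "\<zero>\<^bsub>R\<^esub> \<in> ?I" by (intro CollectI conjI exI[of _ "\<zero>\<^bsub>Hom C V U\<^esub>"]) (use Q0 in simp_all)
    fix r s assume r: "r \<in> ?I"
    {
      assume s: "s \<in> ?I"
      obtain g h where "?Q r g" "?Q s h" using r s by auto
      from Qadd[OF _ _ this] r s show "r \<oplus>\<^bsub>R\<^esub> s \<in> ?I"
        by (intro CollectI conjI exI[of _ "g \<oplus>\<^bsub>Hom C V U\<^esub> h"]) simp_all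
    }
    assume s: "s \<in> carrier R"
    obtain h where "?Q r h" using r by auto
    from Qmult[OF s _ this] r s show "s \<otimes>\<^bsub>R\<^esub> r \<in> ?I"
      by (intro CollectI conjI exI[of _ "s \<odot>\<^bsub>Hom C V U\<^esub> h"]) simp_all
  qed auto
  have "?I = carrier R"
  proof (rule ccontr)
    assume "?I \<noteq> carrier R"
    then obtain P where P: "maximalideal P R" "?I \<subseteq> P" using N.exists_maximalideal[OF I] by auto
    show False using assms(5)[OF P(1)] P(2) unfolding p_iso_def by blast
  qed
  hence "\<one>\<^bsub>R\<^esub> \<in> ?I" by simp
  then obtain g where "?Q \<one>\<^bsub>R\<^esub> g" by auto
  thus ?thesis unfolding isomorphic_in_def using U V f by (auto simp: cat_simps)
qed

end

text \<open>The instance of the Chinese remainder theorem by which a change at one place leaves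
  finitely many others alone: a product of elements of the \<open>Q\<close> outside
  \<open>P\<close>, normalized to be 1 modulo \<open>P\<close>.\<close>

lemma (in cring) maximalideal_avoid:
  assumes "finite T" "\<And>Q. Q \<in> T \<Longrightarrow> maximalideal Q R \<and> Q \<noteq> P" and P: "maximalideal P R"
  shows "\<exists>e \<in> carrier R. (\<forall>Q \<in> T. e \<in> Q) \<and> \<one> \<ominus> e \<in> P"
proof -
  interpret P: maximalideal P R by (rule P)
  have prime: "primeideal P R" by (rule maximalideal_prime[OF P])
  have "\<exists>e \<in> carrier R - P. \<forall>Q \<in> T. e \<in> Q"
    using assms(1,2)
  proof induction
    case empty
    show ?case using P.I_notcarr P.one_imp_carrier by auto
  next
    case (insert Q T)
    then obtain e where e: "e \<in> carrier R - P" "\<And>Q. Q \<in> T \<Longrightarrow> e \<in> Q" by auto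
    interpret Q: maximalideal Q R using insert.prems by auto
    have "\<not> Q \<subseteq> P" using Q.I_maximal[OF P.is_ideal _ P.a_subset] insert.prems P.I_notcarr by auto
    then obtain x where x: "x \<in> Q" "x \<notin> P" by auto
    have xc: "x \<in> carrier R" using x(1) Q.Icarr by auto
    have "x \<otimes> e \<in> carrier R - P" using e x(2) xc primeideal.I_prime[OF prime] by auto
    moreover have "x \<otimes> e \<in> Q" using x e Q.I_r_closed by auto
    moreover have "x \<otimes> e \<in> Q'" if "Q' \<in> T" for Q'
    proof -
      interpret Q': maximalideal Q' R using insert.prems that by auto
      show ?thesis using Q'.I_l_closed[OF e(2)[OF that] xc] .
    qed
    ultimately show ?case by auto
  qed
  then obtain e where e: "e \<in> carrier R - P" "\<And>Q. Q \<in> T \<Longrightarrow> e \<in> Q" by blast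
  obtain t p where t: "t \<in> carrier R - P" "p \<in> P" "e \<otimes> t = \<one> \<oplus> p" using maximalideal_inverse[OF P e(1)] by auto
  have "e \<otimes> t \<in> Q" if "Q \<in> T" for Q
  proof -
    interpret Q: maximalideal Q R using assms(2)[OF that] by auto
    show ?thesis using Q.I_r_closed[OF e(2)[OF that]] t(1) by auto
  qed
  moreover have "\<one> \<ominus> e \<otimes> t = \<ominus> p" unfolding t(3) using P.Icarr[OF t(2)] by (simp add: nc_simps)
  hence "\<one> \<ominus> e \<otimes> t \<in> P" using t(2) by simp
  ultimately show ?thesis using e t by (intro bexI[of _ "e \<otimes> t"]) auto
qed

lemma (in abelian_group) add_minus_cancel:
  "\<lbrakk> x \<in> carrier G; y \<in> carrier G \<rbrakk> \<Longrightarrow> y \<oplus> (x \<ominus> y) = x"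
  by (simp add: a_minus_def a_comm[of x] r_neg2)

section \<open>Matrices of isomorphisms between direct sums, and the repair of torsion\<close>

context linear_category
begin

text \<open>Seven of the eight equations which say that the matrices with rows \<open>a b\<close>,
  \<open>c d\<close> and \<open>a' b'\<close>, \<open>c' d'\<close> are inverse to each
  other.\<close>

lemma direct_sum_matrix:
  assumes S: "direct_sum C S U W" "direct_sum C S' V W" "isomorphic_in C S S'"
    and obj: "U \<in> Obj C" "V \<in> Obj C" "W \<in> Obj C"
  shows "\<exists>a \<in> H U V. \<exists>b \<in> H W V. \<exists>c \<in> H U W. \<exists>d \<in> H W W.
    \<exists>a' \<in> H V U. \<exists>b' \<in> H W U. \<exists>c' \<in> H V W. \<exists>d' \<in> H W W.
      Comp C V U V a a' \<oplus>\<^bsub>Hom C V V\<^esub> Comp C V W V b c' = Id C V \<and>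
      Comp C V U W c a' \<oplus>\<^bsub>Hom C V W\<^esub> Comp C V W W d c' = \<zero>\<^bsub>Hom C V W\<^esub> \<and>
      Comp C U V U a' a \<oplus>\<^bsub>Hom C U U\<^esub> Comp C U W U b' c = Id C U \<and>
      Comp C W V U a' b \<oplus>\<^bsub>Hom C W U\<^esub> Comp C W W U b' d = \<zero>\<^bsub>Hom C W U\<^esub> \<and>
      Comp C W V W c' b \<oplus>\<^bsub>Hom C W W\<^esub> Comp C W W W d' d = Id C W \<and>
      Comp C W U V a b' \<oplus>\<^bsub>Hom C W V\<^esub> Comp C W W V b d' = \<zero>\<^bsub>Hom C W V\<^esub> \<and>
      Comp C W U W c b' \<oplus>\<^bsub>Hom C W W\<^esub> Comp C W W W d d' = Id C W"
proof -
  obtain i j p q where ij: "S \<in> Obj C" "i \<in> H U S" "j \<in> H W S" "p \<in> H S U" "q \<in> H S W"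
      "Comp C U S U p i = Id C U" "Comp C W S W q j = Id C W"
      "Comp C U S W q i = \<zero>\<^bsub>Hom C U W\<^esub>" "Comp C W S U p j = \<zero>\<^bsub>Hom C W U\<^esub>"
      "Comp C S U S i p \<oplus>\<^bsub>Hom C S S\<^esub> Comp C S W S j q = Id C S"
    using S(1) unfolding direct_sum_def by blast
  obtain i' j' p' q' where ij': "S' \<in> Obj C" "i' \<in> H V S'" "j' \<in> H W S'" "p' \<in> H S' V" "q' \<in> H S' W"
      "Comp C V S' V p' i' = Id C V" "Comp C W S' W q' j' = Id C W"
      "Comp C V S' W q' i' = \<zero>\<^bsub>Hom C V W\<^esub>" "Comp C W S' V p' j' = \<zero>\<^bsub>Hom C W V\<^esub>"
      "Comp C S' V S' i' p' \<oplus>\<^bsub>Hom C S' S'\<^esub> Comp C S' W S' j' q' = Id C S'"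
    using S(2) unfolding direct_sum_def by blast
  obtain F G where F: "F \<in> H S S'" "G \<in> H S' S" "Comp C S S' S G F = Id C S" "Comp C S' S S' F G = Id C S'"
    using S(3) unfolding isomorphic_in_def by blast
  \<comment> \<open>Matrix multiplication amounts to inserting the decomposed identity of
    \<open>S\<close> between two morphisms.\<close>
  have middle: "Comp C T U T' (Comp C U S T' g i) (Comp C T S U p h) \<oplus>\<^bsub>Hom C T T'\<^esub>
      Comp C T W T' (Comp C W S T' g j) (Comp C T S W q h) = Comp C T S T' g h"
    if "T \<in> Obj C" "T' \<in> Obj C" "g \<in> H S T'" "h \<in> H T S" for T T' g h
  proof -
    have "Comp C T S T' g (Comp C T S S (Comp C S U S i p \<oplus>\<^bsub>Hom C S S\<^esub> Comp C S W S j q) h) = Comp C T S T' g h"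
      unfolding ij(10) using that ij(1) by (simp add: cat_simps)
    thus ?thesis using that ij(1-5) obj by (simp add: cat_simps)
  qed
  have middle': "Comp C T V T' (Comp C V S' T' g i') (Comp C T S' V p' h) \<oplus>\<^bsub>Hom C T T'\<^esub>
      Comp C T W T' (Comp C W S' T' g j') (Comp C T S' W q' h) = Comp C T S' T' g h"
    if "T \<in> Obj C" "T' \<in> Obj C" "g \<in> H S' T'" "h \<in> H T S'" for T T' g h
  proof -
    have "Comp C T S' T' g (Comp C T S' S' (Comp C S' V S' i' p' \<oplus>\<^bsub>Hom C S' S'\<^esub> Comp C S' W S' j' q') h) = Comp C T S' T' g h"
      unfolding ij'(10) using that ij'(1) by (simp add: cat_simps)
    thus ?thesis using that ij'(1-5) obj by (simp add: cat_simps)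
  qed
  have FG: "\<lbrakk> T \<in> Obj C; h \<in> H T S' \<rbrakk> \<Longrightarrow> Comp C T S S' F (Comp C T S' S G h) = h"
    "\<lbrakk> T \<in> Obj C; k \<in> H T S \<rbrakk> \<Longrightarrow> Comp C T S' S G (Comp C T S S' F k) = k" for T h k
    using F ij(1) ij'(1) comp_assoc[of T S' S S' h G F] comp_assoc[of T S S' S k F G] by (simp_all add: comp_id_left)
  define g1 g2 where "g1 = Comp C S S' V p' F" and "g2 = Comp C S S' W q' F"
  define h1 h2 where "h1 = Comp C V S' S G i'" and "h2 = Comp C W S' S G j'"
  define a b c d where "a = Comp C U S V g1 i" and "b = Comp C W S V g1 j" and "c = Comp C U S W g2 i" and "d = Comp C W S W g2 j"
  define a' b' c' d' where "a' = Comp C V S U p h1" and "b' = Comp C W S U p h2" and "c' = Comp C V S W q h1" and "d' = Comp C W S W q h2"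
  note objs = obj ij(1) ij'(1)
  have gh: "g1 \<in> H S V" "g2 \<in> H S W" "h1 \<in> H V S" "h2 \<in> H W S"
    unfolding g1_def g2_def h1_def h2_def using objs ij(2-5) ij'(2-5) F(1,2) by (simp_all add: cat_simps)
  have cl: "a \<in> H U V" "b \<in> H W V" "c \<in> H U W" "d \<in> H W W" "a' \<in> H V U" "b' \<in> H W U" "c' \<in> H V W" "d' \<in> H W W"
    unfolding a_def b_def c_def d_def a'_def b'_def c'_def d'_def using objs ij(2-5) gh by (simp_all add: cat_simps)
  have alt: "a = Comp C U S' V p' (Comp C U S S' F i)" "b = Comp C W S' V p' (Comp C W S S' F j)"
    "c = Comp C U S' W q' (Comp C U S S' F i)" "d = Comp C W S' W q' (Comp C W S S' F j)"
    "a' = Comp C V S' U (Comp C S' S U p G) i'" "b' = Comp C W S' U (Comp C S' S U p G) j'"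
    "c' = Comp C V S' W (Comp C S' S W q G) i'" "d' = Comp C W S' W (Comp C S' S W q G) j'"
    unfolding a_def b_def c_def d_def a'_def b'_def c'_def d'_def g1_def g2_def h1_def h2_def
    using objs ij(2-5) ij'(2-5) F(1,2) by (simp_all add: cat_simps)
  have "Comp C V U V a a' \<oplus>\<^bsub>Hom C V V\<^esub> Comp C V W V b c' = Comp C V S V g1 h1"
    unfolding a_def b_def a'_def c'_def by (rule middle) (use objs gh in auto)
  also have "\<dots> = Id C V" unfolding g1_def h1_def using objs ij'(2-6) F(1,2) FG(1) by (simp add: cat_simps)
  finally have 1: "Comp C V U V a a' \<oplus>\<^bsub>Hom C V V\<^esub> Comp C V W V b c' = Id C V" .
  have "Comp C V U W c a' \<oplus>\<^bsub>Hom C V W\<^esub> Comp C V W W d c' = Comp C V S W g2 h1"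
    unfolding c_def d_def a'_def c'_def by (rule middle) (use objs gh in auto)
  also have "\<dots> = \<zero>\<^bsub>Hom C V W\<^esub>" unfolding g2_def h1_def using objs ij'(2-5,8) F(1,2) FG(1) by (simp add: cat_simps)
  finally have 2: "Comp C V U W c a' \<oplus>\<^bsub>Hom C V W\<^esub> Comp C V W W d c' = \<zero>\<^bsub>Hom C V W\<^esub>" .
  have pG: "Comp C S' S U p G \<in> H S' U" "Comp C S' S W q G \<in> H S' W" "Comp C U S S' F i \<in> H U S'" "Comp C W S S' F j \<in> H W S'"
    using objs ij(2-5) F(1,2) by (simp_all add: cat_simps)
  have "Comp C U V U a' a \<oplus>\<^bsub>Hom C U U\<^esub> Comp C U W U b' c = Comp C U S' U (Comp C S' S U p G) (Comp C U S S' F i)"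
    unfolding alt by (rule middle') (use objs pG in auto)
  also have "\<dots> = Id C U" using objs ij(2-6) F(1,2) FG(2)[OF obj(1) ij(2)] pG by (simp add: cat_simps)
  finally have 3: "Comp C U V U a' a \<oplus>\<^bsub>Hom C U U\<^esub> Comp C U W U b' c = Id C U" .
  have "Comp C W V U a' b \<oplus>\<^bsub>Hom C W U\<^esub> Comp C W W U b' d = Comp C W S' U (Comp C S' S U p G) (Comp C W S S' F j)"
    unfolding alt by (rule middle') (use objs pG in auto)
  also have "\<dots> = \<zero>\<^bsub>Hom C W U\<^esub>" using objs ij(2-5,9) F(1,2) FG(2)[OF obj(3) ij(3)] pG by (simp add: cat_simps)
  finally have 4: "Comp C W V U a' b \<oplus>\<^bsub>Hom C W U\<^esub> Comp C W W U b' d = \<zero>\<^bsub>Hom C W U\<^esub>" .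
  have "Comp C W V W c' b \<oplus>\<^bsub>Hom C W W\<^esub> Comp C W W W d' d = Comp C W S' W (Comp C S' S W q G) (Comp C W S S' F j)"
    unfolding alt by (rule middle') (use objs pG in auto)
  also have "\<dots> = Id C W" using objs ij(2-5,7) F(1,2) FG(2)[OF obj(3) ij(3)] pG by (simp add: cat_simps)
  finally have 5: "Comp C W V W c' b \<oplus>\<^bsub>Hom C W W\<^esub> Comp C W W W d' d = Id C W" .
  have "Comp C W U V a b' \<oplus>\<^bsub>Hom C W V\<^esub> Comp C W W V b d' = Comp C W S V g1 h2"
    unfolding a_def b_def b'_def d'_def by (rule middle) (use objs gh in auto)
  also have "\<dots> = \<zero>\<^bsub>Hom C W V\<^esub>" unfolding g1_def h2_def using objs ij'(2-5,9) F(1,2) FG(1) by (simp add: cat_simps)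
  finally have 6: "Comp C W U V a b' \<oplus>\<^bsub>Hom C W V\<^esub> Comp C W W V b d' = \<zero>\<^bsub>Hom C W V\<^esub>" .
  have "Comp C W U W c b' \<oplus>\<^bsub>Hom C W W\<^esub> Comp C W W W d d' = Comp C W S W g2 h2"
    unfolding c_def d_def b'_def d'_def by (rule middle) (use objs gh in auto)
  also have "\<dots> = Id C W" unfolding g2_def h2_def using objs ij'(2-5,7) F(1,2) FG(1) by (simp add: cat_simps)
  finally have 7: "Comp C W U W c b' \<oplus>\<^bsub>Hom C W W\<^esub> Comp C W W W d d' = Id C W" .
  from 1 2 3 4 5 6 7 cl show ?thesis by blast
qed

lemma direct_sum_cong:
  assumes S: "direct_sum C S U W" "direct_sum C S' V W" "isomorphic_in C U V"
    and obj: "U \<in> Obj C" "V \<in> Obj C" "W \<in> Obj C"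
  shows "isomorphic_in C S S'"
proof -
  obtain i j p q where ij: "S \<in> Obj C" "i \<in> H U S" "j \<in> H W S" "p \<in> H S U" "q \<in> H S W"
      "Comp C U S U p i = Id C U" "Comp C W S W q j = Id C W"
      "Comp C U S W q i = \<zero>\<^bsub>Hom C U W\<^esub>" "Comp C W S U p j = \<zero>\<^bsub>Hom C W U\<^esub>"
      "Comp C S U S i p \<oplus>\<^bsub>Hom C S S\<^esub> Comp C S W S j q = Id C S"
    using S(1) unfolding direct_sum_def by blast
  obtain i' j' p' q' where ij': "S' \<in> Obj C" "i' \<in> H V S'" "j' \<in> H W S'" "p' \<in> H S' V" "q' \<in> H S' W"
      "Comp C V S' V p' i' = Id C V" "Comp C W S' W q' j' = Id C W"
      "Comp C V S' W q' i' = \<zero>\<^bsub>Hom C V W\<^esub>" "Comp C W S' V p' j' = \<zero>\<^bsub>Hom C W V\<^esub>"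
      "Comp C S' V S' i' p' \<oplus>\<^bsub>Hom C S' S'\<^esub> Comp C S' W S' j' q' = Id C S'"
    using S(2) unfolding direct_sum_def by blast
  obtain f g where f: "f \<in> H U V" "g \<in> H V U" "Comp C U V U g f = Id C U" "Comp C V U V f g = Id C V"
    using S(3) unfolding isomorphic_in_def by blast
  note objs = obj ij(1) ij'(1)
  define F where "F = Comp C S U S' (Comp C U V S' i' f) p \<oplus>\<^bsub>Hom C S S'\<^esub> Comp C S W S' j' q"
  define G where "G = Comp C S' V S (Comp C V U S i g) p' \<oplus>\<^bsub>Hom C S' S\<^esub> Comp C S' W S j q'"
  have FG: "F \<in> H S S'" "G \<in> H S' S"
    unfolding F_def G_def using objs ij(2-5) ij'(2-5) f(1,2) by (simp_all add: cat_simps)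
  have c: "Comp C T S U p (Comp C T U S i x) = x" "Comp C T S W q (Comp C T U S i x) = \<zero>\<^bsub>Hom C T W\<^esub>"
      "Comp C T V U g (Comp C T U V f x) = x" if "T \<in> Obj C" "x \<in> H T U" for T x
    using that objs ij(2-9) f comp_assoc[of T U S U x i p] comp_assoc[of T U S W x i q] comp_assoc[of T U V U x f g]
    by (simp_all add: comp_id_left)
  have c': "Comp C T S' V p' (Comp C T V S' i' x) = x" "Comp C T S' W q' (Comp C T V S' i' x) = \<zero>\<^bsub>Hom C T W\<^esub>"
      "Comp C T U V f (Comp C T V U g x) = x" if "T \<in> Obj C" "x \<in> H T V" for T x
    using that objs ij'(2-9) f comp_assoc[of T V S' V x i' p'] comp_assoc[of T V S' W x i' q'] comp_assoc[of T V U V x g f]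
    by (simp_all add: comp_id_left)
  have e: "Comp C T S W q (Comp C T W S j x) = x" "Comp C T S U p (Comp C T W S j x) = \<zero>\<^bsub>Hom C T U\<^esub>"
    "Comp C T S' W q' (Comp C T W S' j' x) = x" "Comp C T S' V p' (Comp C T W S' j' x) = \<zero>\<^bsub>Hom C T V\<^esub>"
    if "T \<in> Obj C" "x \<in> H T W" for T x
    using that objs ij(2-9) ij'(2-9) comp_assoc[of T W S W x j q] comp_assoc[of T W S U x j p]
      comp_assoc[of T W S' W x j' q'] comp_assoc[of T W S' V x j' p']
    by (simp_all add: comp_id_left)
  have "Comp C S S' S G F = Comp C S U S i p \<oplus>\<^bsub>Hom C S S\<^esub> Comp C S W S j q"
    unfolding F_def G_def using objs ij(2-5) ij'(2-5) f(1,2) by (simp add: cat_simps c c' e)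
  moreover have "Comp C S' S S' F G = Comp C S' V S' i' p' \<oplus>\<^bsub>Hom C S' S'\<^esub> Comp C S' W S' j' q'"
    unfolding F_def G_def using objs ij(2-5) ij'(2-5) f(1,2) by (simp add: cat_simps c c' e)
  ultimately show ?thesis unfolding isomorphic_in_def using FG ij(10) ij'(10) by auto
qed

text \<open>If \<open>t\<close> and \<open>t f\<close> are invertible at \<open>P\<close>, so is
  \<open>f\<close>. Its right inverse is found by conjugating \<open>(t f) y = s\<close> with
  \<open>t\<close>.\<close>

lemma p_iso_factor:
  assumes U: "U \<in> Obj C" and V: "V \<in> Obj C" and P: "primeideal P R" and f: "f \<in> H U V" and t: "p_iso P V U t"
    and tf: "central_algebra.p_unit R (End_ring C U) (\<lambda>r. r \<odot>\<^bsub>Hom C U U\<^esub> Id C U) P (Comp C U V U t f)"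
  shows "p_iso P U V f"
proof -
  interpret A: central_algebra R "End_ring C U" "\<lambda>r. r \<odot>\<^bsub>Hom C U U\<^esub> Id C U" by (rule End_algebra[OF U])
  obtain y s where y: "y \<in> H U U" "s \<in> carrier R - P" "Comp C U U U y (Comp C U V U t f) = s \<odot>\<^bsub>Hom C U U\<^esub> Id C U"
      "Comp C U U U (Comp C U V U t f) y = s \<odot>\<^bsub>Hom C U U\<^esub> Id C U"
    using tf unfolding A.p_unit_def by auto
  obtain t' s' where t': "t \<in> H V U" "t' \<in> H U V" "s' \<in> carrier R - P"
      "Comp C V U V t' t = s' \<odot>\<^bsub>Hom C V V\<^esub> Id C V" "Comp C U V U t t' = s' \<odot>\<^bsub>Hom C U U\<^esub> Id C U"
    using t unfolding p_iso_def by blast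
  have ss: "s' \<otimes>\<^bsub>R\<^esub> s \<in> carrier R - P" using y(2) t'(3) primeideal.I_prime[OF P] by auto
  have "Comp C V U V (Comp C U U V t' (Comp C U U U (Comp C U V U t f) y)) t = (s' \<otimes>\<^bsub>R\<^esub> s) \<odot>\<^bsub>Hom C V V\<^esub> Id C V"
    unfolding y(4) using U V t' y(1,2) by (simp add: cat_simps m_comm)
  also have "Comp C V U V (Comp C U U V t' (Comp C U U U (Comp C U V U t f) y)) t
      = Comp C V V V (Comp C V U V t' t) (Comp C V U V f (Comp C V U U y t))"
    using U V t'(1,2) y(1) f by (simp add: cat_simps)
  also have "\<dots> = Comp C V U V f (s' \<odot>\<^bsub>Hom C V U\<^esub> Comp C V U U y t)"
    unfolding t'(4) using U V t'(1-3) y(1) f by (simp add: cat_simps)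
  finally have 1: "Comp C V U V f (s' \<odot>\<^bsub>Hom C V U\<^esub> Comp C V U U y t) = (s' \<otimes>\<^bsub>R\<^esub> s) \<odot>\<^bsub>Hom C V V\<^esub> Id C V" .
  have 2: "Comp C U V U (Comp C V U U y t) f = s \<odot>\<^bsub>Hom C U U\<^esub> Id C U"
    using U V t'(1) y f by (simp add: comp_assoc)
  show ?thesis
    by (rule p_isoI[OF U V P f _ y(2) 2 _ ss 1]) (use U V t' y in \<open>simp_all add: comp_closed\<close>)
qed

text \<open>A morphism that is invertible modulo torsion can be corrected at the finitely many places that carry
  the torsion: there the stable range condition allows to absorb the torsion error.\<close>

lemma iso_of_iso_mod_torsion:
  assumes fin: "hom_finite R C" and dom: "one_dimensional_domain R" and U: "U \<in> Obj C" and V: "V \<in> Obj C"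
    and f: "f \<in> H U V" and y: "y \<in> H V U" and r: "r \<in> carrier R" "r \<noteq> \<zero>\<^bsub>R\<^esub>"
    and yf: "r \<odot>\<^bsub>Hom C U U\<^esub> Comp C U V U y f = r \<odot>\<^bsub>Hom C U U\<^esub> Id C U"
    and fy: "r \<odot>\<^bsub>Hom C V V\<^esub> Comp C V U V f y = r \<odot>\<^bsub>Hom C V V\<^esub> Id C V"
    and loc: "\<And>P. maximalideal P R \<Longrightarrow> \<exists>t. p_iso P V U t"
  shows "isomorphic_in C U V"
proof -
  let ?L = "Hom C U U" and ?M = "Hom C U V"
  interpret D: one_dimensional_domain R by (rule dom)
  interpret A: central_algebra R "End_ring C U" "\<lambda>r. r \<odot>\<^bsub>?L\<^esub> Id C U" by (rule End_algebra[OF U])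
  interpret HU: abelian_group "Hom C U U" by (rule hom_group[OF U U])
  interpret HUV: abelian_group "Hom C U V" by (rule hom_group[OF U V])
  obtain G where G: "A.generates G" using End_generates[OF fin U] by blast
  define \<tau> where "\<tau> = Comp C U V U y f \<ominus>\<^bsub>?L\<^esub> Id C U"
  have \<tau>: "\<tau> \<in> H U U" unfolding \<tau>_def using U V y f by (simp add: a_minus_def cat_simps)
  have yf': "Comp C U V U y f = Id C U \<oplus>\<^bsub>?L\<^esub> \<tau>"
    unfolding \<tau>_def using U V y f by (intro HU.add_minus_cancel[symmetric]) (simp_all add: cat_simps)
  have r\<tau>: "r \<odot>\<^bsub>?L\<^esub> \<tau> = \<zero>\<^bsub>?L\<^esub>"
  proof -
    have "r \<odot>\<^bsub>?L\<^esub> Id C U \<oplus>\<^bsub>?L\<^esub> r \<odot>\<^bsub>?L\<^esub> \<tau> = r \<odot>\<^bsub>?L\<^esub> Id C U"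
      using yf unfolding yf' using U \<tau> r(1) by (simp add: id_closed)
    thus ?thesis using U \<tau> r(1) by (simp add: id_closed)
  qed
  \<comment> \<open>All \<open>F z\<close> agree with \<open>f\<close> up to torsion killed by
    \<open>r\<close>. They stay invertible at the places that do not contain \<open>r\<close>, and
    \<open>z\<close> is at disposal for the others.\<close>
  define F where "F z = f \<oplus>\<^bsub>?M\<^esub> Comp C U U V z \<tau>" for z
  have F: "F z \<in> H U V" if "z \<in> H U V" for z unfolding F_def using that U V f \<tau> by (simp add: cat_simps)
  have local: "\<exists>z \<in> H U V. p_iso P U V (F z)" if P: "maximalideal P R" for P
  proof -
    obtain t where t: "p_iso P V U t" using loc[OF P] by blast
    then obtain t' s where t': "t \<in> H V U" "t' \<in> H U V" "s \<in> carrier R - P"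
        "Comp C V U V t' t = s \<odot>\<^bsub>Hom C V V\<^esub> Id C V" "Comp C U V U t t' = s \<odot>\<^bsub>?L\<^esub> Id C U"
      unfolding p_iso_def by blast
    have sc: "s \<in> carrier R" using t' by auto
    \<comment> \<open>Here \<open>(y t') (t f) = s y f = s + s \<tau>\<close>, so the torsion error
      enters as the second term of a unimodular pair for the endomorphism \<open>t f\<close> of
      \<open>U\<close>.\<close>
    let ?w = "(\<ominus>\<^bsub>R\<^esub> s) \<odot>\<^bsub>?L\<^esub> \<tau>"
    have sw: "s \<odot>\<^bsub>?L\<^esub> \<tau> \<oplus>\<^bsub>?L\<^esub> ?w = \<zero>\<^bsub>?L\<^esub>"
      using hom_smult_add[OF U U sc _ \<tau>, of "\<ominus>\<^bsub>R\<^esub> s"] sc \<tau> U by (simp add: r_neg)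
    have "Comp C U U U (Comp C U V U y t') (Comp C U V U t f) = Comp C U V U y (Comp C U V V (Comp C V U V t' t) f)"
      using U V y f t'(1,2) by (simp add: cat_simps)
    also have "\<dots> = s \<odot>\<^bsub>?L\<^esub> Id C U \<oplus>\<^bsub>?L\<^esub> s \<odot>\<^bsub>?L\<^esub> \<tau>"
      unfolding t'(4) using U V y f sc \<tau> by (simp add: cat_simps yf')
    finally have "Comp C U U U (Comp C U V U y t') (Comp C U V U t f) \<oplus>\<^bsub>?L\<^esub> ?w = s \<odot>\<^bsub>?L\<^esub> Id C U"
      using sw U \<tau> sc by (simp add: HU.a_assoc id_closed)
    then obtain e where e: "e \<in> H U U" "A.p_unit P (Comp C U V U t f \<oplus>\<^bsub>?L\<^esub> Comp C U U U e ?w)"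
      using A.p_unit_stable_range[OF G P, of "Comp C U V U t f" "Comp C U V U y t'" ?w s] U V y f t'(1,2,3) \<tau> sc
      by (auto simp: comp_closed)
    \<comment> \<open>Then \<open>t z \<tau> = - s e \<tau>\<close>, which is \<open>e ?w\<close>:
      the correction supplied by stable range one has the form \<open>z \<tau>\<close> required in
      \<open>F\<close>.\<close>
    define z where "z = (\<ominus>\<^bsub>R\<^esub> \<one>\<^bsub>R\<^esub>) \<odot>\<^bsub>?M\<^esub> Comp C U U V t' e"
    have z: "z \<in> H U V" unfolding z_def using U V t' e by (simp add: cat_simps)
    have "Comp C U V U t (Comp C U U V t' (Comp C U U U e \<tau>)) = s \<odot>\<^bsub>?L\<^esub> Comp C U U U e \<tau>"
      using U V t' e(1) \<tau> comp_assoc[of U U V U "Comp C U U U e \<tau>" t' t] by (simp add: cat_simps(1,2,3,4,6-))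
    hence "Comp C U V U t (F z) = Comp C U V U t f \<oplus>\<^bsub>?L\<^esub> Comp C U U U e ?w"
      unfolding F_def z_def using U V f t'(1,2) e(1) \<tau> sc by (simp add: cat_simps l_minus)
    thus ?thesis using p_iso_factor[OF U V maximalideal_prime[OF P] F[OF z] t] e(2) z by auto
  qed
  define S where "S = {P. maximalideal P R \<and> r \<in> P}"
  have S: "finite S" unfolding S_def by (rule D.finite_maximalideals[OF r])
  have "\<exists>z \<in> H U V. \<forall>P \<in> T. p_iso P U V (F z)" if "finite T" "T \<subseteq> S" for T
    using that
  proof induction
    case empty
    show ?case using U V by auto
  next
    case (insert P T)
    then obtain z where z: "z \<in> H U V" "\<And>Q. Q \<in> T \<Longrightarrow> p_iso Q U V (F z)" by auto
    have P: "maximalideal P R" using insert.prems unfolding S_def by auto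
    obtain x where x: "x \<in> H U V" "p_iso P U V (F x)" using local[OF P] by auto
    have "\<And>Q. Q \<in> T \<Longrightarrow> maximalideal Q R \<and> Q \<noteq> P" using insert.prems insert.hyps unfolding S_def by auto
    then obtain e where e: "e \<in> carrier R" "\<And>Q. Q \<in> T \<Longrightarrow> e \<in> Q" "\<one>\<^bsub>R\<^esub> \<ominus>\<^bsub>R\<^esub> e \<in> P"
      using maximalideal_avoid[OF insert.hyps(1) _ P] by blast
    define g where "g x y e = F y \<oplus>\<^bsub>?M\<^esub> e \<odot>\<^bsub>?M\<^esub> Comp C U U V (x \<ominus>\<^bsub>?M\<^esub> y) \<tau>" for x y e
    have pert: "p_iso Q U V (g x y e)" if "maximalideal Q R" "p_iso Q U V (F y)" "e \<in> Q" "x \<in> H U V" "y \<in> H U V" for Q x y e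
      unfolding g_def using that U V \<tau>
      by (intro p_iso_perturb[OF fin U V]) (simp_all add: comp_closed a_minus_def)
    \<comment> \<open>As \<open>e\<close> vanishes modulo the ideals in \<open>T\<close> and is 1
      modulo \<open>P\<close>, this is \<open>z\<close> at the former and \<open>x\<close> at the
      latter. Accordingly \<open>F z'\<close> is a perturbation of \<open>F z\<close> as well as of
      \<open>F x\<close>.\<close>
    define z' where "z' = z \<oplus>\<^bsub>?M\<^esub> e \<odot>\<^bsub>?M\<^esub> (x \<ominus>\<^bsub>?M\<^esub> z)"
    have xz: "x \<ominus>\<^bsub>?M\<^esub> z \<in> H U V" using x z U V by (simp add: a_minus_def)
    have z': "z' \<in> H U V" unfolding z'_def using xz z e(1) U V by simp
    have Fz: "F z' = g x z e"
      unfolding F_def g_def z'_def using z xz e(1) U V f \<tau> by (simp add: cat_simps HUV.a_assoc)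
    define e' where "e' = \<one>\<^bsub>R\<^esub> \<ominus>\<^bsub>R\<^esub> e"
    have e': "e' \<in> carrier R" unfolding e'_def using e(1) by simp
    have zx: "x \<oplus>\<^bsub>?M\<^esub> e' \<odot>\<^bsub>?M\<^esub> (z \<ominus>\<^bsub>?M\<^esub> x) = z'"
      unfolding z'_def e'_def by (rule affine_swap[OF U V x(1) z(1) e(1)])
    have Fx: "F z' = g z x e'"
      unfolding F_def g_def zx[symmetric] using z x U V f \<tau> e' by (simp add: cat_simps HUV.a_assoc a_minus_def)
    have "p_iso Q U V (F z')" if "Q \<in> insert P T" for Q
    proof (cases "Q = P")
      case True
      thus ?thesis unfolding Fx using pert[OF P x(2) _ z(1) x(1), of e'] e(3) unfolding e'_def by simp
    next
      case False
      hence Q: "Q \<in> T" using that by auto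
      have "maximalideal Q R" using Q insert.prems unfolding S_def by auto
      thus ?thesis unfolding Fz using pert[OF _ z(2)[OF Q] e(2)[OF Q] x(1) z(1)] by blast
    qed
    thus ?case using z' by blast
  qed
  from this[OF S] obtain z where z: "z \<in> H U V" "\<And>P. P \<in> S \<Longrightarrow> p_iso P U V (F z)" by blast
  have "p_iso P U V (F z)" if P: "maximalideal P R" for P
  proof (cases "r \<in> P")
    case True
    thus ?thesis using z(2) P unfolding S_def by auto
  next
    case False
    \<comment> \<open>Where \<open>r\<close> is invertible the torsion dies, and \<open>r y\<close>
      inverts \<open>F z\<close> just as it inverts \<open>f\<close>.\<close>
    have ry: "r \<odot>\<^bsub>Hom C V U\<^esub> y \<in> H V U" using U V r y by simp
    have k: "Comp C U U T h (r \<odot>\<^bsub>?L\<^esub> \<tau>) = \<zero>\<^bsub>Hom C U T\<^esub>" if "T \<in> Obj C" "h \<in> H U T" for T h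
      unfolding r\<tau> using that U by simp
    have "Comp C U V U (r \<odot>\<^bsub>Hom C V U\<^esub> y) (F z) = r \<odot>\<^bsub>?L\<^esub> Comp C U V U y f \<oplus>\<^bsub>?L\<^esub>
        Comp C U U U (Comp C U V U y z) (r \<odot>\<^bsub>?L\<^esub> \<tau>)"
      unfolding F_def using U V y f z(1) \<tau> r(1) by (simp add: cat_simps)
    hence 1: "Comp C U V U (r \<odot>\<^bsub>Hom C V U\<^esub> y) (F z) = r \<odot>\<^bsub>?L\<^esub> Id C U"
      using k[OF U] U V y z r yf by (simp add: comp_closed id_closed)
    have fyf: "Comp C U U V f (r \<odot>\<^bsub>?L\<^esub> Comp C U V U y f) = Comp C U V V (r \<odot>\<^bsub>Hom C V V\<^esub> Comp C V U V f y) f"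
      using U V y f r(1) by (simp add: cat_simps)
    have \<tau>y: "r \<odot>\<^bsub>Hom C V U\<^esub> Comp C V U U \<tau> y = \<zero>\<^bsub>Hom C V U\<^esub>"
      using comp_smult_left[OF V U U r(1) y \<tau>] r\<tau> U V y by simp
    have "Comp C V U V (F z) (r \<odot>\<^bsub>Hom C V U\<^esub> y) = r \<odot>\<^bsub>Hom C V V\<^esub> Comp C V U V f y \<oplus>\<^bsub>Hom C V V\<^esub>
        Comp C V U V z (r \<odot>\<^bsub>Hom C V U\<^esub> Comp C V U U \<tau> y)"
      unfolding F_def using U V y f z(1) \<tau> r(1) by (simp add: cat_simps)
    hence 2: "Comp C V U V (F z) (r \<odot>\<^bsub>Hom C V U\<^esub> y) = r \<odot>\<^bsub>Hom C V V\<^esub> Id C V"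
      unfolding \<tau>y fy using U V z(1) r(1) by (simp add: id_closed)
    have rP: "r \<in> carrier R - P" using r False by auto
    show ?thesis by (rule p_isoI[OF U V maximalideal_prime[OF P] F[OF z(1)] ry rP 1 ry rP 2])
  qed
  from iso_of_p_iso[OF D.noetherian_ring_axioms U V F[OF z(1)] this] show ?thesis .
qed

end

section \<open>Cancellation\<close>

context ring
begin

lemma Units_of_two_sided:
  assumes "x \<in> carrier R" "y \<in> carrier R" "u \<in> Units R" "y \<otimes> x = u" "x \<otimes> y = u"
  shows "x \<in> Units R" "u \<otimes> inv x = y"
proof -
  have "x \<otimes> (y \<otimes> inv u) = \<one>" "(inv u \<otimes> y) \<otimes> x = \<one>"
    using assms by (simp_all add: m_assoc[symmetric], simp add: m_assoc)
  moreover from this have "inv u \<otimes> y = y \<otimes> inv u"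
    using assms inv_unique[of "inv u \<otimes> y" x "y \<otimes> inv u"] by simp
  ultimately show x: "x \<in> Units R" unfolding Units_def using assms(1-3) by (auto intro!: bexI[of _ "y \<otimes> inv u"])
  have "u \<otimes> inv x = y \<otimes> (x \<otimes> inv x)" using assms x by (simp add: m_assoc[symmetric] del: Units_r_inv)
  thus "u \<otimes> inv x = y" using assms x by simp
qed

text \<open>Adding \<open>t\<close> times the first row to the second changes the lower row into
  \<open>c + t a\<close>, \<open>d + t b\<close>; in the inverse matrix, \<open>t\<close> times the
  second column is subtracted from the first. Then \<open>schur_complement_unit\<close>
  applies.\<close>

lemma shifted_schur_unit:
  assumes c: "a \<in> carrier R" "b \<in> carrier R" "c \<in> carrier R" "d \<in> carrier R" "t \<in> carrier R"
      "a' \<in> carrier R" "b' \<in> carrier R" "c' \<in> carrier R" "d' \<in> carrier R"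
    and m: "a \<otimes> a' \<oplus> b \<otimes> c' = \<one>" "c \<otimes> a' \<oplus> d \<otimes> c' = \<zero>" "a' \<otimes> a \<oplus> b' \<otimes> c = \<one>" "a' \<otimes> b \<oplus> b' \<otimes> d = \<zero>"
      "a \<otimes> b' \<oplus> b \<otimes> d' = \<zero>" "c \<otimes> b' \<oplus> d \<otimes> d' = \<one>"
    and u: "d \<oplus> t \<otimes> b \<in> Units R"
  defines "\<sigma> \<equiv> a \<ominus> b \<otimes> inv (d \<oplus> t \<otimes> b) \<otimes> (c \<oplus> t \<otimes> a)"
  shows "\<sigma> \<in> Units R" "inv \<sigma> = a' \<ominus> b' \<otimes> t"
proof -
  have "a \<otimes> (a' \<ominus> b' \<otimes> t) \<oplus> b \<otimes> (c' \<ominus> d' \<otimes> t) = (a \<otimes> a' \<oplus> b \<otimes> c') \<ominus> (a \<otimes> b' \<oplus> b \<otimes> d') \<otimes> t"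
    using c by (simp add: nc_simps)
  hence 1: "a \<otimes> (a' \<ominus> b' \<otimes> t) \<oplus> b \<otimes> (c' \<ominus> d' \<otimes> t) = \<one>" using m c by (simp add: a_minus_def)
  have "(c \<oplus> t \<otimes> a) \<otimes> (a' \<ominus> b' \<otimes> t) \<oplus> (d \<oplus> t \<otimes> b) \<otimes> (c' \<ominus> d' \<otimes> t) =
      (c \<otimes> a' \<oplus> d \<otimes> c') \<oplus> t \<otimes> (a \<otimes> a' \<oplus> b \<otimes> c') \<ominus> (c \<otimes> b' \<oplus> d \<otimes> d') \<otimes> t \<ominus> t \<otimes> (a \<otimes> b' \<oplus> b \<otimes> d') \<otimes> t"
    using c by (simp add: nc_simps)
  hence 2: "(c \<oplus> t \<otimes> a) \<otimes> (a' \<ominus> b' \<otimes> t) \<oplus> (d \<oplus> t \<otimes> b) \<otimes> (c' \<ominus> d' \<otimes> t) = \<zero>"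
    using m c by (simp add: a_minus_def r_neg)
  have "(a' \<ominus> b' \<otimes> t) \<otimes> a \<oplus> b' \<otimes> (c \<oplus> t \<otimes> a) = a' \<otimes> a \<oplus> b' \<otimes> c"
    "(a' \<ominus> b' \<otimes> t) \<otimes> b \<oplus> b' \<otimes> (d \<oplus> t \<otimes> b) = a' \<otimes> b \<oplus> b' \<otimes> d"
    using c by (simp_all add: nc_simps)
  hence 3: "(a' \<ominus> b' \<otimes> t) \<otimes> a \<oplus> b' \<otimes> (c \<oplus> t \<otimes> a) = \<one>" "(a' \<ominus> b' \<otimes> t) \<otimes> b \<oplus> b' \<otimes> (d \<oplus> t \<otimes> b) = \<zero>"
    using m by simp_all
  have "\<sigma> \<otimes> (a' \<ominus> b' \<otimes> t) = \<one>" "(a' \<ominus> b' \<otimes> t) \<otimes> \<sigma> = \<one>"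
    unfolding \<sigma>_def
    using c by (auto intro!: schur_complement_unit[OF c(1,2) _ u _ c(7) _ 1 2 3])
  note i = this
  have \<sigma>: "\<sigma> \<in> carrier R" unfolding \<sigma>_def using c u by simp
  show "\<sigma> \<in> Units R" by (rule Units_of_two_sided(1)[OF \<sigma> _ _ i(2) i(1)]) (use c in simp_all)
  show "inv \<sigma> = a' \<ominus> b' \<otimes> t" using i \<sigma> c by (intro inv_unique'[symmetric]) auto
qed

end

text \<open>The powers of a nonzero nonunit are distinct. This provides the infinitely many scalars
  on which the generic choice in \<open>schur_class\<close> rests.\<close>

lemma (in domain) infinite_carrier:
  assumes "a \<in> carrier R" "a \<noteq> \<zero>" "a \<notin> Units R" shows "infinite (carrier R)"
proof -
  have "a [^] m \<noteq> a [^] n" if "m < n" for m n :: nat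
  proof
    assume e: "a [^] m = a [^] n"
    have nz: "a [^] m \<noteq> \<zero>" using assms by (induction m) (auto simp: integral_iff)
    have "a [^] m \<otimes> \<one> = a [^] m \<otimes> a [^] (n - m)" using that e assms nat_pow_mult[of a m "n - m"] by simp
    from iffD1[OF m_lcancel[OF nz] this] have "\<one> = a [^] (n - m)" using assms by simp
    moreover have "a [^] (n - m) = a \<otimes> a [^] (n - m - 1)" using that assms nat_pow_Suc2[of a "n - m - 1"] by (simp add: Suc_diff_Suc del: nat_pow_Suc)
    ultimately have "a \<otimes> a [^] (n - m - 1) = \<one>" by simp
    thus False using assms m_comm[of a "a [^] (n - m - 1)"] unfolding Units_def by auto
  qed
  hence "inj (\<lambda>n::nat. a [^] n)" by (intro linorder_injI) auto
  thus ?thesis using finite_subset[of "range (\<lambda>n::nat. a [^] n)" "carrier R"] assms(1) finite_imageD by auto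
qed

text \<open>The objects in \<open>obs\<close> become isomorphic to \<open>A\<close> over \<open>K\<close>, via \<open>al\<close> and \<open>al'\<close>; this identifies
  \<open>Hom\<close> groups between them with lattices in the endomorphism ring \<open>E\<close> of \<open>A\<close> over \<open>K\<close>.\<close>

locale common_genus = base_changed_category R K \<iota> P C
  for R :: "('r, 'x) ring_scheme" and K :: "('k, 'y) ring_scheme" and \<iota> :: "'r \<Rightarrow> 'k" and P
    and C :: "('r, 'o, 'm) lin_cat" +
  fixes A and obs :: "'o set" and al al' :: "'o \<Rightarrow> 'm" and sc :: "'o \<Rightarrow> 'r"
  assumes P_zero: "P = {\<zero>\<^bsub>R\<^esub>}" and A_obj: "A \<in> Obj C"
    and obs: "U \<in> obs \<Longrightarrow> U \<in> Obj C \<and> al U \<in> lc.H A U \<and> al' U \<in> lc.H U A \<and> sc U \<in> carrier R - P \<and>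
      Comp C A U A (al' U) (al U) = sc U \<odot>\<^bsub>Hom C A A\<^esub> Id C A \<and> Comp C U A U (al U) (al' U) = sc U \<odot>\<^bsub>Hom C U U\<^esub> Id C U"
begin

definition E where "E = End_ring B A"
definition \<rho> where "\<rho> r = scalar A (\<iota> r)"
text \<open>Over \<open>K\<close> the inverse of \<open>al V\<close> is \<open>al' V\<close> divided
  by \<open>sc V\<close>, so a morphism is transported to an endomorphism of \<open>A\<close> by
  these isomorphisms. Hence composition becomes multiplication.\<close>

definition \<phi> where "\<phi> U V f = hfrc A A (sc V) (Comp C A V A (al' V) (Comp C A U V f (al U)))"

lemma obs_simps [simp]:
  assumes "U \<in> obs"
  shows "U \<in> Obj C" "al U \<in> lc.H A U" "al' U \<in> lc.H U A" "sc U \<notin> P" "sc U \<in> carrier R"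
    "Comp C A U A (al' U) (al U) = sc U \<odot>\<^bsub>Hom C A A\<^esub> Id C A" "Comp C U A U (al U) (al' U) = sc U \<odot>\<^bsub>Hom C U U\<^esub> Id C U"
  using obs[OF assms] by auto

lemma sc_mem: "U \<in> obs \<Longrightarrow> sc U \<in> carrier R - P" by simp

lemma E_ring: "ring E" unfolding E_def by (rule ring_End_B[OF A_obj])

text \<open>The structure over \<open>K\<close> supplies the generic scalars for
  \<open>schur_class\<close>; the structure over \<open>R\<close>, introduced below, is the one for
  lattices.\<close>

sublocale KE: central_algebra K E "scalar A"
  unfolding central_algebra_def central_algebra_axioms_def
  using E_ring K.is_cring scalar_hom[OF A_obj] scalar_central[OF A_obj] unfolding E_def local_ring_zero[OF P_zero] by blast

lemma KE_Units:
  assumes k: "k \<in> Units K" shows "scalar A k \<in> Units E"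
proof -
  have c: "k \<in> carrier K" "inv\<^bsub>K\<^esub> k \<in> carrier K" using k by auto
  have "scalar A (inv\<^bsub>K\<^esub> k) \<otimes>\<^bsub>E\<^esub> scalar A k = \<one>\<^bsub>E\<^esub>" "scalar A k \<otimes>\<^bsub>E\<^esub> scalar A (inv\<^bsub>K\<^esub> k) = \<one>\<^bsub>E\<^esub>"
    unfolding KE.rho_simps(2)[OF c(2,1), symmetric] KE.rho_simps(2)[OF c, symmetric]
    using k by (simp_all del: KE.rho_simps(2))
  thus ?thesis using KE.Units_of_two_sided(1)[OF KE.rho_simps(1)[OF c(1)] KE.rho_simps(1)[OF c(2)] KE.Units_one_closed] by blast
qed

sublocale LE: lattices R E \<rho>
proof -
  have "\<rho> \<in> ring_hom R E" unfolding \<rho>_def by (rule ring_hom_memI) simp_all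
  hence "central_algebra R E \<rho>"
    unfolding central_algebra_def central_algebra_axioms_def
    using E_ring R.is_cring KE.rho_central unfolding \<rho>_def by auto
  moreover have "one_dimensional_domain R"
    unfolding one_dimensional_domain_def one_dimensional_domain_axioms_def using R.noetherian_domain_axioms prime_maximal by auto
  ultimately show "lattices R E \<rho>"
    unfolding lattices_def lattices_axioms_def \<rho>_def using KE_Units iota_Units by auto
qed

lemma \<phi>_closed: "\<lbrakk> U \<in> obs; V \<in> obs; f \<in> lc.H U V \<rbrakk> \<Longrightarrow> \<phi> U V f \<in> carrier E"
  unfolding \<phi>_def E_def using hfrc_closed[OF A_obj A_obj] A_obj by (simp add: lc.comp_closed)

lemma \<phi>_add: "\<lbrakk> U \<in> obs; V \<in> obs; f \<in> lc.H U V; g \<in> lc.H U V \<rbrakk> \<Longrightarrow> \<phi> U V (f \<oplus>\<^bsub>Hom C U V\<^esub> g) = \<phi> U V f \<oplus>\<^bsub>E\<^esub> \<phi> U V g"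
  unfolding \<phi>_def E_def using A_obj by (simp add: lc.cat_simps hfrc_add)

lemma \<phi>_mult:
  assumes "U \<in> obs" "V \<in> obs" "W \<in> obs" "f \<in> lc.H U V" "g \<in> lc.H V W"
  shows "\<phi> U W (Comp C U V W g f) = \<phi> V W g \<otimes>\<^bsub>E\<^esub> \<phi> U V f"
proof -
  let ?z = "Comp C A W A (al' W) (Comp C A V W g (Comp C A U V f (al U)))"
  have z: "?z \<in> lc.H A A" using A_obj assms by (simp add: lc.comp_closed)
  have "\<phi> V W g \<otimes>\<^bsub>E\<^esub> \<phi> U V f = hfrc A A (sc W \<otimes>\<^bsub>R\<^esub> sc V)
      (Comp C A A A (Comp C A W A (al' W) (Comp C A V W g (al V))) (Comp C A V A (al' V) (Comp C A U V f (al U))))"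
    unfolding \<phi>_def E_def using A_obj assms sc_mem by (simp add: Comp_hfrc lc.comp_closed)
  also have "Comp C A A A (Comp C A W A (al' W) (Comp C A V W g (al V))) (Comp C A V A (al' V) (Comp C A U V f (al U)))
      = Comp C A W A (al' W) (Comp C A V W g (Comp C A V V (Comp C V A V (al V) (al' V)) (Comp C A U V f (al U))))"
    using A_obj assms by (simp add: lc.cat_simps del: obs_simps(7))
  also have "\<dots> = sc V \<odot>\<^bsub>Hom C A A\<^esub> ?z" using A_obj assms by (simp add: lc.cat_simps)
  also have "hfrc A A (sc W \<otimes>\<^bsub>R\<^esub> sc V) (sc V \<odot>\<^bsub>Hom C A A\<^esub> ?z) = hfrc A A (sc W) ?z"
    using hfrc_expand[OF A_obj A_obj sc_mem[OF assms(3)] sc_mem[OF assms(2)] z] by simp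
  finally show ?thesis unfolding \<phi>_def using A_obj assms by (simp add: lc.cat_simps)
qed

lemma \<phi>_id: "U \<in> obs \<Longrightarrow> \<phi> U U (Id C U) = \<one>\<^bsub>E\<^esub>"
  using hfrc_expand[OF A_obj A_obj W_one, of "sc U" "Id C A"] A_obj
  unfolding \<phi>_def E_def by (simp add: lc.cat_simps Id_B)

lemma \<phi>_zero: "U \<in> obs \<Longrightarrow> V \<in> obs \<Longrightarrow> \<phi> U V \<zero>\<^bsub>Hom C U V\<^esub> = \<zero>\<^bsub>E\<^esub>"
  using \<phi>_add[of U V "\<zero>\<^bsub>Hom C U V\<^esub>" "\<zero>\<^bsub>Hom C U V\<^esub>"] \<phi>_closed[of U V "\<zero>\<^bsub>Hom C U V\<^esub>"] by simp

lemma \<rho>_hfrc: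
  "\<lbrakk> r \<in> carrier R; s \<in> carrier R - P; x \<in> lc.H A A \<rbrakk> \<Longrightarrow> \<rho> r \<otimes>\<^bsub>E\<^esub> hfrc A A s x = hfrc A A s (r \<odot>\<^bsub>Hom C A A\<^esub> x)"
  unfolding \<rho>_def E_def using A_obj W_one by (simp add: scalar_iota Comp_hfrc lc.cat_simps)

lemma \<phi>_smult: "\<lbrakk> U \<in> obs; V \<in> obs; f \<in> lc.H U V; r \<in> carrier R \<rbrakk> \<Longrightarrow> \<phi> U V (r \<odot>\<^bsub>Hom C U V\<^esub> f) = \<rho> r \<otimes>\<^bsub>E\<^esub> \<phi> U V f"
  unfolding \<phi>_def using A_obj sc_mem by (simp add: \<rho>_hfrc lc.cat_simps)

lemma \<phi>_scalar: "\<lbrakk> U \<in> obs; r \<in> carrier R \<rbrakk> \<Longrightarrow> \<phi> U U (r \<odot>\<^bsub>Hom C U U\<^esub> Id C U) = \<rho> r"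
  by (simp add: \<phi>_smult \<phi>_id lc.id_closed)

text \<open>Only torsion is lost: composing the transported morphism with \<open>al V\<close> and
  \<open>al' U\<close> recovers \<open>f\<close> up to the scalar \<open>sc V sc U\<close>.\<close>

lemma \<phi>_eqD:
  assumes "U \<in> obs" "V \<in> obs" "f \<in> lc.H U V" "g \<in> lc.H U V" "\<phi> U V f = \<phi> U V g"
  shows "\<exists>w \<in> carrier R - P. w \<odot>\<^bsub>Hom C U V\<^esub> f = w \<odot>\<^bsub>Hom C U V\<^esub> g"
proof -
  define x where "x f = Comp C A V A (al' V) (Comp C A U V f (al U))" for f
  have x: "x f \<in> lc.H A A" if "f \<in> lc.H U V" for f unfolding x_def using that A_obj assms(1,2) by (simp add: lc.comp_closed)
  obtain w where w: "w \<in> carrier R - P" "(w \<otimes>\<^bsub>R\<^esub> sc V) \<odot>\<^bsub>Hom C A A\<^esub> x f = (w \<otimes>\<^bsub>R\<^esub> sc V) \<odot>\<^bsub>Hom C A A\<^esub> x g"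
    using hfrc_eqD[OF A_obj A_obj _ x _ x] assms unfolding \<phi>_def x_def[symmetric] by (metis sc_mem)
  have k: "Comp C U A V (Comp C A A V (al V) (v \<odot>\<^bsub>Hom C A A\<^esub> x f)) (al' U) = (v \<otimes>\<^bsub>R\<^esub> (sc V \<otimes>\<^bsub>R\<^esub> sc U)) \<odot>\<^bsub>Hom C U V\<^esub> f"
    if "f \<in> lc.H U V" "v \<in> carrier R" for f v
  proof -
    have "Comp C U A V (Comp C A A V (al V) (v \<odot>\<^bsub>Hom C A A\<^esub> x f)) (al' U) =
      v \<odot>\<^bsub>Hom C U V\<^esub> Comp C U V V (Comp C V A V (al V) (al' V)) (Comp C U U V f (Comp C U A U (al U) (al' U)))"
      unfolding x_def using A_obj assms(1,2) that by (simp add: lc.cat_simps del: obs_simps(7))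
    thus ?thesis using A_obj assms(1,2) that R.m_comm[of "sc U" "sc V"] by (simp add: lc.cat_simps)
  qed
  have "w \<otimes>\<^bsub>R\<^esub> sc V \<otimes>\<^bsub>R\<^esub> (sc V \<otimes>\<^bsub>R\<^esub> sc U) \<in> carrier R - P"
    by (intro W_mult sc_mem w(1) assms(1,2))
  moreover have "w \<otimes>\<^bsub>R\<^esub> sc V \<in> carrier R" using w(1) assms(2) by auto
  ultimately show ?thesis using k[OF assms(3)] k[OF assms(4)] w(2) by metis
qed

text \<open>For \<open>x = y / s\<close> the composite of \<open>al' U\<close>, \<open>y\<close> and
  \<open>al V\<close> is mapped to \<open>s sc U\<close> times \<open>x\<close>.\<close>

lemma \<phi>_dense:
  assumes "U \<in> obs" "V \<in> obs" "x \<in> carrier E"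
  shows "\<exists>r \<in> carrier R - {\<zero>\<^bsub>R\<^esub>}. \<rho> r \<otimes>\<^bsub>E\<^esub> x \<in> \<phi> U V ` lc.H U V"
proof -
  obtain s y where y: "s \<in> carrier R - P" "y \<in> lc.H A A" "x = hfrc A A s y"
    using hfrc_exists[OF A_obj A_obj] assms(3) unfolding E_def by (metis End_ring_simps(1))
  have sR: "s \<in> carrier R" using y(1) by auto
  define f where "f = Comp C U A V (Comp C A A V (al V) y) (al' U)"
  have f: "f \<in> lc.H U V" unfolding f_def using A_obj assms y by (simp add: lc.comp_closed)
  have "Comp C A V A (al' V) (Comp C A U V f (al U)) =
      Comp C A A A (Comp C A V A (al' V) (al V)) (Comp C A A A y (Comp C A U A (al' U) (al U)))"
    unfolding f_def using A_obj assms y by (simp add: lc.cat_simps del: obs_simps(6))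
  also have "\<dots> = sc V \<odot>\<^bsub>Hom C A A\<^esub> (sc U \<odot>\<^bsub>Hom C A A\<^esub> y)" using A_obj assms y by (simp add: lc.cat_simps R.m_comm)
  finally have "\<phi> U V f = hfrc A A (\<one>\<^bsub>R\<^esub> \<otimes>\<^bsub>R\<^esub> sc V) (sc V \<odot>\<^bsub>Hom C A A\<^esub> (sc U \<odot>\<^bsub>Hom C A A\<^esub> y))"
    unfolding \<phi>_def using assms by (simp del: lc.hom_simps(5))
  also have "\<dots> = hfrc A A (\<one>\<^bsub>R\<^esub> \<otimes>\<^bsub>R\<^esub> s) (s \<odot>\<^bsub>Hom C A A\<^esub> (sc U \<odot>\<^bsub>Hom C A A\<^esub> y))"
    using hfrc_expand[OF A_obj A_obj W_one sc_mem[OF assms(2)], of "sc U \<odot>\<^bsub>Hom C A A\<^esub> y"]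
      hfrc_expand[OF A_obj A_obj W_one y(1), of "sc U \<odot>\<^bsub>Hom C A A\<^esub> y"] A_obj assms y(2) by (simp del: lc.hom_simps(5))
  also have "\<dots> = \<rho> (s \<otimes>\<^bsub>R\<^esub> sc U) \<otimes>\<^bsub>E\<^esub> x"
    unfolding y(3) using \<rho>_hfrc[OF _ y(1,2)] y(1,2) sR A_obj assms by (simp del: LE.rho_simps(2))
  finally have "\<rho> (s \<otimes>\<^bsub>R\<^esub> sc U) \<otimes>\<^bsub>E\<^esub> x \<in> \<phi> U V ` lc.H U V" using f by (metis imageI)
  moreover have "s \<otimes>\<^bsub>R\<^esub> sc U \<in> carrier R - {\<zero>\<^bsub>R\<^esub>}" using W_mult[OF y(1) sc_mem[OF assms(1)]] P_zero by simp
  ultimately show ?thesis by blast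
qed

lemma \<phi>_lattice: "U \<in> obs \<Longrightarrow> V \<in> obs \<Longrightarrow> LE.lattice (\<phi> U V ` lc.H U V)"
  unfolding LE.lattice_def using \<phi>_closed \<phi>_dense
  by (auto simp: \<phi>_add[symmetric] \<phi>_smult[symmetric] simp del: LE.rho_simps)

text \<open>Write \<open>y = x / s\<close> with \<open>x\<close> an endomorphism in
  \<open>C\<close>. A polynomial relation for \<open>x\<close>, taken modulo the zero ideal, carries
  over to \<open>K\<close>, and \<open>k - y\<close> is the unit \<open>1 / s\<close> times
  \<open>s k - x\<close>.\<close>

lemma finite_nonunits:
  assumes fin: "hom_finite R C" and y: "y \<in> carrier E"
  shows "finite {k \<in> carrier K. scalar A k \<ominus>\<^bsub>E\<^esub> y \<notin> Units E}"
proof -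
  interpret A: central_algebra R "End_ring C A" "\<lambda>r. r \<odot>\<^bsub>Hom C A A\<^esub> Id C A" by (rule lc.End_algebra[OF A_obj])
  obtain G where G: "A.generates G" using lc.End_generates[OF fin A_obj] by blast
  obtain s x where x: "s \<in> carrier R - P" "x \<in> lc.H A A" "y = hfrc A A s x"
    using hfrc_exists[OF A_obj A_obj] y unfolding E_def by (metis End_ring_simps(1))
  define \<eta> where "\<eta> = hfrc A A \<one>\<^bsub>R\<^esub>"
  have \<eta>: "\<eta> f \<in> carrier E" if "f \<in> lc.H A A" for f unfolding \<eta>_def E_def using hfrc_closed[OF A_obj A_obj W_one that] by simp
  have \<eta>_add: "\<eta> (f \<oplus>\<^bsub>Hom C A A\<^esub> g) = \<eta> f \<oplus>\<^bsub>E\<^esub> \<eta> g" if "f \<in> lc.H A A" "g \<in> lc.H A A" for f g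
    unfolding \<eta>_def E_def using hfrc_add[OF A_obj A_obj W_one that] by simp
  have \<eta>0: "\<eta> \<zero>\<^bsub>Hom C A A\<^esub> = \<zero>\<^bsub>E\<^esub>"
    using \<eta>_add[of "\<zero>\<^bsub>Hom C A A\<^esub>" "\<zero>\<^bsub>Hom C A A\<^esub>"] \<eta>[of "\<zero>\<^bsub>Hom C A A\<^esub>"] A_obj by simp
  have pe: "KE.peval (\<eta> x) (map \<iota> rs) = \<eta> (A.peval x rs)" if "set rs \<subseteq> carrier R" for rs
    using that
  proof (induction rs)
    case (Cons r rs)
    have p: "A.peval x rs \<in> lc.H A A" using A.peval_closed[of x rs] x(2) Cons.prems by simp
    have "\<eta> (Comp C A A A x (A.peval x rs)) = \<eta> x \<otimes>\<^bsub>E\<^esub> \<eta> (A.peval x rs)"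
      unfolding \<eta>_def E_def using Comp_hfrc[OF A_obj A_obj A_obj W_one W_one x(2) p] by simp
    moreover have "scalar A (\<iota> r) = \<eta> (r \<odot>\<^bsub>Hom C A A\<^esub> Id C A)" unfolding \<eta>_def using scalar_iota[OF A_obj] Cons.prems by simp
    ultimately show ?case using Cons p x(2) A_obj by (simp add: \<eta>_add lc.cat_simps)
  qed (simp add: \<eta>0)
  have prime: "primeideal {\<zero>\<^bsub>R\<^esub>} R" using prime_P P_zero by simp
  obtain rs where rs: "set rs \<subseteq> carrier R" "\<not> set rs \<subseteq> {\<zero>\<^bsub>R\<^esub>}" "A.peval x rs \<in> A.span G {\<zero>\<^bsub>R\<^esub>}"
    using A.polynomial_relation[OF G prime, of x] x(2) by auto
  have "A.lin_comb G c = \<zero>\<^bsub>Hom C A A\<^esub>" if "c \<in> G \<rightarrow> {\<zero>\<^bsub>R\<^esub>}" for c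
  proof -
    have "A.lin_comb G c = (\<Oplus>\<^bsub>End_ring C A\<^esub>g\<in>G. \<zero>\<^bsub>End_ring C A\<^esub>)"
      unfolding A.lin_comb_def using that G A_obj unfolding A.generates_def
      by (intro A.finsum_cong') (auto simp: Pi_def subset_iff lc.id_closed simp del: A.rho_simps)
    also have "\<dots> = \<zero>\<^bsub>End_ring C A\<^esub>" by (rule A.finsum_zero)
    finally show ?thesis by simp
  qed
  hence "A.peval x rs = \<zero>\<^bsub>Hom C A A\<^esub>" using rs(3) unfolding A.span_def by auto
  hence "KE.peval (\<eta> x) (map \<iota> rs) = \<zero>\<^bsub>E\<^esub>" using pe[OF rs(1)] \<eta>0 by simp
  moreover have "set (map \<iota> rs) \<subseteq> carrier K" using rs(1) by auto
  moreover have "\<not> set (map \<iota> rs) \<subseteq> {\<zero>\<^bsub>K\<^esub>}"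
  proof
    assume *: "set (map \<iota> rs) \<subseteq> {\<zero>\<^bsub>K\<^esub>}"
    have "r = \<zero>\<^bsub>R\<^esub>" if "r \<in> set rs" for r using iota_eq[of r "\<zero>\<^bsub>R\<^esub>"] * that rs(1) by auto
    thus False using rs(2) by auto
  qed
  ultimately have fb: "finite {k \<in> carrier K. scalar A k \<ominus>\<^bsub>E\<^esub> \<eta> x \<notin> Units E}"
    using KE.finite_nonunits[OF K.field_axioms] \<eta>[OF x(2)] by blast
  have yx: "y = scalar A (q s) \<otimes>\<^bsub>E\<^esub> \<eta> x" unfolding x(3) \<eta>_def E_def by (rule hfrc_eq_scalar[OF A_obj x(1,2)])
  note qs = q_simps[OF x(1)]
  have qU: "scalar A (q s) \<in> Units E" using KE_Units iota_Units[OF W_carrier[OF x(1)]] by simp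
  have sR: "s \<in> carrier R" using x(1) by auto
  have "{k \<in> carrier K. scalar A k \<ominus>\<^bsub>E\<^esub> y \<notin> Units E} \<subseteq> (\<lambda>j. q s \<otimes>\<^bsub>K\<^esub> j) ` {k \<in> carrier K. scalar A k \<ominus>\<^bsub>E\<^esub> \<eta> x \<notin> Units E}"
  proof
    fix k assume k: "k \<in> {k \<in> carrier K. scalar A k \<ominus>\<^bsub>E\<^esub> y \<notin> Units E}"
    hence kK: "k \<in> carrier K" by simp
    define j where "j = \<iota> s \<otimes>\<^bsub>K\<^esub> k"
    have j: "j \<in> carrier K" "q s \<otimes>\<^bsub>K\<^esub> j = k" unfolding j_def using kK qs sR by (simp_all add: K.m_assoc[symmetric])
    have "scalar A k \<ominus>\<^bsub>E\<^esub> y = scalar A (q s) \<otimes>\<^bsub>E\<^esub> (scalar A j \<ominus>\<^bsub>E\<^esub> \<eta> x)"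
      unfolding yx j(2)[symmetric] using qs j(1) \<eta>[OF x(2)] by (simp add: KE.nc_simps)
    hence "scalar A j \<ominus>\<^bsub>E\<^esub> \<eta> x \<notin> Units E" using k qU KE.Units_m_closed by auto
    thus "k \<in> (\<lambda>j. q s \<otimes>\<^bsub>K\<^esub> j) ` {k \<in> carrier K. scalar A k \<ominus>\<^bsub>E\<^esub> \<eta> x \<notin> Units E}" using j by blast
  qed
  thus ?thesis using fb finite_subset by blast
qed

text \<open>The local isomorphisms of \<open>V\<close> with \<open>A\<close> serve to carry the
  corner entry from \<open>A\<close> over to \<open>V\<close>, those of \<open>V\<close> with
  \<open>U\<close> to repair torsion at the end.\<close>

theorem cancellation:
  assumes fin: "hom_finite R C" and CU: "commutators_unipotent E" and inf: "infinite (carrier R)"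
    and o: "U \<in> obs" "V \<in> obs" "A \<in> obs"
    and S: "direct_sum C S U A" "direct_sum C S' V A" "isomorphic_in C S S'"
    and loc: "\<And>Q. maximalideal Q R \<Longrightarrow> \<exists>\<theta>. lc.p_iso Q V A \<theta>" "\<And>Q. maximalideal Q R \<Longrightarrow> \<exists>\<theta>. lc.p_iso Q V U \<theta>"
  shows "isomorphic_in C U V"
proof -
  have Ob: "U \<in> Obj C" "V \<in> Obj C" "A \<in> Obj C" using o by auto
  obtain a b c d a' b' c' d' where m: "a \<in> lc.H U V" "b \<in> lc.H A V" "c \<in> lc.H U A" "d \<in> lc.H A A"
      "a' \<in> lc.H V U" "b' \<in> lc.H A U" "c' \<in> lc.H V A" "d' \<in> lc.H A A"
    and r: "Comp C V U V a a' \<oplus>\<^bsub>Hom C V V\<^esub> Comp C V A V b c' = Id C V"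
      "Comp C V U A c a' \<oplus>\<^bsub>Hom C V A\<^esub> Comp C V A A d c' = \<zero>\<^bsub>Hom C V A\<^esub>"
      "Comp C U V U a' a \<oplus>\<^bsub>Hom C U U\<^esub> Comp C U A U b' c = Id C U"
      "Comp C A V U a' b \<oplus>\<^bsub>Hom C A U\<^esub> Comp C A A U b' d = \<zero>\<^bsub>Hom C A U\<^esub>"
      "Comp C A V A c' b \<oplus>\<^bsub>Hom C A A\<^esub> Comp C A A A d' d = Id C A"
      "Comp C A U V a b' \<oplus>\<^bsub>Hom C A V\<^esub> Comp C A A V b d' = \<zero>\<^bsub>Hom C A V\<^esub>"
      "Comp C A U A c b' \<oplus>\<^bsub>Hom C A A\<^esub> Comp C A A A d d' = Id C A"
    using lc.direct_sum_matrix[OF S Ob] by blast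
  define pa pb pc pd pa' pb' pc' pd' where "pa = \<phi> U V a" and "pb = \<phi> A V b" and "pc = \<phi> U A c" and "pd = \<phi> A A d"
    and "pa' = \<phi> V U a'" and "pb' = \<phi> A U b'" and "pc' = \<phi> V A c'" and "pd' = \<phi> A A d'"
  note p_defs = this
  have pm: "pa \<in> carrier E" "pb \<in> carrier E" "pc \<in> carrier E" "pd \<in> carrier E"
      "pa' \<in> carrier E" "pb' \<in> carrier E" "pc' \<in> carrier E" "pd' \<in> carrier E"
    unfolding p_defs using m o by (auto intro!: \<phi>_closed)
  have pr: "pa \<otimes>\<^bsub>E\<^esub> pa' \<oplus>\<^bsub>E\<^esub> pb \<otimes>\<^bsub>E\<^esub> pc' = \<one>\<^bsub>E\<^esub>" "pc \<otimes>\<^bsub>E\<^esub> pa' \<oplus>\<^bsub>E\<^esub> pd \<otimes>\<^bsub>E\<^esub> pc' = \<zero>\<^bsub>E\<^esub>"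
      "pa' \<otimes>\<^bsub>E\<^esub> pa \<oplus>\<^bsub>E\<^esub> pb' \<otimes>\<^bsub>E\<^esub> pc = \<one>\<^bsub>E\<^esub>" "pa' \<otimes>\<^bsub>E\<^esub> pb \<oplus>\<^bsub>E\<^esub> pb' \<otimes>\<^bsub>E\<^esub> pd = \<zero>\<^bsub>E\<^esub>"
      "pa \<otimes>\<^bsub>E\<^esub> pb' \<oplus>\<^bsub>E\<^esub> pb \<otimes>\<^bsub>E\<^esub> pd' = \<zero>\<^bsub>E\<^esub>" "pc \<otimes>\<^bsub>E\<^esub> pb' \<oplus>\<^bsub>E\<^esub> pd \<otimes>\<^bsub>E\<^esub> pd' = \<one>\<^bsub>E\<^esub>"
    unfolding p_defs using m o Ob
    by (simp_all add: \<phi>_mult[symmetric] \<phi>_add[symmetric] lc.comp_closed r \<phi>_id \<phi>_zero)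
  define M M' W where "M = \<phi> U V ` lc.H U V" and "M' = \<phi> V U ` lc.H V U" and "W = \<phi> V V ` lc.H V V"
  have lat: "LE.lattice M" "LE.lattice M'" "LE.lattice W"
    unfolding M_def M'_def W_def using \<phi>_lattice o by auto
  have W: "\<one>\<^bsub>E\<^esub> \<in> W" "\<And>x y. x \<in> W \<Longrightarrow> y \<in> W \<Longrightarrow> x \<otimes>\<^bsub>E\<^esub> y \<in> W"
      "\<And>x y. x \<in> W \<Longrightarrow> y \<in> M \<Longrightarrow> x \<otimes>\<^bsub>E\<^esub> y \<in> M" "\<And>x y. x \<in> M' \<Longrightarrow> y \<in> W \<Longrightarrow> x \<otimes>\<^bsub>E\<^esub> y \<in> M'"
    using imageI[OF lc.id_closed[OF Ob(2)], of "\<phi> V V"] \<phi>_id[OF o(2)] o Ob unfolding M_def M'_def W_def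
    by (auto simp: \<phi>_mult[symmetric] lc.comp_closed)
  \<comment> \<open>The second element is the inverse of the Schur complement after the operation
    given by \<open>t\<close>, so both factors of the determinant are units.\<close>
  define good where "good t \<longleftrightarrow> t \<in> carrier E \<and> pd \<oplus>\<^bsub>E\<^esub> t \<otimes>\<^bsub>E\<^esub> pb \<in> Units E \<and> pa' \<ominus>\<^bsub>E\<^esub> pb' \<otimes>\<^bsub>E\<^esub> t \<in> Units E" for t
  \<comment> \<open>The determinant of the matrix: lower right entry times Schur complement.\<close>
  define kl where "kl t = unit_class E ((pd \<oplus>\<^bsub>E\<^esub> t \<otimes>\<^bsub>E\<^esub> pb) \<otimes>\<^bsub>E\<^esub> inv\<^bsub>E\<^esub> (pa' \<ominus>\<^bsub>E\<^esub> pb' \<otimes>\<^bsub>E\<^esub> t))" for t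
  interpret G: comm_group "unit_class_group E" by (rule KE.unit_class_comm[OF CU])
  have infK: "infinite (carrier K)"
  proof
    assume "finite (carrier K)"
    hence "finite (\<iota> ` carrier R)" by (rule rev_finite_subset) (simp add: image_subset_iff)
    thus False using inf finite_imageD[OF _ emb_inj] by blast
  qed
  \<comment> \<open>\<open>schur_class\<close> compares the classes crosswise; dividing by both
    inverse Schur complements gives the equality.\<close>
  have kl_const: "kl t1 = kl t2" if "good t1" "good t2" for t1 t2
  proof -
    define d1 d2 a1 a2 where "d1 = pd \<oplus>\<^bsub>E\<^esub> t1 \<otimes>\<^bsub>E\<^esub> pb" and "d2 = pd \<oplus>\<^bsub>E\<^esub> t2 \<otimes>\<^bsub>E\<^esub> pb"
      and "a1 = pa' \<ominus>\<^bsub>E\<^esub> pb' \<otimes>\<^bsub>E\<^esub> t1" and "a2 = pa' \<ominus>\<^bsub>E\<^esub> pb' \<otimes>\<^bsub>E\<^esub> t2"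
    have u: "d1 \<in> Units E" "d2 \<in> Units E" "a1 \<in> Units E" "a2 \<in> Units E"
      using that unfolding d1_def d2_def a1_def a2_def good_def by auto
    have eq: "unit_class E (d1 \<otimes>\<^bsub>E\<^esub> a2) = unit_class E (d2 \<otimes>\<^bsub>E\<^esub> a1)"
      unfolding d1_def d2_def a1_def a2_def using that unfolding good_def
      by (intro KE.schur_class(2)[OF K.field_axioms infK finite_nonunits[OF fin] CU pm(5,2,6,4)]) (use pr(4) in auto)
    have i: "inv\<^bsub>E\<^esub> a1 \<in> Units E" "inv\<^bsub>E\<^esub> a2 \<in> Units E" "inv\<^bsub>E\<^esub> a1 \<otimes>\<^bsub>E\<^esub> inv\<^bsub>E\<^esub> a2 \<in> Units E" using u by auto
    have e1: "unit_class E (d1 \<otimes>\<^bsub>E\<^esub> inv\<^bsub>E\<^esub> a1) = unit_class E (d1 \<otimes>\<^bsub>E\<^esub> a2 \<otimes>\<^bsub>E\<^esub> (inv\<^bsub>E\<^esub> a2 \<otimes>\<^bsub>E\<^esub> inv\<^bsub>E\<^esub> a1))"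
      using u i KE.m_assoc[of d1 a2] KE.m_assoc[of a2 "inv\<^bsub>E\<^esub> a2" "inv\<^bsub>E\<^esub> a1"] by (simp add: KE.m_assoc[symmetric]) (simp add: KE.m_assoc)
    have e2: "unit_class E (d2 \<otimes>\<^bsub>E\<^esub> inv\<^bsub>E\<^esub> a2) = unit_class E (d2 \<otimes>\<^bsub>E\<^esub> a1 \<otimes>\<^bsub>E\<^esub> (inv\<^bsub>E\<^esub> a1 \<otimes>\<^bsub>E\<^esub> inv\<^bsub>E\<^esub> a2))"
      using u i by (simp add: KE.m_assoc[symmetric]) (simp add: KE.m_assoc)
    have "unit_class E (inv\<^bsub>E\<^esub> a2 \<otimes>\<^bsub>E\<^esub> inv\<^bsub>E\<^esub> a1) = unit_class E (inv\<^bsub>E\<^esub> a1 \<otimes>\<^bsub>E\<^esub> inv\<^bsub>E\<^esub> a2)"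
      by (rule KE.unit_class_conj[OF CU i(2,1)])
    thus ?thesis
      unfolding kl_def d1_def[symmetric] d2_def[symmetric] a1_def[symmetric] a2_def[symmetric] e1 e2
      using u i eq by (simp add: KE.unit_class_mult del: mult_FactGroup)
  qed
  have ex: "\<exists>t v. good t \<and> v \<in> Units E \<and> v \<in> LE.localized Q M \<and> inv\<^bsub>E\<^esub> v \<in> LE.localized Q M' \<and> unit_class E v = kl t"
    if Q: "maximalideal Q R" for Q
  proof -
    interpret A: central_algebra R "End_ring C A" "\<lambda>r. r \<odot>\<^bsub>Hom C A A\<^esub> Id C A" by (rule lc.End_algebra[OF Ob(3)])
    obtain G where G: "A.generates G" using lc.End_generates[OF fin Ob(3)] by blast
    have sum1: "Comp C A A A d' d \<oplus>\<^bsub>Hom C A A\<^esub> Comp C A V A c' b = \<one>\<^bsub>R\<^esub> \<odot>\<^bsub>Hom C A A\<^esub> Id C A"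
      using r(5) m Ob abelian_group.axioms(1)[OF lc.hom_group[OF Ob(3,3)]]
        abelian_monoid.a_comm[of "Hom C A A" "Comp C A A A d' d" "Comp C A V A c' b"] by (simp add: lc.cat_simps)
    \<comment> \<open>Stable range one is applied to the equation \<open>d' d + c' b = 1\<close>.
      The correction \<open>t0 c' b\<close> of \<open>d\<close> comes from the row operation
      \<open>t0 c'\<close>, a morphism from \<open>V\<close> to \<open>A\<close>.\<close>
    obtain t0 where t0: "t0 \<in> lc.H A A" "A.p_unit Q (d \<oplus>\<^bsub>Hom C A A\<^esub> Comp C A A A t0 (Comp C A V A c' b))"
      using A.p_unit_stable_range[OF G Q, of d d' "Comp C A V A c' b" "\<one>\<^bsub>R\<^esub>"] m Ob sum1 LE.one_not_in_maximal[OF Q]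
      by (auto simp: lc.comp_closed)
    define t where "t = Comp C V A A t0 c'"
    have t: "t \<in> lc.H V A" unfolding t_def using t0 m Ob by (simp add: lc.comp_closed)
    define \<delta>' where "\<delta>' = d \<oplus>\<^bsub>Hom C A A\<^esub> Comp C A V A t b"
    have \<delta>': "\<delta>' \<in> lc.H A A" unfolding \<delta>'_def using t m Ob by (simp add: lc.comp_closed)
    have "A.p_unit Q \<delta>'" using t0(2) unfolding \<delta>'_def t_def using t0(1) m Ob by (simp add: lc.cat_simps)
    then obtain y s1 where y: "y \<in> lc.H A A" "s1 \<in> carrier R - Q" "Comp C A A A y \<delta>' = s1 \<odot>\<^bsub>Hom C A A\<^esub> Id C A"
        "Comp C A A A \<delta>' y = s1 \<odot>\<^bsub>Hom C A A\<^esub> Id C A" unfolding A.p_unit_def by auto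
    obtain \<theta> \<theta>' s2 where th: "\<theta> \<in> lc.H V A" "\<theta>' \<in> lc.H A V" "s2 \<in> carrier R - Q"
        "Comp C V A V \<theta>' \<theta> = s2 \<odot>\<^bsub>Hom C V V\<^esub> Id C V" "Comp C A V A \<theta> \<theta>' = s2 \<odot>\<^bsub>Hom C A A\<^esub> Id C A"
      using loc(1)[OF Q] unfolding lc.p_iso_def by blast
    have zQ: "\<zero>\<^bsub>R\<^esub> \<in> Q" using additive_subgroup.zero_closed[OF ideal.axioms(1)[OF maximalideal.axioms(1)[OF Q]]] .
    have s12: "s1 \<in> carrier R" "s2 \<in> carrier R" "\<rho> s1 \<in> Units E" "\<rho> s2 \<in> Units E"
      using y(2) th(3) zQ by (auto intro!: LE.rho_Units)
    define pt \<delta> py p\<theta> p\<theta>' where "pt = \<phi> V A t" and "\<delta> = \<phi> A A \<delta>'" and "py = \<phi> A A y" and "p\<theta> = \<phi> V A \<theta>" and "p\<theta>' = \<phi> A V \<theta>'"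
    note q_defs = this
    have qc: "pt \<in> carrier E" "\<delta> \<in> carrier E" "py \<in> carrier E" "p\<theta> \<in> carrier E" "p\<theta>' \<in> carrier E"
      unfolding q_defs using t \<delta>' y(1) th(1,2) o by (auto intro!: \<phi>_closed)
    have \<delta>_eq: "\<delta> = pd \<oplus>\<^bsub>E\<^esub> pt \<otimes>\<^bsub>E\<^esub> pb"
      unfolding q_defs p_defs \<delta>'_def using t m o Ob by (simp add: \<phi>_add \<phi>_mult lc.comp_closed)
    have y\<delta>: "py \<otimes>\<^bsub>E\<^esub> \<delta> = \<rho> s1" "\<delta> \<otimes>\<^bsub>E\<^esub> py = \<rho> s1" "p\<theta>' \<otimes>\<^bsub>E\<^esub> p\<theta> = \<rho> s2" "p\<theta> \<otimes>\<^bsub>E\<^esub> p\<theta>' = \<rho> s2"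
      unfolding q_defs using y th \<delta>' o s12 by (simp_all add: \<phi>_mult[symmetric] \<phi>_scalar)
    note \<delta>U = KE.Units_of_two_sided[OF qc(2,3) s12(3) y\<delta>(1,2)]
    note \<theta>U = KE.Units_of_two_sided[OF qc(4,5) s12(4) y\<delta>(3,4)]
    define \<sigma> where "\<sigma> = pa \<ominus>\<^bsub>E\<^esub> pb \<otimes>\<^bsub>E\<^esub> inv\<^bsub>E\<^esub> (pd \<oplus>\<^bsub>E\<^esub> pt \<otimes>\<^bsub>E\<^esub> pb) \<otimes>\<^bsub>E\<^esub> (pc \<oplus>\<^bsub>E\<^esub> pt \<otimes>\<^bsub>E\<^esub> pa)"
    note \<sigma>U = KE.shifted_schur_unit[OF pm(1-4) qc(1) pm(5-8) pr \<delta>U(1)[unfolded \<delta>_eq], folded \<sigma>_def]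
    have goodt: "good pt"
      unfolding good_def \<sigma>U(2)[symmetric] \<delta>_eq[symmetric] using qc \<delta>U(1) \<sigma>U(1) by simp
    note aM = LE.localized_add[OF Q] and sM = LE.localized_self[OF Q] and uM = LE.localized_uminus
    have ic: "inv\<^bsub>E\<^esub> \<delta> \<in> carrier E" "inv\<^bsub>E\<^esub> p\<theta> \<in> carrier E" using \<delta>U \<theta>U by auto
    \<comment> \<open>The only denominator in the Schur complement comes from the inverse of
      \<open>\<delta>\<close>, and \<open>s1\<close>, which is outside \<open>Q\<close>, clears
      it.\<close>
    have \<sigma>M: "\<sigma> \<in> LE.localized Q M"
    proof -
      let ?g = "pc \<oplus>\<^bsub>E\<^esub> pt \<otimes>\<^bsub>E\<^esub> pa"
      define h where "h = c \<oplus>\<^bsub>Hom C U A\<^esub> Comp C U V A t a"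
      have h: "h \<in> lc.H U A" "\<phi> U A h = ?g"
        unfolding h_def q_defs p_defs using t m o Ob by (simp_all add: \<phi>_add \<phi>_mult lc.comp_closed)
      have g: "?g \<in> carrier E" using pm qc by simp
      have "\<rho> s1 \<otimes>\<^bsub>E\<^esub> (pb \<otimes>\<^bsub>E\<^esub> inv\<^bsub>E\<^esub> \<delta> \<otimes>\<^bsub>E\<^esub> ?g) = pb \<otimes>\<^bsub>E\<^esub> (\<rho> s1 \<otimes>\<^bsub>E\<^esub> inv\<^bsub>E\<^esub> \<delta>) \<otimes>\<^bsub>E\<^esub> ?g"
        using pm(2) g ic s12 LE.rho_comm(2)[OF s12(1) pm(2), of "inv\<^bsub>E\<^esub> \<delta> \<otimes>\<^bsub>E\<^esub> ?g"]
        by (simp add: KE.m_assoc del: \<delta>U(2))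
      also have "\<dots> = \<phi> U V (Comp C U A V b (Comp C U A A y h))"
        unfolding \<delta>U(2) h(2)[symmetric] using h(1) y(1) m o Ob pm(2) qc(3) \<phi>_closed[OF o(1,3) h(1)]
        by (simp add: \<phi>_mult lc.comp_closed p_defs q_defs KE.m_assoc)
      finally have "\<rho> s1 \<otimes>\<^bsub>E\<^esub> (pb \<otimes>\<^bsub>E\<^esub> inv\<^bsub>E\<^esub> \<delta> \<otimes>\<^bsub>E\<^esub> ?g) \<in> M"
        unfolding M_def using h(1) y(1) m Ob by (simp add: lc.comp_closed)
      hence "pb \<otimes>\<^bsub>E\<^esub> inv\<^bsub>E\<^esub> \<delta> \<otimes>\<^bsub>E\<^esub> ?g \<in> LE.localized Q M"
        using y(2) pm(2) ic g by (intro LE.localizedI[of s1]) auto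
      moreover have "pa \<in> M" unfolding M_def p_defs using m by simp
      ultimately show ?thesis
        unfolding \<sigma>_def \<delta>_eq[symmetric] a_minus_def using aM[OF lat(1)] sM[OF lat(1)] uM[OF lat(1)] by simp
    qed
    have i\<sigma>M: "inv\<^bsub>E\<^esub> \<sigma> \<in> LE.localized Q M'"
    proof -
      have "pa' \<in> M'" unfolding M'_def p_defs using m by simp
      moreover have "pb' \<otimes>\<^bsub>E\<^esub> pt = \<phi> V U (Comp C V A U b' t)"
        unfolding p_defs q_defs using m t o by (simp add: \<phi>_mult)
      hence "pb' \<otimes>\<^bsub>E\<^esub> pt \<in> M'" unfolding M'_def using m t Ob by (simp add: lc.comp_closed)
      ultimately show ?thesis
        unfolding \<sigma>U(2) a_minus_def using aM[OF lat(2)] sM[OF lat(2)] uM[OF lat(2)] by simp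
    qed
    \<comment> \<open>The class of the Schur complement alone varies with \<open>t\<close>; only its
      product with \<open>\<delta>\<close> is invariant. But \<open>\<delta>\<close> comes from an
      endomorphism of \<open>A\<close>, and conjugation by the local isomorphism
      \<open>\<theta>\<close> turns it into one of \<open>V\<close> at \<open>Q\<close>, of the same
      class, which can be composed with \<open>\<sigma>\<close>.\<close>
    define \<omega> where "\<omega> = inv\<^bsub>E\<^esub> p\<theta> \<otimes>\<^bsub>E\<^esub> \<delta> \<otimes>\<^bsub>E\<^esub> p\<theta>"
    have \<omega>U: "\<omega> \<in> Units E" unfolding \<omega>_def using \<delta>U(1) \<theta>U(1) by simp
    have i\<omega>: "inv\<^bsub>E\<^esub> \<omega> = inv\<^bsub>E\<^esub> p\<theta> \<otimes>\<^bsub>E\<^esub> (inv\<^bsub>E\<^esub> \<delta> \<otimes>\<^bsub>E\<^esub> p\<theta>)"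
      unfolding \<omega>_def using \<delta>U(1) \<theta>U(1) by (simp add: KE.Units_inv_mult)
    have conj: "p\<theta>' \<otimes>\<^bsub>E\<^esub> (\<phi> A A x \<otimes>\<^bsub>E\<^esub> p\<theta>) \<in> W" if "x \<in> lc.H A A" for x
      unfolding W_def q_defs using that th(1,2) o Ob by (simp add: \<phi>_mult[symmetric] lc.comp_closed)
    have \<omega>W: "\<omega> \<in> LE.localized Q W"
    proof (rule LE.localizedI[of s2])
      have "\<rho> s2 \<otimes>\<^bsub>E\<^esub> \<omega> = (\<rho> s2 \<otimes>\<^bsub>E\<^esub> inv\<^bsub>E\<^esub> p\<theta>) \<otimes>\<^bsub>E\<^esub> (\<delta> \<otimes>\<^bsub>E\<^esub> p\<theta>)"
        unfolding \<omega>_def using qc ic s12 by (simp add: KE.m_assoc del: \<theta>U(2))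
      thus "\<rho> s2 \<otimes>\<^bsub>E\<^esub> \<omega> \<in> W" unfolding \<theta>U(2) using conj[OF \<delta>'] unfolding q_defs by simp
    qed (use th(3) \<omega>U in auto)
    have i\<omega>W: "inv\<^bsub>E\<^esub> \<omega> \<in> LE.localized Q W"
    proof (rule LE.localizedI[of "s2 \<otimes>\<^bsub>R\<^esub> s1"])
      have "\<rho> (s2 \<otimes>\<^bsub>R\<^esub> s1) \<otimes>\<^bsub>E\<^esub> inv\<^bsub>E\<^esub> \<omega> = (\<rho> s2 \<otimes>\<^bsub>E\<^esub> inv\<^bsub>E\<^esub> p\<theta>) \<otimes>\<^bsub>E\<^esub> ((\<rho> s1 \<otimes>\<^bsub>E\<^esub> inv\<^bsub>E\<^esub> \<delta>) \<otimes>\<^bsub>E\<^esub> p\<theta>)"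
        unfolding i\<omega> using qc ic s12 LE.rho_comm(2)[OF s12(1) ic(2), of "inv\<^bsub>E\<^esub> \<delta> \<otimes>\<^bsub>E\<^esub> p\<theta>"]
        by (simp add: KE.m_assoc del: \<theta>U(2) \<delta>U(2))
      thus "\<rho> (s2 \<otimes>\<^bsub>R\<^esub> s1) \<otimes>\<^bsub>E\<^esub> inv\<^bsub>E\<^esub> \<omega> \<in> W" unfolding \<theta>U(2) \<delta>U(2) using conj[OF y(1)] unfolding q_defs by simp
      show "s2 \<otimes>\<^bsub>R\<^esub> s1 \<in> carrier R - Q" by (rule LE.prime_mult[OF Q th(3) y(2)])
    qed (use \<omega>U in auto)
    have sub: "W \<subseteq> carrier E" "M \<subseteq> carrier E" "M' \<subseteq> carrier E" using lat unfolding LE.lattice_def by auto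
    have "unit_class E \<omega> = unit_class E (p\<theta> \<otimes>\<^bsub>E\<^esub> (inv\<^bsub>E\<^esub> p\<theta> \<otimes>\<^bsub>E\<^esub> \<delta>))"
      unfolding \<omega>_def using KE.unit_class_conj[OF CU _ \<theta>U(1)] \<theta>U(1) \<delta>U(1) by simp
    also have "p\<theta> \<otimes>\<^bsub>E\<^esub> (inv\<^bsub>E\<^esub> p\<theta> \<otimes>\<^bsub>E\<^esub> \<delta>) = \<delta>" using \<theta>U(1) qc ic by (simp add: KE.m_assoc[symmetric])
    finally have "unit_class E (\<omega> \<otimes>\<^bsub>E\<^esub> \<sigma>) = unit_class E (\<delta> \<otimes>\<^bsub>E\<^esub> \<sigma>)"
      using \<omega>U \<sigma>U(1) \<delta>U(1) by (simp add: KE.unit_class_mult)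
    also have "\<sigma> = inv\<^bsub>E\<^esub> (inv\<^bsub>E\<^esub> \<sigma>)" using \<sigma>U(1) by simp
    finally have cl: "unit_class E (\<omega> \<otimes>\<^bsub>E\<^esub> \<sigma>) = kl pt" unfolding kl_def \<delta>_eq[symmetric] \<sigma>U(2)[symmetric] using \<sigma>U(1) by simp
    have iv: "inv\<^bsub>E\<^esub> (\<omega> \<otimes>\<^bsub>E\<^esub> \<sigma>) = inv\<^bsub>E\<^esub> \<sigma> \<otimes>\<^bsub>E\<^esub> inv\<^bsub>E\<^esub> \<omega>" by (rule KE.Units_inv_mult[OF \<omega>U \<sigma>U(1)])
    have "\<omega> \<otimes>\<^bsub>E\<^esub> \<sigma> \<in> LE.localized Q M" by (rule LE.localized_mult[OF Q sub(1,2) W(3) \<omega>W \<sigma>M])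
    moreover have "inv\<^bsub>E\<^esub> (\<omega> \<otimes>\<^bsub>E\<^esub> \<sigma>) \<in> LE.localized Q M'"
      unfolding iv by (rule LE.localized_mult[OF Q sub(3,1) W(4) i\<sigma>M i\<omega>W])
    moreover have "\<omega> \<otimes>\<^bsub>E\<^esub> \<sigma> \<in> Units E" using \<omega>U \<sigma>U(1) by simp
    ultimately show ?thesis using goodt cl by blast
  qed
  define u where "u Q = (SOME v. \<exists>t. good t \<and> v \<in> Units E \<and> v \<in> LE.localized Q M \<and> inv\<^bsub>E\<^esub> v \<in> LE.localized Q M' \<and> unit_class E v = kl t)" for Q
  have u: "\<exists>t. good t \<and> u Q \<in> Units E \<and> u Q \<in> LE.localized Q M \<and> inv\<^bsub>E\<^esub> (u Q) \<in> LE.localized Q M' \<and> unit_class E (u Q) = kl t"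
    if "maximalideal Q R" for Q
    unfolding u_def by (rule someI_ex) (use ex[OF that] in blast)
  have "\<exists>v \<in> Units E. v \<in> M \<and> inv\<^bsub>E\<^esub> v \<in> M'"
  proof (rule LE.unit_of_local_units[OF lat(3) W(1) _ lat(1,2)])
    fix Q Q' assume Q: "maximalideal Q R" "maximalideal Q' R"
    show "u Q \<in> Units E \<and> u Q \<in> LE.localized Q M \<and> inv\<^bsub>E\<^esub> (u Q) \<in> LE.localized Q M'" using u[OF Q(1)] by blast
    show "unit_class E (u Q) = unit_class E (u Q')" using u[OF Q(1)] u[OF Q(2)] kl_const by metis
  qed (use W in auto)
  then obtain v where v: "v \<in> Units E" "v \<in> M" "inv\<^bsub>E\<^esub> v \<in> M'" by blast
  from v(2,3) obtain f y where f: "f \<in> lc.H U V" "v = \<phi> U V f" and y: "y \<in> lc.H V U" "inv\<^bsub>E\<^esub> v = \<phi> V U y"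
    unfolding M_def M'_def by auto
  \<comment> \<open>Back in \<open>C\<close>, the morphisms that represent the glued unit and its
    inverse are inverse to each other only up to torsion.\<close>
  have "\<phi> U U (Comp C U V U y f) = \<phi> U U (Id C U)" "\<phi> V V (Comp C V U V f y) = \<phi> V V (Id C V)"
    using f y o v(1) by (simp_all add: \<phi>_mult \<phi>_id f(2)[symmetric] y(2)[symmetric])
  then obtain w1 w2 where w: "w1 \<in> carrier R - P" "w1 \<odot>\<^bsub>Hom C U U\<^esub> Comp C U V U y f = w1 \<odot>\<^bsub>Hom C U U\<^esub> Id C U"
      "w2 \<in> carrier R - P" "w2 \<odot>\<^bsub>Hom C V V\<^esub> Comp C V U V f y = w2 \<odot>\<^bsub>Hom C V V\<^esub> Id C V"
    using \<phi>_eqD[OF o(1,1)] \<phi>_eqD[OF o(2,2)] f(1) y(1) Ob by (metis lc.comp_closed lc.id_closed)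
  have wR: "w1 \<in> carrier R" "w2 \<in> carrier R" using w by auto
  have fy: "Comp C U V U y f \<in> lc.H U U" "Comp C V U V f y \<in> lc.H V V" using f(1) y(1) Ob by (simp_all add: lc.comp_closed)
  have 1: "(w2 \<otimes>\<^bsub>R\<^esub> w1) \<odot>\<^bsub>Hom C U U\<^esub> Comp C U V U y f = (w2 \<otimes>\<^bsub>R\<^esub> w1) \<odot>\<^bsub>Hom C U U\<^esub> Id C U"
    using arg_cong[OF w(2), of "\<lambda>x. w2 \<odot>\<^bsub>Hom C U U\<^esub> x"] wR fy Ob by (simp add: lc.id_closed)
  have 2: "(w2 \<otimes>\<^bsub>R\<^esub> w1) \<odot>\<^bsub>Hom C V V\<^esub> Comp C V U V f y = (w2 \<otimes>\<^bsub>R\<^esub> w1) \<odot>\<^bsub>Hom C V V\<^esub> Id C V"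
    using arg_cong[OF w(4), of "\<lambda>x. w1 \<odot>\<^bsub>Hom C V V\<^esub> x"] wR fy Ob by (simp add: lc.id_closed R.m_comm[OF wR(2,1)])
  have nz: "w2 \<otimes>\<^bsub>R\<^esub> w1 \<noteq> \<zero>\<^bsub>R\<^esub>" using W_mult[OF w(3,1)] P_zero by auto
  show ?thesis
    by (rule lc.iso_of_iso_mod_torsion[OF fin LE.D.one_dimensional_domain_axioms Ob(1,2) f(1) y(1) _ nz 1 2 loc(2)]) (use wR in auto)
qed

end

theorem theorem2p8:
  fixes R :: "('r, 'x) ring_scheme" and K :: "('k, 'y) ring_scheme" and \<iota> :: "'r \<Rightarrow> 'k"
    and C :: "('r, 'o, 'm) lin_cat" and A A' A'' S' S'' :: 'o
    and m :: nat and n :: "nat \<Rightarrow> nat" and D :: "nat \<Rightarrow> 'd ring"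
  defines "E \<equiv> End_ring (base_change R K \<iota> C) A"
  assumes "dedekind_domain R K \<iota>"
    and "linear_category R C" and "fully_additive C" and "hom_finite R C"
    and "A \<in> Obj C"
    and "\<And>i. i < m \<Longrightarrow> 1 \<le> n i \<and> skewfield (D i)"
    and "E Quot prime_radical E \<simeq> RDirProd_list (map (\<lambda>i. matrix_ring (n i) (D i)) [0..<m])"
    and "\<And>i. i < m \<Longrightarrow> cring (D i) \<or> 1 < n i"
    and "A' \<in> genus R K \<iota> C A" and "A'' \<in> genus R K \<iota> C A"
    and "direct_sum C S' A' A" and "direct_sum C S'' A'' A"
  shows "isomorphic_in C S' S'' \<longleftrightarrow> isomorphic_in C A' A''"
proof
  interpret DD: dedekind_domain R K \<iota> by fact
  interpret lc: linear_category R C by fact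
  have Ob: "A \<in> Obj C" "A' \<in> Obj C" "A'' \<in> Obj C" using assms unfolding genus_def by auto
  {
    assume "isomorphic_in C A' A''"
    thus "isomorphic_in C S' S''" using lc.direct_sum_cong[OF assms(12,13) _ Ob(2,3,1)] by blast
  }
  assume iso: "isomorphic_in C S' S''"
  have bc: "base_changed_category R K \<iota> Q C" if "primeideal Q R" for Q
    unfolding base_changed_category_def fractions_at_def fractions_at_axioms_def using assms(2,3) that by blast
  have piso: "\<exists>f. lc.p_iso Q U A f" if Q: "maximalideal Q R" and U: "U \<in> {A', A''}" for Q U
  proof -
    interpret Q: base_changed_category R K \<iota> Q C by (rule bc[OF DD.R.maximalideal_prime[OF Q]])
    have "isomorphic_in Q.B U A" using assms(10,11) Q U unfolding genus_def by auto
    thus ?thesis using Q.isomorphic_base_change[of U A] Ob U unfolding lc.p_iso_def by blast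
  qed
  have inverse: "\<exists>g. lc.p_iso Q V U g" if "lc.p_iso Q U V f" for Q U V f
    using that unfolding lc.p_iso_def by blast
  show "isomorphic_in C A' A''"
  \<comment> \<open>If \<open>R\<close> is a field, the zero ideal is the only maximal ideal, and
    isomorphisms there already are isomorphisms in \<open>C\<close>. This case stands apart because
    \<open>K\<close> may then be finite and offer no generic scalars.\<close>
  proof (cases "maximalideal {\<zero>\<^bsub>R\<^esub>} R")
    case True
    have only: "Q = {\<zero>\<^bsub>R\<^esub>}" if "maximalideal Q R" for Q
      using maximalideal.I_maximal[OF True maximalideal.axioms(1)[OF that]] maximalideal.I_notcarr[OF that]
        additive_subgroup.zero_closed[OF ideal.axioms(1)[OF maximalideal.axioms(1)[OF that]]]
        additive_subgroup.a_subset[OF ideal.axioms(1)[OF maximalideal.axioms(1)[OF that]]] by blast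
    obtain f1 f2 where f1: "lc.p_iso {\<zero>\<^bsub>R\<^esub>} A' A f1" and f2: "lc.p_iso {\<zero>\<^bsub>R\<^esub>} A'' A f2" using piso[OF True] by blast
    obtain f3 where f3: "lc.p_iso {\<zero>\<^bsub>R\<^esub>} A A'' f3" using inverse[OF f2] by blast
    obtain f where f: "lc.p_iso {\<zero>\<^bsub>R\<^esub>} A' A'' f"
      using lc.p_iso_trans[OF DD.R.maximalideal_prime[OF True] f1 f3 Ob(2,1,3)] by blast
    show ?thesis
      by (rule lc.iso_of_p_iso[OF DD.R.noetherian_ring_axioms Ob(2,3), of f]) (use f only in \<open>auto simp: lc.p_iso_def\<close>)
  next
    case False
    have zid: "ideal {\<zero>\<^bsub>R\<^esub>} R" by (rule DD.R.zeroideal)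
    have ne: "{\<zero>\<^bsub>R\<^esub>} \<noteq> carrier R" using DD.R.one_not_zero DD.R.one_closed by (metis singletonD)
    obtain P0 where P0: "maximalideal P0 R" using DD.R.exists_maximalideal[OF zid ne] by blast
    interpret P0: maximalideal P0 R by (rule P0)
    have "P0 \<noteq> {\<zero>\<^bsub>R\<^esub>}" using P0 False by blast
    then obtain x where x: "x \<in> P0" "x \<noteq> \<zero>\<^bsub>R\<^esub>" using P0.zero_closed by blast
    have "x \<notin> Units R"
    proof
      assume xU: "x \<in> Units R"
      hence "\<one>\<^bsub>R\<^esub> \<in> P0" using P0.I_r_closed[OF x(1) DD.R.Units_inv_closed[OF xU]] by simp
      thus False using P0.one_imp_carrier P0.I_notcarr by blast
    qed
    hence inf: "infinite (carrier R)" using DD.R.infinite_carrier[of x] x P0.Icarr by blast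
    have prime: "primeideal {\<zero>\<^bsub>R\<^esub>} R" using DD.R.zeroprimeideal .
    interpret Z: base_changed_category R K \<iota> "{\<zero>\<^bsub>R\<^esub>}" C by (rule bc[OF prime])
    have idA: "lc.p_iso P0 A A (Id C A)"
      unfolding lc.p_iso_def using Ob lc.id_closed[OF Ob(1)] P0.I_notcarr P0.one_imp_carrier
      by (intro conjI bexI[of _ "Id C A"] bexI[of _ "\<one>\<^bsub>R\<^esub>"]) (auto simp: lc.cat_simps)
    \<comment> \<open>A single place \<open>P0\<close> suffices to obtain isomorphisms over
      \<open>K\<close>, since denominators outside \<open>P0\<close> are nonzero.\<close>
    have "\<exists>al al' s. al \<in> lc.H A U \<and> al' \<in> lc.H U A \<and> s \<in> carrier R - {\<zero>\<^bsub>R\<^esub>} \<and>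
        Comp C A U A al' al = s \<odot>\<^bsub>Hom C A A\<^esub> Id C A \<and> Comp C U A U al al' = s \<odot>\<^bsub>Hom C U U\<^esub> Id C U"
      if "U \<in> {A', A'', A}" for U
    proof -
      have "\<exists>f. lc.p_iso P0 U A f" using piso[OF P0] idA that by auto
      thus ?thesis unfolding lc.p_iso_def using P0.zero_closed by blast
    qed
    then obtain al al' sc where al: "\<And>U. U \<in> {A', A'', A} \<Longrightarrow> al U \<in> lc.H A U \<and> al' U \<in> lc.H U A \<and> sc U \<in> carrier R - {\<zero>\<^bsub>R\<^esub>} \<and>
        Comp C A U A (al' U) (al U) = sc U \<odot>\<^bsub>Hom C A A\<^esub> Id C A \<and> Comp C U A U (al U) (al' U) = sc U \<odot>\<^bsub>Hom C U U\<^esub> Id C U"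
      by metis
    interpret CG: common_genus R K \<iota> "{\<zero>\<^bsub>R\<^esub>}" C A "{A', A'', A}" al al' sc
      by unfold_locales (use al Ob in auto)
    have EE: "CG.E = E" unfolding CG.E_def E_def Z.local_ring_zero[OF refl] ..
    interpret E: ring E using CG.E_ring unfolding EE .
    let ?Ms = "map (\<lambda>i. matrix_ring (n i) (D i)) [0..<m]"
    have rad: "ideal (prime_radical E) E" by (rule E.prime_radical_ideal)
    have Ms: "ring (RDirProd_list ?Ms) \<and> commutators_unipotent (RDirProd_list ?Ms)"
    proof (rule commutators_unipotent_RDirProd_list)
      fix T assume "T \<in> set ?Ms"
      then obtain i where i: "i < m" "T = matrix_ring (n i) (D i)" by auto
      show "ring T \<and> commutators_unipotent T"
        unfolding i(2) using commutators_unipotent_matrix_ring assms(7,9)[OF i(1)] by blast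
    qed
    obtain h where h: "h \<in> ring_iso (E Quot prime_radical E) (RDirProd_list ?Ms)"
      using assms(8) unfolding is_ring_iso_def by blast
    have "commutators_unipotent (E Quot prime_radical E)"
      using commutators_unipotent_iso[OF ideal.quotient_is_ring[OF rad] _ h] Ms by blast
    hence CU: "commutators_unipotent CG.E"
      unfolding EE using E.commutators_unipotent_Quot[OF rad] E.prime_radical_nilpotent by blast
    have "\<exists>\<theta>. lc.p_iso Q A'' A' \<theta>" if Q: "maximalideal Q R" for Q
    proof -
      obtain f1 f2 where f1: "lc.p_iso Q A' A f1" and f2: "lc.p_iso Q A'' A f2" using piso[OF Q] by blast
      obtain f3 where "lc.p_iso Q A A' f3" using inverse[OF f1] by blast
      from lc.p_iso_trans[OF DD.R.maximalideal_prime[OF Q] f2 this Ob(3,1,2)] show ?thesis .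
    qed
    thus ?thesis using piso by (intro CG.cancellation[OF assms(5) CU inf _ _ _ assms(12,13) iso]) auto
  qed
qed

end
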